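(* Let $G$ be a group which acts on a small category $\mathcal{C}$ via $\rho:G\to\mathrm{Aut}(\mathcal{C})$, let $\mathcal{K}$ be a bicomplete category, and suppose that the functor category $\mathcal{K}^{\mathcal{C}}$ has a cofibrantly generated model category structure. Suppose one of the following conditions holds: (1) all objects of $\mathcal{K}$ are small and for all $g\in G$ the functor $(\rho_g)^*:\mathcal{K}^{\mathcal{C}}\to\mathcal{K}^{\mathcal{C}}$ preserves acyclic cofibrations, or (2) for all $g\in G$, $(\rho_g)^*$ is a left Quillen functor. Then $\mathcal{K}^{\mathcal{C}\rtimes G}$ has a cofibrantly generated model category structure lifted from $\mathcal{K}^{\mathcal{C}}$ along the restriction functor $\iota^*:\mathcal{K}^{\mathcal{C}\rtimes G}\to\mathcal{K}^{\mathcal{C}}$.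
   Context: $\mathrm{Aut}(\mathcal{C})$ is the group of isomorphisms of categories $\mathcal{C}\to\mathcal{C}$, and an action of $G$ on $\mathcal{C}$ is a group homomorphism $\rho:G\to\mathrm{Aut}(\mathcal{C})$, $g\mapsto\rho_g$. The functor $(\rho_g)^*$ is precomposition with $\rho_g$. The semidirect product $\mathcal{C}\rtimes G$ has the same objects as $\mathcal{C}$; its morphisms are pairs $(\varphi,g)$ with $\varphi:x\to y$ a morphism of $\mathcal{C}$ and $g\in G$, where $(\varphi,g)$ has source $\rho_{g^{-1}}(x)$ and target $y$; composition is $(\varphi,g)\circ(\psi,h)=(\varphi\circ\rho_g(\psi),gh)$. The functor $\iota:\mathcal{C}\to\mathcal{C}\rtimes G$ is the identity on objects and sends $\varphi$ to $(\varphi,1)$; $\iota^*$ is precomposition with $\iota$. A model structure on $\mathcal{N}$ is lifted along a functor $F:\mathcal{N}\to\mathcal{M}$ to a model category if a morphism $f$ of $\mathcal{N}$ is a weak equivalence (resp. fibration) if and only if $F(f)$ is one in $\mathcal{M}$. An object $A$ of a cocomplete category $\mathcal{K}$ is $\kappa$-small, for a cardinal $\kappa$, if for every regular cardinal $\lambda\ge\kappa$ and every $\lambda$-sequence $Z:\lambda\to\mathcal{K}$ (i.e. a colimit-preserving functor from the ordinal $\lambda$) the canonical map $\mathrm{colim}_{\beta<\lambda}\mathcal{K}(A,Z_\beta)\to\mathcal{K}(A,\mathrm{colim}_{\beta<\lambda}Z_\beta)$ is a bijection; $A$ is small if it is $\kappa$-small for some $\kappa$. *)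

theory Defs
  imports "HOL-Algebra.Group" "HOL-Library.FuncSet"
begin

unbundle cardinal_syntax

section \<open>Universes\<close>

text \<open>
  Size is measured against a type \<open>'u\<close> playing the role of a Grothendieck universe: its
  cardinality is assumed to be uncountable and strongly inaccessible, and a set (over any type) is
  small if it has smaller cardinality.
\<close>

definition universe :: "'u itself \<Rightarrow> bool" where
  "universe U \<longleftrightarrow>
     natLeq <o |UNIV :: 'u set| \<and> regularCard |UNIV :: 'u set| \<and>
     (\<forall>A :: 'u set. |A| <o |UNIV :: 'u set| \<longrightarrow> |Pow A| <o |UNIV :: 'u set| )"

definition small :: "'u itself \<Rightarrow> 'a set \<Rightarrow> bool" where
  "small U A \<longleftrightarrow> |A| <o |UNIV :: 'u set|"

section \<open>Categories, functors, natural transformations\<close>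

record ('o, 'a) cat =
  Obj :: "'o set"
  Arr :: "'a set"
  Dom :: "'a \<Rightarrow> 'o"
  Cod :: "'a \<Rightarrow> 'o"
  Id :: "'o \<Rightarrow> 'a"
  Comp :: "'a \<Rightarrow> 'a \<Rightarrow> 'a" (infixl \<open>\<cdot>\<index>\<close> 70)

locale category =
  fixes C :: "('o, 'a) cat" (structure)
  assumes Dom_Obj: "f \<in> Arr C \<Longrightarrow> Dom C f \<in> Obj C"
    and Cod_Obj: "f \<in> Arr C \<Longrightarrow> Cod C f \<in> Obj C"
    and Id_Arr: "x \<in> Obj C \<Longrightarrow> Id C x \<in> Arr C"
    and Dom_Id: "x \<in> Obj C \<Longrightarrow> Dom C (Id C x) = x"
    and Cod_Id: "x \<in> Obj C \<Longrightarrow> Cod C (Id C x) = x"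
    and Comp_Arr: "\<lbrakk>f \<in> Arr C; g \<in> Arr C; Dom C g = Cod C f\<rbrakk> \<Longrightarrow> g \<cdot> f \<in> Arr C"
    and Dom_Comp: "\<lbrakk>f \<in> Arr C; g \<in> Arr C; Dom C g = Cod C f\<rbrakk> \<Longrightarrow> Dom C (g \<cdot> f) = Dom C f"
    and Cod_Comp: "\<lbrakk>f \<in> Arr C; g \<in> Arr C; Dom C g = Cod C f\<rbrakk> \<Longrightarrow> Cod C (g \<cdot> f) = Cod C g"
    and Comp_Id: "f \<in> Arr C \<Longrightarrow> f \<cdot> Id C (Dom C f) = f"
    and Id_Comp: "f \<in> Arr C \<Longrightarrow> Id C (Cod C f) \<cdot> f = f"
    and Comp_assoc: "\<lbrakk>f \<in> Arr C; g \<in> Arr C; h \<in> Arr C; Dom C g = Cod C f; Dom C h = Cod C g\<rbrakk>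
      \<Longrightarrow> (h \<cdot> g) \<cdot> f = h \<cdot> (g \<cdot> f)"

definition Hom :: "('o, 'a) cat \<Rightarrow> 'o \<Rightarrow> 'o \<Rightarrow> 'a set" where
  "Hom C x y = {f \<in> Arr C. Dom C f = x \<and> Cod C f = y}"

definition small_category :: "'u itself \<Rightarrow> ('o, 'a) cat \<Rightarrow> bool" where
  "small_category U C \<longleftrightarrow> category C \<and> small U (Obj C) \<and> small U (Arr C)"

definition locally_small_category :: "'u itself \<Rightarrow> ('o, 'a) cat \<Rightarrow> bool" where
  "locally_small_category U C \<longleftrightarrow>
     category C \<and> (\<forall>x \<in> Obj C. \<forall>y \<in> Obj C. small U (Hom C x y))"

record ('o1, 'a1, 'o2, 'a2) fctr =
  FOb :: "'o1 \<Rightarrow> 'o2"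
  FAr :: "'a1 \<Rightarrow> 'a2"

definition is_functor :: "('o1, 'a1) cat \<Rightarrow> ('o2, 'a2) cat \<Rightarrow> ('o1, 'a1, 'o2, 'a2) fctr \<Rightarrow> bool" where
  "is_functor A B F \<longleftrightarrow>
     (\<forall>x \<in> Obj A. FOb F x \<in> Obj B) \<and>
     (\<forall>f \<in> Arr A. FAr F f \<in> Hom B (FOb F (Dom A f)) (FOb F (Cod A f))) \<and>
     (\<forall>x \<in> Obj A. FAr F (Id A x) = Id B (FOb F x)) \<and>
     (\<forall>f \<in> Arr A. \<forall>g \<in> Arr A. Dom A g = Cod A f \<longrightarrow>
        FAr F (g \<cdot>\<^bsub>A\<^esub> f) = FAr F g \<cdot>\<^bsub>B\<^esub> FAr F f)"

text \<open>
  Where functors are themselves elements of a structure (objects of a functor category, elements of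
  an automorphism group) they are required to be \<open>undefined\<close> outside their domain, so that equality
  of records is equality of functors. The same applies to the components of natural transformations.
\<close>

definition Functors :: "('o1, 'a1) cat \<Rightarrow> ('o2, 'a2) cat \<Rightarrow> ('o1, 'a1, 'o2, 'a2) fctr set" where
  "Functors A B =
     {F. is_functor A B F \<and> FOb F \<in> extensional (Obj A) \<and> FAr F \<in> extensional (Arr A)}"

definition id_fctr :: "('o, 'a) cat \<Rightarrow> ('o, 'a, 'o, 'a) fctr" where
  "id_fctr A = \<lparr> FOb = restrict (\<lambda>x. x) (Obj A), FAr = restrict (\<lambda>f. f) (Arr A) \<rparr>"

text \<open>The composite \<open>H \<circ> F\<close> of functors, where \<open>F\<close> is defined on \<open>A\<close>.\<close>

definition comp_fctr ::
  "('o1, 'a1) cat \<Rightarrow> ('o2, 'a2, 'o3, 'a3) fctr \<Rightarrow> ('o1, 'a1, 'o2, 'a2) fctr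
    \<Rightarrow> ('o1, 'a1, 'o3, 'a3) fctr" where
  "comp_fctr A H F =
     \<lparr> FOb = restrict (\<lambda>x. FOb H (FOb F x)) (Obj A),
       FAr = restrict (\<lambda>f. FAr H (FAr F f)) (Arr A) \<rparr>"

record ('o1, 'a1, 'o2, 'a2) nattr =
  Src :: "('o1, 'a1, 'o2, 'a2) fctr"
  Tgt :: "('o1, 'a1, 'o2, 'a2) fctr"
  Cmp :: "'o1 \<Rightarrow> 'a2"

definition is_nattr :: "('o1, 'a1) cat \<Rightarrow> ('o2, 'a2) cat \<Rightarrow> ('o1, 'a1, 'o2, 'a2) nattr \<Rightarrow> bool" where
  "is_nattr A B t \<longleftrightarrow>
     (\<forall>x \<in> Obj A. Cmp t x \<in> Hom B (FOb (Src t) x) (FOb (Tgt t) x)) \<and>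
     (\<forall>f \<in> Arr A. Cmp t (Cod A f) \<cdot>\<^bsub>B\<^esub> FAr (Src t) f = FAr (Tgt t) f \<cdot>\<^bsub>B\<^esub> Cmp t (Dom A f))"

text \<open>The functor category \<open>K\<^sup>A\<close>.\<close>

definition fun_cat ::
  "('o1, 'a1) cat \<Rightarrow> ('o2, 'a2) cat \<Rightarrow> (('o1, 'a1, 'o2, 'a2) fctr, ('o1, 'a1, 'o2, 'a2) nattr) cat" where
  "fun_cat A K =
     \<lparr> Obj = Functors A K,
       Arr = {t. Src t \<in> Functors A K \<and> Tgt t \<in> Functors A K \<and> is_nattr A K t \<and>
                 Cmp t \<in> extensional (Obj A)},
       Dom = Src,
       Cod = Tgt,
       Id = (\<lambda>F. \<lparr> Src = F, Tgt = F, Cmp = restrict (\<lambda>x. Id K (FOb F x)) (Obj A) \<rparr>),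
       Comp = (\<lambda>t s. \<lparr> Src = Src s, Tgt = Tgt t,
                       Cmp = restrict (\<lambda>x. Cmp t x \<cdot>\<^bsub>K\<^esub> Cmp s x) (Obj A) \<rparr>) \<rparr>"

text \<open>Precomposition with \<open>F : A \<rightarrow> B\<close>, as a functor \<open>K\<^sup>B \<rightarrow> K\<^sup>A\<close>.\<close>

definition precomp ::
  "('o1, 'a1) cat \<Rightarrow> ('o1, 'a1, 'o2, 'a2) fctr
    \<Rightarrow> (('o2, 'a2, 'o3, 'a3) fctr, ('o2, 'a2, 'o3, 'a3) nattr,
        ('o1, 'a1, 'o3, 'a3) fctr, ('o1, 'a1, 'o3, 'a3) nattr) fctr" where
  "precomp A F =
     \<lparr> FOb = (\<lambda>H. comp_fctr A H F),
       FAr = (\<lambda>t. \<lparr> Src = comp_fctr A (Src t) F, Tgt = comp_fctr A (Tgt t) F,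
                    Cmp = restrict (\<lambda>x. Cmp t (FOb F x)) (Obj A) \<rparr>) \<rparr>"

text \<open>The category of arrows of \<open>M\<close>: a morphism \<open>(f, f', u, v)\<close> is a commutative square
  \<open>v \<cdot> f = f' \<cdot> u\<close> from \<open>f\<close> to \<open>f'\<close>.\<close>

definition arrow_cat :: "('o, 'a) cat \<Rightarrow> ('a, 'a \<times> 'a \<times> 'a \<times> 'a) cat" where
  "arrow_cat M =
     \<lparr> Obj = Arr M,
       Arr = {(f, f', u, v). f \<in> Arr M \<and> f' \<in> Arr M \<and>
                u \<in> Hom M (Dom M f) (Dom M f') \<and> v \<in> Hom M (Cod M f) (Cod M f') \<and>
                v \<cdot>\<^bsub>M\<^esub> f = f' \<cdot>\<^bsub>M\<^esub> u},
       Dom = (\<lambda>(f, f', u, v). f),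
       Cod = (\<lambda>(f, f', u, v). f'),
       Id = (\<lambda>f. (f, f, Id M (Dom M f), Id M (Cod M f))),
       Comp = (\<lambda>(f', f'', u', v') (f, g', u, v). (f, f'', u' \<cdot>\<^bsub>M\<^esub> u, v' \<cdot>\<^bsub>M\<^esub> v)) \<rparr>"

definition retract_of :: "('o, 'a) cat \<Rightarrow> 'o \<Rightarrow> 'o \<Rightarrow> bool" where
  "retract_of C x y \<longleftrightarrow> (\<exists>i \<in> Hom C x y. \<exists>r \<in> Hom C y x. r \<cdot>\<^bsub>C\<^esub> i = Id C x)"

definition left_adjoint :: "('o1, 'a1) cat \<Rightarrow> ('o2, 'a2) cat \<Rightarrow> ('o1, 'a1, 'o2, 'a2) fctr \<Rightarrow> bool" where
  "left_adjoint A B F \<longleftrightarrow> is_functor A B F \<and>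
     (\<exists>R \<phi>. is_functor B A R \<and>
       (\<forall>x \<in> Obj A. \<forall>y \<in> Obj B. bij_betw (\<phi> x y) (Hom B (FOb F x) y) (Hom A x (FOb R y))) \<and>
       (\<forall>u \<in> Arr A. \<forall>v \<in> Arr B. \<forall>f \<in> Hom B (FOb F (Cod A u)) (Dom B v).
          \<phi> (Dom A u) (Cod B v) (v \<cdot>\<^bsub>B\<^esub> f \<cdot>\<^bsub>B\<^esub> FAr F u) =
          FAr R v \<cdot>\<^bsub>A\<^esub> \<phi> (Cod A u) (Dom B v) f \<cdot>\<^bsub>A\<^esub> u))"

section \<open>Limits and colimits\<close>

definition is_cocone ::
  "('oj, 'aj) cat \<Rightarrow> ('o, 'a) cat \<Rightarrow> ('oj, 'aj, 'o, 'a) fctr \<Rightarrow> 'o \<Rightarrow> ('oj \<Rightarrow> 'a) \<Rightarrow> bool" where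
  "is_cocone J K D c \<tau> \<longleftrightarrow> c \<in> Obj K \<and> (\<forall>j \<in> Obj J. \<tau> j \<in> Hom K (FOb D j) c) \<and>
     (\<forall>u \<in> Arr J. \<tau> (Cod J u) \<cdot>\<^bsub>K\<^esub> FAr D u = \<tau> (Dom J u))"

definition is_colimit ::
  "('oj, 'aj) cat \<Rightarrow> ('o, 'a) cat \<Rightarrow> ('oj, 'aj, 'o, 'a) fctr \<Rightarrow> 'o \<Rightarrow> ('oj \<Rightarrow> 'a) \<Rightarrow> bool" where
  "is_colimit J K D c \<tau> \<longleftrightarrow> is_cocone J K D c \<tau> \<and>
     (\<forall>d \<sigma>. is_cocone J K D d \<sigma> \<longrightarrow> (\<exists>!h. h \<in> Hom K c d \<and> (\<forall>j \<in> Obj J. h \<cdot>\<^bsub>K\<^esub> \<tau> j = \<sigma> j)))"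

definition is_cone ::
  "('oj, 'aj) cat \<Rightarrow> ('o, 'a) cat \<Rightarrow> ('oj, 'aj, 'o, 'a) fctr \<Rightarrow> 'o \<Rightarrow> ('oj \<Rightarrow> 'a) \<Rightarrow> bool" where
  "is_cone J K D c \<tau> \<longleftrightarrow> c \<in> Obj K \<and> (\<forall>j \<in> Obj J. \<tau> j \<in> Hom K c (FOb D j)) \<and>
     (\<forall>u \<in> Arr J. FAr D u \<cdot>\<^bsub>K\<^esub> \<tau> (Dom J u) = \<tau> (Cod J u))"

definition is_limit ::
  "('oj, 'aj) cat \<Rightarrow> ('o, 'a) cat \<Rightarrow> ('oj, 'aj, 'o, 'a) fctr \<Rightarrow> 'o \<Rightarrow> ('oj \<Rightarrow> 'a) \<Rightarrow> bool" where
  "is_limit J K D c \<tau> \<longleftrightarrow> is_cone J K D c \<tau> \<and>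
     (\<forall>d \<sigma>. is_cone J K D d \<sigma> \<longrightarrow> (\<exists>!h. h \<in> Hom K d c \<and> (\<forall>j \<in> Obj J. \<tau> j \<cdot>\<^bsub>K\<^esub> h = \<sigma> j)))"

text \<open>Every small category is isomorphic to one whose objects and arrows are elements of \<open>'u\<close>, so
  these suffice as index categories.\<close>

definition bicomplete :: "'u itself \<Rightarrow> ('o, 'a) cat \<Rightarrow> bool" where
  "bicomplete U K \<longleftrightarrow> category K \<and>
     (\<forall>(J :: ('u, 'u) cat) D. small_category U J \<and> is_functor J K D \<longrightarrow>
        (\<exists>c \<tau>. is_limit J K D c \<tau>) \<and> (\<exists>c \<tau>. is_colimit J K D c \<tau>))"

text \<open>\<open>h\<close> is a pushout of \<open>i\<close> along some morphism.\<close>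

definition pushout_of :: "('o, 'a) cat \<Rightarrow> 'a \<Rightarrow> 'a \<Rightarrow> bool" where
  "pushout_of M i h \<longleftrightarrow> i \<in> Arr M \<and> h \<in> Arr M \<and>
     (\<exists>a b. a \<in> Hom M (Dom M i) (Dom M h) \<and> b \<in> Hom M (Cod M i) (Cod M h) \<and>
        h \<cdot>\<^bsub>M\<^esub> a = b \<cdot>\<^bsub>M\<^esub> i \<and>
        (\<forall>z. \<forall>p \<in> Hom M (Dom M h) z. \<forall>q \<in> Hom M (Cod M i) z. p \<cdot>\<^bsub>M\<^esub> a = q \<cdot>\<^bsub>M\<^esub> i \<longrightarrow>
           (\<exists>!k. k \<in> Hom M (Cod M h) z \<and> k \<cdot>\<^bsub>M\<^esub> h = p \<and> k \<cdot>\<^bsub>M\<^esub> b = q)))"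

section \<open>Transfinite sequences and smallness of objects\<close>

text \<open>Ordinals are well-orders \<open>r\<close> (reflexive relations) on subsets of \<open>'u\<close>, viewed as posets;
  the ordinal \<open>\<beta> < r\<close> is the initial segment \<open>underS r \<beta>\<close>.\<close>

definition ord_cat :: "'u rel \<Rightarrow> ('u, 'u \<times> 'u) cat" where
  "ord_cat r =
     \<lparr> Obj = Field r, Arr = r, Dom = fst, Cod = snd, Id = (\<lambda>x. (x, x)),
       Comp = (\<lambda>g f. (fst f, snd g)) \<rparr>"

definition least_elem :: "'u rel \<Rightarrow> 'u \<Rightarrow> bool" where
  "least_elem r a \<longleftrightarrow> a \<in> Field r \<and> underS r a = {}"

definition succ_elem :: "'u rel \<Rightarrow> 'u \<Rightarrow> 'u \<Rightarrow> bool" where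
  "succ_elem r a b \<longleftrightarrow> a \<in> Field r \<and> b \<in> Field r \<and> underS r b = insert a (underS r a) \<and> a \<noteq> b"

definition limit_elem :: "'u rel \<Rightarrow> 'u \<Rightarrow> bool" where
  "limit_elem r b \<longleftrightarrow> b \<in> Field r \<and> \<not> least_elem r b \<and> \<not> (\<exists>a. succ_elem r a b)"

text \<open>The colimits a sequence is required to preserve are those at limit ordinals, the usual meaning
  of \<open>colimit-preserving\<close> here: preservation of the empty colimit would force the sequence to start
  at an initial object, and preservation of the binary coproduct \<open>\<alpha> \<squnion> \<alpha> = \<alpha>\<close> would make the fold
  maps of all its terms invertible.\<close>

definition lambda_sequence :: "'u rel \<Rightarrow> ('o, 'a) cat \<Rightarrow> ('u, 'u \<times> 'u, 'o, 'a) fctr \<Rightarrow> bool" where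
  "lambda_sequence r M Z \<longleftrightarrow> is_functor (ord_cat r) M Z \<and>
     (\<forall>b. limit_elem r b \<longrightarrow>
        is_colimit (ord_cat (Restr r (underS r b))) M Z (FOb Z b) (\<lambda>a. FAr Z (a, b)))"

text \<open>\<open>colim\<^sub>\<beta> M(A, Z\<^sub>\<beta>)\<close> as the quotient of the disjoint union of the \<open>M(A, Z\<^sub>\<beta>)\<close> by the generated
  equivalence relation.\<close>

definition hom_union ::
  "'u rel \<Rightarrow> ('o, 'a) cat \<Rightarrow> ('u, 'u \<times> 'u, 'o, 'a) fctr \<Rightarrow> 'o \<Rightarrow> ('u \<times> 'a) set" where
  "hom_union r M Z A = (SIGMA b : Field r. Hom M A (FOb Z b))"

definition hom_equiv ::
  "'u rel \<Rightarrow> ('o, 'a) cat \<Rightarrow> ('u, 'u \<times> 'u, 'o, 'a) fctr \<Rightarrow> 'o \<Rightarrow> ('u \<times> 'a) rel" where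
  "hom_equiv r M Z A =
     (let R = {((b, f), (b', FAr Z (b, b') \<cdot>\<^bsub>M\<^esub> f)) | b b' f.
                 (b, b') \<in> r \<and> f \<in> Hom M A (FOb Z b)}
      in (R \<union> R\<inverse>)\<^sup>* \<inter> (hom_union r M Z A \<times> hom_union r M Z A))"

definition colim_hom ::
  "'u rel \<Rightarrow> ('o, 'a) cat \<Rightarrow> ('u, 'u \<times> 'u, 'o, 'a) fctr \<Rightarrow> 'o \<Rightarrow> ('u \<times> 'a) set set" where
  "colim_hom r M Z A = hom_union r M Z A // hom_equiv r M Z A"

text \<open>The canonical map \<open>colim\<^sub>\<beta> M(A, Z\<^sub>\<beta>) \<rightarrow> M(A, colim\<^sub>\<beta> Z\<^sub>\<beta>)\<close>, where \<open>\<tau>\<close> is the family of legs of the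
  colimit cocone of \<open>Z\<close>.\<close>

definition canonical_map :: "('o, 'a) cat \<Rightarrow> ('u \<Rightarrow> 'a) \<Rightarrow> ('u \<times> 'a) set \<Rightarrow> 'a" where
  "canonical_map M \<tau> X = the_elem ((\<lambda>(b, f). \<tau> b \<cdot>\<^bsub>M\<^esub> f) ` X)"

definition card_small_rel :: "'u rel \<Rightarrow> ('o, 'a) cat \<Rightarrow> 'a set \<Rightarrow> 'o \<Rightarrow> bool" where
  "card_small_rel \<kappa> M W A \<longleftrightarrow>
     (\<forall>(r :: 'u rel) Z c \<tau>. Card_order r \<and> infinite (Field r) \<and> regularCard r \<and>
        r <o |UNIV :: 'u set| \<and> \<kappa> \<le>o r \<and>
        lambda_sequence r M Z \<and> (\<forall>a b. succ_elem r a b \<longrightarrow> FAr Z (a, b) \<in> W) \<and>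
        is_colimit (ord_cat r) M Z c \<tau> \<longrightarrow>
        bij_betw (canonical_map M \<tau>) (colim_hom r M Z A) (Hom M A c))"

definition small_rel :: "'u itself \<Rightarrow> ('o, 'a) cat \<Rightarrow> 'a set \<Rightarrow> 'o \<Rightarrow> bool" where
  "small_rel U M W A \<longleftrightarrow>
     (\<exists>\<kappa> :: 'u rel. Card_order \<kappa> \<and> \<kappa> <o |UNIV :: 'u set| \<and> card_small_rel \<kappa> M W A)"

definition small_object :: "'u itself \<Rightarrow> ('o, 'a) cat \<Rightarrow> 'o \<Rightarrow> bool" where
  "small_object U M A \<longleftrightarrow> A \<in> Obj M \<and> small_rel U M (Arr M) A"

text \<open>Relative cell complexes: transfinite compositions (of nonempty small ordinal length) of pushouts
  of elements of \<open>I\<close>.\<close>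

definition relative_cell :: "'u itself \<Rightarrow> ('o, 'a) cat \<Rightarrow> 'a set \<Rightarrow> 'a set" where
  "relative_cell U M I =
     {f. \<exists>(r :: 'u rel) Z c \<tau> a.
        Well_order r \<and> small U (Field r) \<and> lambda_sequence r M Z \<and>
        (\<forall>a b. succ_elem r a b \<longrightarrow> (\<exists>i \<in> I. pushout_of M i (FAr Z (a, b)))) \<and>
        is_colimit (ord_cat r) M Z c \<tau> \<and> least_elem r a \<and> f = \<tau> a}"

definition permits_small_object_argument :: "'u itself \<Rightarrow> ('o, 'a) cat \<Rightarrow> 'a set \<Rightarrow> bool" where
  "permits_small_object_argument U M I \<longleftrightarrow>
     (\<forall>i \<in> I. small_rel U M (relative_cell U M I) (Dom M i))"

section \<open>Model categories\<close>

record 'a model_str =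
  WE :: "'a set"
  Cofib :: "'a set"
  Fib :: "'a set"

definition has_lift :: "('o, 'a) cat \<Rightarrow> 'a \<Rightarrow> 'a \<Rightarrow> bool" where
  "has_lift M i p \<longleftrightarrow>
     (\<forall>u \<in> Hom M (Dom M i) (Dom M p). \<forall>v \<in> Hom M (Cod M i) (Cod M p).
        v \<cdot>\<^bsub>M\<^esub> i = p \<cdot>\<^bsub>M\<^esub> u \<longrightarrow>
        (\<exists>h \<in> Hom M (Cod M i) (Dom M p). h \<cdot>\<^bsub>M\<^esub> i = u \<and> p \<cdot>\<^bsub>M\<^esub> h = v))"

definition functorial_factorization :: "('o, 'a) cat \<Rightarrow> 'a set \<Rightarrow> 'a set \<Rightarrow> bool" where
  "functorial_factorization M L R \<longleftrightarrow>
     (\<exists>E l r. is_functor (arrow_cat M) M E \<and>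
        (\<forall>f \<in> Arr M. l f \<in> Hom M (Dom M f) (FOb E f) \<inter> L \<and>
                     r f \<in> Hom M (FOb E f) (Cod M f) \<inter> R \<and> r f \<cdot>\<^bsub>M\<^esub> l f = f) \<and>
        (\<forall>(f, f', u, v) \<in> Arr (arrow_cat M).
           FAr E (f, f', u, v) \<cdot>\<^bsub>M\<^esub> l f = l f' \<cdot>\<^bsub>M\<^esub> u \<and>
           r f' \<cdot>\<^bsub>M\<^esub> FAr E (f, f', u, v) = v \<cdot>\<^bsub>M\<^esub> r f))"

definition model_category :: "'u itself \<Rightarrow> ('o, 'a) cat \<Rightarrow> 'a model_str \<Rightarrow> bool" where
  "model_category U M S \<longleftrightarrow>
     bicomplete U M \<and>
     WE S \<subseteq> Arr M \<and> Cofib S \<subseteq> Arr M \<and> Fib S \<subseteq> Arr M \<and>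
     (\<forall>f \<in> Arr M. \<forall>g \<in> Arr M. Dom M g = Cod M f \<longrightarrow>
        (f \<in> WE S \<and> g \<in> WE S \<longrightarrow> g \<cdot>\<^bsub>M\<^esub> f \<in> WE S) \<and>
        (f \<in> WE S \<and> g \<cdot>\<^bsub>M\<^esub> f \<in> WE S \<longrightarrow> g \<in> WE S) \<and>
        (g \<in> WE S \<and> g \<cdot>\<^bsub>M\<^esub> f \<in> WE S \<longrightarrow> f \<in> WE S)) \<and>
     (\<forall>W \<in> {WE S, Cofib S, Fib S}. \<forall>f \<in> Arr M. \<forall>g \<in> W.
        retract_of (arrow_cat M) f g \<longrightarrow> f \<in> W) \<and>
     (\<forall>i \<in> Cofib S. \<forall>p \<in> Fib S \<inter> WE S. has_lift M i p) \<and>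
     (\<forall>i \<in> Cofib S \<inter> WE S. \<forall>p \<in> Fib S. has_lift M i p) \<and>
     functorial_factorization M (Cofib S) (Fib S \<inter> WE S) \<and>
     functorial_factorization M (Cofib S \<inter> WE S) (Fib S)"

definition cofibrantly_generated :: "'u itself \<Rightarrow> ('o, 'a) cat \<Rightarrow> 'a model_str \<Rightarrow> bool" where
  "cofibrantly_generated U M S \<longleftrightarrow>
     (\<exists>I. I \<subseteq> Arr M \<and> small U I \<and> permits_small_object_argument U M I \<and>
        Fib S \<inter> WE S = {p \<in> Arr M. \<forall>i \<in> I. has_lift M i p}) \<and>
     (\<exists>J. J \<subseteq> Arr M \<and> small U J \<and> permits_small_object_argument U M J \<and>
        Fib S = {p \<in> Arr M. \<forall>j \<in> J. has_lift M j p})"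

definition left_quillen ::
  "('o1, 'a1) cat \<Rightarrow> 'a1 model_str \<Rightarrow> ('o2, 'a2) cat \<Rightarrow> 'a2 model_str
    \<Rightarrow> ('o1, 'a1, 'o2, 'a2) fctr \<Rightarrow> bool" where
  "left_quillen M S N T F \<longleftrightarrow> left_adjoint M N F \<and>
     (\<forall>f \<in> Cofib S. FAr F f \<in> Cofib T) \<and>
     (\<forall>f \<in> Cofib S \<inter> WE S. FAr F f \<in> Cofib T \<inter> WE T)"

definition lifted_along ::
  "('o1, 'a1) cat \<Rightarrow> 'a1 model_str \<Rightarrow> 'a2 model_str \<Rightarrow> ('o1, 'a1, 'o2, 'a2) fctr \<Rightarrow> bool" where
  "lifted_along N T S F \<longleftrightarrow>
     (\<forall>f \<in> Arr N. (f \<in> WE T \<longleftrightarrow> FAr F f \<in> WE S) \<and> (f \<in> Fib T \<longleftrightarrow> FAr F f \<in> Fib S))"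

section \<open>Group actions on categories\<close>

definition Aut_cat :: "('o, 'a) cat \<Rightarrow> ('o, 'a, 'o, 'a) fctr monoid" where
  "Aut_cat C =
     \<lparr> carrier = {F \<in> Functors C C. \<exists>H \<in> Functors C C.
                    comp_fctr C H F = id_fctr C \<and> comp_fctr C F H = id_fctr C},
       mult = comp_fctr C,
       one = id_fctr C \<rparr>"

definition semidirect ::
  "('o, 'a) cat \<Rightarrow> ('g, 'z) monoid_scheme \<Rightarrow> ('g \<Rightarrow> ('o, 'a, 'o, 'a) fctr) \<Rightarrow> ('o, 'a \<times> 'g) cat" where
  "semidirect C G \<rho> =
     \<lparr> Obj = Obj C,
       Arr = Arr C \<times> carrier G,
       Dom = (\<lambda>(f, g). FOb (\<rho> (inv\<^bsub>G\<^esub> g)) (Dom C f)),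
       Cod = (\<lambda>(f, g). Cod C f),
       Id = (\<lambda>x. (Id C x, \<one>\<^bsub>G\<^esub>)),
       Comp = (\<lambda>(f, g) (f', g'). (f \<cdot>\<^bsub>C\<^esub> FAr (\<rho> g) f', g \<otimes>\<^bsub>G\<^esub> g')) \<rparr>"

definition semidirect_incl ::
  "('o, 'a) cat \<Rightarrow> ('g, 'z) monoid_scheme \<Rightarrow> ('o, 'a, 'o, 'a \<times> 'g) fctr" where
  "semidirect_incl C G = \<lparr> FOb = (\<lambda>x. x), FAr = (\<lambda>f. (f, \<one>\<^bsub>G\<^esub>)) \<rparr>"

end

theory Submission
  imports Defs
begin

text \<open>Let \<open>M = K\<^sup>C\<close>, let \<open>N\<close> be the category of functors from the semidirect product \<open>C \<rtimes> G\<close> to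
  \<open>K\<close>, and let \<open>V : N \<rightarrow> M\<close> be restriction along \<open>\<iota>\<close>. A morphism \<open>x \<rightarrow> y\<close> of \<open>C \<rtimes> G\<close> is an element
  \<open>g\<close> of \<open>G\<close> with a morphism \<open>\<rho>\<^sub>g x \<rightarrow> y\<close> of \<open>C\<close>, so the Kan extensions of \<open>X\<close> along \<open>\<iota>\<close> are simply
  the coproduct and the product over \<open>h \<in> G\<close> of the objects \<open>X(\<rho>\<^sub>h y)\<close>. Hence \<open>V\<close> has a left
  adjoint (\<open>free_universal\<close>) and a right adjoint (\<open>cofree_universal\<close>), and in particular it
  preserves colimits (\<open>preserves_colimits\<close>). Weak equivalences and fibrations of \<open>N\<close> are those
  created by \<open>V\<close>, and cofibrations are what the left lifting property prescribes. Two-out-of-three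
  and closure under retracts are immediate; the work lies in the two factorisations, in the
  smallness of the generating sets, and in one compatibility: a map of \<open>N\<close> that lifts against all
  fibrations must be sent by \<open>V\<close> to an acyclic cofibration.

  The compatibility comes from the right adjoint. If \<open>p'\<close> is the cofree map on a map \<open>p\<close> of \<open>M\<close>,
  then a map \<open>s\<close> of \<open>N\<close> lifts against \<open>p'\<close> exactly when \<open>V s\<close> lifts against \<open>p\<close>, and \<open>V p'\<close> is the
  product of the translates of \<open>p\<close>, so \<open>i\<close> lifts against it as soon as all translates of \<open>i\<close> under
  the \<open>(\<rho>\<^sub>g)\<^sup>*\<close> lift against \<open>p\<close> (\<open>lifting_against_cofree\<close>). If translation preserves a left class
  \<open>L\<close>, then \<open>p'\<close> has the right lifting property against \<open>L\<close> whenever \<open>p\<close> has; therefore \<open>V\<close> sends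
  maps of the transferred left class into \<open>L\<close>. Applied to acyclic cofibrations this is the
  compatibility, and applied to cofibrations it provides the class relative to which objects are
  small under the second hypothesis.

  The functorial factorisations of \<open>N\<close> are made out of those of \<open>M\<close> (\<open>adjoint_factorization\<close>).
  Given \<open>q : X \<rightarrow> Y\<close> in \<open>N\<close>, factor \<open>V q = r \<cdot> l\<close> in \<open>M\<close> and extend \<open>X\<close> freely along \<open>l\<close>; the
  result still maps to \<open>Y\<close>, because of \<open>r\<close>. Repeating this transfinitely and taking the colimit
  yields a map \<open>q'\<close> to \<open>Y\<close>. By smallness, every lifting problem between a generating map and
  \<open>V q'\<close> is posed at an earlier stage, where \<open>r\<close> solves it. Carrying out the construction in the
  category of functors from arrows of \<open>N\<close> to \<open>N\<close> makes it functorial.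

  What is needed for this is that the domains of the generating maps are small relative to the
  class of maps that \<open>V\<close> produces from the steps. If all objects of \<open>K\<close> are small, then all
  objects of \<open>M\<close> are small, because \<open>C\<close> is small and smallness can be tested pointwise
  (\<open>fun_cat_objects_small\<close>). Otherwise the domains are known to be small relative to the relative
  cell complexes only, and smallness is extended to the whole left class (\<open>small_rel_llp\<close>): any
  sequence of maps in that class is a retract of a sequence of relative cell complexes, which is
  built by factoring maps through cell complexes (\<open>cell_factorization\<close>). Since the transfinite
  compositions here attach one cell at a time, this last factorisation is obtained by running
  along the well-ordered universe and always attaching a cell for the oldest open lifting
  problem.\<close>

section \<open>Small sets and cardinals\<close>

lemma universe_infinite: "universe (U :: 'u itself) \<Longrightarrow> infinite (UNIV :: 'u set)"
  unfolding universe_def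
  using infinite_iff_natLeq_ordLeq[of "UNIV :: 'u set"] ordLess_imp_ordLeq[of natLeq "|UNIV :: 'u set|"]
  by blast

lemma universe_stable: "universe (U :: 'u itself) \<Longrightarrow> stable |UNIV :: 'u set|"
  using regularCard_stable[of "|UNIV :: 'u set|", OF card_of_Card_order] universe_infinite[of U]
  unfolding universe_def by (simp add: Field_card_of)

lemma small_subset: "small U B \<Longrightarrow> A \<subseteq> B \<Longrightarrow> small U A"
  unfolding small_def by (metis card_of_mono1 ordLeq_ordLess_trans)

lemma small_image: "small U A \<Longrightarrow> small U (f ` A)"
  unfolding small_def by (rule ordLeq_ordLess_trans[OF card_of_image])

lemma small_inj_on:
  assumes "small U B" "inj_on f A" "f ` A \<subseteq> B"
  shows "small U A"
proof -
  have "|A| \<le>o |B|" using assms(2,3) by (intro card_of_ordLeqI[of f]) auto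
  then show ?thesis using assms(1) unfolding small_def by (rule ordLeq_ordLess_trans)
qed

lemma small_finite:
  assumes "universe (U :: 'u itself)" "finite A"
  shows "small U A"
  unfolding small_def
  by (rule finite_ordLess_infinite[OF card_of_Well_order card_of_Well_order])
    (simp_all add: Field_card_of assms(2) universe_infinite[OF assms(1)])

lemma small_Sigma:
  assumes "universe U" "small U A" "\<And>a. a \<in> A \<Longrightarrow> small U (F a)"
  shows "small U (Sigma A F)"
  unfolding small_def
  by (rule stable_elim[OF universe_stable[OF assms(1)]]) (use assms in \<open>auto simp: small_def\<close>)

lemma small_Un: "universe U \<Longrightarrow> small U A \<Longrightarrow> small U B \<Longrightarrow> small U (A \<union> B)"
  unfolding small_def by (rule card_of_Un_ordLess_infinite[OF universe_infinite])

lemma small_embeds: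
  assumes "small (U :: 'u itself) A"
  shows "\<exists>f :: 'a \<Rightarrow> 'u. inj_on f (A :: 'a set)"
proof -
  have "|A| \<le>o |UNIV :: 'u set|" using assms unfolding small_def by (rule ordLess_imp_ordLeq)
  then show ?thesis using card_of_ordLeq[of A "UNIV :: 'u set"] by auto
qed

lemma small_Pow:
  assumes "universe (U :: 'u itself)" "small U A"
  shows "small U (Pow A)"
proof -
  obtain f :: "'a \<Rightarrow> 'u" where f: "inj_on f A" using small_embeds[OF assms(2)] by blast
  have "small U (Pow (f ` A))"
    using assms(1) small_image[OF assms(2), of f] unfolding universe_def small_def by blast
  moreover have "inj_on (image f) (Pow A)" using f by (rule inj_on_image_Pow)
  moreover have "image f ` Pow A \<subseteq> Pow (f ` A)" by blast
  ultimately show ?thesis by (rule small_inj_on)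
qed

text \<open>A function on \<open>A\<close> with values in the \<open>F a\<close> is determined by its graph, a subset of the
  disjoint union of the \<open>F a\<close>, so strong inaccessibility bounds their number.\<close>

lemma small_PiE:
  fixes A :: "'b set" and F :: "'b \<Rightarrow> 'c set"
  assumes U: "universe U" and A: "small U A" and F: "\<And>a. a \<in> A \<Longrightarrow> small U (F a)"
  shows "small U (Pi\<^sub>E A F)"
proof -
  let ?g = "\<lambda>f :: 'b \<Rightarrow> 'c. (\<lambda>a. (a, f a)) ` A"
  have "inj_on ?g (Pi\<^sub>E A F)"
  proof (rule inj_onI)
    fix f h assume f: "f \<in> Pi\<^sub>E A F" and h: "h \<in> Pi\<^sub>E A F" and eq: "?g f = ?g h"
    have "f a = h a" if "a \<in> A" for a
      using that eq by (auto simp: set_eq_iff image_iff)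
    then show "f = h" using f h by (meson PiE_ext)
  qed
  moreover have "?g ` (Pi\<^sub>E A F) \<subseteq> Pow (Sigma A F)" by auto
  moreover have "small U (Pow (Sigma A F))"
    using small_Pow[OF U] small_Sigma[OF U A, of F] F by blast
  ultimately show ?thesis using small_inj_on by blast
qed

text \<open>The successor of \<open>|A|\<close> plus aleph zero is regular, and it stays below the universe because
  it is bounded by a power set.\<close>

lemma small_regular_above:
  assumes U: "universe (U :: 'u itself)" and A: "small U A"
  shows "\<exists>k :: 'u rel. Card_order k \<and> infinite (Field k) \<and> regularCard k \<and>
    k <o |UNIV :: 'u set| \<and> |A| <o k"
proof -
  let ?B = "A <+> (UNIV :: nat set)"
  have nat: "small U (UNIV :: nat set)"
    unfolding small_def using U unfolding universe_def by (metis card_of_nat ordIso_ordLess_trans)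
  have smB: "small U ?B"
    using card_of_Plus_ordLess_infinite[OF universe_infinite[OF U]] A nat unfolding small_def by metis
  have infB: "infinite ?B" by (simp add: finite_Plus_iff)
  have c: "Card_order |?B|" by (rule card_of_Card_order)
  have "cardSuc |?B| \<le>o |Pow ?B|"
    by (rule cardSuc_ordLess_ordLeq[OF c card_of_Card_order, THEN iffD1]) (rule card_of_Pow)
  moreover have "|Pow ?B| <o |UNIV :: 'u set|"
    using small_Pow[OF U smB] unfolding small_def .
  ultimately have lt: "cardSuc |?B| <o |UNIV :: 'u set|" by (rule ordLeq_ordLess_trans)
  have co: "Card_order (cardSuc |?B| )" using cardSuc_Card_order[OF c] .
  obtain k :: "'u rel" where k: "Field k < Field |UNIV :: 'u set|" "cardSuc |?B| =o k" "k <o |UNIV :: 'u set|"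
    using internalize_ordLess[THEN iffD1, OF lt] by (elim exE conjE)
  have cok: "Card_order k" using Card_order_ordIso2[OF co k(2)] .
  have inf: "infinite (Field (cardSuc |?B| ))"
    using cardSuc_finite[OF c] infB by (simp add: Field_card_of)
  have reg: "regularCard (cardSuc |?B| )"
    using infinite_cardSuc_regularCard[OF _ c] infB by (simp add: Field_card_of)
  have "Cinfinite (cardSuc |?B| )" using inf co by (simp add: cinfinite_def)
  then have regk: "regularCard k" using regularCard_ordIso[OF k(2)] reg by blast
  have "cardSuc |?B| =o |Field k|"
    using ordIso_transitive[OF k(2) ordIso_symmetric[OF card_of_Field_ordIso[OF cok]]] .
  then have infk: "infinite (Field k)"
    using card_of_ordIso_finite_Field[OF co] inf by blast
  have "|A| \<le>o |?B|" by (rule card_of_Plus1)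
  moreover have "|?B| <o cardSuc |?B|" by (rule cardSuc_greater[OF c])
  ultimately have "|A| <o cardSuc |?B|" by (rule ordLeq_ordLess_trans)
  then have "|A| <o k" using k(2) by (rule ordLess_ordIso_trans)
  then show ?thesis using cok infk regk k(3) by blast
qed

text \<open>Smallness of one object comes with one cardinal; a set of generating maps needs a single
  cardinal that is large enough for all their domains. Having \<open>|A|\<close> below it as well allows to
  take upper bounds of \<open>A\<close>-indexed families of stages.\<close>

lemma small_cardinals_bounded:
  assumes U: "universe (U :: 'u itself)" and A: "small U A"
    and k: "\<And>a. a \<in> A \<Longrightarrow> Card_order (k a :: 'u rel) \<and> k a <o |UNIV :: 'u set|"
  shows "\<exists>\<kappa> :: 'u rel. Card_order \<kappa> \<and> infinite (Field \<kappa>) \<and> regularCard \<kappa> \<and>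
    \<kappa> <o |UNIV :: 'u set| \<and> |A| <o \<kappa> \<and> (\<forall>a\<in>A. k a \<le>o \<kappa>)"
proof -
  have sF: "small U (Field (k a))" if "a \<in> A" for a
    using k[OF that] unfolding small_def by (metis card_of_Field_ordIso ordIso_ordLess_trans)
  let ?S = "A <+> (Sigma A (\<lambda>a. Field (k a)))"
  have "small U ?S"
    using card_of_Plus_ordLess_infinite[OF universe_infinite[OF U]] A small_Sigma[OF U A sF, of "\<lambda>a. a"]
    unfolding small_def by metis
  from small_regular_above[OF U this] obtain \<kappa> :: "'u rel" where \<kappa>: "Card_order \<kappa>"
    "infinite (Field \<kappa>)" "regularCard \<kappa>" "\<kappa> <o |UNIV :: 'u set|" "|?S| <o \<kappa>" by blast
  have "k a \<le>o \<kappa>" if "a \<in> A" for a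
  proof -
    have "|Field (k a)| \<le>o |?S|"
      using that by (intro card_of_ordLeqI[of "\<lambda>x. Inr (a, x)"]) (auto simp: inj_on_def)
    then have "|Field (k a)| \<le>o \<kappa>" by (rule ordLess_imp_ordLeq[OF ordLeq_ordLess_trans[OF _ \<kappa>(5)]])
    moreover have "k a =o |Field (k a)|" using k[OF that] by (metis ordIso_symmetric card_of_Field_ordIso)
    ultimately show ?thesis by (metis ordIso_ordLeq_trans)
  qed
  moreover have "|A| <o \<kappa>" using ordLeq_ordLess_trans[OF card_of_Plus1 \<kappa>(5)] .
  ultimately show ?thesis using \<kappa> by blast
qed

text \<open>Regularity in the form in which it is used: fewer than \<open>r\<close> many stages of a sequence of
  length \<open>r\<close> have a common later stage.\<close>

lemma regular_bounded:
  assumes r: "Card_order r" "regularCard r" and lt: "|X| <o r" and f: "\<And>x. x \<in> X \<Longrightarrow> f x \<in> Field r"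
  shows "\<exists>b \<in> Field r. \<forall>x \<in> X. (f x, b) \<in> r"
proof -
  have wo: "Well_order r" using r(1) card_order_on_well_order_on by blast
  have "|f ` X| <o r" using ordLeq_ordLess_trans[OF card_of_image lt] .
  then have "\<not> |f ` X| =o r" by (metis not_ordLess_ordIso)
  then have "\<not> cofinal (f ` X) r" using r(2) f unfolding regularCard_def by blast
  then obtain b where b: "b \<in> Field r" "\<forall>y \<in> f ` X. \<not> (b \<noteq> y \<and> (b, y) \<in> r)"
    unfolding cofinal_def by blast
  have "(f x, b) \<in> r" if "x \<in> X" for x
  proof -
    have "(f x, b) \<in> r \<or> (b, f x) \<in> r"
      using wo_rel.TOTALS[of r] wo b(1) f[OF that] by (auto simp: wo_rel_def)
    moreover have "(b, b) \<in> r" using wo_rel.REFL[of r] wo b(1) by (auto simp: wo_rel_def refl_on_def)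
    ultimately show ?thesis using b(2) that by (cases "b = f x") auto
  qed
  then show ?thesis using b(1) by blast
qed

section \<open>Well-orders\<close>

lemma wo_reflD: "Well_order r \<Longrightarrow> x \<in> Field r \<Longrightarrow> (x, x) \<in> r"
  by (auto simp: order_on_defs refl_on_def)

lemma wo_transD: "Well_order r \<Longrightarrow> (x, y) \<in> r \<Longrightarrow> (y, z) \<in> r \<Longrightarrow> (x, z) \<in> r"
  by (auto simp: order_on_defs dest: transD)

lemma wo_antisymD: "Well_order r \<Longrightarrow> (x, y) \<in> r \<Longrightarrow> (y, x) \<in> r \<Longrightarrow> x = y"
  by (auto simp: order_on_defs antisym_def)

lemma wo_totalD: "Well_order r \<Longrightarrow> x \<in> Field r \<Longrightarrow> y \<in> Field r \<Longrightarrow> (x, y) \<in> r \<or> (y, x) \<in> r"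
  using wo_rel.TOTALS[of r] by (auto simp: wo_rel_def)

lemma wo_leastD:
  assumes "Well_order r" "S \<subseteq> Field r" "S \<noteq> {}"
  shows "\<exists>m\<in>S. \<forall>x\<in>S. (m, x) \<in> r"
  using wo_rel.minim_in[of r S] wo_rel.minim_least[of r S] assms by (auto simp: wo_rel_def)

lemma FieldD: "(x, y) \<in> r \<Longrightarrow> x \<in> Field r \<and> y \<in> Field r"
  by (auto simp: Field_def)

lemma underSD: "x \<in> underS r b \<Longrightarrow> (x, b) \<in> r \<and> x \<noteq> b \<and> x \<in> Field r"
  by (auto simp: underS_def Field_def)

lemma wo_underS_trans:
  "Well_order r \<Longrightarrow> (x, y) \<in> r \<Longrightarrow> y \<in> underS r b \<Longrightarrow> x \<in> underS r b"
  unfolding underS_def using wo_transD[of r x y b] wo_antisymD[of r x y] by auto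

lemma wo_not_underS:
  "Well_order r \<Longrightarrow> x \<in> Field r \<Longrightarrow> b \<in> Field r \<Longrightarrow> x \<notin> underS r b \<longleftrightarrow> (b, x) \<in> r"
  unfolding underS_def using wo_totalD[of r x b] wo_antisymD[of r x b] wo_reflD[of r b] by auto

lemma wo_wf_underS: "Well_order r \<Longrightarrow> wf {(a, b). a \<in> underS r b}"
proof -
  assume "Well_order r"
  then have "wf (r - Relation.Id)" by (simp add: order_on_defs)
  moreover have "{(a, b). a \<in> underS r b} = r - Relation.Id" by (auto simp: underS_def)
  ultimately show ?thesis by simp
qed

text \<open>Recursion along a well-order in which the value at \<open>b\<close> is only required to satisfy a
  relation to the earlier values. By \<open>cong\<close> the relation \<open>P f b\<close> looks at \<open>f\<close> below \<open>b\<close> only, and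
  \<open>ex\<close> may assume that all earlier choices were made correctly.\<close>

lemma wo_dependent_choice:
  assumes r: "Well_order r"
    and cong: "\<And>f g b x. (\<And>a. a \<in> underS r b \<Longrightarrow> f a = g a) \<Longrightarrow> P f b x \<Longrightarrow> P g b x"
    and ex: "\<And>b f. b \<in> Field r \<Longrightarrow> (\<And>a. a \<in> underS r b \<Longrightarrow> P f a (f a)) \<Longrightarrow> \<exists>x. P f b x"
  shows "\<exists>f. \<forall>b\<in>Field r. P f b (f b)"
proof -
  let ?Q = "\<lambda>f b x. b \<in> Field r \<longrightarrow> P f b x"
  have "\<exists>f. \<forall>b. ?Q f b (f b)"
  proof (rule dependent_wf_choice[OF wo_wf_underS[OF r]])
    fix f g :: "'a \<Rightarrow> 'b" and b x
    assume eq: "\<And>z. (z, b) \<in> {(a, b). a \<in> underS r b} \<Longrightarrow> f z = g z"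
    have e: "f z = g z" if "z \<in> underS r b" for z using eq that by simp
    show "?Q f b x = ?Q g b x"
      using cong[of b f g x] cong[of b g f x] e by metis
  next
    fix b f assume IH: "\<And>y. (y, b) \<in> {(a, b). a \<in> underS r b} \<Longrightarrow> ?Q f y (f y)"
    show "\<exists>x. ?Q f b x"
    proof (cases "b \<in> Field r")
      case True
      have "P f a (f a)" if "a \<in> underS r b" for a
        using IH[of a] that underSD[OF that] by simp
      then show ?thesis using ex[OF True] by blast
    qed auto
  qed
  then show ?thesis by blast
qed

lemma succ_elemD:
  assumes "succ_elem r a b"
  shows "a \<in> Field r" "b \<in> Field r" "a \<in> underS r b" "(a, b) \<in> r" "a \<noteq> b"
  using assms by (auto simp: succ_elem_def underS_def)

lemma succ_elem_le:
  assumes "Well_order r" "succ_elem r a b" "x \<in> underS r b"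
  shows "(x, a) \<in> r"
proof -
  have "x = a \<or> x \<in> underS r a" using assms(2,3) by (auto simp: succ_elem_def)
  then show ?thesis using wo_reflD[OF assms(1) succ_elemD(1)[OF assms(2)]] by (auto simp: underS_def)
qed

lemma succ_elem_unique:
  assumes "Well_order r" "succ_elem r a b" "succ_elem r a' b"
  shows "a = a'"
  using succ_elem_le[OF assms(1,2) succ_elemD(3)[OF assms(3)]]
    succ_elem_le[OF assms(1,3) succ_elemD(3)[OF assms(2)]] wo_antisymD[OF assms(1)] by blast

lemma succ_elem_next:
  assumes "Well_order r" "succ_elem r a b" "x \<in> Field r" "(a, x) \<in> r" "a \<noteq> x"
  shows "(b, x) \<in> r"
proof (rule ccontr)
  assume "(b, x) \<notin> r"
  then have "x \<in> underS r b"
    using wo_not_underS[OF assms(1,3) succ_elemD(2)[OF assms(2)]] by blast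
  then have "(x, a) \<in> r" by (rule succ_elem_le[OF assms(1,2)])
  then show False using assms(4,5) wo_antisymD[OF assms(1)] by blast
qed

lemma succ_elemI:
  assumes r: "Well_order r" and "(a, b) \<in> r" "a \<noteq> b" "\<And>x. x \<in> underS r b \<Longrightarrow> (x, a) \<in> r"
  shows "succ_elem r a b"
  unfolding succ_elem_def
proof (intro conjI equalityI subsetI)
  show "a \<in> Field r" "b \<in> Field r" using assms(2) by (auto simp: Field_def)
  fix x assume "x \<in> underS r b"
  then show "x \<in> insert a (underS r a)" using assms(4)[of x] by (auto simp: underS_def)
next
  fix x assume "x \<in> insert a (underS r a)"
  then show "x \<in> underS r b"
    using assms(2,3) wo_transD[OF r, of x a b] wo_antisymD[OF r, of a b]
    by (auto simp: underS_def)
qed (use assms in auto)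

lemma elem_cases:
  assumes "b \<in> Field r"
  obtains "least_elem r b" | a where "succ_elem r a b" | "limit_elem r b"
  using assms unfolding limit_elem_def by blast

lemma succ_elem_exists:
  assumes r: "Well_order r" and a: "a \<in> Field r" and x: "(a, x) \<in> r" "a \<noteq> x"
  shows "\<exists>b. succ_elem r a b"
proof -
  let ?S = "{y. (a, y) \<in> r \<and> a \<noteq> y}"
  obtain m where m: "m \<in> ?S" "\<And>y. y \<in> ?S \<Longrightarrow> (m, y) \<in> r"
    using wo_leastD[OF r, of ?S] x by (force simp: Field_def)
  have "(x, a) \<in> r" if "x \<in> underS r m" for x
  proof (rule ccontr)
    assume n: "(x, a) \<notin> r"
    have xF: "x \<in> Field r" using underSD[OF that] by blast
    then have "(a, x) \<in> r" using wo_totalD[OF r a] n by blast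
    moreover have "a \<noteq> x" using n wo_reflD[OF r a] by blast
    ultimately have "(m, x) \<in> r" using m(2) by blast
    then show False using underSD[OF that] wo_antisymD[OF r] by blast
  qed
  then have "succ_elem r a m" using m(1) by (intro succ_elemI[OF r]) auto
  then show ?thesis by blast
qed

lemma infinite_card_succ:
  assumes "Card_order r" "infinite (Field r)" "a \<in> Field r"
  shows "\<exists>b. succ_elem r a b"
proof -
  have "Well_order r" using assms(1) by (rule card_order_on_well_order_on)
  then show ?thesis
    using infinite_Card_order_limit[OF assms(1,2,3)] succ_elem_exists[OF _ assms(3)] by blast
qed

lemma Card_order_wo: "Card_order r \<Longrightarrow> Well_order r"
  by (rule card_order_on_well_order_on)

lemma Field_Restr: "Well_order r \<Longrightarrow> S \<subseteq> Field r \<Longrightarrow> Field (Restr r S) = S"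
  using wo_reflD[of r] by (force simp: Field_def)

lemma Restr_wo: "Well_order r \<Longrightarrow> Well_order (Restr r S)"
  by (rule Well_order_Restr)

lemma underS_subset: "underS r b \<subseteq> Field r"
  by (auto simp: underS_def Field_def)

lemma Field_Restr_underS: "Well_order r \<Longrightarrow> Field (Restr r (underS r b)) = underS r b"
  by (rule Field_Restr[OF _ underS_subset])

lemma underS_Restr: "b \<in> S \<Longrightarrow> underS (Restr r S) b = underS r b \<inter> S"
  by (auto simp: underS_def)

lemma least_elem_le: "Well_order r \<Longrightarrow> least_elem r a \<Longrightarrow> x \<in> Field r \<Longrightarrow> (a, x) \<in> r"
  unfolding least_elem_def using wo_not_underS[of r x a] by blast

lemma least_elem_exists:
  assumes "Well_order r" "Field r \<noteq> {}"
  shows "\<exists>a. least_elem r a"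
proof -
  obtain m where m: "m \<in> Field r" "\<And>x. x \<in> Field r \<Longrightarrow> (m, x) \<in> r"
    using wo_leastD[OF assms(1) order_refl assms(2)] by blast
  have "underS r m = {}"
    using m(2) underSD wo_antisymD[OF assms(1)] by fastforce
  then show ?thesis using m(1) unfolding least_elem_def by blast
qed

section \<open>Categories and functors\<close>

lemma HomD: "f \<in> Hom M a b \<Longrightarrow> f \<in> Arr M" "f \<in> Hom M a b \<Longrightarrow> Dom M f = a" "f \<in> Hom M a b \<Longrightarrow> Cod M f = b"
  by (auto simp: Hom_def)

lemma HomI: "f \<in> Arr M \<Longrightarrow> f \<in> Hom M (Dom M f) (Cod M f)"
  by (simp add: Hom_def)

lemma Hom_Obj:
  assumes "category M" "f \<in> Hom M a b"
  shows "a \<in> Obj M" "b \<in> Obj M"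
  using category.Dom_Obj[OF assms(1), of f] category.Cod_Obj[OF assms(1), of f] assms(2)
  by (auto simp: Hom_def)

lemma comp_Hom:
  "category M \<Longrightarrow> f \<in> Hom M a b \<Longrightarrow> g \<in> Hom M b c \<Longrightarrow> g \<cdot>\<^bsub>M\<^esub> f \<in> Hom M a c"
  by (auto simp: Hom_def category.Comp_Arr category.Dom_Comp category.Cod_Comp)

lemma comp_assoc:
  "category M \<Longrightarrow> f \<in> Hom M a b \<Longrightarrow> g \<in> Hom M b c \<Longrightarrow> h \<in> Hom M c d \<Longrightarrow>
    (h \<cdot>\<^bsub>M\<^esub> g) \<cdot>\<^bsub>M\<^esub> f = h \<cdot>\<^bsub>M\<^esub> (g \<cdot>\<^bsub>M\<^esub> f)"
  by (auto simp: Hom_def category.Comp_assoc)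

lemma id_Hom: "category M \<Longrightarrow> x \<in> Obj M \<Longrightarrow> Id M x \<in> Hom M x x"
  by (auto simp: Hom_def category.Id_Arr category.Dom_Id category.Cod_Id)

lemma comp_id: "category M \<Longrightarrow> f \<in> Hom M a b \<Longrightarrow> f \<cdot>\<^bsub>M\<^esub> Id M a = f"
  by (auto simp: Hom_def category.Comp_Id)

lemma id_comp: "category M \<Longrightarrow> f \<in> Hom M a b \<Longrightarrow> Id M b \<cdot>\<^bsub>M\<^esub> f = f"
  by (auto simp: Hom_def category.Id_Comp)

text \<open>With composites nested to the right, an equation \<open>h \<cdot> g = k\<close> does not apply to \<open>h \<cdot> (g \<cdot> f)\<close>
  as a rewrite rule; this rule does.\<close>

lemma comp_eq_right:
  fixes M (structure)
  assumes "category M" "f \<in> Hom M a b" "g \<in> Hom M b c" "h \<in> Hom M c d" "h \<cdot> g = k"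
  shows "h \<cdot> (g \<cdot> f) = k \<cdot> f"
  using comp_assoc[OF assms(1-4)] assms(5) by simp

lemma categoryI:
  fixes M (structure)
  assumes "\<And>f. f \<in> Arr M \<Longrightarrow> Dom M f \<in> Obj M \<and> Cod M f \<in> Obj M"
    and "\<And>x. x \<in> Obj M \<Longrightarrow> Id M x \<in> Hom M x x"
    and "\<And>f g a b c. f \<in> Hom M a b \<Longrightarrow> g \<in> Hom M b c \<Longrightarrow> g \<cdot> f \<in> Hom M a c"
    and "\<And>f a b. f \<in> Hom M a b \<Longrightarrow> f \<cdot> Id M a = f"
    and "\<And>f a b. f \<in> Hom M a b \<Longrightarrow> Id M b \<cdot> f = f"
    and "\<And>f g h a b c d. f \<in> Hom M a b \<Longrightarrow> g \<in> Hom M b c \<Longrightarrow> h \<in> Hom M c d \<Longrightarrow>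
      (h \<cdot> g) \<cdot> f = h \<cdot> (g \<cdot> f)"
  shows "category M"
proof
  fix f assume "f \<in> Arr M"
  then show "Dom M f \<in> Obj M" "Cod M f \<in> Obj M" using assms(1) by auto
next
  fix x assume "x \<in> Obj M"
  then have "Id M x \<in> Hom M x x" using assms(2) by auto
  then show "Id M x \<in> Arr M" "Dom M (Id M x) = x" "Cod M (Id M x) = x" by (auto simp: Hom_def)
next
  fix f g assume a: "f \<in> Arr M" "g \<in> Arr M" "Dom M g = Cod M f"
  have "g \<cdot> f \<in> Hom M (Dom M f) (Cod M g)"
    using assms(3)[OF HomI[OF a(1)], of g] HomI[OF a(2)] a(3) by simp
  then show "g \<cdot> f \<in> Arr M" "Dom M (g \<cdot> f) = Dom M f" "Cod M (g \<cdot> f) = Cod M g"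
    by (auto simp: Hom_def)
next
  fix f assume a: "f \<in> Arr M"
  show "f \<cdot> Id M (Dom M f) = f" using assms(4)[OF HomI[OF a]] .
  show "Id M (Cod M f) \<cdot> f = f" using assms(5)[OF HomI[OF a]] .
next
  fix f g h assume a: "f \<in> Arr M" "g \<in> Arr M" "h \<in> Arr M" "Dom M g = Cod M f" "Dom M h = Cod M g"
  show "(h \<cdot> g) \<cdot> f = h \<cdot> (g \<cdot> f)"
    using assms(6)[OF HomI[OF a(1)], of g "Cod M g" h "Cod M h"] a by (simp add: Hom_def)
qed

lemma is_functorI:
  assumes "\<And>x. x \<in> Obj A \<Longrightarrow> FOb F x \<in> Obj B"
    and "\<And>f x y. f \<in> Hom A x y \<Longrightarrow> FAr F f \<in> Hom B (FOb F x) (FOb F y)"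
    and "\<And>x. x \<in> Obj A \<Longrightarrow> FAr F (Id A x) = Id B (FOb F x)"
    and "\<And>f g x y z. f \<in> Hom A x y \<Longrightarrow> g \<in> Hom A y z \<Longrightarrow> FAr F (g \<cdot>\<^bsub>A\<^esub> f) = FAr F g \<cdot>\<^bsub>B\<^esub> FAr F f"
  shows "is_functor A B F"
  unfolding is_functor_def using assms by (auto simp: Hom_def)

lemma functor_Ob: "is_functor A B F \<Longrightarrow> x \<in> Obj A \<Longrightarrow> FOb F x \<in> Obj B"
  by (auto simp: is_functor_def)

lemma functor_Hom: "is_functor A B F \<Longrightarrow> f \<in> Hom A x y \<Longrightarrow> FAr F f \<in> Hom B (FOb F x) (FOb F y)"
  by (auto simp: is_functor_def Hom_def)

lemma functor_Id: "is_functor A B F \<Longrightarrow> x \<in> Obj A \<Longrightarrow> FAr F (Id A x) = Id B (FOb F x)"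
  by (auto simp: is_functor_def)

lemma functor_Comp: "is_functor A B F \<Longrightarrow> f \<in> Hom A x y \<Longrightarrow> g \<in> Hom A y z \<Longrightarrow>
    FAr F (g \<cdot>\<^bsub>A\<^esub> f) = FAr F g \<cdot>\<^bsub>B\<^esub> FAr F f"
  by (auto simp: is_functor_def Hom_def)

section \<open>Preorders as categories\<close>

lemma ord_cat_simps [simp]:
  "Obj (ord_cat r) = Field r" "Arr (ord_cat r) = r" "Dom (ord_cat r) = fst" "Cod (ord_cat r) = snd"
  "Id (ord_cat r) x = (x, x)" "Comp (ord_cat r) g f = (fst f, snd g)"
  by (auto simp: ord_cat_def)

lemma Hom_ord_cat: "f \<in> Hom (ord_cat r) x y \<longleftrightarrow> f = (x, y) \<and> (x, y) \<in> r"
  by (auto simp: Hom_def)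

lemma ord_cat_category:
  assumes "\<And>x. x \<in> Field r \<Longrightarrow> (x, x) \<in> r" "trans r"
  shows "category (ord_cat r)"
  by (rule categoryI) (use assms in \<open>auto simp: Hom_def Field_def dest: transD\<close>)

lemma wo_category: "Well_order r \<Longrightarrow> category (ord_cat r)"
  by (rule ord_cat_category) (auto intro: wo_reflD simp: order_on_defs)

lemma ord_functorI:
  assumes "\<And>x. x \<in> Field r \<Longrightarrow> FOb F x \<in> Obj M"
    and "\<And>x y. (x, y) \<in> r \<Longrightarrow> FAr F (x, y) \<in> Hom M (FOb F x) (FOb F y)"
    and "\<And>x. x \<in> Field r \<Longrightarrow> FAr F (x, x) = Id M (FOb F x)"
    and "\<And>x y z. (x, y) \<in> r \<Longrightarrow> (y, z) \<in> r \<Longrightarrow> FAr F (x, z) = FAr F (y, z) \<cdot>\<^bsub>M\<^esub> FAr F (x, y)"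
  shows "is_functor (ord_cat r) M F"
  by (rule is_functorI) (auto simp: Hom_ord_cat assms)

lemma ord_functor_Ob: "is_functor (ord_cat r) M F \<Longrightarrow> x \<in> Field r \<Longrightarrow> FOb F x \<in> Obj M"
  by (drule functor_Ob) auto

lemma ord_functor_Hom:
  "is_functor (ord_cat r) M F \<Longrightarrow> (x, y) \<in> r \<Longrightarrow> FAr F (x, y) \<in> Hom M (FOb F x) (FOb F y)"
  by (erule functor_Hom) (auto simp: Hom_ord_cat)

lemma ord_functor_Id:
  "is_functor (ord_cat r) M F \<Longrightarrow> x \<in> Field r \<Longrightarrow> FAr F (x, x) = Id M (FOb F x)"
  by (drule functor_Id[of _ _ _ x]) auto

lemma ord_functor_Comp:
  "is_functor (ord_cat r) M F \<Longrightarrow> (x, y) \<in> r \<Longrightarrow> (y, z) \<in> r \<Longrightarrow>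
    FAr F (y, z) \<cdot>\<^bsub>M\<^esub> FAr F (x, y) = FAr F (x, z)"
  using functor_Comp[of "ord_cat r" M F "(x, y)" x y "(y, z)" z] by (auto simp: Hom_ord_cat)

lemma ord_functor_Restr:
  assumes r: "Well_order r" and F: "is_functor (ord_cat r) M F" and S: "S \<subseteq> Field r"
  shows "is_functor (ord_cat (Restr r S)) M F"
  by (rule ord_functorI)
    (use ord_functor_Ob[OF F] ord_functor_Hom[OF F] ord_functor_Id[OF F] ord_functor_Comp[OF F] S
        Field_Restr[OF r S] in auto)

section \<open>Colimits and limits\<close>

lemma coconeD:
  assumes "is_cocone J K D c \<tau>"
  shows "c \<in> Obj K" "j \<in> Obj J \<Longrightarrow> \<tau> j \<in> Hom K (FOb D j) c"
    "u \<in> Hom J i j \<Longrightarrow> \<tau> j \<cdot>\<^bsub>K\<^esub> FAr D u = \<tau> i"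
  using assms by (auto simp: is_cocone_def Hom_def)

lemma coconeI:
  assumes "c \<in> Obj K" "\<And>j. j \<in> Obj J \<Longrightarrow> \<tau> j \<in> Hom K (FOb D j) c"
    "\<And>u i j. u \<in> Hom J i j \<Longrightarrow> \<tau> j \<cdot>\<^bsub>K\<^esub> FAr D u = \<tau> i"
  shows "is_cocone J K D c \<tau>"
  using assms by (auto simp: is_cocone_def Hom_def)

lemma ord_coconeI:
  assumes "c \<in> Obj K" "\<And>j. j \<in> Field r \<Longrightarrow> \<tau> j \<in> Hom K (FOb D j) c"
    "\<And>i j. (i, j) \<in> r \<Longrightarrow> \<tau> j \<cdot>\<^bsub>K\<^esub> FAr D (i, j) = \<tau> i"
  shows "is_cocone (ord_cat r) K D c \<tau>"
  by (rule coconeI) (auto simp: assms Hom_ord_cat)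

lemma ord_coconeD:
  assumes "is_cocone (ord_cat r) K D c \<tau>"
  shows "c \<in> Obj K" "j \<in> Field r \<Longrightarrow> \<tau> j \<in> Hom K (FOb D j) c"
    "(i, j) \<in> r \<Longrightarrow> \<tau> j \<cdot>\<^bsub>K\<^esub> FAr D (i, j) = \<tau> i"
  using coconeD[OF assms] by (auto simp: Hom_ord_cat)

lemma colimit_cocone: "is_colimit J K D c \<tau> \<Longrightarrow> is_cocone J K D c \<tau>"
  by (simp add: is_colimit_def)

lemma colimit_ex:
  assumes "is_colimit J K D c \<tau>" "is_cocone J K D d \<sigma>"
  shows "\<exists>h. h \<in> Hom K c d \<and> (\<forall>j \<in> Obj J. h \<cdot>\<^bsub>K\<^esub> \<tau> j = \<sigma> j)"
  using assms unfolding is_colimit_def by blast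

lemma cocone_comp:
  fixes K (structure)
  assumes K: "category K" and J: "category J" and D: "is_functor J K D"
    and c: "is_cocone J K D c \<tau>" and h: "h \<in> Hom K c d"
  shows "is_cocone J K D d (\<lambda>j. h \<cdot> \<tau> j)"
proof (rule coconeI)
  show "d \<in> Obj K" using Hom_Obj[OF K h] by simp
  show "h \<cdot> \<tau> j \<in> Hom K (FOb D j) d" if "j \<in> Obj J" for j
    using comp_Hom[OF K coconeD(2)[OF c that] h] .
  show "h \<cdot> \<tau> j \<cdot> FAr D u = h \<cdot> \<tau> i" if u: "u \<in> Hom J i j" for u i j
    using comp_assoc[OF K functor_Hom[OF D u] coconeD(2)[OF c Hom_Obj(2)[OF J u]] h] coconeD(3)[OF c u]
    by simp
qed

lemma colimit_uniq:
  fixes K (structure)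
  assumes K: "category K" and J: "category J" and D: "is_functor J K D"
    and c: "is_colimit J K D c \<tau>" and h: "h \<in> Hom K c d" "h' \<in> Hom K c d"
    and eq: "\<And>j. j \<in> Obj J \<Longrightarrow> h \<cdot> \<tau> j = h' \<cdot> \<tau> j"
  shows "h = h'"
proof -
  have "\<exists>!k. k \<in> Hom K c d \<and> (\<forall>j \<in> Obj J. k \<cdot> \<tau> j = h' \<cdot> \<tau> j)"
    using c cocone_comp[OF K J D colimit_cocone[OF c] h(2)] unfolding is_colimit_def by blast
  then show ?thesis using h eq by blast
qed

lemma colimitI:
  fixes K (structure)
  assumes "is_cocone J K D c \<tau>"
    and "\<And>d \<sigma>. is_cocone J K D d \<sigma> \<Longrightarrow> \<exists>h. h \<in> Hom K c d \<and> (\<forall>j \<in> Obj J. h \<cdot> \<tau> j = \<sigma> j)"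
    and "\<And>d h h'. h \<in> Hom K c d \<Longrightarrow> h' \<in> Hom K c d \<Longrightarrow>
      (\<And>j. j \<in> Obj J \<Longrightarrow> h \<cdot> \<tau> j = h' \<cdot> \<tau> j) \<Longrightarrow> h = h'"
  shows "is_colimit J K D c \<tau>"
  unfolding is_colimit_def
proof (intro conjI allI impI)
  fix d \<sigma> assume "is_cocone J K D d \<sigma>"
  then obtain h where h: "h \<in> Hom K c d" "\<forall>j \<in> Obj J. h \<cdot> \<tau> j = \<sigma> j" using assms(2) by blast
  show "\<exists>!h. h \<in> Hom K c d \<and> (\<forall>j\<in>Obj J. h \<cdot> \<tau> j = \<sigma> j)"
  proof (rule ex1I[of _ h])
    show "h' = h" if h': "h' \<in> Hom K c d \<and> (\<forall>j\<in>Obj J. h' \<cdot> \<tau> j = \<sigma> j)" for h'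
      by (rule assms(3)[OF h'[THEN conjunct1] h(1)]) (simp add: h(2) h')
  qed (use h in simp)
qed (rule assms(1))

lemma is_cocone_cong:
  assumes J: "category J" and D: "\<And>j. j \<in> Obj J \<Longrightarrow> FOb D j = FOb D' j" "\<And>u. u \<in> Arr J \<Longrightarrow> FAr D u = FAr D' u"
    and \<tau>: "\<And>j. j \<in> Obj J \<Longrightarrow> \<tau> j = \<tau>' j"
  shows "is_cocone J K D c \<tau> \<longleftrightarrow> is_cocone J K D' c \<tau>'"
  unfolding is_cocone_def using D \<tau> category.Dom_Obj[OF J] category.Cod_Obj[OF J] by simp

lemma is_colimit_cong:
  assumes J: "category J" and D: "\<And>j. j \<in> Obj J \<Longrightarrow> FOb D j = FOb D' j" "\<And>u. u \<in> Arr J \<Longrightarrow> FAr D u = FAr D' u"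
    and \<tau>: "\<And>j. j \<in> Obj J \<Longrightarrow> \<tau> j = \<tau>' j"
  shows "is_colimit J K D c \<tau> \<longleftrightarrow> is_colimit J K D' c \<tau>'"
  unfolding is_colimit_def using is_cocone_cong[of J D D', OF J D \<tau>] is_cocone_cong[of J D D', OF J D refl] \<tau>
  by simp

lemma colimit_iso:
  fixes K (structure)
  assumes K: "category K" and J: "category J" and D: "is_functor J K D"
    and c: "is_colimit J K D c \<tau>" and k: "k \<in> Hom K c c'" "k' \<in> Hom K c' c"
    "k \<cdot> k' = Id K c'" "k' \<cdot> k = Id K c"
  shows "is_colimit J K D c' (\<lambda>j. k \<cdot> \<tau> j)"
proof (rule colimitI)
  have \<tau>: "\<tau> j \<in> Hom K (FOb D j) c" if "j \<in> Obj J" for j using coconeD(2)[OF colimit_cocone[OF c] that] .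
  show "is_cocone J K D c' (\<lambda>j. k \<cdot> \<tau> j)" by (rule cocone_comp[OF K J D colimit_cocone[OF c] k(1)])
  fix d
  {
    fix \<sigma> assume "is_cocone J K D d \<sigma>"
    then obtain h where h: "h \<in> Hom K c d" "\<And>j. j \<in> Obj J \<Longrightarrow> h \<cdot> \<tau> j = \<sigma> j" using colimit_ex[OF c] by blast
    have "(h \<cdot> k') \<cdot> (k \<cdot> \<tau> j) = \<sigma> j" if j: "j \<in> Obj J" for j
      using comp_assoc[OF K comp_Hom[OF K \<tau>[OF j] k(1)] k(2) h(1)]
        comp_eq_right[OF K \<tau>[OF j] k(1,2,4)] id_comp[OF K \<tau>[OF j]] h(2)[OF j] by simp
    then show "\<exists>h. h \<in> Hom K c' d \<and> (\<forall>j \<in> Obj J. h \<cdot> (k \<cdot> \<tau> j) = \<sigma> j)"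
      using comp_Hom[OF K k(2) h(1)] by blast
  next
    fix h h' assume h: "h \<in> Hom K c' d" "h' \<in> Hom K c' d"
      and eq: "\<And>j. j \<in> Obj J \<Longrightarrow> h \<cdot> (k \<cdot> \<tau> j) = h' \<cdot> (k \<cdot> \<tau> j)"
    have "(h \<cdot> k) \<cdot> \<tau> j = (h' \<cdot> k) \<cdot> \<tau> j" if "j \<in> Obj J" for j
      using comp_assoc[OF K \<tau>[OF that] k(1) h(1)] comp_assoc[OF K \<tau>[OF that] k(1) h(2)] eq[OF that] by simp
    then have "h \<cdot> k = h' \<cdot> k"
      using colimit_uniq[OF K J D c comp_Hom[OF K k(1) h(1)] comp_Hom[OF K k(1) h(2)]] by blast
    then have "(h \<cdot> k) \<cdot> k' = (h' \<cdot> k) \<cdot> k'" by simp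
    then show "h = h'"
      using comp_assoc[OF K k(2,1) h(1)] comp_assoc[OF K k(2,1) h(2)] k(3) comp_id[OF K h(1)] comp_id[OF K h(2)]
      by simp
  }
qed

lemma coneD:
  assumes "is_cone J K D c \<tau>"
  shows "c \<in> Obj K" "j \<in> Obj J \<Longrightarrow> \<tau> j \<in> Hom K c (FOb D j)"
    "u \<in> Hom J i j \<Longrightarrow> FAr D u \<cdot>\<^bsub>K\<^esub> \<tau> i = \<tau> j"
  using assms by (auto simp: is_cone_def Hom_def)

lemma coneI:
  assumes "c \<in> Obj K" "\<And>j. j \<in> Obj J \<Longrightarrow> \<tau> j \<in> Hom K c (FOb D j)"
    "\<And>u i j. u \<in> Hom J i j \<Longrightarrow> FAr D u \<cdot>\<^bsub>K\<^esub> \<tau> i = \<tau> j"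
  shows "is_cone J K D c \<tau>"
  using assms by (auto simp: is_cone_def Hom_def)

lemma limit_cone: "is_limit J K D c \<tau> \<Longrightarrow> is_cone J K D c \<tau>"
  by (simp add: is_limit_def)

lemma limit_ex:
  assumes "is_limit J K D c \<tau>" "is_cone J K D d \<sigma>"
  shows "\<exists>h. h \<in> Hom K d c \<and> (\<forall>j \<in> Obj J. \<tau> j \<cdot>\<^bsub>K\<^esub> h = \<sigma> j)"
  using assms unfolding is_limit_def by blast

lemma cone_comp:
  fixes K (structure)
  assumes K: "category K" and J: "category J" and D: "is_functor J K D"
    and c: "is_cone J K D c \<tau>" and h: "h \<in> Hom K d c"
  shows "is_cone J K D d (\<lambda>j. \<tau> j \<cdot> h)"
proof (rule coneI)
  show "d \<in> Obj K" using Hom_Obj[OF K h] by simp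
  show "\<tau> j \<cdot> h \<in> Hom K d (FOb D j)" if "j \<in> Obj J" for j
    using comp_Hom[OF K h coneD(2)[OF c that]] .
  show "FAr D u \<cdot> (\<tau> i \<cdot> h) = \<tau> j \<cdot> h" if u: "u \<in> Hom J i j" for u i j
    using comp_assoc[OF K h coneD(2)[OF c Hom_Obj(1)[OF J u]] functor_Hom[OF D u]] coneD(3)[OF c u]
    by simp
qed

lemma limit_uniq:
  fixes K (structure)
  assumes K: "category K" and J: "category J" and D: "is_functor J K D"
    and c: "is_limit J K D c \<tau>" and h: "h \<in> Hom K d c" "h' \<in> Hom K d c"
    and eq: "\<And>j. j \<in> Obj J \<Longrightarrow> \<tau> j \<cdot> h = \<tau> j \<cdot> h'"
  shows "h = h'"
proof -
  have "\<exists>!k. k \<in> Hom K d c \<and> (\<forall>j \<in> Obj J. \<tau> j \<cdot> k = \<tau> j \<cdot> h')"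
    using c cone_comp[OF K J D limit_cone[OF c] h(2)] unfolding is_limit_def by blast
  then show ?thesis using h eq by blast
qed

lemma limitI:
  fixes K (structure)
  assumes "is_cone J K D c \<tau>"
    and "\<And>d \<sigma>. is_cone J K D d \<sigma> \<Longrightarrow> \<exists>h. h \<in> Hom K d c \<and> (\<forall>j \<in> Obj J. \<tau> j \<cdot> h = \<sigma> j)"
    and "\<And>d h h'. h \<in> Hom K d c \<Longrightarrow> h' \<in> Hom K d c \<Longrightarrow>
      (\<And>j. j \<in> Obj J \<Longrightarrow> \<tau> j \<cdot> h = \<tau> j \<cdot> h') \<Longrightarrow> h = h'"
  shows "is_limit J K D c \<tau>"
  unfolding is_limit_def
proof (intro conjI allI impI)
  fix d \<sigma> assume "is_cone J K D d \<sigma>"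
  then obtain h where h: "h \<in> Hom K d c" "\<forall>j \<in> Obj J. \<tau> j \<cdot> h = \<sigma> j" using assms(2) by blast
  show "\<exists>!h. h \<in> Hom K d c \<and> (\<forall>j\<in>Obj J. \<tau> j \<cdot> h = \<sigma> j)"
  proof (rule ex1I[of _ h])
    show "h' = h" if h': "h' \<in> Hom K d c \<and> (\<forall>j\<in>Obj J. \<tau> j \<cdot> h' = \<sigma> j)" for h'
      by (rule assms(3)[OF h'[THEN conjunct1] h(1)]) (simp add: h(2) h')
  qed (use h in simp)
qed (rule assms(1))

subsection \<open>Index categories of arbitrary type\<close>

text \<open>Completeness speaks about index categories inside the universe; a small category over other
  types is isomorphic to one of these, via injections of its objects and arrows.\<close>

lemma bicomplete_small_index:
  fixes J :: "('oj, 'aj) cat" and K :: "('o, 'a) cat" (structure) and U :: "'u itself"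
  assumes bi: "bicomplete U K" and J: "small_category U J" and D: "is_functor J K D"
  shows "(\<exists>c \<tau>. is_limit J K D c \<tau>) \<and> (\<exists>c \<tau>. is_colimit J K D c \<tau>)"
proof -
  have cJ: "category J" and sO: "small U (Obj J)" and sA: "small U (Arr J)"
    using J by (auto simp: small_category_def)
  obtain eo :: "'oj \<Rightarrow> 'u" where eo: "inj_on eo (Obj J)" using small_embeds[OF sO] by blast
  obtain ea :: "'aj \<Rightarrow> 'u" where ea: "inj_on ea (Arr J)" using small_embeds[OF sA] by blast
  define io where "io = inv_into (Obj J) eo"
  define ia where "ia = inv_into (Arr J) ea"
  have io[simp]: "io (eo x) = x" if "x \<in> Obj J" for x using eo that by (simp add: io_def)
  have ia[simp]: "ia (ea x) = x" if "x \<in> Arr J" for x using ea that by (simp add: ia_def)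
  define J' :: "('u, 'u) cat" where "J' = \<lparr> Obj = eo ` Obj J, Arr = ea ` Arr J,
    Dom = \<lambda>x. eo (Dom J (ia x)), Cod = \<lambda>x. eo (Cod J (ia x)), Id = \<lambda>x. ea (Id J (io x)),
    Comp = \<lambda>g f. ea (ia g \<cdot>\<^bsub>J\<^esub> ia f) \<rparr>"
  define D' where "D' = \<lparr> FOb = \<lambda>x. FOb D (io x), FAr = \<lambda>x. FAr D (ia x) \<rparr>"
  have J's: "Obj J' = eo ` Obj J" "Arr J' = ea ` Arr J" "Dom J' x = eo (Dom J (ia x))"
    "Cod J' x = eo (Cod J (ia x))" "Id J' x = ea (Id J (io x))" "Comp J' g f = ea (ia g \<cdot>\<^bsub>J\<^esub> ia f)" for x f g
    by (simp_all add: J'_def)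
  note cj = category.Dom_Obj[OF cJ] category.Cod_Obj[OF cJ] category.Id_Arr[OF cJ] category.Dom_Id[OF cJ]
    category.Cod_Id[OF cJ] category.Comp_Arr[OF cJ] category.Dom_Comp[OF cJ] category.Cod_Comp[OF cJ]
    category.Comp_Id[OF cJ] category.Id_Comp[OF cJ] category.Comp_assoc[OF cJ]
  have eoeq: "eo x = eo y \<longleftrightarrow> x = y" if "x \<in> Obj J" "y \<in> Obj J" for x y
    using eo that by (auto dest: inj_onD)
  have cJ': "category J'"
    by standard (auto simp: J's cj eoeq)
  have sJ': "small_category U J'"
    unfolding small_category_def using cJ' sO sA by (simp add: J's small_image)
  have D': "is_functor J' K D'"
    using D cJ unfolding is_functor_def by (auto simp: J's D'_def cj eoeq)
  have bi': "\<exists>c \<tau>. is_limit J' K D' c \<tau>" "\<exists>c \<tau>. is_colimit J' K D' c \<tau>"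
    using bi sJ' D' unfolding bicomplete_def by blast+
  have coc: "is_cocone J' K D' c \<tau> \<longleftrightarrow> is_cocone J K D c (\<lambda>j. \<tau> (eo j))" for c \<tau>
    unfolding is_cocone_def by (simp add: J's D'_def cj)
  have coc': "is_cocone J' K D' c (\<lambda>j. \<tau> (io j)) \<longleftrightarrow> is_cocone J K D c \<tau>" for c \<tau>
    unfolding is_cocone_def by (simp add: J's D'_def cj)
  have con: "is_cone J' K D' c \<tau> \<longleftrightarrow> is_cone J K D c (\<lambda>j. \<tau> (eo j))" for c \<tau>
    unfolding is_cone_def by (simp add: J's D'_def cj)
  have con': "is_cone J' K D' c (\<lambda>j. \<tau> (io j)) \<longleftrightarrow> is_cone J K D c \<tau>" for c \<tau>
    unfolding is_cone_def by (simp add: J's D'_def cj)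
  show ?thesis
  proof
    obtain c \<tau> where c: "is_limit J' K D' c \<tau>" using bi'(1) by blast
    have "is_limit J K D c (\<lambda>j. \<tau> (eo j))"
      unfolding is_limit_def
    proof (intro conjI allI impI)
      show "is_cone J K D c (\<lambda>j. \<tau> (eo j))" using c con unfolding is_limit_def by blast
      fix d \<sigma> assume "is_cone J K D d \<sigma>"
      then have "is_cone J' K D' d (\<lambda>j. \<sigma> (io j))" using con' by blast
      then have "\<exists>!h. h \<in> Hom K d c \<and> (\<forall>j \<in> Obj J'. \<tau> j \<cdot> h = \<sigma> (io j))"
        using c unfolding is_limit_def by blast
      then show "\<exists>!h. h \<in> Hom K d c \<and> (\<forall>j \<in> Obj J. \<tau> (eo j) \<cdot> h = \<sigma> j)"
        by (simp add: J's)
    qed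
    then show "\<exists>c \<tau>. is_limit J K D c \<tau>" by blast
    obtain c \<tau> where c: "is_colimit J' K D' c \<tau>" using bi'(2) by blast
    have "is_colimit J K D c (\<lambda>j. \<tau> (eo j))"
      unfolding is_colimit_def
    proof (intro conjI allI impI)
      show "is_cocone J K D c (\<lambda>j. \<tau> (eo j))" using c coc unfolding is_colimit_def by blast
      fix d \<sigma> assume "is_cocone J K D d \<sigma>"
      then have "is_cocone J' K D' d (\<lambda>j. \<sigma> (io j))" using coc' by blast
      then have "\<exists>!h. h \<in> Hom K c d \<and> (\<forall>j \<in> Obj J'. h \<cdot> \<tau> j = \<sigma> (io j))"
        using c unfolding is_colimit_def by blast
      then show "\<exists>!h. h \<in> Hom K c d \<and> (\<forall>j \<in> Obj J. h \<cdot> \<tau> (eo j) = \<sigma> j)"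
        by (simp add: J's)
    qed
    then show "\<exists>c \<tau>. is_colimit J K D c \<tau>" by blast
  qed
qed

lemma bicomplete_category: "bicomplete U K \<Longrightarrow> category K"
  by (simp add: bicomplete_def)

lemma wo_small_category:
  assumes U: "universe U" and r: "Well_order r" and s: "small U (Field r)"
  shows "small_category U (ord_cat r)"
proof -
  have "r \<subseteq> Field r \<times> Field r" by (auto simp: Field_def)
  then have "small U r" using small_subset[OF small_Sigma[OF U s s]] by blast
  then show ?thesis using s wo_category[OF r] by (simp add: small_category_def)
qed

lemma wo_colimit_exists:
  assumes "universe U" "bicomplete U K" "Well_order r" "small U (Field r)" "is_functor (ord_cat r) K D"
  shows "\<exists>c \<tau>. is_colimit (ord_cat r) K D c \<tau>"
  using bicomplete_small_index[OF assms(2) wo_small_category[OF assms(1,3,4)] assms(5)] by blast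

subsection \<open>Products, coproducts and pushouts\<close>

definition coproduct :: "('o, 'a) cat \<Rightarrow> 'i set \<Rightarrow> ('i \<Rightarrow> 'o) \<Rightarrow> 'o \<Rightarrow> ('i \<Rightarrow> 'a) \<Rightarrow> bool" where
  "coproduct K I X c \<kappa> \<longleftrightarrow> c \<in> Obj K \<and> (\<forall>i\<in>I. \<kappa> i \<in> Hom K (X i) c) \<and>
     (\<forall>d \<in> Obj K. \<forall>\<sigma>. (\<forall>i\<in>I. \<sigma> i \<in> Hom K (X i) d) \<longrightarrow> (\<exists>!h. h \<in> Hom K c d \<and> (\<forall>i\<in>I. h \<cdot>\<^bsub>K\<^esub> \<kappa> i = \<sigma> i)))"

definition product :: "('o, 'a) cat \<Rightarrow> 'i set \<Rightarrow> ('i \<Rightarrow> 'o) \<Rightarrow> 'o \<Rightarrow> ('i \<Rightarrow> 'a) \<Rightarrow> bool" where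
  "product K I X c \<pi> \<longleftrightarrow> c \<in> Obj K \<and> (\<forall>i\<in>I. \<pi> i \<in> Hom K c (X i)) \<and>
     (\<forall>d \<in> Obj K. \<forall>\<sigma>. (\<forall>i\<in>I. \<sigma> i \<in> Hom K d (X i)) \<longrightarrow> (\<exists>!h. h \<in> Hom K d c \<and> (\<forall>i\<in>I. \<pi> i \<cdot>\<^bsub>K\<^esub> h = \<sigma> i)))"

lemma product_ex:
  assumes "product K I X c \<pi>" "d \<in> Obj K" "\<And>i. i \<in> I \<Longrightarrow> \<sigma> i \<in> Hom K d (X i)"
  shows "\<exists>h. h \<in> Hom K d c \<and> (\<forall>i\<in>I. \<pi> i \<cdot>\<^bsub>K\<^esub> h = \<sigma> i)"
  using assms unfolding product_def by blast

lemma productD: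
  assumes "product K I X c \<pi>"
  shows "c \<in> Obj K" "i \<in> I \<Longrightarrow> \<pi> i \<in> Hom K c (X i)"
  using assms unfolding product_def by auto

lemma product_uniq:
  fixes K (structure)
  assumes K: "category K" and p: "product K I X c \<pi>" and h: "h \<in> Hom K d c" "h' \<in> Hom K d c"
    and eq: "\<And>i. i \<in> I \<Longrightarrow> \<pi> i \<cdot> h = \<pi> i \<cdot> h'"
  shows "h = h'"
proof -
  have "\<pi> i \<cdot> h' \<in> Hom K d (X i)" if "i \<in> I" for i using comp_Hom[OF K h(2) productD(2)[OF p that]] .
  then have "\<exists>!k. k \<in> Hom K d c \<and> (\<forall>i\<in>I. \<pi> i \<cdot> k = \<pi> i \<cdot> h')"
    using p Hom_Obj(1)[OF K h(1)] unfolding product_def by simp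
  then show ?thesis using h eq by blast
qed

lemma coproduct_ex:
  assumes "coproduct K I X c \<kappa>" "d \<in> Obj K" "\<And>i. i \<in> I \<Longrightarrow> \<sigma> i \<in> Hom K (X i) d"
  shows "\<exists>h. h \<in> Hom K c d \<and> (\<forall>i\<in>I. h \<cdot>\<^bsub>K\<^esub> \<kappa> i = \<sigma> i)"
  using assms unfolding coproduct_def by blast

lemma coproductD:
  assumes "coproduct K I X c \<kappa>"
  shows "c \<in> Obj K" "i \<in> I \<Longrightarrow> \<kappa> i \<in> Hom K (X i) c"
  using assms unfolding coproduct_def by auto

lemma coproduct_uniq:
  fixes K (structure)
  assumes K: "category K" and p: "coproduct K I X c \<kappa>" and h: "h \<in> Hom K c d" "h' \<in> Hom K c d"
    and eq: "\<And>i. i \<in> I \<Longrightarrow> h \<cdot> \<kappa> i = h' \<cdot> \<kappa> i"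
  shows "h = h'"
proof -
  have "h' \<cdot> \<kappa> i \<in> Hom K (X i) d" if "i \<in> I" for i using comp_Hom[OF K coproductD(2)[OF p that] h(2)] .
  then have "\<exists>!k. k \<in> Hom K c d \<and> (\<forall>i\<in>I. k \<cdot> \<kappa> i = h' \<cdot> \<kappa> i)"
    using p Hom_Obj(2)[OF K h(1)] unfolding coproduct_def by simp
  then show ?thesis using h eq by blast
qed

text \<open>A product is a limit over the discrete category on \<open>I\<close>, which is the identity relation on
  \<open>I\<close> seen as a preorder.\<close>

lemma products_exist:
  fixes K :: "('o, 'a) cat" (structure) and I :: "'i set"
  assumes U: "universe U" and bi: "bicomplete U K" and I: "small U I" and X: "\<And>i. i \<in> I \<Longrightarrow> X i \<in> Obj K"
  shows "\<exists>c \<pi>. product K I X c \<pi>" "\<exists>c \<kappa>. coproduct K I X c \<kappa>"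
proof -
  have K: "category K" using bi by (rule bicomplete_category)
  let ?J = "ord_cat (Id_on I)"
  have F: "Field (Id_on I) = I" by (auto simp: Field_def)
  have cJ: "category ?J" by (rule ord_cat_category) (auto simp: Field_def trans_def)
  have "Id_on I = (\<lambda>x. (x, x)) ` I" by auto
  then have "small U (Id_on I)" using small_image[OF I] by metis
  then have sJ: "small_category U ?J"
    using cJ I by (simp add: small_category_def F)
  define D :: "('i, 'i \<times> 'i, 'o, 'a) fctr" where "D = \<lparr> FOb = X, FAr = \<lambda>u. Id K (X (fst u)) \<rparr>"
  have D: "is_functor ?J K D"
    by (rule ord_functorI) (auto simp: D_def F X id_Hom[OF K] comp_id[OF K id_Hom[OF K]])
  have con: "is_cone ?J K D c \<tau> \<longleftrightarrow> c \<in> Obj K \<and> (\<forall>i\<in>I. \<tau> i \<in> Hom K c (X i))" for c \<tau>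
    unfolding is_cone_def by (auto simp: D_def F id_comp[OF K])
  have coc: "is_cocone ?J K D c \<tau> \<longleftrightarrow> c \<in> Obj K \<and> (\<forall>i\<in>I. \<tau> i \<in> Hom K (X i) c)" for c \<tau>
    unfolding is_cocone_def by (auto simp: D_def F comp_id[OF K])
  obtain c \<tau> where c: "is_limit ?J K D c \<tau>" using bicomplete_small_index[OF bi sJ D] by blast
  have "product K I X c \<tau>"
    unfolding product_def
  proof (intro conjI ballI allI impI)
    show "\<tau> i \<in> Hom K c (X i)" if "i \<in> I" for i using limit_cone[OF c] con that by auto
    show "c \<in> Obj K" using limit_cone[OF c] con by auto
    fix d \<sigma> assume "d \<in> Obj K" "\<forall>i\<in>I. \<sigma> i \<in> Hom K d (X i)"
    then have "is_cone ?J K D d \<sigma>" using con by auto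
    then have "\<exists>!h. h \<in> Hom K d c \<and> (\<forall>i\<in>Obj ?J. \<tau> i \<cdot> h = \<sigma> i)" using c unfolding is_limit_def by blast
    then show "\<exists>!h. h \<in> Hom K d c \<and> (\<forall>i\<in>I. \<tau> i \<cdot> h = \<sigma> i)" by (simp add: F)
  qed
  then show "\<exists>c \<pi>. product K I X c \<pi>" by blast
  obtain c \<tau> where c: "is_colimit ?J K D c \<tau>" using bicomplete_small_index[OF bi sJ D] by blast
  have "coproduct K I X c \<tau>"
    unfolding coproduct_def
  proof (intro conjI ballI allI impI)
    show "\<tau> i \<in> Hom K (X i) c" if "i \<in> I" for i using colimit_cocone[OF c] coc that by auto
    show "c \<in> Obj K" using colimit_cocone[OF c] coc by auto
    fix d \<sigma> assume "d \<in> Obj K" "\<forall>i\<in>I. \<sigma> i \<in> Hom K (X i) d"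
    then have "is_cocone ?J K D d \<sigma>" using coc by auto
    then have "\<exists>!h. h \<in> Hom K c d \<and> (\<forall>i\<in>Obj ?J. h \<cdot> \<tau> i = \<sigma> i)" using c unfolding is_colimit_def by blast
    then show "\<exists>!h. h \<in> Hom K c d \<and> (\<forall>i\<in>I. h \<cdot> \<tau> i = \<sigma> i)" by (simp add: F)
  qed
  then show "\<exists>c \<kappa>. coproduct K I X c \<kappa>" by blast
qed

text \<open>Unlike \<open>pushout_of\<close>, this names both legs, so that constructions can refer to them.\<close>

definition is_pushout :: "('o, 'a) cat \<Rightarrow> 'a \<Rightarrow> 'a \<Rightarrow> 'a \<Rightarrow> 'a \<Rightarrow> bool" where
  "is_pushout M i a h b \<longleftrightarrow> b \<in> Hom M (Cod M i) (Cod M h) \<and> h \<cdot>\<^bsub>M\<^esub> a = b \<cdot>\<^bsub>M\<^esub> i \<and>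
     (\<forall>z. \<forall>p \<in> Hom M (Dom M h) z. \<forall>q \<in> Hom M (Cod M i) z. p \<cdot>\<^bsub>M\<^esub> a = q \<cdot>\<^bsub>M\<^esub> i \<longrightarrow>
           (\<exists>!k. k \<in> Hom M (Cod M h) z \<and> k \<cdot>\<^bsub>M\<^esub> h = p \<and> k \<cdot>\<^bsub>M\<^esub> b = q))"

lemma pushout_of_iff:
  "pushout_of M i h \<longleftrightarrow> i \<in> Arr M \<and> h \<in> Arr M \<and>
    (\<exists>a b. a \<in> Hom M (Dom M i) (Dom M h) \<and> is_pushout M i a h b)"
  unfolding pushout_of_def is_pushout_def by auto

text \<open>The span is the preorder on \<open>{0, 1, 2}\<close> generated by \<open>0 \<le> 1\<close> and \<open>0 \<le> 2\<close>.\<close>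

lemma pushouts_exist:
  fixes M :: "('o, 'a) cat" (structure)
  assumes U: "universe U" and bi: "bicomplete U M" and i: "i \<in> Hom M A B" and a: "a \<in> Hom M A X"
  shows "\<exists>X' h b. h \<in> Hom M X X' \<and> b \<in> Hom M B X' \<and> is_pushout M i a h b"
proof -
  have M: "category M" using bi by (rule bicomplete_category)
  define r :: "nat rel" where "r = {(0, 0), (1, 1), (2, 2), (0, 1), (0, 2)}"
  let ?J = "ord_cat r"
  have F: "Field r = {0, 1, 2}" by (auto simp: r_def Field_def)
  have cJ: "category ?J" by (rule ord_cat_category) (auto simp: r_def Field_def trans_def)
  have "finite r" by (simp add: r_def)
  then have sJ: "small_category U ?J"
    using cJ by (simp add: small_category_def F small_finite[OF U])
  define D :: "(nat, nat \<times> nat, 'o, 'a) fctr" where "D = \<lparr> FOb = \<lambda>n. if n = 0 then A else if n = 1 then B else X,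
    FAr = \<lambda>u. if u = (0, 1) then i else if u = (0, 2) then a else
      Id M (if snd u = 0 then A else if snd u = 1 then B else X) \<rparr>"
  have ob: "A \<in> Obj M" "B \<in> Obj M" "X \<in> Obj M" using Hom_Obj[OF M i] Hom_Obj[OF M a] by auto
  have D: "is_functor ?J M D"
    by (rule ord_functorI)
      (auto simp: D_def F r_def ob id_Hom[OF M] i a comp_id[OF M i] comp_id[OF M a] id_comp[OF M i] id_comp[OF M a]
        comp_id[OF M id_Hom[OF M]])
  obtain X' \<tau> where c: "is_colimit ?J M D X' \<tau>"
    using bicomplete_small_index[OF bi sJ D] by blast
  have coc: "is_cocone ?J M D d \<sigma> \<longleftrightarrow> d \<in> Obj M \<and> \<sigma> 0 \<in> Hom M A d \<and> \<sigma> 1 \<in> Hom M B d \<and> \<sigma> 2 \<in> Hom M X d \<and>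
     \<sigma> 1 \<cdot> i = \<sigma> 0 \<and> \<sigma> 2 \<cdot> a = \<sigma> 0" for d \<sigma>
    unfolding is_cocone_def by (auto simp: D_def F r_def comp_id[OF M])
  have t: "X' \<in> Obj M" "\<tau> 1 \<in> Hom M B X'" "\<tau> 2 \<in> Hom M X X'" "\<tau> 1 \<cdot> i = \<tau> 0" "\<tau> 2 \<cdot> a = \<tau> 0"
    using colimit_cocone[OF c] unfolding coc by auto
  have "is_pushout M i a (\<tau> 2) (\<tau> 1)"
    unfolding is_pushout_def
  proof (intro conjI allI ballI impI)
    show "\<tau> 1 \<in> Hom M (Cod M i) (Cod M (\<tau> 2))" using t i by (simp add: Hom_def)
    show "\<tau> 2 \<cdot> a = \<tau> 1 \<cdot> i" using t by simp
    fix z p q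
    assume "p \<in> Hom M (Dom M (\<tau> 2)) z" "q \<in> Hom M (Cod M i) z" and eq: "p \<cdot> a = q \<cdot> i"
    then have p: "p \<in> Hom M X z" and q: "q \<in> Hom M B z" using t(3) i by (auto simp: Hom_def)
    let ?\<sigma> = "\<lambda>n. if n = 0 then q \<cdot> i else if n = 1 then q else p"
    have "is_cocone ?J M D z ?\<sigma>"
      unfolding coc using Hom_Obj[OF M p] p q comp_Hom[OF M i q] eq by auto
    then obtain k where k: "k \<in> Hom M X' z" "\<And>j. j \<in> Field r \<Longrightarrow> k \<cdot> \<tau> j = ?\<sigma> j"
      using colimit_ex[OF c] by fastforce
    have Cod: "Cod M (\<tau> 2) = X'" using t(3) by (simp add: Hom_def)
    show "\<exists>!k. k \<in> Hom M (Cod M (\<tau> 2)) z \<and> k \<cdot> \<tau> 2 = p \<and> k \<cdot> \<tau> 1 = q"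
      unfolding Cod
    proof (rule ex1I[of _ k])
      show "k \<in> Hom M X' z \<and> k \<cdot> \<tau> 2 = p \<and> k \<cdot> \<tau> 1 = q" using k by (auto simp: F)
      fix k' assume k': "k' \<in> Hom M X' z \<and> k' \<cdot> \<tau> 2 = p \<and> k' \<cdot> \<tau> 1 = q"
      have "k' \<cdot> \<tau> 0 = q \<cdot> i"
        using comp_assoc[OF M i t(2), of k' z] k' t(4) by auto
      then have "k' \<cdot> \<tau> j = k \<cdot> \<tau> j" if "j \<in> Obj ?J" for j
        using that k' k(2)[of j] by (auto simp: F)
      then show "k' = k" using colimit_uniq[OF M cJ D c] k(1) k' by blast
    qed
  qed
  then show ?thesis using t by blast
qed

lemma pushout_ex:
  fixes M (structure)
  assumes "is_pushout M i a h b" "i \<in> Hom M A B" "h \<in> Hom M X X'" "p \<in> Hom M X z" "q \<in> Hom M B z"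
    "p \<cdot> a = q \<cdot> i"
  shows "\<exists>!k. k \<in> Hom M X' z \<and> k \<cdot> h = p \<and> k \<cdot> b = q"
  using assms unfolding is_pushout_def by (auto simp: HomD)

section \<open>Functor categories\<close>

lemma fun_cat_simps [simp]:
  "Obj (fun_cat A K) = Functors A K" "Dom (fun_cat A K) = Src" "Cod (fun_cat A K) = Tgt"
  "Id (fun_cat A K) F = \<lparr> Src = F, Tgt = F, Cmp = restrict (\<lambda>x. Id K (FOb F x)) (Obj A) \<rparr>"
  "Comp (fun_cat A K) t s =
    \<lparr> Src = Src s, Tgt = Tgt t, Cmp = restrict (\<lambda>x. Cmp t x \<cdot>\<^bsub>K\<^esub> Cmp s x) (Obj A) \<rparr>"
  by (simp_all add: fun_cat_def)

lemma FunctorsD: "F \<in> Functors A K \<Longrightarrow> is_functor A K F"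
  by (simp add: Functors_def)

text \<open>Makes a functor extensional, which objects of a functor category have to be.\<close>

definition restrict_fctr :: "('o1, 'a1) cat \<Rightarrow> ('o1, 'a1, 'o2, 'a2) fctr \<Rightarrow> ('o1, 'a1, 'o2, 'a2) fctr" where
  "restrict_fctr A F = \<lparr> FOb = restrict (FOb F) (Obj A), FAr = restrict (FAr F) (Arr A) \<rparr>"

lemma restrict_fctr_simps [simp]:
  "x \<in> Obj A \<Longrightarrow> FOb (restrict_fctr A F) x = FOb F x"
  "f \<in> Arr A \<Longrightarrow> FAr (restrict_fctr A F) f = FAr F f"
  by (simp_all add: restrict_fctr_def)

lemma is_functor_cong:
  assumes A: "category A" and "\<And>x. x \<in> Obj A \<Longrightarrow> FOb F x = FOb H x" "\<And>f. f \<in> Arr A \<Longrightarrow> FAr F f = FAr H f"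
  shows "is_functor A K F \<longleftrightarrow> is_functor A K H"
  unfolding is_functor_def
  using assms(2,3) category.Dom_Obj[OF A] category.Cod_Obj[OF A] category.Id_Arr[OF A] category.Comp_Arr[OF A]
  by simp

lemma restrict_fctr_Functors:
  assumes A: "category A" and F: "is_functor A K F"
  shows "restrict_fctr A F \<in> Functors A K"
  using is_functor_cong[OF A, of "restrict_fctr A F" F K] F
  by (simp add: Functors_def restrict_fctr_def)

lemma nat_Hom_iff: "t \<in> Hom (fun_cat A K) F H \<longleftrightarrow> Src t = F \<and> Tgt t = H \<and> F \<in> Functors A K \<and> H \<in> Functors A K \<and>
    is_nattr A K t \<and> Cmp t \<in> extensional (Obj A)"
  by (auto simp: Hom_def fun_cat_def)

lemma nat_comp_Hom: "t \<in> Hom (fun_cat A K) F H \<Longrightarrow> x \<in> Obj A \<Longrightarrow> Cmp t x \<in> Hom K (FOb F x) (FOb H x)"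
  by (auto simp: nat_Hom_iff is_nattr_def)

lemma nat_square:
  assumes "t \<in> Hom (fun_cat A K) F H" "f \<in> Hom A x y"
  shows "Cmp t y \<cdot>\<^bsub>K\<^esub> FAr F f = FAr H f \<cdot>\<^bsub>K\<^esub> Cmp t x"
proof -
  have "is_nattr A K t" "Src t = F" "Tgt t = H" using assms(1) by (auto simp: nat_Hom_iff)
  then show ?thesis using assms(2) by (auto simp: is_nattr_def Hom_def)
qed

lemma nat_Functors: "t \<in> Hom (fun_cat A K) F H \<Longrightarrow> F \<in> Functors A K \<and> H \<in> Functors A K"
  by (auto simp: nat_Hom_iff)

lemma nat_eqI:
  assumes "t \<in> Hom (fun_cat A K) F H" "s \<in> Hom (fun_cat A K) F H" "\<And>x. x \<in> Obj A \<Longrightarrow> Cmp t x = Cmp s x"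
  shows "t = s"
proof (rule nattr.equality)
  show "Cmp t = Cmp s" using assms by (auto simp: nat_Hom_iff intro: extensionalityI)
qed (use assms in \<open>auto simp: nat_Hom_iff\<close>)

lemma nat_HomI:
  assumes A: "category A" and "F \<in> Functors A K" "H \<in> Functors A K" "\<And>x. x \<in> Obj A \<Longrightarrow> h x \<in> Hom K (FOb F x) (FOb H x)"
    and "\<And>f x y. f \<in> Hom A x y \<Longrightarrow> h y \<cdot>\<^bsub>K\<^esub> FAr F f = FAr H f \<cdot>\<^bsub>K\<^esub> h x"
  shows "\<lparr> Src = F, Tgt = H, Cmp = restrict h (Obj A) \<rparr> \<in> Hom (fun_cat A K) F H"
  unfolding nat_Hom_iff is_nattr_def
  using assms(2-5) category.Dom_Obj[OF A] category.Cod_Obj[OF A] by (auto simp: Hom_def)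

lemma fun_cat_category:
  fixes K (structure)
  assumes A: "category A" and K: "category K"
  shows "category (fun_cat A K)"
proof (rule categoryI)
  fix f assume "f \<in> Arr (fun_cat A K)"
  then show "Dom (fun_cat A K) f \<in> Obj (fun_cat A K) \<and> Cod (fun_cat A K) f \<in> Obj (fun_cat A K)"
    by (simp add: fun_cat_def)
next
  fix F assume "F \<in> Obj (fun_cat A K)"
  then have F: "F \<in> Functors A K" by simp
  note fF = FunctorsD[OF F]
  show "Id (fun_cat A K) F \<in> Hom (fun_cat A K) F F"
    unfolding fun_cat_simps
    by (rule nat_HomI[OF A F F])
      (use functor_Ob[OF fF] functor_Hom[OF fF] id_Hom[OF K] id_comp[OF K] comp_id[OF K] in \<open>fastforce+\<close>)
next
  fix t s F G H assume t: "t \<in> Hom (fun_cat A K) F G" and s: "s \<in> Hom (fun_cat A K) G H"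
  have F: "F \<in> Functors A K" and G: "G \<in> Functors A K" and H: "H \<in> Functors A K" using nat_Functors[OF t] nat_Functors[OF s] by auto
  have e: "Src t = F" "Tgt s = H" using s t by (auto simp: nat_Hom_iff)
  show "s \<cdot>\<^bsub>fun_cat A K\<^esub> t \<in> Hom (fun_cat A K) F H"
    unfolding fun_cat_simps e
  proof (rule nat_HomI[OF A F H])
    fix x assume "x \<in> Obj A"
    then show "Cmp s x \<cdot> Cmp t x \<in> Hom K (FOb F x) (FOb H x)"
      using comp_Hom[OF K nat_comp_Hom[OF t] nat_comp_Hom[OF s]] by blast
  next
    fix f x y assume f: "f \<in> Hom A x y"
    note xy = Hom_Obj[OF A f]
    show "(Cmp s y \<cdot> Cmp t y) \<cdot> FAr F f = FAr H f \<cdot> (Cmp s x \<cdot> Cmp t x)"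
      using comp_assoc[OF K functor_Hom[OF FunctorsD[OF F] f] nat_comp_Hom[OF t xy(2)] nat_comp_Hom[OF s xy(2)]]
        comp_assoc[OF K nat_comp_Hom[OF t xy(1)] functor_Hom[OF FunctorsD[OF G] f] nat_comp_Hom[OF s xy(2)]]
        comp_assoc[OF K nat_comp_Hom[OF t xy(1)] nat_comp_Hom[OF s xy(1)] functor_Hom[OF FunctorsD[OF H] f]]
        nat_square[OF t f] nat_square[OF s f] by simp
  qed
next
  fix t F G assume t: "t \<in> Hom (fun_cat A K) F G"
  have e: "Src t = F" "Tgt t = G" "Cmp t \<in> extensional (Obj A)" using t by (auto simp: nat_Hom_iff)
  have "Cmp t x \<cdot> Id K (FOb F x) = Cmp t x" "Id K (FOb G x) \<cdot> Cmp t x = Cmp t x" if "x \<in> Obj A" for x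
    using comp_id[OF K nat_comp_Hom[OF t that]] id_comp[OF K nat_comp_Hom[OF t that]] by auto
  then show "t \<cdot>\<^bsub>fun_cat A K\<^esub> Id (fun_cat A K) F = t" "Id (fun_cat A K) G \<cdot>\<^bsub>fun_cat A K\<^esub> t = t"
    using e by (auto intro!: nattr.equality extensionalityI[of _ "Obj A"])
next
  fix f g h a b c d
  assume f: "f \<in> Hom (fun_cat A K) a b" and g: "g \<in> Hom (fun_cat A K) b c" and h: "h \<in> Hom (fun_cat A K) c d"
  have "(Cmp h x \<cdot> Cmp g x) \<cdot> Cmp f x = Cmp h x \<cdot> (Cmp g x \<cdot> Cmp f x)" if "x \<in> Obj A" for x
    using comp_assoc[OF K nat_comp_Hom[OF f that] nat_comp_Hom[OF g that] nat_comp_Hom[OF h that]] .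
  then show "(h \<cdot>\<^bsub>fun_cat A K\<^esub> g) \<cdot>\<^bsub>fun_cat A K\<^esub> f = h \<cdot>\<^bsub>fun_cat A K\<^esub> (g \<cdot>\<^bsub>fun_cat A K\<^esub> f)"
    by (auto intro!: restrict_ext)
qed

lemma nat_Comp_Cmp: "x \<in> Obj A \<Longrightarrow> Cmp (t \<cdot>\<^bsub>fun_cat A K\<^esub> s) x = Cmp t x \<cdot>\<^bsub>K\<^esub> Cmp s x"
  by simp

lemma nat_Id_Cmp: "x \<in> Obj A \<Longrightarrow> Cmp (Id (fun_cat A K) F) x = Id K (FOb F x)"
  by simp

text \<open>A natural transformation is a family, indexed by the objects of \<open>A\<close>, of elements of small
  hom-sets.\<close>

lemma fun_cat_locally_small:
  assumes U: "universe U" and A: "small_category U A" and K: "locally_small_category U K"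
    and F: "F \<in> Functors A K" and H: "H \<in> Functors A K"
  shows "small U (Hom (fun_cat A K) F H)"
proof -
  have sA: "small U (Obj A)" using A by (simp add: small_category_def)
  have "small U (Hom K (FOb F x) (FOb H x))" if "x \<in> Obj A" for x
    using K functor_Ob[OF FunctorsD[OF F] that] functor_Ob[OF FunctorsD[OF H] that]
    by (simp add: locally_small_category_def)
  then have "small U (Pi\<^sub>E (Obj A) (\<lambda>x. Hom K (FOb F x) (FOb H x)))" by (rule small_PiE[OF U sA])
  moreover have "inj_on Cmp (Hom (fun_cat A K) F H)"
    by (rule inj_onI) (auto intro: nat_eqI)
  moreover have "Cmp ` Hom (fun_cat A K) F H \<subseteq> Pi\<^sub>E (Obj A) (\<lambda>x. Hom K (FOb F x) (FOb H x))"
  proof (intro image_subsetI PiE_I)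
    fix t x assume t: "t \<in> Hom (fun_cat A K) F H"
    show "Cmp t x \<in> Hom K (FOb F x) (FOb H x)" if "x \<in> Obj A" using nat_comp_Hom[OF t that] .
    show "Cmp t x = undefined" if "x \<notin> Obj A"
      using t that unfolding nat_Hom_iff by (auto simp: extensional_def)
  qed
  ultimately show ?thesis by (rule small_inj_on)
qed

subsection \<open>Pointwise colimits and limits\<close>

definition eval_diag :: "('oj, 'aj, ('o1, 'a1, 'o2, 'a2) fctr, ('o1, 'a1, 'o2, 'a2) nattr) fctr \<Rightarrow> 'o1
    \<Rightarrow> ('oj, 'aj, 'o2, 'a2) fctr" where
  "eval_diag D x = \<lparr> FOb = \<lambda>j. FOb (FOb D j) x, FAr = \<lambda>u. Cmp (FAr D u) x \<rparr>"

lemma eval_diag_simps [simp]: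
  "FOb (eval_diag D x) j = FOb (FOb D j) x" "FAr (eval_diag D x) u = Cmp (FAr D u) x"
  by (simp_all add: eval_diag_def)

context
  fixes A :: "('o1, 'a1) cat" and K :: "('o2, 'a2) cat" (structure) and J :: "('oj, 'aj) cat"
    and D :: "('oj, 'aj, ('o1, 'a1, 'o2, 'a2) fctr, ('o1, 'a1, 'o2, 'a2) nattr) fctr"
  assumes A: "category A" and K: "category K" and J: "category J" and D: "is_functor J (fun_cat A K) D"
begin

lemma diag_Functors: "j \<in> Obj J \<Longrightarrow> FOb D j \<in> Functors A K"
  using functor_Ob[OF D] by simp

lemma eval_diag_functor:
  assumes x: "x \<in> Obj A"
  shows "is_functor J K (eval_diag D x)"
proof (rule is_functorI)
  show "FOb (eval_diag D x) j \<in> Obj K" if "j \<in> Obj J" for j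
    using functor_Ob[OF FunctorsD[OF diag_Functors[OF that]] x] by simp
  show "FAr (eval_diag D x) f \<in> Hom K (FOb (eval_diag D x) i) (FOb (eval_diag D x) j)" if "f \<in> Hom J i j" for f i j
    using nat_comp_Hom[OF functor_Hom[OF D that] x] by simp
  show "FAr (eval_diag D x) (Id J j) = Id K (FOb (eval_diag D x) j)" if "j \<in> Obj J" for j
    using functor_Id[OF D that] x by simp
  show "FAr (eval_diag D x) (g \<cdot>\<^bsub>J\<^esub> f) = FAr (eval_diag D x) g \<cdot> FAr (eval_diag D x) f"
    if "f \<in> Hom J i j" "g \<in> Hom J j k" for f g i j k
    using functor_Comp[OF D that] x by simp
qed

lemma cocone_eval:
  assumes c: "is_cocone J (fun_cat A K) D c \<tau>" and x: "x \<in> Obj A"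
  shows "is_cocone J K (eval_diag D x) (FOb c x) (\<lambda>j. Cmp (\<tau> j) x)"
proof (rule coconeI)
  show "FOb c x \<in> Obj K" using functor_Ob[OF FunctorsD x, of c K] coconeD(1)[OF c] by simp
  show "Cmp (\<tau> j) x \<in> Hom K (FOb (eval_diag D x) j) (FOb c x)" if "j \<in> Obj J" for j
    using nat_comp_Hom[OF coconeD(2)[OF c that] x] by simp
  show "Cmp (\<tau> j) x \<cdot> FAr (eval_diag D x) u = Cmp (\<tau> i) x" if "u \<in> Hom J i j" for u i j
    using coconeD(3)[OF c that, symmetric] x by simp
qed

lemma pointwise_colimit:
  assumes c: "is_cocone J (fun_cat A K) D c \<tau>"
    and pw: "\<And>x. x \<in> Obj A \<Longrightarrow> is_colimit J K (eval_diag D x) (FOb c x) (\<lambda>j. Cmp (\<tau> j) x)"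
  shows "is_colimit J (fun_cat A K) D c \<tau>"
proof (rule colimitI[OF c])
  note FK = fun_cat_category[OF A K]
  have cF: "c \<in> Functors A K" using coconeD(1)[OF c] by simp
  fix d \<sigma> assume d: "is_cocone J (fun_cat A K) D d \<sigma>"
  have dF: "d \<in> Functors A K" using coconeD(1)[OF d] by simp
  have "\<forall>x. \<exists>h. x \<in> Obj A \<longrightarrow> h \<in> Hom K (FOb c x) (FOb d x) \<and> (\<forall>j \<in> Obj J. h \<cdot> Cmp (\<tau> j) x = Cmp (\<sigma> j) x)"
    using colimit_ex[OF pw cocone_eval[OF d]] by blast
  then obtain h where h: "\<And>x. x \<in> Obj A \<Longrightarrow> h x \<in> Hom K (FOb c x) (FOb d x)"
    "\<And>x j. x \<in> Obj A \<Longrightarrow> j \<in> Obj J \<Longrightarrow> h x \<cdot> Cmp (\<tau> j) x = Cmp (\<sigma> j) x" by metis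
  let ?h = "\<lparr> Src = c, Tgt = d, Cmp = restrict h (Obj A) \<rparr>"
  have "?h \<in> Hom (fun_cat A K) c d"
  proof (rule nat_HomI[OF A cF dF h(1)])
    fix f x y assume f: "f \<in> Hom A x y"
    note x = Hom_Obj(1)[OF A f] and y = Hom_Obj(2)[OF A f]
    note cf = functor_Hom[OF FunctorsD[OF cF] f] and df = functor_Hom[OF FunctorsD[OF dF] f]
    show "h y \<cdot> FAr c f = FAr d f \<cdot> h x"
    proof (rule colimit_uniq[OF K J eval_diag_functor[OF x] pw[OF x] comp_Hom[OF K cf h(1)[OF y]] comp_Hom[OF K h(1)[OF x] df]])
      fix j assume j: "j \<in> Obj J"
      note Df = functor_Hom[OF FunctorsD[OF diag_Functors[OF j]] f]
      note tx = nat_comp_Hom[OF coconeD(2)[OF c j] x] and ty = nat_comp_Hom[OF coconeD(2)[OF c j] y]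
      have "(h y \<cdot> FAr c f) \<cdot> Cmp (\<tau> j) x = h y \<cdot> (Cmp (\<tau> j) y \<cdot> FAr (FOb D j) f)"
        using comp_assoc[OF K tx cf h(1)[OF y]] nat_square[OF coconeD(2)[OF c j] f] by simp
      also have "\<dots> = Cmp (\<sigma> j) y \<cdot> FAr (FOb D j) f"
        using comp_assoc[OF K Df ty h(1)[OF y]] h(2)[OF y j] by simp
      also have "\<dots> = (FAr d f \<cdot> h x) \<cdot> Cmp (\<tau> j) x"
        using comp_assoc[OF K tx h(1)[OF x] df] h(2)[OF x j] nat_square[OF coconeD(2)[OF d j] f] by simp
      finally show "(h y \<cdot> FAr c f) \<cdot> Cmp (\<tau> j) x = (FAr d f \<cdot> h x) \<cdot> Cmp (\<tau> j) x" .
    qed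
  qed
  moreover have "?h \<cdot>\<^bsub>fun_cat A K\<^esub> \<tau> j = \<sigma> j" if "j \<in> Obj J" for j
    by (rule nat_eqI[OF comp_Hom[OF FK coconeD(2)[OF c that] calculation] coconeD(2)[OF d that]])
      (use h(2) that in simp)
  ultimately show "\<exists>h. h \<in> Hom (fun_cat A K) c d \<and> (\<forall>j\<in>Obj J. h \<cdot>\<^bsub>fun_cat A K\<^esub> \<tau> j = \<sigma> j)" by blast
next
  fix d h h' assume h: "h \<in> Hom (fun_cat A K) c d" "h' \<in> Hom (fun_cat A K) c d"
    and eq: "\<And>j. j \<in> Obj J \<Longrightarrow> h \<cdot>\<^bsub>fun_cat A K\<^esub> \<tau> j = h' \<cdot>\<^bsub>fun_cat A K\<^esub> \<tau> j"
  show "h = h'"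
  proof (rule nat_eqI[OF h])
    fix x assume x: "x \<in> Obj A"
    have "Cmp h x \<cdot> Cmp (\<tau> j) x = Cmp h' x \<cdot> Cmp (\<tau> j) x" if "j \<in> Obj J" for j
      using arg_cong[OF eq[OF that], of "\<lambda>t. Cmp t x"] x by simp
    then show "Cmp h x = Cmp h' x"
      by (rule colimit_uniq[OF K J eval_diag_functor[OF x] pw[OF x] nat_comp_Hom[OF h(1) x] nat_comp_Hom[OF h(2) x]])
  qed
qed

text \<open>Choosing colimits at every object, the universal properties provide the action on arrows.
  The resulting cocone is pointwise a colimit by construction; this is recorded because a colimit
  of functors need not be one pointwise unless the pointwise colimits exist.\<close>

lemma pointwise_colimit_exists:
  assumes ex: "\<And>x. x \<in> Obj A \<Longrightarrow> \<exists>c \<tau>. is_colimit J K (eval_diag D x) c \<tau>"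
  shows "\<exists>c \<tau>. is_cocone J (fun_cat A K) D c \<tau> \<and>
    (\<forall>x \<in> Obj A. is_colimit J K (eval_diag D x) (FOb c x) (\<lambda>j. Cmp (\<tau> j) x))"
proof -
  have "\<forall>x. \<exists>c \<tau>. x \<in> Obj A \<longrightarrow> is_colimit J K (eval_diag D x) c \<tau>" using ex by blast
  then obtain cc tt where c: "\<And>x. x \<in> Obj A \<Longrightarrow> is_colimit J K (eval_diag D x) (cc x) (tt x)" by metis
  have t: "tt x j \<in> Hom K (FOb (FOb D j) x) (cc x)" if "x \<in> Obj A" "j \<in> Obj J" for x j
    using coconeD(2)[OF colimit_cocone[OF c[OF that(1)]] that(2)] by simp
  have tD: "tt x j \<cdot> Cmp (FAr D u) x = tt x i" if "x \<in> Obj A" "u \<in> Hom J i j" for x u i j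
    using coconeD(3)[OF colimit_cocone[OF c[OF that(1)]] that(2)] by simp
  have exaa: "\<exists>h. h \<in> Hom K (cc x) (cc y) \<and> (\<forall>j \<in> Obj J. h \<cdot> tt x j = tt y j \<cdot> FAr (FOb D j) f)" if f: "f \<in> Hom A x y" for f x y
  proof (rule colimit_ex[OF c[OF Hom_Obj(1)[OF A f]]], rule coconeI)
    note x = Hom_Obj(1)[OF A f] and y = Hom_Obj(2)[OF A f]
    show "cc y \<in> Obj K" using coconeD(1)[OF colimit_cocone[OF c[OF y]]] .
    fix j assume j: "j \<in> Obj J"
    show "tt y j \<cdot> FAr (FOb D j) f \<in> Hom K (FOb (eval_diag D x) j) (cc y)"
      using comp_Hom[OF K functor_Hom[OF FunctorsD[OF diag_Functors[OF j]] f] t[OF y j]] by simp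
  next
    note x = Hom_Obj(1)[OF A f] and y = Hom_Obj(2)[OF A f]
    fix u i j assume u: "u \<in> Hom J i j"
    note i = Hom_Obj(1)[OF J u] and j = Hom_Obj(2)[OF J u]
    note Di = functor_Hom[OF FunctorsD[OF diag_Functors[OF i]] f] and Dj = functor_Hom[OF FunctorsD[OF diag_Functors[OF j]] f]
    note ux = nat_comp_Hom[OF functor_Hom[OF D u] x] and uy = nat_comp_Hom[OF functor_Hom[OF D u] y]
    show "(tt y j \<cdot> FAr (FOb D j) f) \<cdot> FAr (eval_diag D x) u = tt y i \<cdot> FAr (FOb D i) f"
      using comp_assoc[OF K ux Dj t[OF y j]] comp_assoc[OF K Di uy t[OF y j]] nat_square[OF functor_Hom[OF D u] f]
        tD[OF y u] by simp
  qed
  have "\<exists>h. f \<in> Arr A \<longrightarrow> h \<in> Hom K (cc (Dom A f)) (cc (Cod A f)) \<and>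
      (\<forall>j \<in> Obj J. h \<cdot> tt (Dom A f) j = tt (Cod A f) j \<cdot> FAr (FOb D j) f)" for f
    using exaa[OF HomI, of f] by meson
  then obtain aa where aa0: "\<And>f. f \<in> Arr A \<Longrightarrow> aa f \<in> Hom K (cc (Dom A f)) (cc (Cod A f)) \<and>
      (\<forall>j \<in> Obj J. aa f \<cdot> tt (Dom A f) j = tt (Cod A f) j \<cdot> FAr (FOb D j) f)" by metis
  have aa: "aa f \<in> Hom K (cc x) (cc y)" "\<And>j. j \<in> Obj J \<Longrightarrow> aa f \<cdot> tt x j = tt y j \<cdot> FAr (FOb D j) f"
    if "f \<in> Hom A x y" for f x y
    using aa0[of f] that by (auto simp: Hom_def)
  define C where "C = restrict_fctr A \<lparr> FOb = cc, FAr = aa \<rparr>"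
  have "is_functor A K \<lparr> FOb = cc, FAr = aa \<rparr>"
  proof (rule is_functorI)
    fix x assume x: "x \<in> Obj A"
    show xK: "FOb \<lparr> FOb = cc, FAr = aa \<rparr> x \<in> Obj K" using coconeD(1)[OF colimit_cocone[OF c[OF x]]] by simp
    have "aa (Id A x) = Id K (cc x)"
    proof (rule colimit_uniq[OF K J eval_diag_functor[OF x] c[OF x] aa(1)[OF id_Hom[OF A x]] id_Hom[OF K]])
      show "cc x \<in> Obj K" using xK by simp
      fix j assume j: "j \<in> Obj J"
      show "aa (Id A x) \<cdot> tt x j = Id K (cc x) \<cdot> tt x j"
        using aa(2)[OF id_Hom[OF A x] j] functor_Id[OF FunctorsD[OF diag_Functors[OF j]] x] comp_id[OF K t[OF x j]]
          id_comp[OF K t[OF x j]] by simp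
    qed
    then show "FAr \<lparr> FOb = cc, FAr = aa \<rparr> (Id A x) = Id K (FOb \<lparr> FOb = cc, FAr = aa \<rparr> x)" by simp
  next
    fix f x y assume "f \<in> Hom A x y"
    then show "FAr \<lparr> FOb = cc, FAr = aa \<rparr> f \<in> Hom K (FOb \<lparr> FOb = cc, FAr = aa \<rparr> x) (FOb \<lparr> FOb = cc, FAr = aa \<rparr> y)"
      using aa(1) by simp
  next
    fix f g x y z assume f: "f \<in> Hom A x y" and g: "g \<in> Hom A y z"
    note x = Hom_Obj(1)[OF A f] and y = Hom_Obj(2)[OF A f] and z = Hom_Obj(2)[OF A g]
    note gf = comp_Hom[OF A f g]
    have "aa (g \<cdot>\<^bsub>A\<^esub> f) = aa g \<cdot> aa f"
    proof (rule colimit_uniq[OF K J eval_diag_functor[OF x] c[OF x] aa(1)[OF gf] comp_Hom[OF K aa(1)[OF f] aa(1)[OF g]]])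
      fix j assume j: "j \<in> Obj J"
      note Df = functor_Hom[OF FunctorsD[OF diag_Functors[OF j]] f] and Dg = functor_Hom[OF FunctorsD[OF diag_Functors[OF j]] g]
      show "aa (g \<cdot>\<^bsub>A\<^esub> f) \<cdot> tt x j = (aa g \<cdot> aa f) \<cdot> tt x j"
        using comp_assoc[OF K t[OF x j] aa(1)[OF f] aa(1)[OF g]] aa(2)[OF f j] aa(2)[OF g j] aa(2)[OF gf j]
          comp_assoc[OF K Df t[OF y j] aa(1)[OF g]] comp_assoc[OF K Df Dg t[OF z j]]
          functor_Comp[OF FunctorsD[OF diag_Functors[OF j]] f g] by simp
    qed
    then show "FAr \<lparr> FOb = cc, FAr = aa \<rparr> (g \<cdot>\<^bsub>A\<^esub> f) = FAr \<lparr> FOb = cc, FAr = aa \<rparr> g \<cdot> FAr \<lparr> FOb = cc, FAr = aa \<rparr> f" by simp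
  qed
  then have CF: "C \<in> Functors A K" unfolding C_def by (rule restrict_fctr_Functors[OF A])
  have C: "FOb C x = cc x" if "x \<in> Obj A" for x using that by (simp add: C_def)
  have C': "FAr C f = aa f" if "f \<in> Hom A x y" for f x y using that by (simp add: C_def HomD)
  define T where "T = (\<lambda>j. \<lparr> Src = FOb D j, Tgt = C, Cmp = restrict (\<lambda>x. tt x j) (Obj A) \<rparr>)"
  have T: "T j \<in> Hom (fun_cat A K) (FOb D j) C" if j: "j \<in> Obj J" for j
    unfolding T_def
  proof (rule nat_HomI[OF A diag_Functors[OF j] CF])
    show "tt x j \<in> Hom K (FOb (FOb D j) x) (FOb C x)" if "x \<in> Obj A" for x using t[OF that j] C[OF that] by simp
    show "tt y j \<cdot> FAr (FOb D j) f = FAr C f \<cdot> tt x j" if "f \<in> Hom A x y" for f x y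
      using aa(2)[OF that j] C'[OF that] by simp
  qed
  have "is_cocone J (fun_cat A K) D C T"
  proof (rule coconeI)
    show "C \<in> Obj (fun_cat A K)" using CF by simp
    show "T j \<in> Hom (fun_cat A K) (FOb D j) C" if "j \<in> Obj J" for j using T[OF that] .
    fix u i j assume u: "u \<in> Hom J i j"
    show "T j \<cdot>\<^bsub>fun_cat A K\<^esub> FAr D u = T i"
      by (rule nat_eqI[OF comp_Hom[OF fun_cat_category[OF A K] functor_Hom[OF D u] T[OF Hom_Obj(2)[OF J u]]] T[OF Hom_Obj(1)[OF J u]]])
        (use tD[OF _ u] in \<open>simp add: T_def\<close>)
  qed
  moreover have "is_colimit J K (eval_diag D x) (FOb C x) (\<lambda>j. Cmp (T j) x)" if "x \<in> Obj A" for x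
    using c[OF that] that C[OF that] by (simp add: T_def)
  ultimately show ?thesis by blast
qed

text \<open>Compare with a pointwise colimit: both are colimits in the functor category, hence
  isomorphic, and evaluation preserves isomorphisms.\<close>

lemma colimit_pointwise:
  assumes ex: "\<And>x. x \<in> Obj A \<Longrightarrow> \<exists>c \<tau>. is_colimit J K (eval_diag D x) c \<tau>"
    and c: "is_colimit J (fun_cat A K) D c \<tau>" and x: "x \<in> Obj A"
  shows "is_colimit J K (eval_diag D x) (FOb c x) (\<lambda>j. Cmp (\<tau> j) x)"
proof -
  note FK = fun_cat_category[OF A K]
  obtain c' \<tau>' where c': "is_cocone J (fun_cat A K) D c' \<tau>'"
    "\<And>x. x \<in> Obj A \<Longrightarrow> is_colimit J K (eval_diag D x) (FOb c' x) (\<lambda>j. Cmp (\<tau>' j) x)"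
    using pointwise_colimit_exists[OF ex] by blast
  note col' = pointwise_colimit[OF c']
  obtain k where k: "k \<in> Hom (fun_cat A K) c' c" "\<And>j. j \<in> Obj J \<Longrightarrow> k \<cdot>\<^bsub>fun_cat A K\<^esub> \<tau>' j = \<tau> j"
    using colimit_ex[OF col' colimit_cocone[OF c]] by blast
  obtain k' where k': "k' \<in> Hom (fun_cat A K) c c'" "\<And>j. j \<in> Obj J \<Longrightarrow> k' \<cdot>\<^bsub>fun_cat A K\<^esub> \<tau> j = \<tau>' j"
    using colimit_ex[OF c c'(1)] by blast
  have "k \<cdot>\<^bsub>fun_cat A K\<^esub> k' = Id (fun_cat A K) c"
  proof (rule colimit_uniq[OF FK J D c comp_Hom[OF FK k'(1) k(1)] id_Hom[OF FK coconeD(1)[OF colimit_cocone[OF c]]]])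
    fix j assume j: "j \<in> Obj J"
    note tj = coconeD(2)[OF colimit_cocone[OF c] j]
    show "(k \<cdot>\<^bsub>fun_cat A K\<^esub> k') \<cdot>\<^bsub>fun_cat A K\<^esub> \<tau> j = Id (fun_cat A K) c \<cdot>\<^bsub>fun_cat A K\<^esub> \<tau> j"
      using comp_assoc[OF FK tj k'(1) k(1)] k(2)[OF j] k'(2)[OF j] id_comp[OF FK tj] by metis
  qed
  then have 1: "Cmp k x \<cdot> Cmp k' x = Id K (FOb c x)" using nat_Comp_Cmp[OF x] nat_Id_Cmp[OF x] by metis
  have "k' \<cdot>\<^bsub>fun_cat A K\<^esub> k = Id (fun_cat A K) c'"
  proof (rule colimit_uniq[OF FK J D col' comp_Hom[OF FK k(1) k'(1)] id_Hom[OF FK coconeD(1)[OF c'(1)]]])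
    fix j assume j: "j \<in> Obj J"
    note tj = coconeD(2)[OF c'(1) j]
    show "(k' \<cdot>\<^bsub>fun_cat A K\<^esub> k) \<cdot>\<^bsub>fun_cat A K\<^esub> \<tau>' j = Id (fun_cat A K) c' \<cdot>\<^bsub>fun_cat A K\<^esub> \<tau>' j"
      using comp_assoc[OF FK tj k(1) k'(1)] k(2)[OF j] k'(2)[OF j] id_comp[OF FK tj] by metis
  qed
  then have 2: "Cmp k' x \<cdot> Cmp k x = Id K (FOb c' x)" using nat_Comp_Cmp[OF x] nat_Id_Cmp[OF x] by metis
  have 3: "is_colimit J K (eval_diag D x) (FOb c x) (\<lambda>j. Cmp k x \<cdot> Cmp (\<tau>' j) x)"
    by (rule colimit_iso[OF K J eval_diag_functor[OF x] c'(2)[OF x] nat_comp_Hom[OF k(1) x] nat_comp_Hom[OF k'(1) x] 1 2])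
  have "Cmp k x \<cdot> Cmp (\<tau>' j) x = Cmp (\<tau> j) x" if "j \<in> Obj J" for j
    using k(2)[OF that] nat_Comp_Cmp[OF x] by metis
  then have "is_colimit J K (eval_diag D x) (FOb c x) (\<lambda>j. Cmp k x \<cdot> Cmp (\<tau>' j) x) \<longleftrightarrow>
      is_colimit J K (eval_diag D x) (FOb c x) (\<lambda>j. Cmp (\<tau> j) x)"
    by (intro is_colimit_cong[OF J] refl)
  then show ?thesis using 3 by (rule iffD1)
qed

lemma cone_eval:
  assumes c: "is_cone J (fun_cat A K) D c \<tau>" and x: "x \<in> Obj A"
  shows "is_cone J K (eval_diag D x) (FOb c x) (\<lambda>j. Cmp (\<tau> j) x)"
proof (rule coneI)
  show "FOb c x \<in> Obj K" using functor_Ob[OF FunctorsD x, of c K] coneD(1)[OF c] by simp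
  show "Cmp (\<tau> j) x \<in> Hom K (FOb c x) (FOb (eval_diag D x) j)" if "j \<in> Obj J" for j
    using nat_comp_Hom[OF coneD(2)[OF c that] x] by simp
  show "FAr (eval_diag D x) u \<cdot> Cmp (\<tau> i) x = Cmp (\<tau> j) x" if "u \<in> Hom J i j" for u i j
    using coneD(3)[OF c that, symmetric] x by simp
qed

lemma pointwise_limit:
  assumes c: "is_cone J (fun_cat A K) D c \<tau>"
    and pw: "\<And>x. x \<in> Obj A \<Longrightarrow> is_limit J K (eval_diag D x) (FOb c x) (\<lambda>j. Cmp (\<tau> j) x)"
  shows "is_limit J (fun_cat A K) D c \<tau>"
proof (rule limitI[OF c])
  note FK = fun_cat_category[OF A K]
  have cF: "c \<in> Functors A K" using coneD(1)[OF c] by simp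
  fix d \<sigma> assume d: "is_cone J (fun_cat A K) D d \<sigma>"
  have dF: "d \<in> Functors A K" using coneD(1)[OF d] by simp
  have "\<forall>x. \<exists>h. x \<in> Obj A \<longrightarrow> h \<in> Hom K (FOb d x) (FOb c x) \<and> (\<forall>j \<in> Obj J. Cmp (\<tau> j) x \<cdot> h = Cmp (\<sigma> j) x)"
    using limit_ex[OF pw cone_eval[OF d]] by blast
  then obtain h where h: "\<And>x. x \<in> Obj A \<Longrightarrow> h x \<in> Hom K (FOb d x) (FOb c x)"
    "\<And>x j. x \<in> Obj A \<Longrightarrow> j \<in> Obj J \<Longrightarrow> Cmp (\<tau> j) x \<cdot> h x = Cmp (\<sigma> j) x" by metis
  let ?h = "\<lparr> Src = d, Tgt = c, Cmp = restrict h (Obj A) \<rparr>"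
  have "?h \<in> Hom (fun_cat A K) d c"
  proof (rule nat_HomI[OF A dF cF h(1)])
    fix f x y assume f: "f \<in> Hom A x y"
    note x = Hom_Obj(1)[OF A f] and y = Hom_Obj(2)[OF A f]
    note cf = functor_Hom[OF FunctorsD[OF cF] f] and df = functor_Hom[OF FunctorsD[OF dF] f]
    show "h y \<cdot> FAr d f = FAr c f \<cdot> h x"
    proof (rule limit_uniq[OF K J eval_diag_functor[OF y] pw[OF y] comp_Hom[OF K df h(1)[OF y]] comp_Hom[OF K h(1)[OF x] cf]])
      fix j assume j: "j \<in> Obj J"
      note Df = functor_Hom[OF FunctorsD[OF diag_Functors[OF j]] f]
      note tx = nat_comp_Hom[OF coneD(2)[OF c j] x] and ty = nat_comp_Hom[OF coneD(2)[OF c j] y]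
      have "Cmp (\<tau> j) y \<cdot> (h y \<cdot> FAr d f) = FAr (FOb D j) f \<cdot> Cmp (\<sigma> j) x"
        using comp_assoc[OF K df h(1)[OF y] ty] h(2)[OF y j] nat_square[OF coneD(2)[OF d j] f] by simp
      also have "\<dots> = (FAr (FOb D j) f \<cdot> Cmp (\<tau> j) x) \<cdot> h x"
        using comp_assoc[OF K h(1)[OF x] tx Df] h(2)[OF x j] by simp
      also have "\<dots> = Cmp (\<tau> j) y \<cdot> (FAr c f \<cdot> h x)"
        using comp_assoc[OF K h(1)[OF x] cf ty] nat_square[OF coneD(2)[OF c j] f] by simp
      finally show "Cmp (\<tau> j) y \<cdot> (h y \<cdot> FAr d f) = Cmp (\<tau> j) y \<cdot> (FAr c f \<cdot> h x)" .
    qed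
  qed
  moreover have "\<tau> j \<cdot>\<^bsub>fun_cat A K\<^esub> ?h = \<sigma> j" if "j \<in> Obj J" for j
    by (rule nat_eqI[OF comp_Hom[OF FK calculation coneD(2)[OF c that]] coneD(2)[OF d that]])
      (use h(2) that in simp)
  ultimately show "\<exists>h. h \<in> Hom (fun_cat A K) d c \<and> (\<forall>j\<in>Obj J. \<tau> j \<cdot>\<^bsub>fun_cat A K\<^esub> h = \<sigma> j)" by blast
next
  fix d h h' assume h: "h \<in> Hom (fun_cat A K) d c" "h' \<in> Hom (fun_cat A K) d c"
    and eq: "\<And>j. j \<in> Obj J \<Longrightarrow> \<tau> j \<cdot>\<^bsub>fun_cat A K\<^esub> h = \<tau> j \<cdot>\<^bsub>fun_cat A K\<^esub> h'"
  show "h = h'"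
  proof (rule nat_eqI[OF h])
    fix x assume x: "x \<in> Obj A"
    have "Cmp (\<tau> j) x \<cdot> Cmp h x = Cmp (\<tau> j) x \<cdot> Cmp h' x" if "j \<in> Obj J" for j
      using arg_cong[OF eq[OF that], of "\<lambda>t. Cmp t x"] x by simp
    then show "Cmp h x = Cmp h' x"
      by (rule limit_uniq[OF K J eval_diag_functor[OF x] pw[OF x] nat_comp_Hom[OF h(1) x] nat_comp_Hom[OF h(2) x]])
  qed
qed

lemma pointwise_limit_exists:
  assumes ex: "\<And>x. x \<in> Obj A \<Longrightarrow> \<exists>c \<tau>. is_limit J K (eval_diag D x) c \<tau>"
  shows "\<exists>c \<tau>. is_cone J (fun_cat A K) D c \<tau> \<and>
    (\<forall>x \<in> Obj A. is_limit J K (eval_diag D x) (FOb c x) (\<lambda>j. Cmp (\<tau> j) x))"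
proof -
  have "\<forall>x. \<exists>c \<tau>. x \<in> Obj A \<longrightarrow> is_limit J K (eval_diag D x) c \<tau>" using ex by blast
  then obtain cc tt where c: "\<And>x. x \<in> Obj A \<Longrightarrow> is_limit J K (eval_diag D x) (cc x) (tt x)" by metis
  have t: "tt x j \<in> Hom K (cc x) (FOb (FOb D j) x)" if "x \<in> Obj A" "j \<in> Obj J" for x j
    using coneD(2)[OF limit_cone[OF c[OF that(1)]] that(2)] by simp
  have tD: "Cmp (FAr D u) x \<cdot> tt x i = tt x j" if "x \<in> Obj A" "u \<in> Hom J i j" for x u i j
    using coneD(3)[OF limit_cone[OF c[OF that(1)]] that(2)] by simp
  have exaa: "\<exists>h. h \<in> Hom K (cc x) (cc y) \<and> (\<forall>j \<in> Obj J. tt y j \<cdot> h = FAr (FOb D j) f \<cdot> tt x j)" if f: "f \<in> Hom A x y" for f x y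
  proof (rule limit_ex[OF c[OF Hom_Obj(2)[OF A f]]], rule coneI)
    note x = Hom_Obj(1)[OF A f] and y = Hom_Obj(2)[OF A f]
    show "cc x \<in> Obj K" using coneD(1)[OF limit_cone[OF c[OF x]]] .
    fix j assume j: "j \<in> Obj J"
    show "FAr (FOb D j) f \<cdot> tt x j \<in> Hom K (cc x) (FOb (eval_diag D y) j)"
      using comp_Hom[OF K t[OF x j] functor_Hom[OF FunctorsD[OF diag_Functors[OF j]] f]] by simp
  next
    note x = Hom_Obj(1)[OF A f] and y = Hom_Obj(2)[OF A f]
    fix u i j assume u: "u \<in> Hom J i j"
    note i = Hom_Obj(1)[OF J u] and j = Hom_Obj(2)[OF J u]
    note Di = functor_Hom[OF FunctorsD[OF diag_Functors[OF i]] f] and Dj = functor_Hom[OF FunctorsD[OF diag_Functors[OF j]] f]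
    note ux = nat_comp_Hom[OF functor_Hom[OF D u] x] and uy = nat_comp_Hom[OF functor_Hom[OF D u] y]
    show "FAr (eval_diag D y) u \<cdot> (FAr (FOb D i) f \<cdot> tt x i) = FAr (FOb D j) f \<cdot> tt x j"
      using comp_assoc[OF K t[OF x i] Di uy] comp_assoc[OF K t[OF x i] ux Dj] nat_square[OF functor_Hom[OF D u] f]
        tD[OF x u] by simp
  qed
  have "\<exists>h. f \<in> Arr A \<longrightarrow> h \<in> Hom K (cc (Dom A f)) (cc (Cod A f)) \<and>
      (\<forall>j \<in> Obj J. tt (Cod A f) j \<cdot> h = FAr (FOb D j) f \<cdot> tt (Dom A f) j)" for f
    using exaa[OF HomI, of f] by meson
  then obtain aa where aa0: "\<And>f. f \<in> Arr A \<Longrightarrow> aa f \<in> Hom K (cc (Dom A f)) (cc (Cod A f)) \<and>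
      (\<forall>j \<in> Obj J. tt (Cod A f) j \<cdot> aa f = FAr (FOb D j) f \<cdot> tt (Dom A f) j)" by metis
  have aa: "aa f \<in> Hom K (cc x) (cc y)" "\<And>j. j \<in> Obj J \<Longrightarrow> tt y j \<cdot> aa f = FAr (FOb D j) f \<cdot> tt x j"
    if "f \<in> Hom A x y" for f x y
    using aa0[of f] that by (auto simp: Hom_def)
  define C where "C = restrict_fctr A \<lparr> FOb = cc, FAr = aa \<rparr>"
  have "is_functor A K \<lparr> FOb = cc, FAr = aa \<rparr>"
  proof (rule is_functorI)
    fix x assume x: "x \<in> Obj A"
    show xK: "FOb \<lparr> FOb = cc, FAr = aa \<rparr> x \<in> Obj K" using coneD(1)[OF limit_cone[OF c[OF x]]] by simp
    have "aa (Id A x) = Id K (cc x)"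
    proof (rule limit_uniq[OF K J eval_diag_functor[OF x] c[OF x] aa(1)[OF id_Hom[OF A x]] id_Hom[OF K]])
      show "cc x \<in> Obj K" using xK by simp
      fix j assume j: "j \<in> Obj J"
      show "tt x j \<cdot> aa (Id A x) = tt x j \<cdot> Id K (cc x)"
        using aa(2)[OF id_Hom[OF A x] j] functor_Id[OF FunctorsD[OF diag_Functors[OF j]] x] comp_id[OF K t[OF x j]]
          id_comp[OF K t[OF x j]] by simp
    qed
    then show "FAr \<lparr> FOb = cc, FAr = aa \<rparr> (Id A x) = Id K (FOb \<lparr> FOb = cc, FAr = aa \<rparr> x)" by simp
  next
    fix f x y assume "f \<in> Hom A x y"
    then show "FAr \<lparr> FOb = cc, FAr = aa \<rparr> f \<in> Hom K (FOb \<lparr> FOb = cc, FAr = aa \<rparr> x) (FOb \<lparr> FOb = cc, FAr = aa \<rparr> y)"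
      using aa(1) by simp
  next
    fix f g x y z assume f: "f \<in> Hom A x y" and g: "g \<in> Hom A y z"
    note x = Hom_Obj(1)[OF A f] and y = Hom_Obj(2)[OF A f] and z = Hom_Obj(2)[OF A g]
    note gf = comp_Hom[OF A f g]
    have "aa (g \<cdot>\<^bsub>A\<^esub> f) = aa g \<cdot> aa f"
    proof (rule limit_uniq[OF K J eval_diag_functor[OF z] c[OF z] aa(1)[OF gf] comp_Hom[OF K aa(1)[OF f] aa(1)[OF g]]])
      fix j assume j: "j \<in> Obj J"
      note Df = functor_Hom[OF FunctorsD[OF diag_Functors[OF j]] f] and Dg = functor_Hom[OF FunctorsD[OF diag_Functors[OF j]] g]
      show "tt z j \<cdot> aa (g \<cdot>\<^bsub>A\<^esub> f) = tt z j \<cdot> (aa g \<cdot> aa f)"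
        using comp_assoc[OF K aa(1)[OF f] aa(1)[OF g] t[OF z j], symmetric] aa(2)[OF f j] aa(2)[OF g j] aa(2)[OF gf j]
          comp_assoc[OF K aa(1)[OF f] t[OF y j] Dg] comp_assoc[OF K t[OF x j] Df Dg]
          functor_Comp[OF FunctorsD[OF diag_Functors[OF j]] f g] by simp
    qed
    then show "FAr \<lparr> FOb = cc, FAr = aa \<rparr> (g \<cdot>\<^bsub>A\<^esub> f) = FAr \<lparr> FOb = cc, FAr = aa \<rparr> g \<cdot> FAr \<lparr> FOb = cc, FAr = aa \<rparr> f" by simp
  qed
  then have CF: "C \<in> Functors A K" unfolding C_def by (rule restrict_fctr_Functors[OF A])
  have C: "FOb C x = cc x" if "x \<in> Obj A" for x using that by (simp add: C_def)
  have C': "FAr C f = aa f" if "f \<in> Hom A x y" for f x y using that by (simp add: C_def HomD)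
  define T where "T = (\<lambda>j. \<lparr> Src = C, Tgt = FOb D j, Cmp = restrict (\<lambda>x. tt x j) (Obj A) \<rparr>)"
  have T: "T j \<in> Hom (fun_cat A K) C (FOb D j)" if j: "j \<in> Obj J" for j
    unfolding T_def
  proof (rule nat_HomI[OF A CF diag_Functors[OF j]])
    show "tt x j \<in> Hom K (FOb C x) (FOb (FOb D j) x)" if "x \<in> Obj A" for x using t[OF that j] C[OF that] by simp
    show "tt y j \<cdot> FAr C f = FAr (FOb D j) f \<cdot> tt x j" if "f \<in> Hom A x y" for f x y
      using aa(2)[OF that j] C'[OF that] by simp
  qed
  have "is_cone J (fun_cat A K) D C T"
  proof (rule coneI)
    show "C \<in> Obj (fun_cat A K)" using CF by simp
    show "T j \<in> Hom (fun_cat A K) C (FOb D j)" if "j \<in> Obj J" for j using T[OF that] .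
    fix u i j assume u: "u \<in> Hom J i j"
    show "FAr D u \<cdot>\<^bsub>fun_cat A K\<^esub> T i = T j"
      by (rule nat_eqI[OF comp_Hom[OF fun_cat_category[OF A K] T[OF Hom_Obj(1)[OF J u]] functor_Hom[OF D u]] T[OF Hom_Obj(2)[OF J u]]])
        (use tD[OF _ u] in \<open>simp add: T_def\<close>)
  qed
  moreover have "is_limit J K (eval_diag D x) (FOb C x) (\<lambda>j. Cmp (T j) x)" if "x \<in> Obj A" for x
    using c[OF that] that C[OF that] by (simp add: T_def)
  ultimately show ?thesis by blast
qed

end

lemma fun_cat_bicomplete:
  assumes A: "category A" and K: "bicomplete U K"
  shows "bicomplete U (fun_cat A K)"
  unfolding bicomplete_def
proof (intro conjI allI impI; (elim conjE)?)
  note cK = bicomplete_category[OF K]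
  show "category (fun_cat A K)" using fun_cat_category[OF A cK] .
  fix J D assume J: "small_category U J" and D: "is_functor J (fun_cat A K) D"
  have cJ: "category J" using J by (simp add: small_category_def)
  note ex = bicomplete_small_index[OF K J eval_diag_functor[OF A cK cJ D]]
  show "\<exists>c \<tau>. is_limit J (fun_cat A K) D c \<tau>"
    using pointwise_limit_exists[OF A cK cJ D] pointwise_limit[OF A cK cJ D] ex by metis
  show "\<exists>c \<tau>. is_colimit J (fun_cat A K) D c \<tau>"
    using pointwise_colimit_exists[OF A cK cJ D] pointwise_colimit[OF A cK cJ D] ex by metis
qed

section \<open>Cofinal subsequences\<close>

definition reindex :: "('i \<Rightarrow> 'j) \<Rightarrow> ('j, 'j \<times> 'j, 'o, 'a) fctr \<Rightarrow> ('i, 'i \<times> 'i, 'o, 'a) fctr" where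
  "reindex d Z = \<lparr> FOb = \<lambda>x. FOb Z (d x), FAr = \<lambda>u. FAr Z (d (fst u), d (snd u)) \<rparr>"

lemma reindex_simps [simp]:
  "FOb (reindex d Z) x = FOb Z (d x)" "FAr (reindex d Z) (x, y) = FAr Z (d x, d y)"
  by (simp_all add: reindex_def)

lemma reindex_functor:
  assumes Z: "is_functor (ord_cat r) M Z"
    and d: "\<And>x. x \<in> Field s \<Longrightarrow> d x \<in> Field r" "\<And>x y. (x, y) \<in> s \<Longrightarrow> (d x, d y) \<in> r"
  shows "is_functor (ord_cat s) M (reindex d Z)"
  by (rule ord_functorI)
    (use ord_functor_Ob[OF Z] ord_functor_Hom[OF Z] ord_functor_Id[OF Z] ord_functor_Comp[OF Z] d in auto)

text \<open>Every stage of \<open>Z\<close> is dominated by a stage of the subsequence, so a cocone on the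
  subsequence extends uniquely to all of \<open>Z\<close>.\<close>

lemma cofinal_colimit:
  fixes M (structure)
  assumes M: "category M" and r: "Well_order r" and s: "Well_order s" and Z: "is_functor (ord_cat r) M Z"
    and d: "\<And>x. x \<in> Field s \<Longrightarrow> d x \<in> Field r" "\<And>x y. (x, y) \<in> s \<Longrightarrow> (d x, d y) \<in> r"
    and cof: "\<And>x. x \<in> Field r \<Longrightarrow> \<exists>y \<in> Field s. (x, d y) \<in> r"
    and c: "is_colimit (ord_cat r) M Z c \<tau>"
  shows "is_colimit (ord_cat s) M (reindex d Z) c (\<lambda>x. \<tau> (d x))"
proof (rule colimitI)
  note coc = ord_coconeD[OF colimit_cocone[OF c]]
  show "is_cocone (ord_cat s) M (reindex d Z) c (\<lambda>x. \<tau> (d x))"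
    by (rule ord_coconeI) (auto simp: coc d)
  fix e \<sigma> assume e: "is_cocone (ord_cat s) M (reindex d Z) e \<sigma>"
  note ec = ord_coconeD[OF e]
  obtain p where p: "\<And>x. x \<in> Field r \<Longrightarrow> p x \<in> Field s" "\<And>x. x \<in> Field r \<Longrightarrow> (x, d (p x)) \<in> r"
    using cof by metis
  define \<sigma>' where "\<sigma>' = (\<lambda>x. \<sigma> (p x) \<cdot> FAr Z (x, d (p x)))"
  have mono: "\<sigma> z \<cdot> FAr Z (x, d z) = \<sigma> y \<cdot> FAr Z (x, d y)" if yz: "(y, z) \<in> s" and x: "(x, d y) \<in> r" for x y z
  proof -
    have zF: "z \<in> Field s" and yF: "y \<in> Field s" using FieldD[OF yz] by auto
    have e: "FAr Z (x, d z) = FAr Z (d y, d z) \<cdot> FAr Z (x, d y)"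
      using ord_functor_Comp[OF Z x d(2)[OF yz]] by simp
    have sz: "\<sigma> z \<in> Hom M (FOb Z (d z)) e" using ec(2)[OF zF] by simp
    show ?thesis
      using comp_assoc[OF M ord_functor_Hom[OF Z x] ord_functor_Hom[OF Z d(2)[OF yz]] sz] ec(3)[OF yz] e by simp
  qed
  have indep: "\<sigma> z \<cdot> FAr Z (x, d z) = \<sigma> y \<cdot> FAr Z (x, d y)"
    if "z \<in> Field s" "y \<in> Field s" "(x, d y) \<in> r" "(x, d z) \<in> r" for x y z
    using wo_totalD[OF s that(1,2)] mono[of y z x] mono[of z y x] that by auto
  have s'H: "\<sigma>' x \<in> Hom M (FOb Z x) e" if "x \<in> Field r" for x
    unfolding \<sigma>'_def using comp_Hom[OF M ord_functor_Hom[OF Z p(2)[OF that]]] ec(2)[OF p(1)[OF that]] by simp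
  have "is_cocone (ord_cat r) M Z e \<sigma>'"
  proof (rule ord_coconeI)
    show "e \<in> Obj M" using ec(1) .
    show "\<sigma>' x \<in> Hom M (FOb Z x) e" if "x \<in> Field r" for x using s'H[OF that] .
    fix x y assume xy: "(x, y) \<in> r"
    note xF = FieldD[OF xy, THEN conjunct1] and yF = FieldD[OF xy, THEN conjunct2]
    have sz: "\<sigma> (p y) \<in> Hom M (FOb Z (d (p y))) e" using ec(2)[OF p(1)[OF yF]] by simp
    have "\<sigma>' y \<cdot> FAr Z (x, y) = \<sigma> (p y) \<cdot> FAr Z (x, d (p y))"
      unfolding \<sigma>'_def
      using comp_assoc[OF M ord_functor_Hom[OF Z xy] ord_functor_Hom[OF Z p(2)[OF yF]] sz]
        ord_functor_Comp[OF Z xy p(2)[OF yF]] by simp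
    also have "\<dots> = \<sigma>' x"
      unfolding \<sigma>'_def by (rule indep[OF p(1)[OF yF] p(1)[OF xF] p(2)[OF xF] wo_transD[OF r xy p(2)[OF yF]]])
    finally show "\<sigma>' y \<cdot> FAr Z (x, y) = \<sigma>' x" .
  qed
  then obtain h where h: "h \<in> Hom M c e" "\<And>x. x \<in> Field r \<Longrightarrow> h \<cdot> \<tau> x = \<sigma>' x"
    using colimit_ex[OF c] by fastforce
  have "h \<cdot> \<tau> (d y) = \<sigma> y" if y: "y \<in> Field s" for y
  proof -
    have sy: "\<sigma> y \<in> Hom M (FOb Z (d y)) e" using ec(2)[OF y] by simp
    have "\<sigma>' (d y) = \<sigma> y \<cdot> FAr Z (d y, d y)"
      unfolding \<sigma>'_def
      by (rule indep[OF p(1)[OF d(1)[OF y]] y wo_reflD[OF r d(1)[OF y]] p(2)[OF d(1)[OF y]]])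
    then show ?thesis using h(2)[OF d(1)[OF y]] ord_functor_Id[OF Z d(1)[OF y]] comp_id[OF M sy] by simp
  qed
  then show "\<exists>h. h \<in> Hom M c e \<and> (\<forall>j\<in>Obj (ord_cat s). h \<cdot> \<tau> (d j) = \<sigma> j)" using h(1) by auto
next
  note coc = ord_coconeD[OF colimit_cocone[OF c]]
  fix e h h' assume h: "h \<in> Hom M c e" "h' \<in> Hom M c e"
    and eq: "\<And>j. j \<in> Obj (ord_cat s) \<Longrightarrow> h \<cdot> \<tau> (d j) = h' \<cdot> \<tau> (d j)"
  show "h = h'"
  proof (rule colimit_uniq[OF M wo_category[OF r] Z c h])
    fix x assume "x \<in> Obj (ord_cat r)"
    then obtain y where y: "y \<in> Field s" "(x, d y) \<in> r" using cof by auto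
    note ty = coc(2)[OF d(1)[OF y(1)]] and Zx = ord_functor_Hom[OF Z y(2)]
    show "h \<cdot> \<tau> x = h' \<cdot> \<tau> x"
      using comp_assoc[OF M Zx ty h(1)] comp_assoc[OF M Zx ty h(2)] eq[of y] y(1) coc(3)[OF y(2)] by simp
  qed
qed

section \<open>Transfinite constructions\<close>

text \<open>All transfinite constructions below are instances. Stage \<open>b\<close> is a cocone on the part of the
  sequence built so far, with some extra datum \<open>e\<close>, subject to a requirement \<open>Ext\<close> that may depend
  on the earlier stages and their data. A requirement is typically a conjunction of clauses for
  the first stage, for successors (attach something) and for limits (the cocone is a colimit). The
  assumption \<open>ex\<close> may use that all earlier stages meet the requirement.\<close>

lemma transfinite_construction:
  fixes r :: "'i rel" and M :: "('o, 'a) cat"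
    and Ext :: "'i \<Rightarrow> ('i, 'i \<times> 'i, 'o, 'a) fctr \<Rightarrow> ('i \<Rightarrow> 'e) \<Rightarrow> 'o \<Rightarrow> ('i \<Rightarrow> 'a) \<Rightarrow> 'e \<Rightarrow> bool"
  assumes r: "Well_order r" and M: "category M"
    and cong: "\<And>b D E c \<tau> e D' E' \<tau>'.
      (\<And>a. a \<in> underS r b \<Longrightarrow> FOb D a = FOb D' a \<and> E a = E' a \<and> \<tau> a = \<tau>' a) \<Longrightarrow>
      (\<And>a a'. (a, a') \<in> r \<Longrightarrow> a' \<in> underS r b \<Longrightarrow> FAr D (a, a') = FAr D' (a, a')) \<Longrightarrow>
      Ext b D E c \<tau> e \<Longrightarrow> Ext b D' E' c \<tau>' e"
    and ex: "\<And>b D E. b \<in> Field r \<Longrightarrow> is_functor (ord_cat (Restr r (underS r b))) M D \<Longrightarrow>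
      (\<And>a. a \<in> underS r b \<Longrightarrow> Ext a D E (FOb D a) (\<lambda>x. FAr D (x, a)) (E a)) \<Longrightarrow>
      \<exists>c \<tau> e. is_cocone (ord_cat (Restr r (underS r b))) M D c \<tau> \<and> Ext b D E c \<tau> e"
  shows "\<exists>Z E. is_functor (ord_cat r) M Z \<and>
    (\<forall>b \<in> Field r. Ext b Z E (FOb Z b) (\<lambda>x. FAr Z (x, b)) (E b))"
proof -
  define DD :: "('i \<Rightarrow> 'o \<times> ('i \<Rightarrow> 'a) \<times> 'e) \<Rightarrow> ('i, 'i \<times> 'i, 'o, 'a) fctr" where
    "DD = (\<lambda>f. \<lparr> FOb = \<lambda>a. fst (f a), FAr = \<lambda>u. if fst u = snd u then Id M (fst (f (fst u))) else fst (snd (f (snd u))) (fst u) \<rparr>)"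
  define EE :: "('i \<Rightarrow> 'o \<times> ('i \<Rightarrow> 'a) \<times> 'e) \<Rightarrow> 'i \<Rightarrow> 'e" where "EE = (\<lambda>f a. snd (snd (f a)))"
  define P where "P = (\<lambda>f b (x :: 'o \<times> ('i \<Rightarrow> 'a) \<times> 'e).
    is_cocone (ord_cat (Restr r (underS r b))) M (DD f) (fst x) (fst (snd x)) \<and>
    Ext b (DD f) (EE f) (fst x) (fst (snd x)) (snd (snd x)))"
  have DDs: "FOb (DD f) a = fst (f a)" "FAr (DD f) (a, a) = Id M (fst (f a))"
    "a \<noteq> b \<Longrightarrow> FAr (DD f) (a, b) = fst (snd (f b)) a" for f a b
    by (simp_all add: DD_def)
  have fld: "Field (Restr r (underS r b)) = underS r b" for b by (rule Field_Restr_underS[OF r])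
  have func: "is_functor (ord_cat (Restr r S)) M (DD f)"
    if S: "S \<subseteq> Field r" "\<And>a b. b \<in> S \<Longrightarrow> (a, b) \<in> r \<Longrightarrow> a \<in> S" and f: "\<And>a. a \<in> S \<Longrightarrow> P f a (f a)" for S f
  proof (rule ord_functorI)
    note FS = Field_Restr[OF r S(1)]
    have ob: "fst (f a) \<in> Obj M" if "a \<in> S" for a
      using f[OF that] by (simp add: P_def is_cocone_def)
    have leg: "fst (snd (f b)) a \<in> Hom M (fst (f a)) (fst (f b))" if "b \<in> S" "(a, b) \<in> r" "a \<noteq> b" for a b
      using ord_coconeD(2)[of "Restr r (underS r b)" M "DD f" "fst (f b)" "fst (snd (f b))" a] f[OF that(1)] that(2,3)
      unfolding P_def fld DDs by (auto simp: underS_def)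
    show "FOb (DD f) x \<in> Obj M" if "x \<in> Field (Restr r S)" for x using ob that by (simp add: FS DDs)
    show "FAr (DD f) (x, x) = Id M (FOb (DD f) x)" for x by (simp add: DDs)
    have hom: "FAr (DD f) (x, y) \<in> Hom M (FOb (DD f) x) (FOb (DD f) y)" if "(x, y) \<in> Restr r S" for x y
      by (cases "x = y") (use leg that ob id_Hom[OF M] in \<open>auto simp: DDs\<close>)
    then show "FAr (DD f) (x, y) \<in> Hom M (FOb (DD f) x) (FOb (DD f) y)" if "(x, y) \<in> Restr r S" for x y using that .
    fix x y z assume xy: "(x, y) \<in> Restr r S" and yz: "(y, z) \<in> Restr r S"
    consider "x = y" | "y = z" | "x \<noteq> y" "y \<noteq> z" by blast
    then show "FAr (DD f) (x, z) = FAr (DD f) (y, z) \<cdot>\<^bsub>M\<^esub> FAr (DD f) (x, y)"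
    proof cases
      case 1
      then show ?thesis using comp_id[OF M hom[OF yz]] by (simp add: DDs)
    next
      case 2
      then show ?thesis using id_comp[OF M hom[OF xy]] by (simp add: DDs)
    next
      case 3
      have xz: "(x, z) \<in> r" "x \<noteq> z"
        using wo_transD[OF r, of x y z] wo_antisymD[OF r, of y z] xy yz 3 by auto
      have "(x, y) \<in> Restr r (underS r z)" using xy yz 3 xz by (auto simp: underS_def)
      then have "fst (snd (f z)) y \<cdot>\<^bsub>M\<^esub> FAr (DD f) (x, y) = fst (snd (f z)) x"
        using ord_coconeD(3)[of "Restr r (underS r z)" M "DD f" "fst (f z)" "fst (snd (f z))" x y] f[of z] yz
        unfolding P_def by auto
      then show ?thesis using 3 xz by (simp add: DDs)
    qed
  qed
  have extD: "Ext a (DD f) (EE f) (FOb (DD f) a) (\<lambda>x. FAr (DD f) (x, a)) (EE f a)" if "P f a (f a)" for f a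
    by (rule cong[of a "DD f" "DD f" "EE f" "EE f" "fst (snd (f a))"])
      (use that in \<open>auto simp: P_def DDs EE_def underS_def\<close>)
  have "\<exists>f. \<forall>b\<in>Field r. P f b (f b)"
  proof (rule wo_dependent_choice[OF r])
    fix f g b x assume eq: "\<And>a. a \<in> underS r b \<Longrightarrow> f a = g a" and P: "P f b x"
    have e1: "FOb (DD f) a = FOb (DD g) a" "EE f a = EE g a" if "a \<in> underS r b" for a
      using eq[OF that] by (simp_all add: DDs EE_def)
    have e2: "FAr (DD f) (a, a') = FAr (DD g) (a, a')" if "(a, a') \<in> r" "a' \<in> underS r b" for a a'
      using eq[OF that(2)] eq[OF wo_underS_trans[OF r that]] by (simp add: DD_def)
    have "is_cocone (ord_cat (Restr r (underS r b))) M (DD f) (fst x) (fst (snd x)) \<longleftrightarrow>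
      is_cocone (ord_cat (Restr r (underS r b))) M (DD g) (fst x) (fst (snd x))"
      by (rule is_cocone_cong[OF wo_category[OF Restr_wo[OF r]]]) (auto simp: fld e1 e2)
    moreover have "Ext b (DD g) (EE g) (fst x) (fst (snd x)) (snd (snd x))"
      by (rule cong[of b "DD f" "DD g" "EE f" "EE g" "fst (snd x)"]) (use P e1 e2 in \<open>auto simp: P_def\<close>)
    ultimately show "P g b x" using P unfolding P_def by blast
  next
    fix b f assume b: "b \<in> Field r" and f: "\<And>a. a \<in> underS r b \<Longrightarrow> P f a (f a)"
    have "is_functor (ord_cat (Restr r (underS r b))) M (DD f)"
      by (rule func[OF underS_subset _ f]) (auto intro: wo_underS_trans[OF r])
    from ex[OF b this] obtain c \<tau> e where
      "is_cocone (ord_cat (Restr r (underS r b))) M (DD f) c \<tau>" "Ext b (DD f) (EE f) c \<tau> e"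
      using extD f by blast
    then show "\<exists>x. P f b x" unfolding P_def by (intro exI[of _ "(c, \<tau>, e)"]) simp
  qed
  then obtain f where f: "\<And>b. b \<in> Field r \<Longrightarrow> P f b (f b)" by blast
  have "is_functor (ord_cat (Restr r (Field r))) M (DD f)"
    by (rule func[OF subset_refl _ f]) (auto simp: Field_def)
  then have "is_functor (ord_cat r) M (DD f)" by (simp add: Restr_Field)
  then show ?thesis using extD f by blast
qed

section \<open>Lifting properties\<close>

lemma has_liftI:
  fixes M (structure)
  assumes "i \<in> Hom M A B" "p \<in> Hom M X Y"
    and "\<And>u v. u \<in> Hom M A X \<Longrightarrow> v \<in> Hom M B Y \<Longrightarrow> v \<cdot> i = p \<cdot> u \<Longrightarrow>
      \<exists>h. h \<in> Hom M B X \<and> h \<cdot> i = u \<and> p \<cdot> h = v"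
  shows "has_lift M i p"
  unfolding has_lift_def using assms by (auto simp: HomD Bex_def)

lemma has_liftD:
  fixes M (structure)
  assumes "has_lift M i p" "i \<in> Hom M A B" "p \<in> Hom M X Y" "u \<in> Hom M A X" "v \<in> Hom M B Y" "v \<cdot> i = p \<cdot> u"
  shows "\<exists>h. h \<in> Hom M B X \<and> h \<cdot> i = u \<and> p \<cdot> h = v"
  using assms unfolding has_lift_def by (auto simp: HomD)

lemma pushout_has_lift:
  fixes M (structure)
  assumes M: "category M" and ph: "pushout_of M i h" and p: "p \<in> Arr M" and l: "has_lift M i p"
  shows "has_lift M h p"
proof -
  obtain a b where i: "i \<in> Arr M" and h: "h \<in> Arr M" and a: "a \<in> Hom M (Dom M i) (Dom M h)" and po: "is_pushout M i a h b"
    using ph unfolding pushout_of_iff by blast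
  have b: "b \<in> Hom M (Cod M i) (Cod M h)" and sq: "h \<cdot> a = b \<cdot> i" using po unfolding is_pushout_def by auto
  note iH = HomI[OF i] and hH = HomI[OF h] and pH = HomI[OF p]
  show ?thesis
  proof (rule has_liftI[OF hH pH])
    fix u v assume u: "u \<in> Hom M (Dom M h) (Dom M p)" and v: "v \<in> Hom M (Cod M h) (Cod M p)" and e: "v \<cdot> h = p \<cdot> u"
    have e2: "(v \<cdot> b) \<cdot> i = p \<cdot> (u \<cdot> a)"
      using comp_assoc[OF M iH b v] comp_assoc[OF M a hH v] comp_assoc[OF M a u pH] sq e by simp
    obtain k where k: "k \<in> Hom M (Cod M i) (Dom M p)" "k \<cdot> i = u \<cdot> a" "p \<cdot> k = v \<cdot> b"
      using has_liftD[OF l iH pH comp_Hom[OF M a u] comp_Hom[OF M b v] e2] by blast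
    obtain w where w: "w \<in> Hom M (Cod M h) (Dom M p)" "w \<cdot> h = u" "w \<cdot> b = k"
      using pushout_ex[OF po iH hH u k(1)] k(2) by metis
    have "p \<cdot> w = v"
    proof -
      have "(p \<cdot> u) \<cdot> a = (p \<cdot> k) \<cdot> i"
        using comp_assoc[OF M a u pH] comp_assoc[OF M iH k(1) pH] k(2) by simp
      from pushout_ex[OF po iH hH comp_Hom[OF M u pH] comp_Hom[OF M k(1) pH] this]
      show ?thesis
        using comp_Hom[OF M w(1) pH] v comp_assoc[OF M hH w(1) pH] comp_assoc[OF M b w(1) pH] w e k(3) by metis
    qed
    then show "\<exists>w. w \<in> Hom M (Cod M h) (Dom M p) \<and> w \<cdot> h = u \<and> p \<cdot> w = v" using w by blast
  qed
qed

text \<open>The lift is built along the sequence: at a successor by the lifting property of the step, at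
  a limit by the colimit property, which applies because the lifts chosen before form a cocone.\<close>

lemma transfinite_has_lift:
  fixes M (structure)
  assumes M: "category M" and r: "Well_order r" and Z: "lambda_sequence r M Z"
    and c: "is_colimit (ord_cat r) M Z c \<tau>" and a0: "least_elem r a0" and p: "p \<in> Arr M"
    and step: "\<And>a b. succ_elem r a b \<Longrightarrow> has_lift M (FAr Z (a, b)) p"
  shows "has_lift M (\<tau> a0) p"
proof -
  have fZ: "is_functor (ord_cat r) M Z" using Z by (simp add: lambda_sequence_def)
  note coc = ord_coconeD[OF colimit_cocone[OF c]]
  have a0F: "a0 \<in> Field r" using a0 by (simp add: least_elem_def)
  note pH = HomI[OF p]
  show ?thesis
  proof (rule has_liftI[OF coc(2)[OF a0F] pH])
    fix u v assume u: "u \<in> Hom M (FOb Z a0) (Dom M p)" and v: "v \<in> Hom M c (Cod M p)" and e: "v \<cdot> \<tau> a0 = p \<cdot> u"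
    define P where "P = (\<lambda>h b x. x \<in> Hom M (FOb Z b) (Dom M p) \<and> p \<cdot> x = v \<cdot> \<tau> b \<and>
      (\<forall>a \<in> underS r b. x \<cdot> FAr Z (a, b) = h a) \<and> (b = a0 \<longrightarrow> x = u))"
    have "\<exists>h. \<forall>b \<in> Field r. P h b (h b)"
    proof (rule wo_dependent_choice[OF r])
      fix f g b x assume "\<And>a. a \<in> underS r b \<Longrightarrow> f a = g a" "P f b x"
      then show "P g b x" by (simp add: P_def)
    next
      fix b h assume b: "b \<in> Field r" and IH: "\<And>a. a \<in> underS r b \<Longrightarrow> P h a (h a)"
      from b show "\<exists>x. P h b x"
      proof (cases rule: elem_cases)
        case 1
        then have "b = a0" using least_elem_le[OF r] a0 a0F b wo_antisymD[OF r] by metis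
        then show ?thesis using u e a0 by (intro exI[of _ u]) (simp add: P_def least_elem_def)
      next
        case (2 a)
        note ab = succ_elemD[OF 2]
        note Zab = ord_functor_Hom[OF fZ ab(4)]
        have ha: "h a \<in> Hom M (FOb Z a) (Dom M p)" "p \<cdot> h a = v \<cdot> \<tau> a"
          using IH[OF ab(3)] by (auto simp: P_def)
        have "(v \<cdot> \<tau> b) \<cdot> FAr Z (a, b) = p \<cdot> h a"
          using comp_assoc[OF M Zab coc(2)[OF b] v] coc(3)[OF ab(4)] ha(2) by simp
        then obtain x where x: "x \<in> Hom M (FOb Z b) (Dom M p)" "x \<cdot> FAr Z (a, b) = h a" "p \<cdot> x = v \<cdot> \<tau> b"
          using has_liftD[OF step[OF 2] Zab pH ha(1) comp_Hom[OF M coc(2)[OF b] v]] by blast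
        have "x \<cdot> FAr Z (y, b) = h y" if y: "y \<in> underS r b" for y
        proof (cases "y = a")
          case False
          have ya: "(y, a) \<in> r" using succ_elem_le[OF r 2 y] .
          then have "y \<in> underS r a" using False by (simp add: underS_def)
          then have "h a \<cdot> FAr Z (y, a) = h y" using IH[OF ab(3)] by (simp add: P_def)
          then show ?thesis
            using comp_assoc[OF M ord_functor_Hom[OF fZ ya] Zab x(1)] ord_functor_Comp[OF fZ ya ab(4)] x(2) by simp
        qed (use x in simp)
        moreover have "b \<noteq> a0" using ab(3) a0 by (auto simp: least_elem_def)
        ultimately show ?thesis using x by (auto simp: P_def)
      next
        case 3
        then have cb: "is_colimit (ord_cat (Restr r (underS r b))) M Z (FOb Z b) (\<lambda>a. FAr Z (a, b))"
          using Z by (simp add: lambda_sequence_def)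
        note fR = ord_functor_Restr[OF r fZ underS_subset]
        have coch: "is_cocone (ord_cat (Restr r (underS r b))) M Z (Dom M p) h"
        proof (rule ord_coconeI)
          show "Dom M p \<in> Obj M" using Hom_Obj[OF M pH] by simp
          show "h j \<in> Hom M (FOb Z j) (Dom M p)" if "j \<in> Field (Restr r (underS r b))" for j
            using IH[of j] that by (simp add: P_def Field_Restr_underS[OF r])
          show "h j \<cdot> FAr Z (i, j) = h i" if "(i, j) \<in> Restr r (underS r b)" for i j
          proof (cases "i = j")
            case True
            have j: "j \<in> underS r b" using that by simp
            have hj: "h j \<in> Hom M (FOb Z j) (Dom M p)" using IH[OF j] by (simp add: P_def)
            show ?thesis using True ord_functor_Id[OF fZ, of j] comp_id[OF M hj] underSD[OF j] by simp
          next
            case False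
            then show ?thesis using IH[of j] that by (auto simp: P_def underS_def)
          qed
        qed
        obtain x where x: "x \<in> Hom M (FOb Z b) (Dom M p)" "\<And>a. a \<in> underS r b \<Longrightarrow> x \<cdot> FAr Z (a, b) = h a"
          using colimit_ex[OF cb coch] unfolding ord_cat_simps Field_Restr_underS[OF r] by blast
        have "p \<cdot> x = v \<cdot> \<tau> b"
        proof (rule colimit_uniq[OF M wo_category[OF Restr_wo[OF r]] fR cb comp_Hom[OF M x(1) pH] comp_Hom[OF M coc(2)[OF b] v]])
          fix a assume "a \<in> Obj (ord_cat (Restr r (underS r b)))"
          then have a: "a \<in> underS r b" by (simp add: Field_Restr_underS[OF r])
          have ab: "(a, b) \<in> r" using underSD[OF a] by simp
          note Zab = ord_functor_Hom[OF fZ ab]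
          show "(p \<cdot> x) \<cdot> FAr Z (a, b) = (v \<cdot> \<tau> b) \<cdot> FAr Z (a, b)"
            using comp_assoc[OF M Zab x(1) pH] comp_assoc[OF M Zab coc(2)[OF b] v] x(2)[OF a] coc(3)[OF ab] IH[OF a]
            by (simp add: P_def)
        qed
        moreover have "b \<noteq> a0" using 3 a0 by (auto simp: limit_elem_def)
        ultimately show ?thesis using x by (auto simp: P_def)
      qed
    qed
    then obtain h where h: "\<And>b. b \<in> Field r \<Longrightarrow> P h b (h b)" by blast
    have coch: "is_cocone (ord_cat r) M Z (Dom M p) h"
    proof (rule ord_coconeI)
      show "Dom M p \<in> Obj M" using Hom_Obj[OF M pH] by simp
      show "h j \<in> Hom M (FOb Z j) (Dom M p)" if "j \<in> Field r" for j using h[OF that] by (simp add: P_def)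
      show "h j \<cdot> FAr Z (i, j) = h i" if "(i, j) \<in> r" for i j
      proof (cases "i = j")
        case True
        have hj: "h j \<in> Hom M (FOb Z j) (Dom M p)" using h[of j] FieldD[OF that] by (simp add: P_def)
        show ?thesis using True ord_functor_Id[OF fZ, of j] comp_id[OF M hj] FieldD[OF that] by simp
      next
        case False
        then show ?thesis using h[of j] that FieldD[OF that] by (auto simp: P_def underS_def)
      qed
    qed
    obtain w where w: "w \<in> Hom M c (Dom M p)" "\<And>a. a \<in> Field r \<Longrightarrow> w \<cdot> \<tau> a = h a"
      using colimit_ex[OF c coch] unfolding ord_cat_simps by blast
    have "p \<cdot> w = v"
    proof (rule colimit_uniq[OF M wo_category[OF r] fZ c comp_Hom[OF M w(1) pH] v])
      fix a assume "a \<in> Obj (ord_cat r)"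
      then have a: "a \<in> Field r" by simp
      show "(p \<cdot> w) \<cdot> \<tau> a = v \<cdot> \<tau> a"
        using comp_assoc[OF M coc(2)[OF a] w(1) pH] w(2)[OF a] h[OF a] by (simp add: P_def)
    qed
    moreover have "w \<cdot> \<tau> a0 = u" using w(2)[OF a0F] h[OF a0F] by (simp add: P_def)
    ultimately show "\<exists>h. h \<in> Hom M c (Dom M p) \<and> h \<cdot> \<tau> a0 = u \<and> p \<cdot> h = v" using w(1) by blast
  qed
qed

lemma relative_cell_has_lift:
  fixes U :: "'u itself"
  assumes M: "category M" and f: "f \<in> relative_cell U M I" and p: "p \<in> Arr M"
    and l: "\<And>i. i \<in> I \<Longrightarrow> has_lift M i p"
  shows "has_lift M f p"
proof -
  obtain r :: "'u rel" and Z c \<tau> a where r: "Well_order r" and Z: "lambda_sequence r M Z"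
    and st: "\<And>a b. succ_elem r a b \<Longrightarrow> \<exists>i \<in> I. pushout_of M i (FAr Z (a, b))"
    and c: "is_colimit (ord_cat r) M Z c \<tau>" and a: "least_elem r a" "f = \<tau> a"
    using f unfolding relative_cell_def by blast
  show ?thesis
    unfolding a(2)
    by (rule transfinite_has_lift[OF M r Z c a(1) p]) (use st pushout_has_lift[OF M _ p l] in blast)
qed

lemma relative_cell_Arr:
  fixes U :: "'u itself"
  assumes "f \<in> relative_cell U M I"
  shows "f \<in> Arr M"
proof -
  obtain r :: "'u rel" and Z c \<tau> a where c: "is_colimit (ord_cat r) M Z c \<tau>" and a: "least_elem r a" "f = \<tau> a"
    using assms unfolding relative_cell_def by blast
  show ?thesis
    using ord_coconeD(2)[OF colimit_cocone[OF c], of a] a by (simp add: least_elem_def HomD)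
qed

section \<open>Smallness in terms of factorisations\<close>

text \<open>The meaning of a bijective canonical map \<open>colim M(A, Z\<^sub>b) \<rightarrow> M(A, c)\<close> without quotients: maps
  to the colimit factor through a stage, and two such factorisations agree at a later stage.\<close>

definition seq_small :: "'u rel \<Rightarrow> ('o, 'a) cat \<Rightarrow> ('u, 'u \<times> 'u, 'o, 'a) fctr \<Rightarrow> 'o \<Rightarrow> ('u \<Rightarrow> 'a) \<Rightarrow> 'o \<Rightarrow> bool" where
  "seq_small r M Z c \<tau> A \<longleftrightarrow>
    (\<forall>f \<in> Hom M A c. \<exists>b \<in> Field r. \<exists>g \<in> Hom M A (FOb Z b). \<tau> b \<cdot>\<^bsub>M\<^esub> g = f) \<and>
    (\<forall>b \<in> Field r. \<forall>g \<in> Hom M A (FOb Z b). \<forall>g' \<in> Hom M A (FOb Z b). \<tau> b \<cdot>\<^bsub>M\<^esub> g = \<tau> b \<cdot>\<^bsub>M\<^esub> g' \<longrightarrow>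
      (\<exists>b'. (b, b') \<in> r \<and> FAr Z (b, b') \<cdot>\<^bsub>M\<^esub> g = FAr Z (b, b') \<cdot>\<^bsub>M\<^esub> g'))"

text \<open>Because the index is a linear order, the equivalence relation generated by the transition
  maps is already given by agreement at some common later stage; with this description the first
  clause of \<open>seq_small\<close> is surjectivity and the second one is injectivity.\<close>

lemma canonical_map_bij_iff:
  fixes M (structure)
  assumes M: "category M" and r: "Well_order r" and Z: "is_functor (ord_cat r) M Z"
    and c: "is_cocone (ord_cat r) M Z c \<tau>"
  shows "bij_betw (canonical_map M \<tau>) (colim_hom r M Z A) (Hom M A c) \<longleftrightarrow> seq_small r M Z c \<tau> A"
proof -
  note coc = ord_coconeD[OF c]
  define H where "H = hom_union r M Z A"
  have H: "(b, f) \<in> H \<longleftrightarrow> b \<in> Field r \<and> f \<in> Hom M A (FOb Z b)" for b f by (simp add: H_def hom_union_def)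
  define EQ where "EQ = hom_equiv r M Z A"
  define E where "E = (\<lambda>x y. \<exists>d. (fst x, d) \<in> r \<and> (fst y, d) \<in> r \<and>
    FAr Z (fst x, d) \<cdot> snd x = FAr Z (fst y, d) \<cdot> snd y)"
  have Ei: "E (b, f) (b', f') \<longleftrightarrow> (\<exists>d. (b, d) \<in> r \<and> (b', d) \<in> r \<and>
    FAr Z (b, d) \<cdot> f = FAr Z (b', d) \<cdot> f')" for b f b' f' by (simp add: E_def)
  define R where "R = {((b, f), (b', FAr Z (b, b') \<cdot> f)) | b b' f. (b, b') \<in> r \<and> f \<in> Hom M A (FOb Z b)}"
  have EQ: "EQ = (R \<union> R\<inverse>)\<^sup>* \<inter> (H \<times> H)" by (simp add: EQ_def hom_equiv_def R_def H_def Let_def)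
  have push: "FAr Z (b, e) \<cdot> f = FAr Z (d, e) \<cdot> (FAr Z (b, d) \<cdot> f)"
    if "(b, d) \<in> r" "(d, e) \<in> r" "f \<in> Hom M A (FOb Z b)" for b d e f
    using comp_assoc[OF M that(3) ord_functor_Hom[OF Z that(1)] ord_functor_Hom[OF Z that(2)]]
      ord_functor_Comp[OF Z that(1,2)] by simp
  have Etrans: "E x z" if t: "E x y" "E y z" "x \<in> H" "y \<in> H" "z \<in> H" for x y z
  proof -
    obtain b f b' f' b'' f'' where xyz: "x = (b, f)" "y = (b', f')" "z = (b'', f'')" by (metis surj_pair)
    obtain d where d: "(b, d) \<in> r" "(b', d) \<in> r" "FAr Z (b, d) \<cdot> f = FAr Z (b', d) \<cdot> f'"
      using t(1) unfolding xyz Ei by blast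
    obtain e where e: "(b', e) \<in> r" "(b'', e) \<in> r" "FAr Z (b', e) \<cdot> f' = FAr Z (b'', e) \<cdot> f''"
      using t(2) unfolding xyz Ei by blast
    have f: "f \<in> Hom M A (FOb Z b)" "f' \<in> Hom M A (FOb Z b')" "f'' \<in> Hom M A (FOb Z b'')"
      using that(3-5) unfolding xyz H by auto
    have "(d, e) \<in> r \<or> (e, d) \<in> r" using wo_totalD[OF r] FieldD[OF d(1)] FieldD[OF e(1)] by blast
    then obtain k where k: "(d, k) \<in> r" "(e, k) \<in> r"
      using wo_reflD[OF r] FieldD[OF d(1)] FieldD[OF e(1)] by blast
    have "FAr Z (b, k) \<cdot> f = FAr Z (b', k) \<cdot> f'"
      using push[OF d(1) k(1) f(1)] push[OF d(2) k(1) f(2)] d(3) by simp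
    also have "\<dots> = FAr Z (b'', k) \<cdot> f''"
      using push[OF e(1) k(2) f(2)] push[OF e(2) k(2) f(3)] e(3) by simp
    finally show ?thesis unfolding xyz Ei using wo_transD[OF r d(1) k(1)] wo_transD[OF r e(2) k(2)] by blast
  qed
  have Erefl: "E x x" if "x \<in> H" for x
    using that wo_reflD[OF r] unfolding E_def by (cases x) (auto simp: H)
  have Esym: "E y x" if "E x y" for x y using that unfolding E_def by metis
  have RH: "x \<in> H \<and> y \<in> H \<and> E x y" if "(x, y) \<in> R" for x y
  proof -
    obtain b b' f where xy: "x = (b, f)" "y = (b', FAr Z (b, b') \<cdot> f)" "(b, b') \<in> r" "f \<in> Hom M A (FOb Z b)"
      using \<open>(x, y) \<in> R\<close> unfolding R_def by blast
    note b = FieldD[OF xy(3)]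
    have h: "FAr Z (b, b') \<cdot> f \<in> Hom M A (FOb Z b')" using comp_Hom[OF M xy(4) ord_functor_Hom[OF Z xy(3)]] .
    have bb: "(b', b') \<in> r" using wo_reflD[OF r] b by blast
    have "FAr Z (b', b') \<cdot> (FAr Z (b, b') \<cdot> f) = FAr Z (b, b') \<cdot> f"
      using push[OF xy(3) bb xy(4)] by simp
    then have "E x y" unfolding xy(1,2) Ei using xy(3) bb by metis
    then show ?thesis using xy h b by (simp add: H)
  qed
  have EQE: "(x, y) \<in> EQ \<longleftrightarrow> x \<in> H \<and> y \<in> H \<and> E x y" for x y
  proof
    assume "(x, y) \<in> EQ"
    then have xy: "(x, y) \<in> (R \<union> R\<inverse>)\<^sup>*" "x \<in> H" "y \<in> H" unfolding EQ by auto
    from xy(1) have "y \<in> H \<and> E x y"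
    proof (induction rule: rtrancl_induct)
      case base
      show ?case using Erefl xy(2) by blast
    next
      case (step y z)
      consider "(y, z) \<in> R" | "(z, y) \<in> R" using step(2) by auto
      then have yz: "y \<in> H \<and> z \<in> H \<and> E y z"
        by cases (use RH[of y z] RH[of z y] Esym[of z y] in simp_all)
      then show ?case using Etrans[of x y z] step.IH xy(2) by simp
    qed
    then show "x \<in> H \<and> y \<in> H \<and> E x y" using xy by blast
  next
    assume xy: "x \<in> H \<and> y \<in> H \<and> E x y"
    obtain b f b' f' where e: "x = (b, f)" "y = (b', f')" by (metis surj_pair)
    obtain d where d: "(b, d) \<in> r" "(b', d) \<in> r" "FAr Z (b, d) \<cdot> f = FAr Z (b', d) \<cdot> f'"
      using xy unfolding e Ei by blast
    have "(x, (d, FAr Z (b, d) \<cdot> f)) \<in> R" "(y, (d, FAr Z (b', d) \<cdot> f')) \<in> R"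
      unfolding R_def e using d xy unfolding e H by blast+
    then have "(x, (d, FAr Z (b, d) \<cdot> f)) \<in> R \<union> R\<inverse>" "((d, FAr Z (b, d) \<cdot> f), y) \<in> R \<union> R\<inverse>"
      using d(3) by auto
    then have "(x, y) \<in> (R \<union> R\<inverse>)\<^sup>*" by (rule converse_rtrancl_into_rtrancl[OF _ r_into_rtrancl])
    then show "(x, y) \<in> EQ" unfolding EQ using xy by blast
  qed
  define \<phi> where "\<phi> = (\<lambda>(b, f). \<tau> b \<cdot> f)"
  have tpush: "\<tau> b \<cdot> f = \<tau> d \<cdot> (FAr Z (b, d) \<cdot> f)" if "(b, d) \<in> r" "f \<in> Hom M A (FOb Z b)" for b d f
    using comp_assoc[OF M that(2) ord_functor_Hom[OF Z that(1)] coc(2)] coc(3)[OF that(1)] FieldD[OF that(1)] by metis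
  have \<phi>H: "\<phi> x \<in> Hom M A c" if "x \<in> H" for x
    using that comp_Hom[OF M _ coc(2)] unfolding \<phi>_def by (cases x) (auto simp: H)
  have \<phi>E: "\<phi> x = \<phi> y" if t: "E x y" "x \<in> H" "y \<in> H" for x y
  proof -
    obtain b f b' f' where e: "x = (b, f)" "y = (b', f')" by (metis surj_pair)
    obtain d where d: "(b, d) \<in> r" "(b', d) \<in> r" "FAr Z (b, d) \<cdot> f = FAr Z (b', d) \<cdot> f'"
      using t unfolding e Ei by blast
    show ?thesis
      unfolding \<phi>_def e using tpush[OF d(1), of f] tpush[OF d(2), of f'] d(3) t(2,3) unfolding e H by simp
  qed
  have img: "f \<in> \<phi> ` H \<longleftrightarrow> (\<exists>b \<in> Field r. \<exists>g \<in> Hom M A (FOb Z b). \<tau> b \<cdot> g = f)" for f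
  proof
    assume "f \<in> \<phi> ` H"
    then obtain b g where bg: "(b, g) \<in> H" "f = \<phi> (b, g)" by (metis imageE surj_pair)
    then show "\<exists>b \<in> Field r. \<exists>g \<in> Hom M A (FOb Z b). \<tau> b \<cdot> g = f"
      unfolding H \<phi>_def by auto
  next
    assume "\<exists>b \<in> Field r. \<exists>g \<in> Hom M A (FOb Z b). \<tau> b \<cdot> g = f"
    then obtain b g where "b \<in> Field r" "g \<in> Hom M A (FOb Z b)" "\<tau> b \<cdot> g = f" by blast
    then have "(b, g) \<in> H" "f = \<phi> (b, g)" by (simp_all add: H \<phi>_def)
    then show "f \<in> \<phi> ` H" by (rule image_eqI[rotated])
  qed
  have cm: "canonical_map M \<tau> (EQ `` {x}) = \<phi> x" if "x \<in> H" for x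
  proof -
    have "\<phi> ` (EQ `` {x}) = {\<phi> x}"
    proof (rule equalityI)
      show "\<phi> ` (EQ `` {x}) \<subseteq> {\<phi> x}"
      proof (rule image_subsetI)
        fix z assume "z \<in> EQ `` {x}"
        then have "E x z" "z \<in> H" unfolding Image_singleton_iff EQE by auto
        then show "\<phi> z \<in> {\<phi> x}" using \<phi>E[of x z] that by simp
      qed
      have "x \<in> EQ `` {x}" unfolding Image_singleton_iff EQE using Erefl[OF that] that by simp
      then show "{\<phi> x} \<subseteq> \<phi> ` (EQ `` {x})" by blast
    qed
    then show ?thesis unfolding canonical_map_def \<phi>_def by simp
  qed
  have CH: "colim_hom r M Z A = (\<lambda>x. EQ `` {x}) ` H"
    unfolding colim_hom_def EQ_def[symmetric] H_def[symmetric] quotient_def by auto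
  have cls: "EQ `` {x} = EQ `` {y} \<longleftrightarrow> E x y" if "x \<in> H" "y \<in> H" for x y
  proof
    assume "EQ `` {x} = EQ `` {y}"
    moreover have "y \<in> EQ `` {y}" using Erefl that by (simp add: EQE)
    ultimately have "y \<in> EQ `` {x}" by simp
    then show "E x y" by (simp add: EQE)
  next
    assume xy: "E x y"
    have "z \<in> EQ `` {x} \<longleftrightarrow> z \<in> EQ `` {y}" for z
      unfolding Image_singleton_iff EQE using Etrans[of y x z] Etrans[of x y z] Esym[OF xy] xy that by blast
    then show "EQ `` {x} = EQ `` {y}" by (simp only: set_eq_iff) simp
  qed
  have inj1: "inj_on (canonical_map M \<tau>) (colim_hom r M Z A) \<longleftrightarrow> (\<forall>x \<in> H. \<forall>y \<in> H. \<phi> x = \<phi> y \<longrightarrow> E x y)"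
    unfolding CH inj_on_def by (simp add: cm cls)
  have inj2: "(\<forall>x \<in> H. \<forall>y \<in> H. \<phi> x = \<phi> y \<longrightarrow> E x y) \<longleftrightarrow> (\<forall>b \<in> Field r. \<forall>g \<in> Hom M A (FOb Z b). \<forall>g' \<in> Hom M A (FOb Z b). \<tau> b \<cdot> g = \<tau> b \<cdot> g' \<longrightarrow>
      (\<exists>b'. (b, b') \<in> r \<and> FAr Z (b, b') \<cdot> g = FAr Z (b, b') \<cdot> g'))" (is "?L \<longleftrightarrow> ?R")
  proof
    assume L: ?L
    show ?R
    proof (intro ballI impI)
      fix b g g' assume a: "b \<in> Field r" "g \<in> Hom M A (FOb Z b)" "g' \<in> Hom M A (FOb Z b)" "\<tau> b \<cdot> g = \<tau> b \<cdot> g'"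
      then have "(b, g) \<in> H" "(b, g') \<in> H" "\<phi> (b, g) = \<phi> (b, g')" by (simp_all add: H \<phi>_def)
      then have "E (b, g) (b, g')" using L by blast
      then show "\<exists>b'. (b, b') \<in> r \<and> FAr Z (b, b') \<cdot> g = FAr Z (b, b') \<cdot> g'" unfolding Ei by metis
    qed
  next
    assume R: ?R
    show ?L
    proof (intro ballI impI)
      fix x y assume xy: "x \<in> H" "y \<in> H" "\<phi> x = \<phi> y"
      obtain b f b' f' where e: "x = (b, f)" "y = (b', f')" by (metis surj_pair)
      have f: "b \<in> Field r" "f \<in> Hom M A (FOb Z b)" "b' \<in> Field r" "f' \<in> Hom M A (FOb Z b')" using xy unfolding e H by auto
      obtain d where d: "(b, d) \<in> r" "(b', d) \<in> r"
        using wo_totalD[OF r f(1,3)] wo_reflD[OF r] f(1,3) by blast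
      have g: "FAr Z (b, d) \<cdot> f \<in> Hom M A (FOb Z d)" "FAr Z (b', d) \<cdot> f' \<in> Hom M A (FOb Z d)"
        using comp_Hom[OF M f(2) ord_functor_Hom[OF Z d(1)]] comp_Hom[OF M f(4) ord_functor_Hom[OF Z d(2)]] by auto
      have "\<tau> d \<cdot> (FAr Z (b, d) \<cdot> f) = \<tau> d \<cdot> (FAr Z (b', d) \<cdot> f')"
        using tpush[OF d(1) f(2)] tpush[OF d(2) f(4)] xy(3) unfolding \<phi>_def e by simp
      then obtain k where k: "(d, k) \<in> r" "FAr Z (d, k) \<cdot> (FAr Z (b, d) \<cdot> f) = FAr Z (d, k) \<cdot> (FAr Z (b', d) \<cdot> f')"
        using R g FieldD[OF d(1)] by blast
      then show "E x y"
        unfolding e Ei using wo_transD[OF r d(1) k(1)] wo_transD[OF r d(2) k(1)]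
          push[OF d(1) k(1) f(2)] push[OF d(2) k(1) f(4)] by metis
    qed
  qed
  note inj = trans[OF inj1 inj2]
  have "canonical_map M \<tau> ` colim_hom r M Z A = \<phi> ` H"
    unfolding CH image_image using cm by (rule image_cong[OF refl])
  moreover have "\<phi> ` H \<subseteq> Hom M A c" by (rule image_subsetI) (rule \<phi>H)
  ultimately have sur1: "canonical_map M \<tau> ` colim_hom r M Z A = Hom M A c \<longleftrightarrow> Hom M A c \<subseteq> \<phi> ` H"
    by (metis subset_antisym order_refl)
  have sur2: "Hom M A c \<subseteq> \<phi> ` H \<longleftrightarrow> (\<forall>f \<in> Hom M A c. \<exists>b \<in> Field r. \<exists>g \<in> Hom M A (FOb Z b). \<tau> b \<cdot> g = f)"
    unfolding subset_iff img Ball_def ..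
  show ?thesis
    unfolding bij_betw_def seq_small_def inj trans[OF sur1 sur2] by (rule conj_commute)
qed

lemma card_small_rel_iff:
  fixes \<kappa> :: "'u rel"
  assumes M: "category M"
  shows "card_small_rel \<kappa> M W A \<longleftrightarrow>
    (\<forall>(r :: 'u rel) Z c \<tau>. Card_order r \<and> infinite (Field r) \<and> regularCard r \<and>
        r <o |UNIV :: 'u set| \<and> \<kappa> \<le>o r \<and>
        lambda_sequence r M Z \<and> (\<forall>a b. succ_elem r a b \<longrightarrow> FAr Z (a, b) \<in> W) \<and>
        is_colimit (ord_cat r) M Z c \<tau> \<longrightarrow> seq_small r M Z c \<tau> A)"
proof -
  have eq: "bij_betw (canonical_map M \<tau>) (colim_hom r M Z A) (Hom M A c) \<longleftrightarrow> seq_small r M Z c \<tau> A"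
    if "Card_order r" "lambda_sequence r M Z" "is_colimit (ord_cat r) M Z c \<tau>" for r :: "'u rel" and Z c \<tau>
    using canonical_map_bij_iff[OF M Card_order_wo[OF that(1)] _ colimit_cocone[OF that(3)]] that(2)
    by (simp add: lambda_sequence_def)
  show ?thesis
  proof
    assume L: "card_small_rel \<kappa> M W A"
    show "\<forall>(r :: 'u rel) Z c \<tau>. Card_order r \<and> infinite (Field r) \<and> regularCard r \<and>
        r <o |UNIV :: 'u set| \<and> \<kappa> \<le>o r \<and>
        lambda_sequence r M Z \<and> (\<forall>a b. succ_elem r a b \<longrightarrow> FAr Z (a, b) \<in> W) \<and>
        is_colimit (ord_cat r) M Z c \<tau> \<longrightarrow> seq_small r M Z c \<tau> A"
      using L unfolding card_small_rel_def by (auto simp: eq)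
  next
    assume R: "\<forall>(r :: 'u rel) Z c \<tau>. Card_order r \<and> infinite (Field r) \<and> regularCard r \<and>
        r <o |UNIV :: 'u set| \<and> \<kappa> \<le>o r \<and>
        lambda_sequence r M Z \<and> (\<forall>a b. succ_elem r a b \<longrightarrow> FAr Z (a, b) \<in> W) \<and>
        is_colimit (ord_cat r) M Z c \<tau> \<longrightarrow> seq_small r M Z c \<tau> A"
    show "card_small_rel \<kappa> M W A"
      using R unfolding card_small_rel_def by (auto simp: eq)
  qed
qed

section \<open>Relative cell complexes as intervals of a sequence\<close>

lemma colimit_top:
  fixes M (structure)
  assumes M: "category M" and r: "Well_order r" and Z: "is_functor (ord_cat r) M Z"
    and b: "b \<in> Field r" "\<And>x. x \<in> Field r \<Longrightarrow> (x, b) \<in> r"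
  shows "is_colimit (ord_cat r) M Z (FOb Z b) (\<lambda>x. FAr Z (x, b))"
proof (rule colimitI)
  show "is_cocone (ord_cat r) M Z (FOb Z b) (\<lambda>x. FAr Z (x, b))"
    by (rule ord_coconeI)
      (use ord_functor_Ob[OF Z b(1)] ord_functor_Hom[OF Z b(2)] ord_functor_Comp[OF Z _ b(2)] FieldD in fast)+
  fix e \<sigma> assume e: "is_cocone (ord_cat r) M Z e \<sigma>"
  show "\<exists>h. h \<in> Hom M (FOb Z b) e \<and> (\<forall>j\<in>Obj (ord_cat r). h \<cdot> FAr Z (j, b) = \<sigma> j)"
    using ord_coconeD(2)[OF e b(1)] ord_coconeD(3)[OF e b(2)] by auto
next
  fix e h h' assume h: "h \<in> Hom M (FOb Z b) e" "h' \<in> Hom M (FOb Z b) e"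
    and eq: "\<And>j. j \<in> Obj (ord_cat r) \<Longrightarrow> h \<cdot> FAr Z (j, b) = h' \<cdot> FAr Z (j, b)"
  show "h = h'"
    using eq[of b] b(1) ord_functor_Id[OF Z b(1)] comp_id[OF M h(1)] comp_id[OF M h(2)] by simp
qed

lemma reindex_id [simp]: "reindex (\<lambda>x. x) Z = Z"
  by (simp add: reindex_def)

text \<open>The closed interval from \<open>a\<close> to \<open>b\<close> is a well-order with least element \<open>a\<close>; it has a
  greatest element \<open>b\<close>, so its colimit is the stage \<open>b\<close>. Successors in the interval are successors
  in \<open>R\<close>, and limits in the interval are limits in \<open>R\<close> in which the interval is cofinal.\<close>

lemma interval_relative_cell:
  fixes U :: "'u itself" and R :: "'u rel"
  assumes M: "category M" and R: "Well_order R" and Z: "lambda_sequence R M Z" and ab: "(a, b) \<in> R"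
    and sm: "small U {x. (x, b) \<in> R}"
    and st: "\<And>x y. succ_elem R x y \<Longrightarrow> (a, x) \<in> R \<Longrightarrow> (y, b) \<in> R \<Longrightarrow> \<exists>i \<in> I. pushout_of M i (FAr Z (x, y))"
  shows "FAr Z (a, b) \<in> relative_cell U M I"
proof -
  define S where "S = {x. (a, x) \<in> R \<and> (x, b) \<in> R}"
  define r where "r = Restr R S"
  have SF: "S \<subseteq> Field R" unfolding S_def by (auto simp: Field_def)
  have r: "Well_order r" unfolding r_def by (rule Restr_wo[OF R])
  have Fr: "Field r = S" unfolding r_def by (rule Field_Restr[OF R SF])
  have aS: "a \<in> S" and bS: "b \<in> S" using ab wo_reflD[OF R] FieldD[OF ab] by (auto simp: S_def)
  have und: "underS r y = underS R y \<inter> S" if "y \<in> S" for y unfolding r_def by (rule underS_Restr[OF that])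
  have fZ: "is_functor (ord_cat R) M Z" using Z by (simp add: lambda_sequence_def)
  have fr: "is_functor (ord_cat r) M Z" unfolding r_def by (rule ord_functor_Restr[OF R fZ SF])
  have succ: "succ_elem R x y" if s: "succ_elem r x y" for x y
  proof (rule succ_elemI[OF R])
    note sd = succ_elemD[OF s]
    show "(x, y) \<in> R" "x \<noteq> y" using sd by (auto simp: r_def)
    have xS: "x \<in> S" and yS: "y \<in> S" using sd(1,2) Fr by auto
    fix z assume z: "z \<in> underS R y"
    show "(z, x) \<in> R"
    proof (cases "(a, z) \<in> R")
      case True
      have "(z, b) \<in> R" using wo_transD[OF R, of z y b] z yS by (auto simp: underS_def S_def)
      then have "z \<in> underS r y" using und[OF yS] z True by (simp add: S_def)
      then show ?thesis using succ_elem_le[OF r s] by (auto simp: r_def)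
    next
      case False
      have "(z, a) \<in> R" using wo_totalD[OF R, of z a] False underSD[OF z] FieldD[OF ab] by blast
      then show ?thesis using wo_transD[OF R, of z a x] xS by (simp add: S_def)
    qed
  qed
  have lim: "limit_elem R y \<and> (a, y) \<in> R \<and> a \<noteq> y" if l: "limit_elem r y" for y
  proof -
    have yS: "y \<in> S" using l Fr by (simp add: limit_elem_def)
    have "\<not> least_elem r y" using l by (simp add: limit_elem_def)
    then obtain z where z: "z \<in> underS r y" using yS Fr unfolding least_elem_def by blast
    have az: "(a, z) \<in> R" using z und[OF yS] by (simp add: S_def)
    have ay: "a \<in> underS R y" using wo_underS_trans[OF R az] z und[OF yS] by simp
    have "\<not> succ_elem R x y" for x
    proof
      assume s: "succ_elem R x y"
      have "(a, x) \<in> R" using succ_elem_le[OF R s ay] .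
      moreover have "(x, b) \<in> R" using wo_transD[OF R succ_elemD(4)[OF s]] yS by (simp add: S_def)
      ultimately have xS: "x \<in> S" by (simp add: S_def)
      have "succ_elem r x y"
        by (rule succ_elemI[OF r])
          (use succ_elemD[OF s] xS yS succ_elem_le[OF R s] und[OF yS] in \<open>auto simp: r_def\<close>)
      then show False using l by (auto simp: limit_elem_def)
    qed
    then show ?thesis using ay SF yS by (auto simp: limit_elem_def least_elem_def underS_def)
  qed
  have "lambda_sequence r M Z"
    unfolding lambda_sequence_def
  proof (intro conjI allI impI)
    show "is_functor (ord_cat r) M Z" by (rule fr)
    fix y assume l: "limit_elem r y"
    have yS: "y \<in> S" using l Fr by (simp add: limit_elem_def)
    have c: "is_colimit (ord_cat (Restr R (underS R y))) M Z (FOb Z y) (\<lambda>a. FAr Z (a, y))"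
      using Z lim[OF l] by (simp add: lambda_sequence_def)
    have e: "Restr r (underS r y) = Restr R (underS R y \<inter> S)" using und[OF yS] by (auto simp: r_def)
    have F1: "Field (Restr R (underS R y \<inter> S)) = underS R y \<inter> S" by (rule Field_Restr[OF R]) (use SF in auto)
    have F2: "Field (Restr R (underS R y)) = underS R y" by (rule Field_Restr_underS[OF R])
    have "is_colimit (ord_cat (Restr R (underS R y \<inter> S))) M (reindex (\<lambda>x. x) Z) (FOb Z y) (\<lambda>a. FAr Z (a, y))"
    proof (rule cofinal_colimit[OF M Restr_wo[OF R] Restr_wo[OF R] ord_functor_Restr[OF R fZ underS_subset] _ _ _ c])
      show "x \<in> Field (Restr R (underS R y))" if "x \<in> Field (Restr R (underS R y \<inter> S))" for x
        using that F1 F2 by simp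
      show "(x, x') \<in> Restr R (underS R y)" if "(x, x') \<in> Restr R (underS R y \<inter> S)" for x x' using that by auto
      fix x assume "x \<in> Field (Restr R (underS R y))"
      then have x: "x \<in> underS R y" using F2 by simp
      have ay: "a \<in> underS R y" using lim[OF l] by (simp add: underS_def)
      show "\<exists>x'\<in>Field (Restr R (underS R y \<inter> S)). (x, x') \<in> Restr R (underS R y)"
      proof (cases "(a, x) \<in> R")
        case True
        have "(x, b) \<in> R" using wo_transD[OF R, of x y b] underSD[OF x] yS by (auto simp: S_def)
        then have "x \<in> S" using True by (simp add: S_def)
        then show ?thesis unfolding F1 using x wo_reflD[OF R] underSD[OF x] by auto
      next
        case False
        then have "(x, a) \<in> R" using wo_totalD[OF R, of x a] underSD[OF x] FieldD[OF ab] by blast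
        then show ?thesis unfolding F1 using x ay aS by auto
      qed
    qed
    then show "is_colimit (ord_cat (Restr r (underS r y))) M Z (FOb Z y) (\<lambda>a. FAr Z (a, y))" using e by simp
  qed
  moreover have "small U (Field r)" unfolding Fr by (rule small_subset[OF sm]) (auto simp: S_def)
  moreover have "\<exists>i \<in> I. pushout_of M i (FAr Z (x, y))" if s: "succ_elem r x y" for x y
    using st[OF succ[OF s]] succ_elemD(1,2)[OF s] unfolding Fr S_def by blast
  moreover have "is_colimit (ord_cat r) M Z (FOb Z b) (\<lambda>x. FAr Z (x, b))"
    by (rule colimit_top[OF M r fr]) (use bS Fr in \<open>auto simp: r_def S_def\<close>)
  moreover have "least_elem r a"
    unfolding least_elem_def using aS und[OF aS] Fr wo_antisymD[OF R] by (auto simp: S_def underS_def)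
  ultimately show ?thesis unfolding relative_cell_def using r by blast
qed

section \<open>Factorisation through a relative cell complex\<close>

text \<open>The cells are attached one by one along the well-order \<open>R\<close> of the universe itself. A lifting
  problem is posed at a stage \<open>x\<close> and has been solved at a later stage \<open>a\<close> if a diagonal exists
  after pushing it forward to \<open>a\<close>. As long as the map \<open>q a\<close> from stage \<open>a\<close> to \<open>C\<close> is not injective
  relative to \<open>I\<close>, that is, lacks the right lifting property against \<open>I\<close>, a problem that is open
  at \<open>a\<close> and was posed as early as possible is solved by a pushout.

  Suppose this never ends. A stage poses only a small set of problems and older problems have
  priority, so all problems posed up to stage \<open>b\<close> are solved at some later stage \<open>gc b\<close>: otherwise
  every step from \<open>b\<close> on would solve a new problem posed before or at \<open>b\<close>, giving an injection of
  a final segment of the universe into a small set. Iterating \<open>gc\<close> along a regular cardinal \<open>rk\<close>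
  leads to a stage \<open>\<delta>\<close> which is the colimit of a sequence of length \<open>rk\<close> of relative cell
  complexes. Since domains of elements of \<open>I\<close> are small, any problem posed at \<open>\<delta>\<close> is posed earlier
  and hence solved at \<open>\<delta>\<close>. So \<open>q \<delta>\<close> is injective relative to \<open>I\<close> after all.

  Therefore some \<open>q a\<close> is injective, and for the first such \<open>a\<close> every step before it is a pushout
  of an element of \<open>I\<close>.\<close>

lemma cell_factorization:
  fixes U :: "'u itself" and M :: "('o, 'a) cat" (structure)
  assumes U: "universe U" and bi: "bicomplete U M"
    and ls: "\<And>x y. x \<in> Obj M \<Longrightarrow> y \<in> Obj M \<Longrightarrow> small U (Hom M x y)"
    and IA: "I \<subseteq> Arr M" and sI: "small U I" and soa: "permits_small_object_argument U M I"
    and g: "g \<in> Hom M B C"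
  shows "\<exists>Y f q. f \<in> Hom M B Y \<and> f \<in> relative_cell U M I \<and> q \<in> Hom M Y C \<and> (\<forall>i \<in> I. has_lift M i q) \<and> q \<cdot> f = g"
proof -
  have M: "category M" using bi by (rule bicomplete_category)
  have IHom: "i \<in> Hom M (Dom M i) (Cod M i)" if "i \<in> I" for i
    using HomI[OF subsetD[OF IA that]] .
  define R :: "'u rel" where "R = |UNIV :: 'u set|"
  have cR: "Card_order R" unfolding R_def by (rule card_of_Card_order)
  have R: "Well_order R" using cR by (rule Card_order_wo)
  have FR[simp]: "Field R = UNIV" by (simp add: R_def Field_card_of)
  have infR: "infinite (Field R)" using universe_infinite[OF U] by simp
  have regR: "regularCard R" using U by (simp add: R_def universe_def)
  have smU: "small U (underS R b)" for b
    unfolding small_def using card_of_underS[OF cR, of b] by (simp add: R_def Field_card_of)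
  have smU': "small U {x. (x, b) \<in> R}" for b
    by (rule small_subset[OF small_Un[OF U smU[of b] small_finite[OF U, of "{b}"]]]) (auto simp: underS_def)
  have reflR: "(x, x) \<in> R" for x using wo_reflD[OF R] by simp
  have totR: "(x, y) \<in> R \<or> (y, x) \<in> R" for x y using wo_totalD[OF R] by simp
  define RLP where "RLP = (\<lambda>q. \<forall>i \<in> I. has_lift M i q)"
  define prob where "prob = (\<lambda>X q. {(i, u, v). i \<in> I \<and> u \<in> Hom M (Dom M i) X \<and> v \<in> Hom M (Cod M i) C \<and> q \<cdot> u = v \<cdot> i})"
  define solved where "solved = (\<lambda>(i, u, v) w X q. \<exists>h \<in> Hom M (Cod M i) X. h \<cdot> i = w \<cdot> u \<and> q \<cdot> h = v)"
  \<comment> \<open>The step from \<open>a\<close> attaches a cell for a problem \<open>\<pi>\<close> posed at \<open>x\<close>, open at \<open>a\<close>, where all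
    problems posed before \<open>x\<close> have been solved.\<close>
  define Step :: "'u \<Rightarrow> ('u, 'u \<times> 'u, 'o, 'a) fctr \<Rightarrow> ('u \<Rightarrow> 'a) \<Rightarrow> 'o \<Rightarrow> 'a \<Rightarrow> 'a \<Rightarrow> bool"
    where "Step = (\<lambda>a D E c s e. \<exists>x \<pi>. (x, a) \<in> R \<and> \<pi> \<in> prob (FOb D x) (E x) \<and>
      \<not> solved \<pi> (FAr D (x, a)) (FOb D a) (E a) \<and>
      (\<forall>x' \<in> underS R x. \<forall>\<pi>' \<in> prob (FOb D x') (E x'). solved \<pi>' (FAr D (x', a)) (FOb D a) (E a)) \<and>
      pushout_of M (fst \<pi>) s \<and> solved \<pi> (s \<cdot> FAr D (x, a)) c e)"
  define Ext :: "'u \<Rightarrow> ('u, 'u \<times> 'u, 'o, 'a) fctr \<Rightarrow> ('u \<Rightarrow> 'a) \<Rightarrow> 'o \<Rightarrow> ('u \<Rightarrow> 'a) \<Rightarrow> 'a \<Rightarrow> bool"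
    where "Ext = (\<lambda>b D E c \<tau> e. e \<in> Hom M c C \<and> (\<forall>a \<in> underS R b. e \<cdot> \<tau> a = E a) \<and>
      (least_elem R b \<longrightarrow> c = B \<and> e = g) \<and>
      (limit_elem R b \<longrightarrow> is_colimit (ord_cat (Restr R (underS R b))) M D c \<tau>) \<and>
      (\<forall>a. succ_elem R a b \<and> \<not> RLP (E a) \<longrightarrow> Step a D E c (\<tau> a) e))"
  have "\<exists>Z E. is_functor (ord_cat R) M Z \<and> (\<forall>b \<in> Field R. Ext b Z E (FOb Z b) (\<lambda>x. FAr Z (x, b)) (E b))"
  proof (rule transfinite_construction[OF R M])
    fix b c \<tau> e E' \<tau>' and D D' :: "('u, 'u \<times> 'u, 'o, 'a) fctr" and E
    assume e1: "\<And>a. a \<in> underS R b \<Longrightarrow> FOb D a = FOb D' a \<and> E a = E' a \<and> \<tau> a = \<tau>' a"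
      and e2: "\<And>a a'. (a, a') \<in> R \<Longrightarrow> a' \<in> underS R b \<Longrightarrow> FAr D (a, a') = FAr D' (a, a')"
      and X: "Ext b D E c \<tau> e"
    have st: "Step a D' E' c (\<tau>' a) e" if s: "succ_elem R a b" and n: "\<not> RLP (E' a)" for a
    proof -
      note ab = succ_elemD(3)[OF s]
      have "Step a D E c (\<tau> a) e" using X s n e1[OF ab, THEN conjunct2, THEN conjunct1] unfolding Ext_def by simp
      then obtain x \<pi> where x: "(x, a) \<in> R" "\<pi> \<in> prob (FOb D x) (E x)" "\<not> solved \<pi> (FAr D (x, a)) (FOb D a) (E a)"
        "\<forall>x' \<in> underS R x. \<forall>\<pi>' \<in> prob (FOb D x') (E x'). solved \<pi>' (FAr D (x', a)) (FOb D a) (E a)"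
        "pushout_of M (fst \<pi>) (\<tau> a)" "solved \<pi> (\<tau> a \<cdot> FAr D (x, a)) c e" unfolding Step_def by blast
      have xb: "x \<in> underS R b" using wo_underS_trans[OF R x(1) ab] .
      have x'a: "(x', a) \<in> R" "x' \<in> underS R b" if "x' \<in> underS R x" for x'
        using wo_transD[OF R _ x(1), of x'] wo_underS_trans[OF R _ xb, of x'] underSD[OF that] by auto
      show ?thesis
        unfolding Step_def
        using x e1[OF xb] e1[OF ab] e2[OF x(1) ab] e1[OF x'a(2)] e2[OF x'a(1) ab]
        by (intro exI[of _ x] exI[of _ \<pi>]) auto
    qed
    have "is_colimit (ord_cat (Restr R (underS R b))) M D c \<tau> \<longleftrightarrow> is_colimit (ord_cat (Restr R (underS R b))) M D' c \<tau>'"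
      by (rule is_colimit_cong[OF wo_category[OF Restr_wo[OF R]]]) (auto simp: Field_Restr_underS[OF R] e1 e2)
    then show "Ext b D' E' c \<tau>' e" using X e1 st unfolding Ext_def by auto
  next
    fix b E and D :: "('u, 'u \<times> 'u, 'o, 'a) fctr" assume D: "is_functor (ord_cat (Restr R (underS R b))) M D"
      and IH: "\<And>a. a \<in> underS R b \<Longrightarrow> Ext a D E (FOb D a) (\<lambda>x. FAr D (x, a)) (E a)"
    have fu: "Field (Restr R (underS R b)) = underS R b" by (rule Field_Restr_underS[OF R])
    have EH: "E a \<in> Hom M (FOb D a) C" if "a \<in> underS R b" for a using IH[OF that] by (simp add: Ext_def)
    have Dob: "FOb D a \<in> Obj M" if "a \<in> underS R b" for a using ord_functor_Ob[OF D] that fu by simp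
    have ED: "E a \<cdot> FAr D (x, a) = E x" if "a \<in> underS R b" "(x, a) \<in> R" for a x
    proof (cases "x = a")
      case True
      then show ?thesis using ord_functor_Id[OF D, of a] that fu comp_id[OF M EH[OF that(1)]] by simp
    next
      case False
      then show ?thesis using IH[OF that(1)] that(2) by (simp add: Ext_def underS_def)
    qed
    have "b \<in> Field R" by simp
    then show "\<exists>c \<tau> e. is_cocone (ord_cat (Restr R (underS R b))) M D c \<tau> \<and> Ext b D E c \<tau> e"
    proof (cases rule: elem_cases)
      case 1
      then have u: "underS R b = {}" by (simp add: least_elem_def)
      have "is_cocone (ord_cat (Restr R (underS R b))) M D B (\<lambda>_. g)"
        unfolding is_cocone_def using Hom_Obj[OF M g] by (simp add: u fu)
      moreover have "Ext b D E B (\<lambda>_. g) g"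
        using g 1 u by (auto simp: Ext_def limit_elem_def succ_elem_def)
      ultimately show ?thesis by blast
    next
      case (2 a)
      note ab = succ_elemD(3)[OF 2]
      have below: "(x, a) \<in> R" if "x \<in> underS R b" for x using succ_elem_le[OF R 2 that] .
      note aOb = Dob[OF ab]
      have "\<exists>c s e. s \<in> Hom M (FOb D a) c \<and> e \<in> Hom M c C \<and> e \<cdot> s = E a \<and> (\<not> RLP (E a) \<longrightarrow> Step a D E c s e)"
      proof (cases "RLP (E a)")
        case True
        then show ?thesis using id_Hom[OF M aOb] EH[OF ab] comp_id[OF M EH[OF ab]] by blast
      next
        case False
        \<comment> \<open>The stages that have posed a problem which is still open at \<open>a\<close>; the least of them is
          served.\<close>
        define US where "US = {x. (x, a) \<in> R \<and> (\<exists>\<pi> \<in> prob (FOb D x) (E x). \<not> solved \<pi> (FAr D (x, a)) (FOb D a) (E a))}"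
        obtain i u v where i: "i \<in> I" "u \<in> Hom M (Dom M i) (FOb D a)" "v \<in> Hom M (Cod M i) C" "v \<cdot> i = E a \<cdot> u"
          "\<not> (\<exists>h \<in> Hom M (Cod M i) (FOb D a). h \<cdot> i = u \<and> E a \<cdot> h = v)"
          using False HomD[OF EH[OF ab]] unfolding RLP_def has_lift_def by auto
        have "(i, u, v) \<in> prob (FOb D a) (E a)" using i by (simp add: prob_def)
        moreover have "\<not> solved (i, u, v) (FAr D (a, a)) (FOb D a) (E a)"
          using i(5) ord_functor_Id[OF D, of a] ab fu id_comp[OF M i(2)] by (simp add: solved_def)
        ultimately have "US \<noteq> {}" using reflR[of a] unfolding US_def by blast
        then obtain x where x: "x \<in> US" "\<And>y. y \<in> US \<Longrightarrow> (x, y) \<in> R" using wo_leastD[OF R, of US] by auto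
        have xa: "(x, a) \<in> R" using x(1) by (simp add: US_def)
        have xb: "x \<in> underS R b" using wo_underS_trans[OF R xa ab] .
        obtain \<pi> where p: "\<pi> \<in> prob (FOb D x) (E x)" "\<not> solved \<pi> (FAr D (x, a)) (FOb D a) (E a)"
          using x(1) unfolding US_def by blast
        obtain i u v where e: "\<pi> = (i, u, v)" by (metis surj_pair)
        have i: "i \<in> I" "u \<in> Hom M (Dom M i) (FOb D x)" "v \<in> Hom M (Cod M i) C" "E x \<cdot> u = v \<cdot> i"
          using p(1) by (auto simp: e prob_def)
        note iH = IHom[OF i(1)]
        have Dxa: "FAr D (x, a) \<in> Hom M (FOb D x) (FOb D a)" using ord_functor_Hom[OF D] xa xb ab by simp
        note ua = comp_Hom[OF M i(2) Dxa]
        obtain c s t where po: "s \<in> Hom M (FOb D a) c" "t \<in> Hom M (Cod M i) c" "is_pushout M i (FAr D (x, a) \<cdot> u) s t"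
          using pushouts_exist[OF U bi iH ua] by blast
        have "E a \<cdot> (FAr D (x, a) \<cdot> u) = v \<cdot> i"
          using comp_assoc[OF M i(2) Dxa EH[OF ab]] ED[OF ab xa] i(4) by simp
        then obtain k where k: "k \<in> Hom M c C" "k \<cdot> s = E a" "k \<cdot> t = v"
          using pushout_ex[OF po(3) iH po(1) EH[OF ab] i(3)] by blast
        have "pushout_of M i s"
          unfolding pushout_of_iff using IA i(1) po ua by (auto simp: HomD)
        moreover have "solved \<pi> (s \<cdot> FAr D (x, a)) c k"
        proof -
          have "t \<cdot> i = (s \<cdot> FAr D (x, a)) \<cdot> u"
            using po(3) comp_assoc[OF M i(2) Dxa po(1)] unfolding is_pushout_def by simp
          then show ?thesis using po(2) k(3) by (auto simp: e solved_def)
        qed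
        moreover have "solved \<pi>' (FAr D (x', a)) (FOb D a) (E a)" if "x' \<in> underS R x" "\<pi>' \<in> prob (FOb D x') (E x')" for x' \<pi>'
        proof (rule ccontr)
          assume "\<not> ?thesis"
          then have "x' \<in> US" unfolding US_def using that wo_transD[OF R _ xa, of x'] underSD by fastforce
          then have "(x, x') \<in> R" by (rule x(2))
          then show False using underSD[OF that(1)] wo_antisymD[OF R] by blast
        qed
        ultimately have "Step a D E c s k" unfolding Step_def using xa p e by (intro exI[of _ x] exI[of _ \<pi>]) simp
        then show ?thesis using po(1) k by blast
      qed
      then obtain c s e where s: "s \<in> Hom M (FOb D a) c" "e \<in> Hom M c C" "e \<cdot> s = E a" "\<not> RLP (E a) \<longrightarrow> Step a D E c s e"
        by blast
      define \<tau> where "\<tau> = (\<lambda>x. s \<cdot> FAr D (x, a))"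
      have Dxa: "FAr D (x, a) \<in> Hom M (FOb D x) (FOb D a)" if "x \<in> underS R b" for x
        using ord_functor_Hom[OF D] below[OF that] that ab by simp
      have ta: "\<tau> a = s" using ord_functor_Id[OF D, of a] ab fu comp_id[OF M s(1)] by (simp add: \<tau>_def)
      have "is_cocone (ord_cat (Restr R (underS R b))) M D c \<tau>"
      proof (rule ord_coconeI)
        show "c \<in> Obj M" using Hom_Obj[OF M s(1)] by simp
        show "\<tau> x \<in> Hom M (FOb D x) c" if "x \<in> Field (Restr R (underS R b))" for x
          unfolding \<tau>_def using comp_Hom[OF M Dxa s(1)] that fu by simp
        fix x y assume xy: "(x, y) \<in> Restr R (underS R b)"
        then have y: "y \<in> underS R b" and x: "x \<in> underS R b" by auto
        have ya: "(y, a) \<in> Restr R (underS R b)" using below[OF y] y ab by simp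
        show "\<tau> y \<cdot> FAr D (x, y) = \<tau> x"
          unfolding \<tau>_def using comp_assoc[OF M ord_functor_Hom[OF D xy] Dxa[OF y] s(1)] ord_functor_Comp[OF D xy ya] by simp
      qed
      moreover have "e \<cdot> \<tau> x = E x" if "x \<in> underS R b" for x
        unfolding \<tau>_def using comp_assoc[OF M Dxa[OF that] s(1,2)] s(3) ED[OF ab below[OF that]] by simp
      moreover have "Step a' D E c (\<tau> a') e" if "succ_elem R a' b" "\<not> RLP (E a')" for a'
        using s(4) that(2) unfolding succ_elem_unique[OF R that(1) 2] ta by simp
      moreover have "\<not> least_elem R b" "\<not> limit_elem R b" using ab 2 by (auto simp: limit_elem_def least_elem_def)
      ultimately have "is_cocone (ord_cat (Restr R (underS R b))) M D c \<tau> \<and> Ext b D E c \<tau> e"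
        unfolding Ext_def using s(2) by simp
      then show ?thesis by blast
    next
      case 3
      obtain c \<tau> where c: "is_colimit (ord_cat (Restr R (underS R b))) M D c \<tau>"
        using wo_colimit_exists[OF U bi Restr_wo[OF R] _ D] smU fu by metis
      have "is_cocone (ord_cat (Restr R (underS R b))) M D C E"
      proof (rule ord_coconeI)
        show "C \<in> Obj M" using Hom_Obj[OF M g] by simp
      qed (use EH ED fu in auto)
      then obtain e where e: "e \<in> Hom M c C" "\<forall>a \<in> underS R b. e \<cdot> \<tau> a = E a"
        using colimit_ex[OF c] unfolding ord_cat_simps fu by blast
      have "Ext b D E c \<tau> e" using e c 3 by (auto simp: Ext_def limit_elem_def)
      then show ?thesis using colimit_cocone[OF c] by blast
    qed
  qed
  then obtain Z :: "('u, 'u \<times> 'u, 'o, 'a) fctr" and q where fZ: "is_functor (ord_cat R) M Z"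
    and X: "\<And>b. Ext b Z q (FOb Z b) (\<lambda>x. FAr Z (x, b)) (q b)" by auto
  have ZH: "FAr Z (a, b) \<in> Hom M (FOb Z a) (FOb Z b)" if "(a, b) \<in> R" for a b using ord_functor_Hom[OF fZ that] .
  have Zob: "FOb Z a \<in> Obj M" for a using ord_functor_Ob[OF fZ] by simp
  have qH: "q b \<in> Hom M (FOb Z b) C" for b using X by (simp add: Ext_def)
  have qZ: "q b \<cdot> FAr Z (a, b) = q a" if "(a, b) \<in> R" for a b
    by (cases "a = b") (use X[of b] that ord_functor_Id[OF fZ, of b] comp_id[OF M qH] in \<open>auto simp: Ext_def underS_def\<close>)
  have lam: "lambda_sequence R M Z" using fZ X by (auto simp: lambda_sequence_def Ext_def)
  obtain a0 where a0: "least_elem R a0" using least_elem_exists[OF R] by auto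
  have a00: "FOb Z a0 = B" "q a0 = g" using X[of a0] a0 by (auto simp: Ext_def)
  have st: "Step a Z q (FOb Z b) (FAr Z (a, b)) (q b)" if "succ_elem R a b" "\<not> RLP (q a)" for a b
    using X[of b] that by (auto simp: Ext_def)
  have po: "\<exists>i \<in> I. pushout_of M i (FAr Z (a, b))" if s: "succ_elem R a b" "\<not> RLP (q a)" for a b
  proof -
    obtain x \<pi> where "\<pi> \<in> prob (FOb Z x) (q x)" "pushout_of M (fst \<pi>) (FAr Z (a, b))"
      using st[OF s] unfolding Step_def by blast
    then show ?thesis by (auto simp: prob_def)
  qed
  have "\<exists>a. RLP (q a)"
  proof (rule ccontr)
    assume "\<not> (\<exists>a. RLP (q a))"
    then have nR: "\<not> RLP (q a)" for a by blast
    \<comment> \<open>\<open>sol x \<pi> a\<close>: the problem \<open>\<pi>\<close> posed at \<open>x\<close> has been solved by stage \<open>a\<close>.\<close>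
    define sol where "sol = (\<lambda>x \<pi> a. solved \<pi> (FAr Z (x, a)) (FOb Z a) (q a))"
    have mono: "sol x \<pi> a'" if that: "sol x \<pi> a" "(x, a) \<in> R" "(a, a') \<in> R" "\<pi> \<in> prob (FOb Z x) (q x)" for x \<pi> a a'
    proof -
      obtain i u v where e: "\<pi> = (i, u, v)" by (metis surj_pair)
      have i: "i \<in> Hom M (Dom M i) (Cod M i)" "u \<in> Hom M (Dom M i) (FOb Z x)" using that(4) IHom by (auto simp: e prob_def)
      note sl = that(1)
      obtain h where h: "h \<in> Hom M (Cod M i) (FOb Z a)" "h \<cdot> i = FAr Z (x, a) \<cdot> u" "q a \<cdot> h = v"
        using sl by (auto simp: sol_def solved_def e)
      have "FAr Z (a, a') \<cdot> h \<in> Hom M (Cod M i) (FOb Z a')" using comp_Hom[OF M h(1) ZH[OF that(3)]] .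
      moreover have "(FAr Z (a, a') \<cdot> h) \<cdot> i = FAr Z (x, a') \<cdot> u"
        using comp_assoc[OF M i(1) h(1) ZH[OF that(3)]] comp_assoc[OF M i(2) ZH[OF that(2)] ZH[OF that(3)]] h(2)
          ord_functor_Comp[OF fZ that(2,3)] by simp
      moreover have "q a' \<cdot> (FAr Z (a, a') \<cdot> h) = v"
        using comp_assoc[OF M h(1) ZH[OF that(3)] qH] qZ[OF that(3)] h(3) by simp
      ultimately show ?thesis by (auto simp: sol_def solved_def e)
    qed
    have smP: "small U (prob (FOb Z x) (q x))" for x
    proof -
      have "small U (Hom M (Dom M i) (FOb Z x))" "small U (Hom M (Cod M i) C)" if "i \<in> I" for i
        using ls Hom_Obj[OF M HomI[of i M]] that IA Zob Hom_Obj[OF M g] by auto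
      then have "small U (Sigma I (\<lambda>i. Hom M (Dom M i) (FOb Z x) \<times> Hom M (Cod M i) C))"
        by (intro small_Sigma[OF U sI] small_Sigma[OF U])
      then show ?thesis by (rule small_subset) (auto simp: prob_def)
    qed
    have "\<exists>a. b \<in> underS R a \<and> (\<forall>x. (x, b) \<in> R \<longrightarrow> (\<forall>\<pi> \<in> prob (FOb Z x) (q x). sol x \<pi> a))" for b
    proof -
      have "\<exists>a. (b, a) \<in> R \<and> (\<forall>x. (x, b) \<in> R \<longrightarrow> (\<forall>\<pi> \<in> prob (FOb Z x) (q x). sol x \<pi> a))"
      proof (rule ccontr)
        assume "\<not> ?thesis"
        then have un: "\<exists>x. (x, b) \<in> R \<and> (\<exists>\<pi> \<in> prob (FOb Z x) (q x). \<not> sol x \<pi> a)" if "(b, a) \<in> R" for a using that by blast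
        have "\<exists>x \<pi>. (x, b) \<in> R \<and> (x, a) \<in> R \<and> \<pi> \<in> prob (FOb Z x) (q x) \<and> \<not> sol x \<pi> a \<and> (\<forall>a'. a \<in> underS R a' \<longrightarrow> sol x \<pi> a')"
          if ba: "(b, a) \<in> R" for a
        proof -
          obtain a1 where a1: "succ_elem R a a1" using infinite_card_succ[OF cR infR] by auto
          obtain x \<pi> where x: "(x, a) \<in> R" "\<pi> \<in> prob (FOb Z x) (q x)" "\<not> sol x \<pi> a"
            "\<forall>x' \<in> underS R x. \<forall>\<pi>' \<in> prob (FOb Z x') (q x'). sol x' \<pi>' a"
            "solved \<pi> (FAr Z (a, a1) \<cdot> FAr Z (x, a)) (FOb Z a1) (q a1)"
            using st[OF a1 nR] unfolding Step_def sol_def by blast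
          have "sol x \<pi> a1" using x(5) ord_functor_Comp[OF fZ x(1) succ_elemD(4)[OF a1]] by (simp add: sol_def)
          moreover have "(a1, a') \<in> R" if "a \<in> underS R a'" for a'
            using succ_elem_next[OF R a1] underSD[OF that] by simp
          ultimately have s: "\<forall>a'. a \<in> underS R a' \<longrightarrow> sol x \<pi> a'"
            using mono[OF _ wo_transD[OF R x(1) succ_elemD(4)[OF a1]] _ x(2)] by blast
          have "(x, b) \<in> R"
          proof (rule ccontr)
            assume n: "(x, b) \<notin> R"
            obtain y where y: "(y, b) \<in> R" "\<exists>\<pi> \<in> prob (FOb Z y) (q y). \<not> sol y \<pi> a" using un[OF ba] by blast
            have "y \<in> underS R x" using n y(1) wo_not_underS[OF R, of y x] wo_transD[OF R, of x y b] by auto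
            then show False using x(4) y(2) by blast
          qed
          then show ?thesis using x s by blast
        qed
        then obtain fx f\<pi> where f: "\<And>a. (b, a) \<in> R \<Longrightarrow> (fx a, b) \<in> R \<and> f\<pi> a \<in> prob (FOb Z (fx a)) (q (fx a)) \<and>
            \<not> sol (fx a) (f\<pi> a) a \<and> (\<forall>a'. a \<in> underS R a' \<longrightarrow> sol (fx a) (f\<pi> a) a')" by metis
        \<comment> \<open>The problem served at \<open>a\<close> is open at \<open>a\<close> and solved at every later stage, so no problem
          is served twice.\<close>
        have "inj_on (\<lambda>a. (fx a, f\<pi> a)) {a. (b, a) \<in> R}"
        proof (rule inj_onI, rule ccontr)
          fix a a' assume a: "a \<in> {a. (b, a) \<in> R}" "a' \<in> {a. (b, a) \<in> R}" "(fx a, f\<pi> a) = (fx a', f\<pi> a')" "a \<noteq> a'"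
          then have "a \<in> underS R a' \<or> a' \<in> underS R a" using totR[of a a'] by (auto simp: underS_def)
          then show False using f[of a] f[of a'] a by auto
        qed
        moreover have "(\<lambda>a. (fx a, f\<pi> a)) ` {a. (b, a) \<in> R} \<subseteq> Sigma {x. (x, b) \<in> R} (\<lambda>x. prob (FOb Z x) (q x))"
          using f by auto
        moreover have "small U (Sigma {x. (x, b) \<in> R} (\<lambda>x. prob (FOb Z x) (q x)))"
          by (rule small_Sigma[OF U smU']) (rule smP)
        ultimately have "small U {a. (b, a) \<in> R}" by (rule small_inj_on[rotated])
        then have "small U (underS R b \<union> {a. (b, a) \<in> R})" using small_Un[OF U smU] by blast
        moreover have "underS R b \<union> {a. (b, a) \<in> R} = UNIV" using wo_not_underS[OF R] by auto
        ultimately show False unfolding small_def using ordLess_irreflexive by auto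
      qed
      then obtain a where a: "(b, a) \<in> R" "\<And>x \<pi>. (x, b) \<in> R \<Longrightarrow> \<pi> \<in> prob (FOb Z x) (q x) \<Longrightarrow> sol x \<pi> a" by blast
      obtain a1 where a1: "succ_elem R a a1" using infinite_card_succ[OF cR infR] by auto
      have "b \<in> underS R a1" using wo_underS_trans[OF R a(1) succ_elemD(3)[OF a1]] .
      moreover have "sol x \<pi> a1" if "(x, b) \<in> R" "\<pi> \<in> prob (FOb Z x) (q x)" for x \<pi>
        using mono[OF a(2)[OF that] wo_transD[OF R that(1) a(1)] succ_elemD(4)[OF a1] that(2)] .
      ultimately show ?thesis by blast
    qed
    then obtain gc where gc: "\<And>b. b \<in> underS R (gc b)"
      "\<And>b x \<pi>. (x, b) \<in> R \<Longrightarrow> \<pi> \<in> prob (FOb Z x) (q x) \<Longrightarrow> sol x \<pi> (gc b)" by metis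
    have "\<forall>i \<in> I. \<exists>\<kappa> :: 'u rel. Card_order \<kappa> \<and> \<kappa> <o |UNIV :: 'u set| \<and> card_small_rel \<kappa> M (relative_cell U M I) (Dom M i)"
      using soa unfolding permits_small_object_argument_def small_rel_def by blast
    then obtain kf :: "'a \<Rightarrow> 'u rel" where kf: "\<And>i. i \<in> I \<Longrightarrow> Card_order (kf i) \<and> kf i <o |UNIV :: 'u set|"
      "\<And>i. i \<in> I \<Longrightarrow> card_small_rel (kf i) M (relative_cell U M I) (Dom M i)" by metis
    obtain rk :: "'u rel" where rk: "Card_order rk" "infinite (Field rk)" "regularCard rk" "rk <o |UNIV :: 'u set|"
      "\<And>i. i \<in> I \<Longrightarrow> kf i \<le>o rk"
      using small_cardinals_bounded[OF U sI, of kf] kf(1) by blast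
    have wk: "Well_order rk" using rk(1) by (rule Card_order_wo)
    have smk: "small U (Field rk)"
      unfolding small_def using ordIso_ordLess_trans[OF card_of_Field_ordIso[OF rk(1)] rk(4)] .
    \<comment> \<open>\<open>d\<close> enumerates closed-off stages: \<open>d \<xi>\<close> is the least stage not before any \<open>gc (d \<eta>)\<close> with
      \<open>\<eta> < \<xi>\<close>. Taking the least one makes \<open>d\<close> continuous, so that \<open>Z \<circ> d\<close> is again a sequence.\<close>
    define SS where "SS = (\<lambda>d (Y :: 'u set). {x. \<forall>\<eta> \<in> Y. (gc (d \<eta>), x) \<in> R})"
    have SS: "\<exists>m \<in> SS d Y. \<forall>y \<in> SS d Y. (m, y) \<in> R" if "Y \<subseteq> Field rk" for d Y
    proof -
      have "|Y| <o R" using small_subset[OF smk that] by (simp add: small_def R_def)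
      then obtain b where "\<forall>\<eta> \<in> Y. (gc (d \<eta>), b) \<in> R"
        using regular_bounded[OF cR regR, of Y "\<lambda>\<eta>. gc (d \<eta>)"] by auto
      then have "SS d Y \<noteq> {}" by (auto simp: SS_def)
      then show ?thesis using wo_leastD[OF R] by simp
    qed
    have "\<exists>d. \<forall>\<xi> \<in> Field rk. d \<xi> \<in> SS d (underS rk \<xi>) \<and> (\<forall>y \<in> SS d (underS rk \<xi>). (d \<xi>, y) \<in> R)"
    proof (rule wo_dependent_choice[OF wk])
      fix f f' :: "'u \<Rightarrow> 'u" and \<xi> x
      assume "\<And>\<eta>. \<eta> \<in> underS rk \<xi> \<Longrightarrow> f \<eta> = f' \<eta>" and P: "x \<in> SS f (underS rk \<xi>) \<and> (\<forall>y \<in> SS f (underS rk \<xi>). (x, y) \<in> R)"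
      then have "SS f (underS rk \<xi>) = SS f' (underS rk \<xi>)" by (simp add: SS_def)
      then show "x \<in> SS f' (underS rk \<xi>) \<and> (\<forall>y \<in> SS f' (underS rk \<xi>). (x, y) \<in> R)" using P by simp
    next
      fix \<xi> f
      show "\<exists>x. x \<in> SS f (underS rk \<xi>) \<and> (\<forall>y\<in>SS f (underS rk \<xi>). (x, y) \<in> R)"
        using SS[OF underS_subset] by blast
    qed
    then obtain d where d: "\<And>\<xi>. \<xi> \<in> Field rk \<Longrightarrow> d \<xi> \<in> SS d (underS rk \<xi>)"
      "\<And>\<xi> y. \<xi> \<in> Field rk \<Longrightarrow> y \<in> SS d (underS rk \<xi>) \<Longrightarrow> (d \<xi>, y) \<in> R" by blast
    obtain \<delta> where \<delta>: "\<delta> \<in> SS d (Field rk)" "\<And>y. y \<in> SS d (Field rk) \<Longrightarrow> (\<delta>, y) \<in> R"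
      using SS[OF subset_refl] by blast
    have dmono: "d \<eta> \<in> underS R (d \<xi>)" "(gc (d \<eta>), d \<xi>) \<in> R" if "\<xi> \<in> Field rk" "\<eta> \<in> underS rk \<xi>" for \<eta> \<xi>
    proof -
      show g: "(gc (d \<eta>), d \<xi>) \<in> R" using d(1)[OF that(1)] that(2) by (simp add: SS_def)
      show "d \<eta> \<in> underS R (d \<xi>)"
        using gc(1)[of "d \<eta>"] g wo_transD[OF R, of "d \<eta>" "gc (d \<eta>)" "d \<xi>"] wo_antisymD[OF R, of "d \<eta>" "gc (d \<eta>)"]
        by (auto simp: underS_def)
    qed
    have dle: "(d \<eta>, d \<xi>) \<in> R" if "(\<eta>, \<xi>) \<in> rk" for \<eta> \<xi>
    proof (cases "\<eta> = \<xi>")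
      case False
      then have "\<eta> \<in> underS rk \<xi>" using that by (simp add: underS_def)
      then show ?thesis using dmono(1)[of \<xi> \<eta>] FieldD[OF that] underSD[of "d \<eta>" R "d \<xi>"] by simp
    qed (simp add: reflR)
    \<comment> \<open>At limits of \<open>rk\<close>, and at its end, the least upper bound of the \<open>d \<eta>\<close> is a limit stage of
      \<open>R\<close> in which they are cofinal.\<close>
    have lim: "limit_elem R m \<and> (\<forall>\<eta> \<in> Y. d \<eta> \<in> underS R m) \<and> (\<forall>x \<in> underS R m. \<exists>\<eta> \<in> Y. (x, d \<eta>) \<in> R)"
      if Y: "Y \<subseteq> Field rk" "Y \<noteq> {}" "\<And>\<eta>. \<eta> \<in> Y \<Longrightarrow> \<exists>\<eta>' \<in> Y. \<eta> \<in> underS rk \<eta>'"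
        and m: "m \<in> SS d Y" "\<And>y. y \<in> SS d Y \<Longrightarrow> (m, y) \<in> R" for Y m
    proof -
      have 1: "d \<eta> \<in> underS R m" if "\<eta> \<in> Y" for \<eta>
      proof -
        have g: "(gc (d \<eta>), m) \<in> R" using m(1) that by (simp add: SS_def)
        show ?thesis
          using gc(1)[of "d \<eta>"] g wo_transD[OF R, of "d \<eta>" "gc (d \<eta>)" m] wo_antisymD[OF R, of "d \<eta>" "gc (d \<eta>)"]
          by (auto simp: underS_def)
      qed
      have 2: "\<exists>\<eta> \<in> Y. (x, d \<eta>) \<in> R" if x: "x \<in> underS R m" for x
      proof -
        have "x \<notin> SS d Y" using m(2) underSD[OF x] wo_antisymD[OF R] by blast
        then obtain \<eta> where \<eta>: "\<eta> \<in> Y" "(gc (d \<eta>), x) \<notin> R" by (auto simp: SS_def)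
        obtain \<eta>' where \<eta>': "\<eta>' \<in> Y" "\<eta> \<in> underS rk \<eta>'" using Y(3)[OF \<eta>(1)] by blast
        have "(x, gc (d \<eta>)) \<in> R" using \<eta>(2) totR by blast
        then have "(x, d \<eta>') \<in> R" using wo_transD[OF R] dmono(2)[OF _ \<eta>'(2)] \<eta>'(1) Y(1) by blast
        then show ?thesis using \<eta>'(1) by blast
      qed
      have "\<not> least_elem R m" using Y(2) 1 unfolding least_elem_def by blast
      moreover have "\<not> succ_elem R a m" for a
      proof
        assume s: "succ_elem R a m"
        obtain \<eta> where \<eta>: "\<eta> \<in> Y" "(a, d \<eta>) \<in> R" using 2[OF succ_elemD(3)[OF s]] by blast
        obtain \<eta>' where \<eta>': "\<eta>' \<in> Y" "\<eta> \<in> underS rk \<eta>'" using Y(3)[OF \<eta>(1)] by blast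
        have "(d \<eta>', a) \<in> R" using succ_elem_le[OF R s 1[OF \<eta>'(1)]] .
        then have "(d \<eta>', d \<eta>) \<in> R" using wo_transD[OF R _ \<eta>(2)] by blast
        moreover have "d \<eta> \<in> underS R (d \<eta>')" using dmono(1)[OF _ \<eta>'(2)] \<eta>'(1) Y(1) by blast
        ultimately show False using wo_antisymD[OF R] underSD[of "d \<eta>" R "d \<eta>'"] by blast
      qed
      ultimately show ?thesis using 1 2 by (auto simp: limit_elem_def)
    qed
    define W where "W = reindex d Z"
    have fW: "is_functor (ord_cat rk) M W" unfolding W_def by (rule reindex_functor[OF fZ]) (use dle in auto)
    have col: "is_colimit (ord_cat (Restr rk Y)) M W (FOb Z m) (\<lambda>\<eta>. FAr Z (d \<eta>, m))"
      if Y: "Y \<subseteq> Field rk" and l: "limit_elem R m \<and> (\<forall>\<eta> \<in> Y. d \<eta> \<in> underS R m) \<and> (\<forall>x \<in> underS R m. \<exists>\<eta> \<in> Y. (x, d \<eta>) \<in> R)" for Y m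
      unfolding W_def
    proof (rule cofinal_colimit[OF M Restr_wo[OF R] Restr_wo[OF wk] ord_functor_Restr[OF R fZ underS_subset[of R m]]])
      have F1: "Field (Restr R (underS R m)) = underS R m" by (rule Field_Restr_underS[OF R])
      have F2: "Field (Restr rk Y) = Y" by (rule Field_Restr[OF wk Y])
      show "d x \<in> Field (Restr R (underS R m))" if "x \<in> Field (Restr rk Y)" for x using that l F1 F2 by simp
      show "(d x, d y) \<in> Restr R (underS R m)" if "(x, y) \<in> Restr rk Y" for x y using that l dle by simp
      show "\<exists>y\<in>Field (Restr rk Y). (x, d y) \<in> Restr R (underS R m)" if "x \<in> Field (Restr R (underS R m))" for x
        using that l unfolding F1 F2 by blast
      show "is_colimit (ord_cat (Restr R (underS R m))) M Z (FOb Z m) (\<lambda>x. FAr Z (x, m))"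
        using lam l by (simp add: lambda_sequence_def)
    qed
    have lamW: "lambda_sequence rk M W"
      unfolding lambda_sequence_def
    proof (intro conjI allI impI)
      show "is_functor (ord_cat rk) M W" by (rule fW)
      fix \<xi> assume l: "limit_elem rk \<xi>"
      have xF: "\<xi> \<in> Field rk" using l by (simp add: limit_elem_def)
      have ne: "underS rk \<xi> \<noteq> {}" using l by (auto simp: limit_elem_def least_elem_def)
      have nm: "\<exists>\<eta>' \<in> underS rk \<xi>. \<eta> \<in> underS rk \<eta>'" if e: "\<eta> \<in> underS rk \<xi>" for \<eta>
      proof (rule ccontr)
        assume n: "\<not> ?thesis"
        have "succ_elem rk \<eta> \<xi>"
        proof (rule succ_elemI[OF wk])
          show "(\<eta>, \<xi>) \<in> rk" "\<eta> \<noteq> \<xi>" using underSD[OF e] by auto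
          fix z assume z: "z \<in> underS rk \<xi>"
          then have "\<eta> \<notin> underS rk z" using n by blast
          then show "(z, \<eta>) \<in> rk" using wo_not_underS[OF wk, of \<eta> z] underSD[OF z] underSD[OF e] by blast
        qed
        then show False using l by (auto simp: limit_elem_def)
      qed
      have "is_colimit (ord_cat (Restr rk (underS rk \<xi>))) M W (FOb Z (d \<xi>)) (\<lambda>\<eta>. FAr Z (d \<eta>, d \<xi>))"
        by (rule col[OF underS_subset lim[OF underS_subset ne nm d(1)[OF xF] d(2)[OF xF]]])
      then show "is_colimit (ord_cat (Restr rk (underS rk \<xi>))) M W (FOb W \<xi>) (\<lambda>a. FAr W (a, \<xi>))" by (simp add: W_def)
    qed
    have nmk: "\<exists>\<eta>' \<in> Field rk. \<eta> \<in> underS rk \<eta>'" if "\<eta> \<in> Field rk" for \<eta>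
      using infinite_card_succ[OF rk(1,2) that] succ_elemD(2,3)[of rk \<eta>] by blast
    have nek: "Field rk \<noteq> {}" using rk(2) by auto
    note ld = lim[OF subset_refl nek nmk \<delta>]
    have cW: "is_colimit (ord_cat rk) M W (FOb Z \<delta>) (\<lambda>\<eta>. FAr Z (d \<eta>, \<delta>))"
      using col[OF subset_refl ld] by (simp add: Restr_Field)
    have "FAr W (\<eta>, \<xi>) \<in> relative_cell U M I" if s: "succ_elem rk \<eta> \<xi>" for \<eta> \<xi>
      unfolding W_def reindex_simps
      by (rule interval_relative_cell[OF M R lam dle[OF succ_elemD(4)[OF s]] smU']) (rule po[OF _ nR])
    then have ss: "seq_small rk M W (FOb Z \<delta>) (\<lambda>\<eta>. FAr Z (d \<eta>, \<delta>)) (Dom M i)" if "i \<in> I" for i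
      using kf(2)[OF that] rk lamW cW that unfolding card_small_rel_iff[OF M] by blast
    \<comment> \<open>A problem posed at \<open>\<delta>\<close> comes from some \<open>d \<eta>\<close>, and has been solved at \<open>gc (d \<eta>)\<close>, before
      \<open>\<delta>\<close>.\<close>
    have "RLP (q \<delta>)"
      unfolding RLP_def
    proof
      fix i assume i: "i \<in> I"
      note iH = IHom[OF i]
      show "has_lift M i (q \<delta>)"
      proof (rule has_liftI[OF iH qH])
        fix u v assume u: "u \<in> Hom M (Dom M i) (FOb Z \<delta>)" and v: "v \<in> Hom M (Cod M i) C" and e: "v \<cdot> i = q \<delta> \<cdot> u"
        obtain \<eta> u' where \<eta>: "\<eta> \<in> Field rk" "u' \<in> Hom M (Dom M i) (FOb Z (d \<eta>))" "FAr Z (d \<eta>, \<delta>) \<cdot> u' = u"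
          using ss[OF i] u unfolding seq_small_def W_def by auto
        have gd: "(gc (d \<eta>), \<delta>) \<in> R" using \<delta>(1) \<eta>(1) by (simp add: SS_def)
        have dd: "(d \<eta>, \<delta>) \<in> R" using ld \<eta>(1) underSD[of "d \<eta>" R \<delta>] by blast
        have pr: "(i, u', v) \<in> prob (FOb Z (d \<eta>)) (q (d \<eta>))"
          using i \<eta>(2) v e comp_assoc[OF M \<eta>(2) ZH[OF dd] qH] qZ[OF dd] \<eta>(3) by (simp add: prob_def)
        have "sol (d \<eta>) (i, u', v) (gc (d \<eta>))" using gc(2)[OF reflR pr] .
        then have "sol (d \<eta>) (i, u', v) \<delta>" using mono[OF _ _ gd pr] underSD[OF gc(1)] by blast
        then show "\<exists>h. h \<in> Hom M (Cod M i) (FOb Z \<delta>) \<and> h \<cdot> i = u \<and> q \<delta> \<cdot> h = v"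
          using \<eta>(3) by (auto simp: sol_def solved_def)
      qed
    qed
    then show False using nR by blast
  qed
  then obtain a where a: "RLP (q a)" "\<And>y. RLP (q y) \<Longrightarrow> (a, y) \<in> R"
    using wo_leastD[OF R, of "{a. RLP (q a)}"] by auto
  have a0a: "(a0, a) \<in> R" using least_elem_le[OF R a0] by simp
  have "FAr Z (a0, a) \<in> relative_cell U M I"
  proof (rule interval_relative_cell[OF M R lam a0a smU'])
    fix x y assume s: "succ_elem R x y" and ya: "(y, a) \<in> R"
    have "\<not> RLP (q x)"
    proof
      assume "RLP (q x)"
      then have "(y, x) \<in> R" using a(2) wo_transD[OF R ya] by blast
      then show False using succ_elemD[OF s] wo_antisymD[OF R] by blast
    qed
    then show "\<exists>i \<in> I. pushout_of M i (FAr Z (x, y))" by (rule po[OF s])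
  qed
  moreover have "FAr Z (a0, a) \<in> Hom M B (FOb Z a)" using ZH[OF a0a] a00 by simp
  ultimately show ?thesis using qH[of a] a(1) qZ[OF a0a] a00 unfolding RLP_def by blast
qed

section \<open>Smallness relative to retracts of relative cell complexes\<close>

text \<open>Here \<open>W\<close> consists of maps with the left lifting property against all maps injective relative
  to \<open>I\<close>, and the point is that \<open>A\<close>, small relative to relative cell complexes, is small relative
  to \<open>W\<close>. Let \<open>X\<close> be a sequence with steps in \<open>W\<close>. There is a sequence \<open>Y\<close> of relative cell
  complexes of which \<open>X\<close> is a retract, compatibly with the transition maps: if \<open>X a\<close> is a retract
  of \<open>Y a\<close> with section \<open>i\<close> and retraction \<open>r\<close>, factor the composite \<open>Y a \<rightarrow> X a \<rightarrow> X b\<close> into a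
  relative cell complex followed by an injective map \<open>q : Y b \<rightarrow> X b\<close>. The step \<open>X a \<rightarrow> X b\<close> lifts
  against \<open>q\<close>, which gives the section of \<open>q\<close>. At limits one passes to colimits. Then the colimit
  of \<open>X\<close> is a retract of the colimit of \<open>Y\<close>, and maps from \<open>A\<close> are compared there.\<close>

lemma small_rel_llp:
  fixes U :: "'u itself" and M :: "('o, 'a) cat" (structure)
  assumes U: "universe U" and bi: "bicomplete U M"
    and ls: "\<And>x y. x \<in> Obj M \<Longrightarrow> y \<in> Obj M \<Longrightarrow> small U (Hom M x y)"
    and IA: "I \<subseteq> Arr M" and sI: "small U I" and soa: "permits_small_object_argument U M I"
    and A: "small_rel U M (relative_cell U M I) A"
    and W: "\<And>f p. f \<in> W \<Longrightarrow> p \<in> Arr M \<Longrightarrow> (\<And>i. i \<in> I \<Longrightarrow> has_lift M i p) \<Longrightarrow> has_lift M f p"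
  shows "small_rel U M W A"
proof -
  have M: "category M" using bi by (rule bicomplete_category)
  obtain \<kappa> :: "'u rel" where \<kappa>: "Card_order \<kappa>" "\<kappa> <o |UNIV :: 'u set|" "card_small_rel \<kappa> M (relative_cell U M I) A"
    using A unfolding small_rel_def by blast
  have "seq_small r M X c \<tau> A"
    if r: "Card_order r" "infinite (Field r)" "regularCard r" "r <o |UNIV :: 'u set|" "\<kappa> \<le>o r"
      and X: "lambda_sequence r M X" and XW: "\<And>a b. succ_elem r a b \<Longrightarrow> FAr X (a, b) \<in> W"
      and c: "is_colimit (ord_cat r) M X c \<tau>" for r :: "'u rel" and X c \<tau>
  proof -
    have wr: "Well_order r" using r(1) by (rule Card_order_wo)
    have smr: "small U (Field r)"
      unfolding small_def using ordIso_ordLess_trans[OF card_of_Field_ordIso[OF r(1)] r(4)] .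
    have smu: "small U (underS r b)" for b using small_subset[OF smr underS_subset] .
    have fX: "is_functor (ord_cat r) M X" using X by (simp add: lambda_sequence_def)
    have Xlim: "is_colimit (ord_cat (Restr r (underS r b))) M X (FOb X b) (\<lambda>a. FAr X (a, b))" if "limit_elem r b" for b
      using X that by (simp add: lambda_sequence_def)
    have XH: "FAr X (a, b) \<in> Hom M (FOb X a) (FOb X b)" if "(a, b) \<in> r" for a b using ord_functor_Hom[OF fX that] .
    \<comment> \<open>The extra datum at \<open>b\<close> is the pair of the section \<open>X b \<rightarrow> Y b\<close> and the retraction
      \<open>Y b \<rightarrow> X b\<close>, both natural in \<open>b\<close>.\<close>
    define Ext :: "'u \<Rightarrow> ('u, 'u \<times> 'u, 'o, 'a) fctr \<Rightarrow> ('u \<Rightarrow> 'a \<times> 'a) \<Rightarrow> 'o \<Rightarrow> ('u \<Rightarrow> 'a) \<Rightarrow> 'a \<times> 'a \<Rightarrow> bool"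
      where "Ext = (\<lambda>b D E y \<sigma> e. fst e \<in> Hom M (FOb X b) y \<and> snd e \<in> Hom M y (FOb X b) \<and>
        snd e \<cdot> fst e = Id M (FOb X b) \<and>
        (\<forall>a \<in> underS r b. \<sigma> a \<cdot> fst (E a) = fst e \<cdot> FAr X (a, b) \<and> snd e \<cdot> \<sigma> a = FAr X (a, b) \<cdot> snd (E a)) \<and>
        (limit_elem r b \<longrightarrow> is_colimit (ord_cat (Restr r (underS r b))) M D y \<sigma>) \<and>
        (\<forall>a. succ_elem r a b \<longrightarrow> \<sigma> a \<in> relative_cell U M I))"
    have "\<exists>Y E. is_functor (ord_cat r) M Y \<and> (\<forall>b \<in> Field r. Ext b Y E (FOb Y b) (\<lambda>x. FAr Y (x, b)) (E b))"
    proof (rule transfinite_construction[OF wr M])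
      fix b c \<tau> e E' \<tau>' and D D' :: "('u, 'u \<times> 'u, 'o, 'a) fctr" and E
      assume e1: "\<And>a. a \<in> underS r b \<Longrightarrow> FOb D a = FOb D' a \<and> E a = E' a \<and> \<tau> a = \<tau>' a"
        and e2: "\<And>a a'. (a, a') \<in> r \<Longrightarrow> a' \<in> underS r b \<Longrightarrow> FAr D (a, a') = FAr D' (a, a')"
        and X: "Ext b D E c \<tau> e"
      have "is_colimit (ord_cat (Restr r (underS r b))) M D c \<tau> \<longleftrightarrow> is_colimit (ord_cat (Restr r (underS r b))) M D' c \<tau>'"
        by (rule is_colimit_cong[OF wo_category[OF Restr_wo[OF wr]]]) (auto simp: Field_Restr_underS[OF wr] e1 e2)
      moreover have "\<tau>' a \<in> relative_cell U M I" if "succ_elem r a b" for a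
        using X that e1[OF succ_elemD(3)[OF that]] unfolding Ext_def by metis
      ultimately show "Ext b D' E' c \<tau>' e" using X e1 unfolding Ext_def by simp
    next
      fix b E and D :: "('u, 'u \<times> 'u, 'o, 'a) fctr" assume b: "b \<in> Field r" and D: "is_functor (ord_cat (Restr r (underS r b))) M D"
        and IH: "\<And>a. a \<in> underS r b \<Longrightarrow> Ext a D E (FOb D a) (\<lambda>x. FAr D (x, a)) (E a)"
      have fu: "Field (Restr r (underS r b)) = underS r b" by (rule Field_Restr_underS[OF wr])
      have iH: "fst (E a) \<in> Hom M (FOb X a) (FOb D a)" and rH: "snd (E a) \<in> Hom M (FOb D a) (FOb X a)"
        and ri: "snd (E a) \<cdot> fst (E a) = Id M (FOb X a)" if "a \<in> underS r b" for a using IH[OF that] by (auto simp: Ext_def)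
      have nat: "FAr D (x, a) \<cdot> fst (E x) = fst (E a) \<cdot> FAr X (x, a) \<and> snd (E a) \<cdot> FAr D (x, a) = FAr X (x, a) \<cdot> snd (E x)"
        if a: "a \<in> underS r b" and xa: "(x, a) \<in> r" for a x
      proof (cases "x = a")
        case True
        have "FAr X (a, a) = Id M (FOb X a)" using ord_functor_Id[OF fX] underSD[OF a] by simp
        moreover have "FAr D (a, a) = Id M (FOb D a)" using ord_functor_Id[OF D] a fu by simp
        ultimately show ?thesis unfolding True using comp_id[OF M iH[OF a]] id_comp[OF M iH[OF a]] comp_id[OF M rH[OF a]] id_comp[OF M rH[OF a]] by simp
      next
        case False
        then have "x \<in> underS r a" using xa by (simp add: underS_def)
        then show ?thesis using IH[OF a] by (simp add: Ext_def)
      qed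
      note Xob = ord_functor_Ob[OF fX b]
      note idX = id_Hom[OF M Xob]
      from b show "\<exists>c \<tau> e. is_cocone (ord_cat (Restr r (underS r b))) M D c \<tau> \<and> Ext b D E c \<tau> e"
      proof (cases rule: elem_cases)
        case 1
        then have u: "underS r b = {}" by (simp add: least_elem_def)
        have "is_cocone (ord_cat (Restr r (underS r b))) M D (FOb X b) (\<lambda>_. Id M (FOb X b))"
          unfolding is_cocone_def using Xob by (simp add: u fu)
        moreover have "Ext b D E (FOb X b) (\<lambda>_. Id M (FOb X b)) (Id M (FOb X b), Id M (FOb X b))"
          using idX comp_id[OF M idX] 1 u by (auto simp: Ext_def limit_elem_def succ_elem_def)
        ultimately show ?thesis by blast
      next
        case (2 a)
        note ab = succ_elemD(3)[OF 2] and abr = succ_elemD(4)[OF 2]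
        have below: "(x, a) \<in> r" if "x \<in> underS r b" for x using succ_elem_le[OF wr 2 that] .
        note Xab = XH[OF abr]
        obtain y f q where f: "f \<in> Hom M (FOb D a) y" "f \<in> relative_cell U M I" "q \<in> Hom M y (FOb X b)"
          "\<forall>i \<in> I. has_lift M i q" "q \<cdot> f = FAr X (a, b) \<cdot> snd (E a)"
          using cell_factorization[OF U bi ls IA sI soa comp_Hom[OF M rH[OF ab] Xab]] by blast
        have l: "has_lift M (FAr X (a, b)) q" using W[OF XW[OF 2], of q] f(3,4) by (simp add: HomD)
        have "Id M (FOb X b) \<cdot> FAr X (a, b) = q \<cdot> (f \<cdot> fst (E a))"
          using comp_assoc[OF M iH[OF ab] f(1,3)] f(5) comp_assoc[OF M iH[OF ab] rH[OF ab] Xab] ri[OF ab]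
            comp_id[OF M Xab] id_comp[OF M Xab] by simp
        \<comment> \<open>The diagonal in the square from \<open>X a \<rightarrow> X b\<close> to \<open>q\<close> with bottom the identity is the next
          section.\<close>
        then obtain i where i: "i \<in> Hom M (FOb X b) y" "i \<cdot> FAr X (a, b) = f \<cdot> fst (E a)" "q \<cdot> i = Id M (FOb X b)"
          using has_liftD[OF l Xab f(3) comp_Hom[OF M iH[OF ab] f(1)] idX] by blast
        define \<sigma> where "\<sigma> = (\<lambda>x. f \<cdot> FAr D (x, a))"
        have Dxa: "FAr D (x, a) \<in> Hom M (FOb D x) (FOb D a)" if "x \<in> underS r b" for x
          using ord_functor_Hom[OF D] below[OF that] that ab by simp
        have ta: "\<sigma> a = f" using ord_functor_Id[OF D, of a] ab fu comp_id[OF M f(1)] by (simp add: \<sigma>_def)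
        have "is_cocone (ord_cat (Restr r (underS r b))) M D y \<sigma>"
        proof (rule ord_coconeI)
          show "y \<in> Obj M" using Hom_Obj[OF M f(1)] by simp
          show "\<sigma> x \<in> Hom M (FOb D x) y" if "x \<in> Field (Restr r (underS r b))" for x
            unfolding \<sigma>_def using comp_Hom[OF M Dxa f(1)] that fu by simp
          fix x z assume xz: "(x, z) \<in> Restr r (underS r b)"
          then have z: "z \<in> underS r b" by auto
          have za: "(z, a) \<in> Restr r (underS r b)" using below[OF z] z ab by simp
          show "\<sigma> z \<cdot> FAr D (x, z) = \<sigma> x"
            unfolding \<sigma>_def using comp_assoc[OF M ord_functor_Hom[OF D xz] Dxa[OF z] f(1)] ord_functor_Comp[OF D xz za] by simp
        qed
        moreover have "\<sigma> x \<cdot> fst (E x) = i \<cdot> FAr X (x, b) \<and> q \<cdot> \<sigma> x = FAr X (x, b) \<cdot> snd (E x)" if x: "x \<in> underS r b" for x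
        proof
          note xa = below[OF x]
          have Xxb: "FAr X (x, b) = FAr X (a, b) \<cdot> FAr X (x, a)" using ord_functor_Comp[OF fX xa abr] by simp
          show "\<sigma> x \<cdot> fst (E x) = i \<cdot> FAr X (x, b)"
            unfolding \<sigma>_def Xxb
            using comp_assoc[OF M iH[OF x] Dxa[OF x] f(1)] nat[OF ab xa] comp_assoc[OF M XH[OF xa] iH[OF ab] f(1)]
              comp_assoc[OF M XH[OF xa] Xab i(1)] i(2) by simp
          show "q \<cdot> \<sigma> x = FAr X (x, b) \<cdot> snd (E x)"
            unfolding \<sigma>_def Xxb
            using comp_assoc[OF M Dxa[OF x] f(1,3)] f(5) comp_assoc[OF M Dxa[OF x] rH[OF ab] Xab] nat[OF ab xa]
              comp_assoc[OF M rH[OF x] XH[OF xa] Xab] by simp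
        qed
        moreover have "\<sigma> a' \<in> relative_cell U M I" if "succ_elem r a' b" for a'
          unfolding succ_elem_unique[OF wr that 2] ta by (rule f(2))
        moreover have "\<not> limit_elem r b" using 2 by (auto simp: limit_elem_def)
        ultimately have "is_cocone (ord_cat (Restr r (underS r b))) M D y \<sigma> \<and> Ext b D E y \<sigma> (i, q)"
          unfolding Ext_def using f(3) i by simp
        then show ?thesis by blast
      next
        case 3
        note cR = wo_category[OF Restr_wo[OF wr]]
        obtain y \<sigma> where y: "is_colimit (ord_cat (Restr r (underS r b))) M D y \<sigma>"
          using wo_colimit_exists[OF U bi Restr_wo[OF wr] _ D] smu fu by metis
        note cy = ord_coconeD[OF colimit_cocone[OF y], unfolded fu]
        have Xxb: "FAr X (x, b) \<in> Hom M (FOb X x) (FOb X b)" if "x \<in> underS r b" for x using XH underSD[OF that] by simp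
        have "is_cocone (ord_cat (Restr r (underS r b))) M D (FOb X b) (\<lambda>x. FAr X (x, b) \<cdot> snd (E x))"
        proof (rule ord_coconeI[OF Xob])
          show "FAr X (x, b) \<cdot> snd (E x) \<in> Hom M (FOb D x) (FOb X b)" if "x \<in> Field (Restr r (underS r b))" for x
            using comp_Hom[OF M rH Xxb] that fu by simp
          fix x z assume xz: "(x, z) \<in> Restr r (underS r b)"
          then have z: "z \<in> underS r b" and x: "x \<in> underS r b" and xzr: "(x, z) \<in> r" by auto
          have zb: "(z, b) \<in> r" using underSD[OF z] by simp
          show "(FAr X (z, b) \<cdot> snd (E z)) \<cdot> FAr D (x, z) = FAr X (x, b) \<cdot> snd (E x)"
            using comp_assoc[OF M ord_functor_Hom[OF D xz] rH[OF z] Xxb[OF z]] nat[OF z xzr]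
              comp_assoc[OF M rH[OF x] XH[OF xzr] Xxb[OF z]] ord_functor_Comp[OF fX xzr zb] by simp
        qed
        from colimit_ex[OF y this] obtain q where q: "q \<in> Hom M y (FOb X b)"
          "\<And>x. x \<in> underS r b \<Longrightarrow> q \<cdot> \<sigma> x = FAr X (x, b) \<cdot> snd (E x)" by (auto simp: fu)
        have "is_cocone (ord_cat (Restr r (underS r b))) M X y (\<lambda>x. \<sigma> x \<cdot> fst (E x))"
        proof (rule ord_coconeI[OF cy(1)])
          show "\<sigma> x \<cdot> fst (E x) \<in> Hom M (FOb X x) y" if "x \<in> Field (Restr r (underS r b))" for x
            using comp_Hom[OF M iH cy(2)] that fu by simp
          fix x z assume xz: "(x, z) \<in> Restr r (underS r b)"
          then have z: "z \<in> underS r b" and x: "x \<in> underS r b" and xzr: "(x, z) \<in> r" by auto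
          show "(\<sigma> z \<cdot> fst (E z)) \<cdot> FAr X (x, z) = \<sigma> x \<cdot> fst (E x)"
            using comp_assoc[OF M XH[OF xzr] iH[OF z] cy(2)[OF z]] nat[OF z xzr]
              comp_assoc[OF M iH[OF x] ord_functor_Hom[OF D xz] cy(2)[OF z]] cy(3)[OF xz] by simp
        qed
        from colimit_ex[OF Xlim[OF 3] this] obtain i where i: "i \<in> Hom M (FOb X b) y"
          "\<And>x. x \<in> underS r b \<Longrightarrow> i \<cdot> FAr X (x, b) = \<sigma> x \<cdot> fst (E x)" by (auto simp: fu)
        have "q \<cdot> i = Id M (FOb X b)"
        proof (rule colimit_uniq[OF M cR ord_functor_Restr[OF wr fX underS_subset] Xlim[OF 3] comp_Hom[OF M i(1) q(1)] idX])
          fix x assume "x \<in> Obj (ord_cat (Restr r (underS r b)))"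
          then have x: "x \<in> underS r b" by (simp add: fu)
          show "(q \<cdot> i) \<cdot> FAr X (x, b) = Id M (FOb X b) \<cdot> FAr X (x, b)"
            using comp_assoc[OF M Xxb[OF x] i(1) q(1)] i(2)[OF x] comp_assoc[OF M iH[OF x] cy(2)[OF x] q(1)] q(2)[OF x]
              comp_assoc[OF M iH[OF x] rH[OF x] Xxb[OF x]] ri[OF x] comp_id[OF M Xxb[OF x]] id_comp[OF M Xxb[OF x]] by simp
        qed
        moreover have "\<not> succ_elem r a b" for a using 3 by (auto simp: limit_elem_def)
        ultimately have "Ext b D E y \<sigma> (i, q)" unfolding Ext_def using i q y by simp
        then show ?thesis using colimit_cocone[OF y] by blast
      qed
    qed
    then obtain Y :: "('u, 'u \<times> 'u, 'o, 'a) fctr" and E where fY: "is_functor (ord_cat r) M Y"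
      and YE: "\<And>b. b \<in> Field r \<Longrightarrow> Ext b Y E (FOb Y b) (\<lambda>x. FAr Y (x, b)) (E b)" by blast
    have iH: "fst (E a) \<in> Hom M (FOb X a) (FOb Y a)" and rH: "snd (E a) \<in> Hom M (FOb Y a) (FOb X a)"
      and ri: "snd (E a) \<cdot> fst (E a) = Id M (FOb X a)" if "a \<in> Field r" for a using YE[OF that] by (auto simp: Ext_def)
    have YH: "FAr Y (a, b) \<in> Hom M (FOb Y a) (FOb Y b)" if "(a, b) \<in> r" for a b using ord_functor_Hom[OF fY that] .
    have nat: "FAr Y (x, a) \<cdot> fst (E x) = fst (E a) \<cdot> FAr X (x, a)"
      "snd (E a) \<cdot> FAr Y (x, a) = FAr X (x, a) \<cdot> snd (E x)" if xa: "(x, a) \<in> r" for a x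
    proof -
      have a: "a \<in> Field r" using FieldD[OF xa] by simp
      have "FAr Y (x, a) \<cdot> fst (E x) = fst (E a) \<cdot> FAr X (x, a) \<and>
        snd (E a) \<cdot> FAr Y (x, a) = FAr X (x, a) \<cdot> snd (E x)"
      proof (cases "x = a")
        case True
        then show ?thesis using ord_functor_Id[OF fX a] ord_functor_Id[OF fY a] comp_id[OF M iH[OF a]] id_comp[OF M iH[OF a]]
          comp_id[OF M rH[OF a]] id_comp[OF M rH[OF a]] by simp
      next
        case False
        then have "x \<in> underS r a" using xa by (simp add: underS_def)
        then show ?thesis using YE[OF a] by (simp add: Ext_def)
      qed
      then show "FAr Y (x, a) \<cdot> fst (E x) = fst (E a) \<cdot> FAr X (x, a)"
        "snd (E a) \<cdot> FAr Y (x, a) = FAr X (x, a) \<cdot> snd (E x)" by auto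
    qed
    have lamY: "lambda_sequence r M Y"
      using fY YE unfolding lambda_sequence_def Ext_def by (auto simp: limit_elem_def)
    have stY: "FAr Y (a, b) \<in> relative_cell U M I" if "succ_elem r a b" for a b
      using YE[OF succ_elemD(2)[OF that]] that by (simp add: Ext_def)
    obtain y \<sigma> where y: "is_colimit (ord_cat r) M Y y \<sigma>" using wo_colimit_exists[OF U bi wr smr fY] by blast
    have ssY: "seq_small r M Y y \<sigma> A"
      using \<kappa>(3) r lamY stY y unfolding card_small_rel_iff[OF M] by blast
    note cy = ord_coconeD[OF colimit_cocone[OF y]] and cx = ord_coconeD[OF colimit_cocone[OF c]]
    have "is_cocone (ord_cat r) M Y c (\<lambda>x. \<tau> x \<cdot> snd (E x))"
    proof (rule ord_coconeI[OF cx(1)])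
      show "\<tau> x \<cdot> snd (E x) \<in> Hom M (FOb Y x) c" if "x \<in> Field r" for x using comp_Hom[OF M rH[OF that] cx(2)[OF that]] .
      fix x z assume xz: "(x, z) \<in> r"
      have z: "z \<in> Field r" and x: "x \<in> Field r" using FieldD[OF xz] by auto
      show "(\<tau> z \<cdot> snd (E z)) \<cdot> FAr Y (x, z) = \<tau> x \<cdot> snd (E x)"
        using comp_assoc[OF M YH[OF xz] rH[OF z] cx(2)[OF z]] nat(2)[OF xz]
          comp_assoc[OF M rH[OF x] XH[OF xz] cx(2)[OF z]] cx(3)[OF xz] by simp
    qed
    from colimit_ex[OF y this] obtain q where q: "q \<in> Hom M y c"
      "\<And>x. x \<in> Field r \<Longrightarrow> q \<cdot> \<sigma> x = \<tau> x \<cdot> snd (E x)" by auto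
    have "is_cocone (ord_cat r) M X y (\<lambda>x. \<sigma> x \<cdot> fst (E x))"
    proof (rule ord_coconeI[OF cy(1)])
      show "\<sigma> x \<cdot> fst (E x) \<in> Hom M (FOb X x) y" if "x \<in> Field r" for x using comp_Hom[OF M iH[OF that] cy(2)[OF that]] .
      fix x z assume xz: "(x, z) \<in> r"
      have z: "z \<in> Field r" and x: "x \<in> Field r" using FieldD[OF xz] by auto
      show "(\<sigma> z \<cdot> fst (E z)) \<cdot> FAr X (x, z) = \<sigma> x \<cdot> fst (E x)"
        using comp_assoc[OF M XH[OF xz] iH[OF z] cy(2)[OF z]] nat(1)[OF xz]
          comp_assoc[OF M iH[OF x] YH[OF xz] cy(2)[OF z]] cy(3)[OF xz] by simp
    qed
    from colimit_ex[OF c this] obtain i where i: "i \<in> Hom M c y"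
      "\<And>x. x \<in> Field r \<Longrightarrow> i \<cdot> \<tau> x = \<sigma> x \<cdot> fst (E x)" by auto
    have qi: "q \<cdot> i = Id M c"
    proof (rule colimit_uniq[OF M wo_category[OF wr] fX c comp_Hom[OF M i(1) q(1)] id_Hom[OF M cx(1)]])
      fix x assume "x \<in> Obj (ord_cat r)"
      then have x: "x \<in> Field r" by simp
      show "(q \<cdot> i) \<cdot> \<tau> x = Id M c \<cdot> \<tau> x"
        using comp_assoc[OF M cx(2)[OF x] i(1) q(1)] i(2)[OF x] comp_assoc[OF M iH[OF x] cy(2)[OF x] q(1)] q(2)[OF x]
          comp_assoc[OF M iH[OF x] rH[OF x] cx(2)[OF x]] ri[OF x] comp_id[OF M cx(2)[OF x]] id_comp[OF M cx(2)[OF x]] by simp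
    qed
    show ?thesis
      unfolding seq_small_def
    proof (intro conjI ballI impI)
      fix f assume f: "f \<in> Hom M A c"
      obtain b g where b: "b \<in> Field r" "g \<in> Hom M A (FOb Y b)" "\<sigma> b \<cdot> g = i \<cdot> f"
        using ssY comp_Hom[OF M f i(1)] unfolding seq_small_def by blast
      have "\<tau> b \<cdot> (snd (E b) \<cdot> g) = f"
        using comp_assoc[OF M b(2) rH[OF b(1)] cx(2)[OF b(1)]] q(2)[OF b(1)] comp_assoc[OF M b(2) cy(2)[OF b(1)] q(1)] b(3)
          comp_assoc[OF M f i(1) q(1)] qi id_comp[OF M f] by simp
      then show "\<exists>b\<in>Field r. \<exists>g\<in>Hom M A (FOb X b). \<tau> b \<cdot> g = f"
        using b(1) comp_Hom[OF M b(2) rH[OF b(1)]] by blast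
    next
      fix b g g' assume b: "b \<in> Field r" and g: "g \<in> Hom M A (FOb X b)" "g' \<in> Hom M A (FOb X b)" "\<tau> b \<cdot> g = \<tau> b \<cdot> g'"
      have "\<sigma> b \<cdot> (fst (E b) \<cdot> h) = i \<cdot> (\<tau> b \<cdot> h)" if "h \<in> Hom M A (FOb X b)" for h
        using comp_assoc[OF M that iH[OF b] cy(2)[OF b]] comp_assoc[OF M that cx(2)[OF b] i(1)] i(2)[OF b] by simp
      then have "\<sigma> b \<cdot> (fst (E b) \<cdot> g) = \<sigma> b \<cdot> (fst (E b) \<cdot> g')" using g by simp
      then obtain b' where b': "(b, b') \<in> r" "FAr Y (b, b') \<cdot> (fst (E b) \<cdot> g) = FAr Y (b, b') \<cdot> (fst (E b) \<cdot> g')"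
        using ssY comp_Hom[OF M g(1) iH[OF b]] comp_Hom[OF M g(2) iH[OF b]] b unfolding seq_small_def by blast
      have b'F: "b' \<in> Field r" using FieldD[OF b'(1)] by simp
      have "snd (E b') \<cdot> (FAr Y (b, b') \<cdot> (fst (E b) \<cdot> h)) = FAr X (b, b') \<cdot> h" if h: "h \<in> Hom M A (FOb X b)" for h
      proof -
        note Xh = comp_Hom[OF M h XH[OF b'(1)]]
        have "FAr Y (b, b') \<cdot> (fst (E b) \<cdot> h) = fst (E b') \<cdot> (FAr X (b, b') \<cdot> h)"
          using comp_assoc[OF M h iH[OF b] YH[OF b'(1)]] nat(1)[OF b'(1)] comp_assoc[OF M h XH[OF b'(1)] iH[OF b'F]] by simp
        then show ?thesis using comp_assoc[OF M Xh iH[OF b'F] rH[OF b'F]] ri[OF b'F] id_comp[OF M Xh] by simp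
      qed
      then have "FAr X (b, b') \<cdot> g = FAr X (b, b') \<cdot> g'" using b'(2) g(1,2) by metis
      then show "\<exists>b'. (b, b') \<in> r \<and> FAr X (b, b') \<cdot> g = FAr X (b, b') \<cdot> g'" using b'(1) by blast
    qed
  qed
  then have "card_small_rel \<kappa> M W A" unfolding card_small_rel_iff[OF M] by blast
  then show ?thesis using \<kappa> unfolding small_rel_def by blast
qed

section \<open>Small objects in functor categories\<close>

lemma eval_lambda_sequence:
  assumes U: "universe U" and A: "category A" and bi: "bicomplete U K" and r: "Well_order r" and sr: "small U (Field r)"
    and Z: "lambda_sequence r (fun_cat A K) Z" and x: "x \<in> Obj A"
  shows "lambda_sequence r K (eval_diag Z x)"
    "is_colimit (ord_cat r) (fun_cat A K) Z c \<tau> \<Longrightarrow> is_colimit (ord_cat r) K (eval_diag Z x) (FOb c x) (\<lambda>j. Cmp (\<tau> j) x)"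
proof -
  note K = bicomplete_category[OF bi]
  have fZ: "is_functor (ord_cat r) (fun_cat A K) Z" using Z by (simp add: lambda_sequence_def)
  have ex: "\<exists>c \<tau>. is_colimit (ord_cat s) K (eval_diag Z y) c \<tau>"
    if "y \<in> Obj A" "Well_order s" "small U (Field s)" "is_functor (ord_cat s) (fun_cat A K) Z" for y s
    using wo_colimit_exists[OF U bi that(2,3) eval_diag_functor[OF A K wo_category[OF that(2)] that(4,1)]] .
  show "is_colimit (ord_cat r) (fun_cat A K) Z c \<tau> \<Longrightarrow> is_colimit (ord_cat r) K (eval_diag Z x) (FOb c x) (\<lambda>j. Cmp (\<tau> j) x)"
    by (rule colimit_pointwise[OF A K wo_category[OF r] fZ ex[OF _ r sr fZ] _ x])
  show "lambda_sequence r K (eval_diag Z x)"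
    unfolding lambda_sequence_def
  proof (intro conjI allI impI)
    show "is_functor (ord_cat r) K (eval_diag Z x)" by (rule eval_diag_functor[OF A K wo_category[OF r] fZ x])
    fix b assume b: "limit_elem r b"
    note fR = ord_functor_Restr[OF r fZ underS_subset[of r b]]
    have sR: "small U (Field (Restr r (underS r b)))"
      unfolding Field_Restr_underS[OF r] by (rule small_subset[OF sr underS_subset])
    have "is_colimit (ord_cat (Restr r (underS r b))) (fun_cat A K) Z (FOb Z b) (\<lambda>a. FAr Z (a, b))"
      using Z b by (simp add: lambda_sequence_def)
    moreover have exR: "\<exists>c \<tau>. is_colimit (ord_cat (Restr r (underS r b))) K (eval_diag Z y) c \<tau>" if "y \<in> Obj A" for y
      by (rule ex[OF that Restr_wo[OF r] sR fR])
    ultimately have "is_colimit (ord_cat (Restr r (underS r b))) K (eval_diag Z x) (FOb (FOb Z b) x) (\<lambda>a. Cmp (FAr Z (a, b)) x)"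
      using colimit_pointwise[OF A K wo_category[OF Restr_wo[OF r]] fR exR _ x] by blast
    then show "is_colimit (ord_cat (Restr r (underS r b))) K (eval_diag Z x) (FOb (eval_diag Z x) b) (\<lambda>a. FAr (eval_diag Z x) (a, b))"
      by simp
  qed
qed

text \<open>A map from \<open>F\<close> to a colimit \<open>c\<close> of a sequence of length \<open>r\<close> factors at each object \<open>x\<close>
  through a stage, and commutes with each arrow of \<open>A\<close> from some stage on. As \<open>A\<close> has fewer than
  \<open>r\<close> arrows, one stage is late enough for all objects and all naturality squares. The same bound
  makes two factorisations agree at a common stage.\<close>

lemma fun_cat_objects_small:
  fixes U :: "'u itself" and A :: "('o1, 'a1) cat" and K :: "('o2, 'a2) cat" (structure)
  assumes U: "universe U" and sA: "small_category U A" and bi: "bicomplete U K"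
    and sm: "\<And>X. X \<in> Obj K \<Longrightarrow> small_object U K X" and F: "F \<in> Functors A K"
  shows "small_rel U (fun_cat A K) W F"
proof -
  note K = bicomplete_category[OF bi]
  have A: "category A" and smA: "small U (Arr A)" using sA by (auto simp: small_category_def)
  note FK = fun_cat_category[OF A K]
  note fF = FunctorsD[OF F]
  have "\<forall>x \<in> Obj A. \<exists>\<kappa> :: 'u rel. Card_order \<kappa> \<and> \<kappa> <o |UNIV :: 'u set| \<and> card_small_rel \<kappa> K (Arr K) (FOb F x)"
    using sm[OF functor_Ob[OF fF]] unfolding small_object_def small_rel_def by blast
  then obtain kx :: "'o1 \<Rightarrow> 'u rel" where kx: "\<And>x. x \<in> Obj A \<Longrightarrow> Card_order (kx x) \<and> kx x <o |UNIV :: 'u set|"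
    "\<And>x. x \<in> Obj A \<Longrightarrow> card_small_rel (kx x) K (Arr K) (FOb F x)" by metis
  obtain \<kappa> :: "'u rel" where k: "Card_order \<kappa>" "\<kappa> <o |UNIV :: 'u set|" "|Arr A| <o \<kappa>" "\<And>f. f \<in> Arr A \<Longrightarrow> kx (Dom A f) \<le>o \<kappa>"
    using small_cardinals_bounded[OF U smA, of "\<lambda>f. kx (Dom A f)"] kx(1) category.Dom_Obj[OF A] by blast
  have kxk: "kx x \<le>o \<kappa>" if "x \<in> Obj A" for x
    using k(4)[OF category.Id_Arr[OF A that]] category.Dom_Id[OF A that] by simp
  have "|Obj A| \<le>o |Arr A|"
    by (rule card_of_ordLeqI[of "Id A"]) (use category.Dom_Id[OF A] category.Id_Arr[OF A] in \<open>auto intro: inj_on_inverseI\<close>)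
  then have OA: "|Obj A| <o \<kappa>" using k(3) by (rule ordLeq_ordLess_trans)
  have "seq_small r (fun_cat A K) Z c \<tau> F"
    if r: "Card_order r" "infinite (Field r)" "regularCard r" "r <o |UNIV :: 'u set|" "\<kappa> \<le>o r"
      and Z: "lambda_sequence r (fun_cat A K) Z" and c: "is_colimit (ord_cat r) (fun_cat A K) Z c \<tau>" for r :: "'u rel" and Z c \<tau>
  proof -
    have wr: "Well_order r" using r(1) by (rule Card_order_wo)
    have smr: "small U (Field r)"
      unfolding small_def using ordIso_ordLess_trans[OF card_of_Field_ordIso[OF r(1)] r(4)] .
    have fZ: "is_functor (ord_cat r) (fun_cat A K) Z" using Z by (simp add: lambda_sequence_def)
    have ZF: "FOb Z b \<in> Functors A K" if "b \<in> Field r" for b using ord_functor_Ob[OF fZ that] by simp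
    note coc = ord_coconeD[OF colimit_cocone[OF c]]
    have cF: "c \<in> Functors A K" using coc(1) by simp
    have lA: "|Arr A| <o r" "|Obj A| <o r" using ordLess_ordLeq_trans[OF k(3) r(5)] ordLess_ordLeq_trans[OF OA r(5)] .
    have ss: "seq_small r K (eval_diag Z x) (FOb c x) (\<lambda>j. Cmp (\<tau> j) x) (FOb F w)" if x: "x \<in> Obj A" and w: "w \<in> Obj A" for x w
    proof -
      note l = eval_lambda_sequence[OF U A bi wr smr Z x]
      have fE: "is_functor (ord_cat r) K (eval_diag Z x)" using l(1) by (simp add: lambda_sequence_def)
      have "FAr (eval_diag Z x) (a, b) \<in> Arr K" if "succ_elem r a b" for a b
        using HomD(1)[OF ord_functor_Hom[OF fE succ_elemD(4)[OF that]]] .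
      moreover have "kx w \<le>o r" using ordLeq_transitive[OF kxk[OF w] r(5)] .
      ultimately show ?thesis
        using kx(2)[OF w] r(1-4) l(1) l(2)[OF c] unfolding card_small_rel_iff[OF K] by blast
    qed
    have Zc: "Cmp (FAr Z (a, b)) x \<in> Hom K (FOb (FOb Z a) x) (FOb (FOb Z b) x)" if "(a, b) \<in> r" "x \<in> Obj A" for a b x
      using nat_comp_Hom[OF ord_functor_Hom[OF fZ that(1)] that(2)] .
    have Zcomp: "Cmp (FAr Z (a, e)) x = Cmp (FAr Z (b, e)) x \<cdot> Cmp (FAr Z (a, b)) x" if "(a, b) \<in> r" "(b, e) \<in> r" "x \<in> Obj A" for a b e x
      using nat_Comp_Cmp[OF that(3)] ord_functor_Comp[OF fZ that(1,2)] by metis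
    have tc: "Cmp (\<tau> b) x \<in> Hom K (FOb (FOb Z b) x) (FOb c x)" if "b \<in> Field r" "x \<in> Obj A" for b x
      using nat_comp_Hom[OF coc(2)[OF that(1)] that(2)] .
    have tZ: "Cmp (\<tau> b) x \<cdot> Cmp (FAr Z (a, b)) x = Cmp (\<tau> a) x" if "(a, b) \<in> r" "x \<in> Obj A" for a b x
      using nat_Comp_Cmp[OF that(2)] coc(3)[OF that(1)] by metis
    have bound: "\<exists>b' \<in> Field r. (b, b') \<in> r \<and> (\<forall>x \<in> X. (f x, b') \<in> r)"
      if t: "|X| <o r" "\<And>x. x \<in> X \<Longrightarrow> f x \<in> Field r" "b \<in> Field r" for X :: "'x set" and f b
    proof -
      obtain b0 where b0: "b0 \<in> Field r" "\<forall>x \<in> X. (f x, b0) \<in> r" using regular_bounded[OF r(1,3) t(1), of f] t(2) by blast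
      show ?thesis
      proof (cases "(b, b0) \<in> r")
        case True
        then show ?thesis using b0 by blast
      next
        case False
        then have "(b0, b) \<in> r" using wo_totalD[OF wr b0(1) t(3)] by blast
        then show ?thesis using b0(2) wo_transD[OF wr _ \<open>(b0, b) \<in> r\<close>] wo_reflD[OF wr t(3)] t(3) by blast
      qed
    qed
    obtain b00 where b00: "b00 \<in> Field r" using r(2) by (metis finite.emptyI all_not_in_conv)
    show ?thesis
      unfolding seq_small_def
    proof (intro conjI ballI impI)
      fix f assume f: "f \<in> Hom (fun_cat A K) F c"
      have "\<forall>x \<in> Obj A. \<exists>b g. b \<in> Field r \<and> g \<in> Hom K (FOb F x) (FOb (FOb Z b) x) \<and> Cmp (\<tau> b) x \<cdot> g = Cmp f x"
        using ss nat_comp_Hom[OF f] unfolding seq_small_def eval_diag_simps by blast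
      then obtain bx gx where g: "\<And>x. x \<in> Obj A \<Longrightarrow> bx x \<in> Field r"
        "\<And>x. x \<in> Obj A \<Longrightarrow> gx x \<in> Hom K (FOb F x) (FOb (FOb Z (bx x)) x)"
        "\<And>x. x \<in> Obj A \<Longrightarrow> Cmp (\<tau> (bx x)) x \<cdot> gx x = Cmp f x" by metis
      obtain b where b: "b \<in> Field r" "\<And>x. x \<in> Obj A \<Longrightarrow> (bx x, b) \<in> r"
        using bound[OF lA(2) _ b00, of bx] g(1) by blast
      \<comment> \<open>The family \<open>g'\<close> need not be natural yet; naturality with respect to \<open>\<phi>\<close> holds from stage
        \<open>b\<phi> \<phi>\<close> on.\<close>
      define g' where "g' = (\<lambda>x. Cmp (FAr Z (bx x, b)) x \<cdot> gx x)"
      have g': "g' x \<in> Hom K (FOb F x) (FOb (FOb Z b) x)" "Cmp (\<tau> b) x \<cdot> g' x = Cmp f x" if "x \<in> Obj A" for x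
        unfolding g'_def
        using comp_Hom[OF K g(2)[OF that] Zc[OF b(2)[OF that] that]]
          comp_assoc[OF K g(2)[OF that] Zc[OF b(2)[OF that] that] tc[OF b(1) that]] tZ[OF b(2)[OF that] that] g(3)[OF that] by auto
      have "\<exists>b'. (b, b') \<in> r \<and> Cmp (FAr Z (b, b')) (Cod A \<phi>) \<cdot> (FAr (FOb Z b) \<phi> \<cdot> g' (Dom A \<phi>)) =
          Cmp (FAr Z (b, b')) (Cod A \<phi>) \<cdot> (g' (Cod A \<phi>) \<cdot> FAr F \<phi>)" if \<phi>A: "\<phi> \<in> Arr A" for \<phi>
      proof -
        define x y where xy: "x = Dom A \<phi>" "y = Cod A \<phi>"
        have \<phi>: "\<phi> \<in> Hom A x y" unfolding xy by (rule HomI[OF \<phi>A])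
        note x = Hom_Obj(1)[OF A \<phi>] and y = Hom_Obj(2)[OF A \<phi>]
        note Zp = functor_Hom[OF FunctorsD[OF ZF[OF b(1)]] \<phi>] and Fp = functor_Hom[OF fF \<phi>] and cp = functor_Hom[OF FunctorsD[OF cF] \<phi>]
        note p = comp_Hom[OF K g'(1)[OF x] Zp] and q = comp_Hom[OF K Fp g'(1)[OF y]]
        have "Cmp (\<tau> b) y \<cdot> (FAr (FOb Z b) \<phi> \<cdot> g' x) = Cmp (\<tau> b) y \<cdot> (g' y \<cdot> FAr F \<phi>)"
          using comp_assoc[OF K g'(1)[OF x] Zp tc[OF b(1) y]] nat_square[OF coc(2)[OF b(1)] \<phi>]
            comp_assoc[OF K g'(1)[OF x] tc[OF b(1) x] cp] g'(2)[OF x] nat_square[OF f \<phi>]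
            comp_assoc[OF K Fp g'(1)[OF y] tc[OF b(1) y]] g'(2)[OF y] by simp
        then show ?thesis
          using ss[OF y x] p q b(1) unfolding seq_small_def eval_diag_simps xy by blast
      qed
      then obtain b\<phi> where b\<phi>: "\<And>\<phi>. \<phi> \<in> Arr A \<Longrightarrow> (b, b\<phi> \<phi>) \<in> r"
        "\<And>\<phi>. \<phi> \<in> Arr A \<Longrightarrow> Cmp (FAr Z (b, b\<phi> \<phi>)) (Cod A \<phi>) \<cdot> (FAr (FOb Z b) \<phi> \<cdot> g' (Dom A \<phi>)) =
          Cmp (FAr Z (b, b\<phi> \<phi>)) (Cod A \<phi>) \<cdot> (g' (Cod A \<phi>) \<cdot> FAr F \<phi>)" by metis
      have "b\<phi> \<phi> \<in> Field r" if "\<phi> \<in> Arr A" for \<phi> using FieldD[OF b\<phi>(1)[OF that]] by simp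
      then obtain b' where b': "b' \<in> Field r" "(b, b') \<in> r" "\<And>\<phi>. \<phi> \<in> Arr A \<Longrightarrow> (b\<phi> \<phi>, b') \<in> r"
        using bound[OF lA(1) _ b(1), of b\<phi>] by blast
      define h where "h = \<lparr> Src = F, Tgt = FOb Z b', Cmp = restrict (\<lambda>x. Cmp (FAr Z (b, b')) x \<cdot> g' x) (Obj A) \<rparr>"
      have h: "h \<in> Hom (fun_cat A K) F (FOb Z b')"
        unfolding h_def
      proof (rule nat_HomI[OF A F ZF[OF b'(1)]])
        show "Cmp (FAr Z (b, b')) x \<cdot> g' x \<in> Hom K (FOb F x) (FOb (FOb Z b') x)" if "x \<in> Obj A" for x
          using comp_Hom[OF K g'(1)[OF that] Zc[OF b'(2) that]] .
        fix \<phi> x y assume \<phi>: "\<phi> \<in> Hom A x y"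
        note x = Hom_Obj(1)[OF A \<phi>] and y = Hom_Obj(2)[OF A \<phi>]
        have \<phi>A: "\<phi> \<in> Arr A" using HomD(1)[OF \<phi>] .
        note Zp = functor_Hom[OF FunctorsD[OF ZF[OF b(1)]] \<phi>] and Fp = functor_Hom[OF fF \<phi>]
          and Zp' = functor_Hom[OF FunctorsD[OF ZF[OF b'(1)]] \<phi>]
        note p = comp_Hom[OF K g'(1)[OF x] Zp] and q = comp_Hom[OF K Fp g'(1)[OF y]]
        note b1 = b\<phi>(1)[OF \<phi>A] and b2 = b'(3)[OF \<phi>A]
        have "Cmp (FAr Z (b, b\<phi> \<phi>)) y \<cdot> (FAr (FOb Z b) \<phi> \<cdot> g' x) = Cmp (FAr Z (b, b\<phi> \<phi>)) y \<cdot> (g' y \<cdot> FAr F \<phi>)"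
          using b\<phi>(2)[OF \<phi>A] HomD(2,3)[OF \<phi>] by simp
        then have e: "Cmp (FAr Z (b, b')) y \<cdot> (FAr (FOb Z b) \<phi> \<cdot> g' x) = Cmp (FAr Z (b, b')) y \<cdot> (g' y \<cdot> FAr F \<phi>)"
          using comp_assoc[OF K p Zc[OF b1 y] Zc[OF b2 y]] comp_assoc[OF K q Zc[OF b1 y] Zc[OF b2 y]] Zcomp[OF b1 b2 y] by simp
        show "(Cmp (FAr Z (b, b')) y \<cdot> g' y) \<cdot> FAr F \<phi> = FAr (FOb Z b') \<phi> \<cdot> (Cmp (FAr Z (b, b')) x \<cdot> g' x)"
          using comp_assoc[OF K Fp g'(1)[OF y] Zc[OF b'(2) y]] e comp_assoc[OF K g'(1)[OF x] Zp Zc[OF b'(2) y]]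
            nat_square[OF ord_functor_Hom[OF fZ b'(2)] \<phi>] comp_assoc[OF K g'(1)[OF x] Zc[OF b'(2) x] Zp'] by simp
      qed
      have "\<tau> b' \<cdot>\<^bsub>fun_cat A K\<^esub> h = f"
      proof (rule nat_eqI[OF comp_Hom[OF FK h coc(2)[OF b'(1)]] f])
        fix x assume x: "x \<in> Obj A"
        show "Cmp (\<tau> b' \<cdot>\<^bsub>fun_cat A K\<^esub> h) x = Cmp f x"
          using x comp_assoc[OF K g'(1)[OF x] Zc[OF b'(2) x] tc[OF b'(1) x]] tZ[OF b'(2) x] g'(2)[OF x] by (simp add: h_def)
      qed
      then show "\<exists>b\<in>Field r. \<exists>g\<in>Hom (fun_cat A K) F (FOb Z b). \<tau> b \<cdot>\<^bsub>fun_cat A K\<^esub> g = f" using h b'(1) by blast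
    next
      fix b g g' assume b: "b \<in> Field r" and g: "g \<in> Hom (fun_cat A K) F (FOb Z b)" "g' \<in> Hom (fun_cat A K) F (FOb Z b)"
        and eq: "\<tau> b \<cdot>\<^bsub>fun_cat A K\<^esub> g = \<tau> b \<cdot>\<^bsub>fun_cat A K\<^esub> g'"
      have "\<exists>b'. (b, b') \<in> r \<and> Cmp (FAr Z (b, b')) x \<cdot> Cmp g x = Cmp (FAr Z (b, b')) x \<cdot> Cmp g' x" if x: "x \<in> Obj A" for x
      proof -
        have "Cmp (\<tau> b) x \<cdot> Cmp g x = Cmp (\<tau> b) x \<cdot> Cmp g' x"
          using arg_cong[OF eq, of "\<lambda>t. Cmp t x"] x by simp
        then show ?thesis
          using ss[OF x x] b nat_comp_Hom[OF g(1) x] nat_comp_Hom[OF g(2) x] unfolding seq_small_def eval_diag_simps by blast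
      qed
      then obtain bx where bx: "\<And>x. x \<in> Obj A \<Longrightarrow> (b, bx x) \<in> r"
        "\<And>x. x \<in> Obj A \<Longrightarrow> Cmp (FAr Z (b, bx x)) x \<cdot> Cmp g x = Cmp (FAr Z (b, bx x)) x \<cdot> Cmp g' x" by metis
      have "bx x \<in> Field r" if "x \<in> Obj A" for x using FieldD[OF bx(1)[OF that]] by simp
      then obtain b' where b': "b' \<in> Field r" "(b, b') \<in> r" "\<And>x. x \<in> Obj A \<Longrightarrow> (bx x, b') \<in> r"
        using bound[OF lA(2) _ b, of bx] by blast
      note Zb = ord_functor_Hom[OF fZ b'(2)]
      have "FAr Z (b, b') \<cdot>\<^bsub>fun_cat A K\<^esub> g = FAr Z (b, b') \<cdot>\<^bsub>fun_cat A K\<^esub> g'"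
      proof (rule nat_eqI[OF comp_Hom[OF FK g(1) Zb] comp_Hom[OF FK g(2) Zb]])
        fix x assume x: "x \<in> Obj A"
        note z1 = Zc[OF bx(1)[OF x] x] and z2 = Zc[OF b'(3)[OF x] x]
        show "Cmp (FAr Z (b, b') \<cdot>\<^bsub>fun_cat A K\<^esub> g) x = Cmp (FAr Z (b, b') \<cdot>\<^bsub>fun_cat A K\<^esub> g') x"
          using comp_assoc[OF K nat_comp_Hom[OF g(1) x] z1 z2] comp_assoc[OF K nat_comp_Hom[OF g(2) x] z1 z2]
            Zcomp[OF bx(1)[OF x] b'(3)[OF x] x] bx(2)[OF x] nat_Comp_Cmp[OF x] by simp
      qed
      then show "\<exists>b'. (b, b') \<in> r \<and> FAr Z (b, b') \<cdot>\<^bsub>fun_cat A K\<^esub> g = FAr Z (b, b') \<cdot>\<^bsub>fun_cat A K\<^esub> g'" using b'(2) by blast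
    qed
  qed
  then have "card_small_rel \<kappa> (fun_cat A K) W F" unfolding card_small_rel_iff[OF FK] by blast
  then show ?thesis using k(1,2) unfolding small_rel_def by blast
qed

section \<open>Precomposition\<close>

lemma precomp_simps [simp]:
  "FOb (precomp A F) H = comp_fctr A H F"
  "Src (FAr (precomp A F) t) = comp_fctr A (Src t) F" "Tgt (FAr (precomp A F) t) = comp_fctr A (Tgt t) F"
  "x \<in> Obj A \<Longrightarrow> Cmp (FAr (precomp A F) t) x = Cmp t (FOb F x)"
  by (simp_all add: precomp_def)

lemma comp_fctr_simps [simp]:
  "x \<in> Obj A \<Longrightarrow> FOb (comp_fctr A H F) x = FOb H (FOb F x)"
  "f \<in> Arr A \<Longrightarrow> FAr (comp_fctr A H F) f = FAr H (FAr F f)"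
  by (simp_all add: comp_fctr_def)

lemma comp_fctr_Functors:
  assumes A: "category A" and B: "category B" and F: "is_functor A B F" and H: "is_functor B K H"
  shows "comp_fctr A H F \<in> Functors A K"
proof -
  have "is_functor A K \<lparr> FOb = \<lambda>x. FOb H (FOb F x), FAr = \<lambda>f. FAr H (FAr F f) \<rparr>"
  proof (rule is_functorI)
    show "FAr \<lparr> FOb = \<lambda>x. FOb H (FOb F x), FAr = \<lambda>f. FAr H (FAr F f) \<rparr> (g \<cdot>\<^bsub>A\<^esub> f) =
      FAr \<lparr> FOb = \<lambda>x. FOb H (FOb F x), FAr = \<lambda>f. FAr H (FAr F f) \<rparr> g \<cdot>\<^bsub>K\<^esub>
      FAr \<lparr> FOb = \<lambda>x. FOb H (FOb F x), FAr = \<lambda>f. FAr H (FAr F f) \<rparr> f"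
      if "f \<in> Hom A x y" "g \<in> Hom A y z" for f g x y z
      using functor_Comp[OF F that] functor_Comp[OF H functor_Hom[OF F that(1)] functor_Hom[OF F that(2)]] by simp
  qed (use functor_Ob[OF H functor_Ob[OF F]] functor_Hom[OF H functor_Hom[OF F]] functor_Id[OF F] functor_Id[OF H functor_Ob[OF F]] in simp_all)
  then have "restrict_fctr A \<lparr> FOb = \<lambda>x. FOb H (FOb F x), FAr = \<lambda>f. FAr H (FAr F f) \<rparr> \<in> Functors A K"
    by (rule restrict_fctr_Functors[OF A])
  then show ?thesis by (simp add: restrict_fctr_def comp_fctr_def)
qed

lemma precomp_Hom:
  assumes A: "category A" and B: "category B" and F: "is_functor A B F" and t: "t \<in> Hom (fun_cat B K) X Y"
  shows "FAr (precomp A F) t \<in> Hom (fun_cat A K) (comp_fctr A X F) (comp_fctr A Y F)"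
proof -
  have X: "X \<in> Functors B K" and Y: "Y \<in> Functors B K" using nat_Functors[OF t] by auto
  have e: "Src t = X" "Tgt t = Y" using t by (auto simp: nat_Hom_iff)
  show ?thesis
    unfolding precomp_def fctr.simps e
  proof (rule nat_HomI[OF A comp_fctr_Functors[OF A B F FunctorsD[OF X]] comp_fctr_Functors[OF A B F FunctorsD[OF Y]]])
    show "Cmp t (FOb F x) \<in> Hom K (FOb (comp_fctr A X F) x) (FOb (comp_fctr A Y F) x)" if "x \<in> Obj A" for x
      using nat_comp_Hom[OF t functor_Ob[OF F that]] that by simp
    show "Cmp t (FOb F y) \<cdot>\<^bsub>K\<^esub> FAr (comp_fctr A X F) f = FAr (comp_fctr A Y F) f \<cdot>\<^bsub>K\<^esub> Cmp t (FOb F x)" if "f \<in> Hom A x y" for f x y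
      using nat_square[OF t functor_Hom[OF F that]] HomD(1)[OF that] by simp
  qed
qed

lemma precomp_functor:
  assumes A: "category A" and B: "category B" and K: "category K" and F: "is_functor A B F"
  shows "is_functor (fun_cat B K) (fun_cat A K) (precomp A F)"
proof (rule is_functorI)
  fix X assume "X \<in> Obj (fun_cat B K)"
  then have X: "X \<in> Functors B K" by simp
  show pX: "FOb (precomp A F) X \<in> Obj (fun_cat A K)" using comp_fctr_Functors[OF A B F FunctorsD[OF X]] by simp
  note FA = fun_cat_category[OF A K] and FB = fun_cat_category[OF B K]
  have "FAr (precomp A F) (Id (fun_cat B K) X) \<in> Hom (fun_cat A K) (comp_fctr A X F) (comp_fctr A X F)"
    using precomp_Hom[OF A B F id_Hom[OF FB, of X]] X by simp
  then show "FAr (precomp A F) (Id (fun_cat B K) X) = Id (fun_cat A K) (FOb (precomp A F) X)"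
    by (rule nat_eqI) (use id_Hom[OF FA pX] functor_Ob[OF F] in auto)
next
  fix t X Y assume "t \<in> Hom (fun_cat B K) X Y"
  then show "FAr (precomp A F) t \<in> Hom (fun_cat A K) (FOb (precomp A F) X) (FOb (precomp A F) Y)"
    using precomp_Hom[OF A B F] by simp
next
  fix t s X Y Z assume t: "t \<in> Hom (fun_cat B K) X Y" and s: "s \<in> Hom (fun_cat B K) Y Z"
  note FA = fun_cat_category[OF A K] and FB = fun_cat_category[OF B K]
  show "FAr (precomp A F) (s \<cdot>\<^bsub>fun_cat B K\<^esub> t) = FAr (precomp A F) s \<cdot>\<^bsub>fun_cat A K\<^esub> FAr (precomp A F) t"
    by (rule nat_eqI[OF precomp_Hom[OF A B F comp_Hom[OF FB t s]] comp_Hom[OF FA precomp_Hom[OF A B F t] precomp_Hom[OF A B F s]]])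
      (use functor_Ob[OF F] in simp)
qed

section \<open>The semidirect product\<close>

lemma semidirect_simps [simp]:
  "Obj (semidirect C G \<rho>) = Obj C" "Arr (semidirect C G \<rho>) = Arr C \<times> carrier G"
  "Dom (semidirect C G \<rho>) (f, g) = FOb (\<rho> (inv\<^bsub>G\<^esub> g)) (Dom C f)" "Cod (semidirect C G \<rho>) (f, g) = Cod C f"
  "Id (semidirect C G \<rho>) x = (Id C x, \<one>\<^bsub>G\<^esub>)"
  "Comp (semidirect C G \<rho>) (f, g) (f', g') = (f \<cdot>\<^bsub>C\<^esub> FAr (\<rho> g) f', g \<otimes>\<^bsub>G\<^esub> g')"
  by (simp_all add: semidirect_def)

lemma incl_simps [simp]:
  "FOb (semidirect_incl C G) x = x" "FAr (semidirect_incl C G) f = (f, \<one>\<^bsub>G\<^esub>)"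
  by (simp_all add: semidirect_incl_def)

locale equivariant =
  fixes U :: "'u itself"
    and G :: "('g, 'z) monoid_scheme"
    and C :: "('co, 'ca) cat"
    and K :: "('ko, 'ka) cat" (structure)
    and \<rho> :: "'g \<Rightarrow> ('co, 'ca, 'co, 'ca) fctr"
  assumes U: "universe U" and G: "group G" and sG: "small U (carrier G)" and sC: "small_category U C"
    and hom: "\<rho> \<in> hom G (Aut_cat C)" and bi: "bicomplete U K"
begin

abbreviation "D \<equiv> semidirect C G \<rho>"
abbreviation "M \<equiv> fun_cat C K"
abbreviation "N \<equiv> fun_cat D K"
abbreviation "V \<equiv> precomp C (semidirect_incl C G)"
abbreviation rO where "rO g x \<equiv> FOb (\<rho> g) x"
abbreviation rA where "rA g f \<equiv> FAr (\<rho> g) f"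

lemma C: "category C" using sC by (simp add: small_category_def)

lemma K: "category K" using bi by (rule bicomplete_category)

lemma mult_closed [simp]: "g \<in> carrier G \<Longrightarrow> h \<in> carrier G \<Longrightarrow> g \<otimes>\<^bsub>G\<^esub> h \<in> carrier G"
  using G by (simp add: group.is_monoid monoid.m_closed)

lemma one_closed [simp]: "\<one>\<^bsub>G\<^esub> \<in> carrier G"
  using G by (simp add: group.is_monoid monoid.one_closed)

lemma inv_closed [simp]: "g \<in> carrier G \<Longrightarrow> inv\<^bsub>G\<^esub> g \<in> carrier G"
  using G by (simp add: group.inv_closed)

lemma inv_inv_G [simp]: "g \<in> carrier G \<Longrightarrow> inv\<^bsub>G\<^esub> (inv\<^bsub>G\<^esub> g) = g"
  using G by (simp add: group.inv_inv)

lemma inv_one_G [simp]: "inv\<^bsub>G\<^esub> \<one>\<^bsub>G\<^esub> = \<one>\<^bsub>G\<^esub>"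
  using G by (simp add: group.is_monoid monoid.inv_one)

lemma G_simps [simp]:
  "g \<in> carrier G \<Longrightarrow> \<one>\<^bsub>G\<^esub> \<otimes>\<^bsub>G\<^esub> g = g" "g \<in> carrier G \<Longrightarrow> g \<otimes>\<^bsub>G\<^esub> \<one>\<^bsub>G\<^esub> = g"
  "g \<in> carrier G \<Longrightarrow> g \<otimes>\<^bsub>G\<^esub> inv\<^bsub>G\<^esub> g = \<one>\<^bsub>G\<^esub>" "g \<in> carrier G \<Longrightarrow> inv\<^bsub>G\<^esub> g \<otimes>\<^bsub>G\<^esub> g = \<one>\<^bsub>G\<^esub>"
  using G by (simp_all add: group.is_monoid monoid.l_one monoid.r_one group.r_inv group.l_inv)

lemma G_assoc: "g \<in> carrier G \<Longrightarrow> h \<in> carrier G \<Longrightarrow> k \<in> carrier G \<Longrightarrow> g \<otimes>\<^bsub>G\<^esub> h \<otimes>\<^bsub>G\<^esub> k = g \<otimes>\<^bsub>G\<^esub> (h \<otimes>\<^bsub>G\<^esub> k)"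
  using G by (simp add: group.is_monoid monoid.m_assoc)

lemma inv_mult: "g \<in> carrier G \<Longrightarrow> h \<in> carrier G \<Longrightarrow> inv\<^bsub>G\<^esub> (g \<otimes>\<^bsub>G\<^esub> h) = inv\<^bsub>G\<^esub> h \<otimes>\<^bsub>G\<^esub> inv\<^bsub>G\<^esub> g"
  using G by (simp add: group.inv_mult_group)

lemma rho: "g \<in> carrier G \<Longrightarrow> \<rho> g \<in> Functors C C"
  using hom by (auto simp: hom_def Aut_cat_def)

lemma rho_functor: "g \<in> carrier G \<Longrightarrow> is_functor C C (\<rho> g)"
  by (rule FunctorsD[OF rho])

lemma rO_Obj [simp]: "g \<in> carrier G \<Longrightarrow> x \<in> Obj C \<Longrightarrow> rO g x \<in> Obj C"
  by (rule functor_Ob[OF rho_functor])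

lemma rA_Hom: "g \<in> carrier G \<Longrightarrow> f \<in> Hom C x y \<Longrightarrow> rA g f \<in> Hom C (rO g x) (rO g y)"
  by (rule functor_Hom[OF rho_functor])

lemma rA_Arr [simp]: "g \<in> carrier G \<Longrightarrow> f \<in> Arr C \<Longrightarrow> rA g f \<in> Arr C"
  using rA_Hom[OF _ HomI] HomD(1) by metis

lemma rA_Id [simp]: "g \<in> carrier G \<Longrightarrow> x \<in> Obj C \<Longrightarrow> rA g (Id C x) = Id C (rO g x)"
  by (rule functor_Id[OF rho_functor])

lemma rA_Comp: "g \<in> carrier G \<Longrightarrow> f \<in> Hom C x y \<Longrightarrow> f' \<in> Hom C y z \<Longrightarrow> rA g (f' \<cdot>\<^bsub>C\<^esub> f) = rA g f' \<cdot>\<^bsub>C\<^esub> rA g f"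
  by (rule functor_Comp[OF rho_functor])

lemma rho_mult: "g \<in> carrier G \<Longrightarrow> h \<in> carrier G \<Longrightarrow> \<rho> (g \<otimes>\<^bsub>G\<^esub> h) = comp_fctr C (\<rho> g) (\<rho> h)"
  using hom by (auto simp: hom_def Aut_cat_def)

lemma rO_mult: "g \<in> carrier G \<Longrightarrow> h \<in> carrier G \<Longrightarrow> x \<in> Obj C \<Longrightarrow> rO (g \<otimes>\<^bsub>G\<^esub> h) x = rO g (rO h x)"
  by (simp add: rho_mult)

lemma rA_mult: "g \<in> carrier G \<Longrightarrow> h \<in> carrier G \<Longrightarrow> f \<in> Arr C \<Longrightarrow> rA (g \<otimes>\<^bsub>G\<^esub> h) f = rA g (rA h f)"
  by (simp add: rho_mult)

lemma rho_one: "x \<in> Obj C \<Longrightarrow> rO \<one>\<^bsub>G\<^esub> x = x" "f \<in> Arr C \<Longrightarrow> rA \<one>\<^bsub>G\<^esub> f = f"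
proof -
  obtain H where H: "comp_fctr C H (\<rho> \<one>\<^bsub>G\<^esub>) = id_fctr C"
  proof -
    have "\<rho> \<one>\<^bsub>G\<^esub> \<in> carrier (Aut_cat C)" using hom one_closed by (auto simp: hom_def)
    then show ?thesis using that by (auto simp: Aut_cat_def)
  qed
  have HO: "FOb H (rO \<one>\<^bsub>G\<^esub> x) = x" if "x \<in> Obj C" for x
    using arg_cong[OF H, of "\<lambda>F. FOb F x"] that by (simp add: id_fctr_def)
  have HA: "FAr H (rA \<one>\<^bsub>G\<^esub> f) = f" if "f \<in> Arr C" for f
    using arg_cong[OF H, of "\<lambda>F. FAr F f"] that by (simp add: id_fctr_def)
  show "rO \<one>\<^bsub>G\<^esub> x = x" if "x \<in> Obj C"
    using HO[OF that] HO[OF rO_Obj[OF one_closed that]] rO_mult[OF one_closed one_closed that] by simp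
  show "rA \<one>\<^bsub>G\<^esub> f = f" if "f \<in> Arr C"
    using HA[OF that] HA[OF rA_Arr[OF one_closed that]] rA_mult[OF one_closed one_closed that] by simp
qed

lemma rho_inv [simp]:
  "g \<in> carrier G \<Longrightarrow> x \<in> Obj C \<Longrightarrow> rO (inv\<^bsub>G\<^esub> g) (rO g x) = x"
  "g \<in> carrier G \<Longrightarrow> x \<in> Obj C \<Longrightarrow> rO g (rO (inv\<^bsub>G\<^esub> g) x) = x"
  "g \<in> carrier G \<Longrightarrow> f \<in> Arr C \<Longrightarrow> rA (inv\<^bsub>G\<^esub> g) (rA g f) = f"
  "g \<in> carrier G \<Longrightarrow> f \<in> Arr C \<Longrightarrow> rA g (rA (inv\<^bsub>G\<^esub> g) f) = f"
  using rO_mult[of "inv\<^bsub>G\<^esub> g" g x] rO_mult[of g "inv\<^bsub>G\<^esub> g" x] rA_mult[of "inv\<^bsub>G\<^esub> g" g f] rA_mult[of g "inv\<^bsub>G\<^esub> g" f] rho_one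
  by simp_all

text \<open>Moving the inverse in the source of \<open>(f, g)\<close> to the other side describes a morphism \<open>x \<rightarrow> y\<close>
  as an element \<open>g\<close> with a morphism \<open>\<rho>\<^sub>g x \<rightarrow> y\<close>, from which the Kan extensions below can be read
  off.\<close>

lemma D_Hom_iff: "(f, g) \<in> Hom D x y \<longleftrightarrow> g \<in> carrier G \<and> x \<in> Obj C \<and> f \<in> Hom C (rO g x) y"
proof
  assume "(f, g) \<in> Hom D x y"
  then have a: "g \<in> carrier G" "f \<in> Arr C" "rO (inv\<^bsub>G\<^esub> g) (Dom C f) = x" "Cod C f = y" by (auto simp: Hom_def)
  have "Dom C f \<in> Obj C" using category.Dom_Obj[OF C a(2)] .
  then show "g \<in> carrier G \<and> x \<in> Obj C \<and> f \<in> Hom C (rO g x) y" using a by (auto simp: Hom_def)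
next
  assume "g \<in> carrier G \<and> x \<in> Obj C \<and> f \<in> Hom C (rO g x) y"
  then show "(f, g) \<in> Hom D x y" by (auto simp: Hom_def)
qed

lemma D_category: "category D"
proof (rule categoryI)
  fix f assume "f \<in> Arr D"
  then show "Dom D f \<in> Obj D \<and> Cod D f \<in> Obj D"
    by (cases f) (auto simp: category.Dom_Obj[OF C] category.Cod_Obj[OF C])
next
  fix x assume "x \<in> Obj D"
  then show "Id D x \<in> Hom D x x" by (simp add: D_Hom_iff rho_one id_Hom[OF C])
next
  fix f g a b c assume f: "f \<in> Hom D a b" and g: "g \<in> Hom D b c"
  obtain f1 f2 g1 g2 where e: "f = (f1, f2)" "g = (g1, g2)" by (metis surj_pair)
  have 1: "f2 \<in> carrier G" "a \<in> Obj C" "f1 \<in> Hom C (rO f2 a) b" "g2 \<in> carrier G" "b \<in> Obj C" "g1 \<in> Hom C (rO g2 b) c"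
    using f g unfolding e D_Hom_iff by auto
  then show "g \<cdot>\<^bsub>D\<^esub> f \<in> Hom D a c"
    using comp_Hom[OF C rA_Hom[OF 1(4,3)] 1(6)] by (simp add: e D_Hom_iff rO_mult)
next
  fix f a b assume f: "f \<in> Hom D a b"
  obtain f1 f2 where e: "f = (f1, f2)" by (metis surj_pair)
  have 1: "f2 \<in> carrier G" "a \<in> Obj C" "f1 \<in> Hom C (rO f2 a) b" using f unfolding e D_Hom_iff by auto
  show "f \<cdot>\<^bsub>D\<^esub> Id D a = f" using 1 comp_id[OF C 1(3)] by (simp add: e)
  show "Id D b \<cdot>\<^bsub>D\<^esub> f = f" using 1 id_comp[OF C 1(3)] rho_one(2)[OF HomD(1)[OF 1(3)]] by (simp add: e)
next
  fix f g h a b c d assume f: "f \<in> Hom D a b" and g: "g \<in> Hom D b c" and h: "h \<in> Hom D c d"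
  obtain f1 f2 g1 g2 h1 h2 where e: "f = (f1, f2)" "g = (g1, g2)" "h = (h1, h2)" by (metis surj_pair)
  have 1: "f2 \<in> carrier G" "a \<in> Obj C" "f1 \<in> Hom C (rO f2 a) b" "g2 \<in> carrier G" "b \<in> Obj C" "g1 \<in> Hom C (rO g2 b) c"
    "h2 \<in> carrier G" "c \<in> Obj C" "h1 \<in> Hom C (rO h2 c) d"
    using f g h unfolding e D_Hom_iff by auto
  note gf = rA_Hom[OF 1(4,3)]
  have "rA h2 (rA g2 f1) = rA (h2 \<otimes>\<^bsub>G\<^esub> g2) f1" using rA_mult[OF 1(7,4) HomD(1)[OF 1(3)]] by simp
  then have "(h1 \<cdot>\<^bsub>C\<^esub> rA h2 g1) \<cdot>\<^bsub>C\<^esub> rA (h2 \<otimes>\<^bsub>G\<^esub> g2) f1 = h1 \<cdot>\<^bsub>C\<^esub> rA h2 (g1 \<cdot>\<^bsub>C\<^esub> rA g2 f1)"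
    using comp_assoc[OF C rA_Hom[OF 1(7) gf] rA_Hom[OF 1(7,6)] 1(9)] rA_Comp[OF 1(7) gf 1(6)] by simp
  then show "(h \<cdot>\<^bsub>D\<^esub> g) \<cdot>\<^bsub>D\<^esub> f = h \<cdot>\<^bsub>D\<^esub> (g \<cdot>\<^bsub>D\<^esub> f)" using 1 by (simp add: e G_assoc)
qed

lemma incl_functor: "is_functor C D (semidirect_incl C G)"
proof (rule is_functorI)
  show "FAr (semidirect_incl C G) f \<in> Hom D (FOb (semidirect_incl C G) x) (FOb (semidirect_incl C G) y)" if "f \<in> Hom C x y" for f x y
    using that Hom_Obj[OF C that] by (simp add: D_Hom_iff rho_one)
  show "FAr (semidirect_incl C G) (g \<cdot>\<^bsub>C\<^esub> f) = FAr (semidirect_incl C G) g \<cdot>\<^bsub>D\<^esub> FAr (semidirect_incl C G) f"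
    if "f \<in> Hom C x y" "g \<in> Hom C y z" for f g x y z
    using that by (simp add: rho_one HomD)
qed auto

lemma M_category: "category M" by (rule fun_cat_category[OF C K])

lemma N_category: "category N" by (rule fun_cat_category[OF D_category K])

lemma V_functor: "is_functor N M V"
  by (rule precomp_functor[OF C D_category K incl_functor])

lemma V_Ob [simp]: "x \<in> Obj C \<Longrightarrow> FOb (comp_fctr C Y (semidirect_incl C G)) x = FOb Y x"
  "f \<in> Arr C \<Longrightarrow> FAr (comp_fctr C Y (semidirect_incl C G)) f = FAr Y (f, \<one>\<^bsub>G\<^esub>)"
  by simp_all

lemma V_Cmp [simp]: "x \<in> Obj C \<Longrightarrow> Cmp (FAr V t) x = Cmp t x"
  by simp

text \<open>Every \<open>\<rho>\<^sub>g x\<close> is isomorphic to \<open>x\<close> in the semidirect product. A morphism \<open>(f, g)\<close> is the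
  first of these isomorphisms followed by the image of \<open>f\<close> under the inclusion.\<close>

lemma D_shift: "g \<in> carrier G \<Longrightarrow> x \<in> Obj C \<Longrightarrow> (Id C (rO g x), g) \<in> Hom D x (rO g x)"
  "g \<in> carrier G \<Longrightarrow> x \<in> Obj C \<Longrightarrow> (Id C x, inv\<^bsub>G\<^esub> g) \<in> Hom D (rO g x) x"
  by (simp_all add: D_Hom_iff id_Hom[OF C])

lemma D_base: "f \<in> Hom C x y \<Longrightarrow> (f, \<one>\<^bsub>G\<^esub>) \<in> Hom D x y"
  using Hom_Obj[OF C, of f x y] by (simp add: D_Hom_iff rho_one)

subsection \<open>The cofree functor\<close>

text \<open>The right Kan extension of \<open>X\<close> along the inclusion takes \<open>y\<close> to the product of the
  \<open>X(\<rho>\<^sub>h y)\<close>. A morphism \<open>(f, g) : x \<rightarrow> y\<close> followed by the projection at \<open>k\<close> only involves the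
  projection at \<open>k \<otimes> g\<close>, because \<open>\<rho>\<^sub>k f\<close> starts in \<open>\<rho>\<^sub>k\<^sub>\<otimes>\<^sub>g x\<close>.\<close>

definition cofree :: "('co, 'ca, 'ko, 'ka) fctr \<Rightarrow> ('co, 'ca \<times> 'g, 'ko, 'ka) fctr \<Rightarrow> ('co \<Rightarrow> 'g \<Rightarrow> 'ka) \<Rightarrow> bool" where
  "cofree X T \<pi> \<longleftrightarrow> X \<in> Functors C K \<and> T \<in> Functors D K \<and>
    (\<forall>y \<in> Obj C. product K (carrier G) (\<lambda>h. FOb X (rO h y)) (FOb T y) (\<pi> y)) \<and>
    (\<forall>f g x y k. (f, g) \<in> Hom D x y \<longrightarrow> k \<in> carrier G \<longrightarrow>
      \<pi> y k \<cdot> FAr T (f, g) = FAr X (rA k f) \<cdot> \<pi> x (k \<otimes>\<^bsub>G\<^esub> g))"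

lemma cofree_exists:
  assumes X: "X \<in> Functors C K"
  shows "\<exists>T \<pi>. cofree X T \<pi>"
proof -
  note fX = FunctorsD[OF X]
  have "\<forall>y. \<exists>c \<pi>. y \<in> Obj C \<longrightarrow> product K (carrier G) (\<lambda>h. FOb X (rO h y)) c \<pi>"
    using products_exist(1)[OF U bi sG, of "\<lambda>h. FOb X (rO h _)"] functor_Ob[OF fX] by (metis rO_Obj)
  then obtain cc \<pi> where p: "\<And>y. y \<in> Obj C \<Longrightarrow> product K (carrier G) (\<lambda>h. FOb X (rO h y)) (cc y) (\<pi> y)" by metis
  note pH = productD(2)[OF p]
  have XA: "FAr X (rA k f) \<in> Hom K (FOb X (rO (k \<otimes>\<^bsub>G\<^esub> g) x)) (FOb X (rO k y))" if "(f, g) \<in> Hom D x y" "k \<in> carrier G" for f g x y k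
    using functor_Hom[OF fX rA_Hom[OF that(2), of f "rO g x" y]] that by (simp add: D_Hom_iff rO_mult)
  have arr: "\<exists>h. h \<in> Hom K (cc x) (cc y) \<and> (\<forall>k \<in> carrier G. \<pi> y k \<cdot> h = FAr X (rA k f) \<cdot> \<pi> x (k \<otimes>\<^bsub>G\<^esub> g))"
    if fg: "(f, g) \<in> Hom D x y" for f g x y
  proof -
    have x: "x \<in> Obj C" and y: "y \<in> Obj C" using Hom_Obj[OF D_category fg] by auto
    have g: "g \<in> carrier G" using fg by (simp add: D_Hom_iff)
    show ?thesis
      by (rule product_ex[OF p[OF y] productD(1)[OF p[OF x]]])
        (rule comp_Hom[OF K pH[OF x mult_closed[OF _ g]] XA[OF fg]])
  qed
  have "\<exists>h. u \<in> Arr D \<longrightarrow> h \<in> Hom K (cc (Dom D u)) (cc (Cod D u)) \<and>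
      (\<forall>k \<in> carrier G. \<pi> (Cod D u) k \<cdot> h = FAr X (rA k (fst u)) \<cdot> \<pi> (Dom D u) (k \<otimes>\<^bsub>G\<^esub> snd u))" for u
    using arr[of "fst u" "snd u" "Dom D u" "Cod D u"] HomI[of u D] by (metis prod.collapse)
  then obtain aa where aa0: "\<And>u. u \<in> Arr D \<Longrightarrow> aa u \<in> Hom K (cc (Dom D u)) (cc (Cod D u)) \<and>
      (\<forall>k \<in> carrier G. \<pi> (Cod D u) k \<cdot> aa u = FAr X (rA k (fst u)) \<cdot> \<pi> (Dom D u) (k \<otimes>\<^bsub>G\<^esub> snd u))" by metis
  have aaH: "aa (f, g) \<in> Hom K (cc x) (cc y)" and aa: "\<And>k. k \<in> carrier G \<Longrightarrow> \<pi> y k \<cdot> aa (f, g) = FAr X (rA k f) \<cdot> \<pi> x (k \<otimes>\<^bsub>G\<^esub> g)"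
    if "(f, g) \<in> Hom D x y" for f g x y
    using aa0[OF HomD(1)[OF that]] unfolding HomD(2,3)[OF that] by auto
  define T0 where "T0 = \<lparr> FOb = cc, FAr = aa \<rparr>"
  define T where "T = restrict_fctr D T0"
  have "is_functor D K T0"
  proof (rule is_functorI)
    fix x assume "x \<in> Obj D"
    then have x: "x \<in> Obj C" by simp
    show c: "FOb T0 x \<in> Obj K" using productD(1)[OF p[OF x]] by (simp add: T0_def)
    have i: "(Id C x, \<one>\<^bsub>G\<^esub>) \<in> Hom D x x" by (rule D_base[OF id_Hom[OF C x]])
    have "aa (Id C x, \<one>\<^bsub>G\<^esub>) = Id K (cc x)"
    proof (rule product_uniq[OF K p[OF x] aaH[OF i] id_Hom[OF K]])
      show "cc x \<in> Obj K" using productD(1)[OF p[OF x]] .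
      fix k assume k: "k \<in> carrier G"
      show "\<pi> x k \<cdot> aa (Id C x, \<one>\<^bsub>G\<^esub>) = \<pi> x k \<cdot> Id K (cc x)"
        using aa[OF i k] k x functor_Id[OF fX, of "rO k x"] id_comp[OF K pH[OF x k]] comp_id[OF K pH[OF x k]] by simp
    qed
    then show "FAr T0 (Id D x) = Id K (FOb T0 x)" by (simp add: T0_def)
  next
    fix f x y assume "f \<in> Hom D x y"
    then show "FAr T0 f \<in> Hom K (FOb T0 x) (FOb T0 y)" using aaH[of "fst f" "snd f" x y] by (simp add: T0_def)
  next
    fix f f' x y z assume f: "f \<in> Hom D x y" and f': "f' \<in> Hom D y z"
    obtain a g b h where e: "f = (a, g)" "f' = (b, h)" by (metis surj_pair)
    note f = f[unfolded e] and f' = f'[unfolded e]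
    have x: "x \<in> Obj C" and y: "y \<in> Obj C" and z: "z \<in> Obj C" using Hom_Obj[OF D_category f] Hom_Obj[OF D_category f'] by auto
    have 1: "g \<in> carrier G" "a \<in> Hom C (rO g x) y" "h \<in> carrier G" "b \<in> Hom C (rO h y) z" using f f' by (auto simp: D_Hom_iff)
    have ff: "(b \<cdot>\<^bsub>C\<^esub> rA h a, h \<otimes>\<^bsub>G\<^esub> g) \<in> Hom D x z" using comp_Hom[OF D_category f f'] by simp
    have "aa (b \<cdot>\<^bsub>C\<^esub> rA h a, h \<otimes>\<^bsub>G\<^esub> g) = aa (b, h) \<cdot> aa (a, g)"
    proof (rule product_uniq[OF K p[OF z] aaH[OF ff] comp_Hom[OF K aaH[OF f] aaH[OF f']]])
      fix k assume k: "k \<in> carrier G"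
      note kh = mult_closed[OF k 1(3)]
      have "rA k (b \<cdot>\<^bsub>C\<^esub> rA h a) = rA k b \<cdot>\<^bsub>C\<^esub> rA (k \<otimes>\<^bsub>G\<^esub> h) a"
        using rA_Comp[OF k rA_Hom[OF 1(3,2)] 1(4)] rA_mult[OF k 1(3) HomD(1)[OF 1(2)]] by simp
      moreover have "rA (k \<otimes>\<^bsub>G\<^esub> h) a \<in> Hom C (rO (k \<otimes>\<^bsub>G\<^esub> h \<otimes>\<^bsub>G\<^esub> g) x) (rO k (rO h y))"
        using rA_Hom[OF kh 1(2)] rO_mult[OF kh 1(1) x] rO_mult[OF k 1(3) y] by simp
      ultimately have X2: "FAr X (rA k (b \<cdot>\<^bsub>C\<^esub> rA h a)) = FAr X (rA k b) \<cdot> FAr X (rA (k \<otimes>\<^bsub>G\<^esub> h) a)"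
        using functor_Comp[OF fX _ rA_Hom[OF k 1(4)]] by simp
      show "\<pi> z k \<cdot> aa (b \<cdot>\<^bsub>C\<^esub> rA h a, h \<otimes>\<^bsub>G\<^esub> g) = \<pi> z k \<cdot> (aa (b, h) \<cdot> aa (a, g))"
        using comp_assoc[OF K aaH[OF f] aaH[OF f'] pH[OF z k], symmetric] aa[OF f' k]
          comp_assoc[OF K aaH[OF f] pH[OF y kh] XA[OF f' k]] aa[OF f kh] aa[OF ff k] X2
          comp_assoc[OF K pH[OF x mult_closed[OF kh 1(1)]] XA[OF f kh] XA[OF f' k]] G_assoc[OF k 1(3,1)] by simp
    qed
    then show "FAr T0 (f' \<cdot>\<^bsub>D\<^esub> f) = FAr T0 f' \<cdot> FAr T0 f" by (simp add: T0_def e)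
  qed
  then have "T \<in> Functors D K" unfolding T_def by (rule restrict_fctr_Functors[OF D_category])
  moreover have "FOb T y = cc y" if "y \<in> Obj C" for y using that by (simp add: T_def T0_def)
  moreover have "FAr T (f, g) = aa (f, g)" if "(f, g) \<in> Hom D x y" for f g x y using HomD(1)[OF that] by (simp add: T_def T0_def)
  ultimately have "cofree X T \<pi>" unfolding cofree_def using X p aa by simp
  then show ?thesis by blast
qed

lemma cofreeD:
  assumes c: "cofree X T \<pi>"
  shows "X \<in> Functors C K" "T \<in> Functors D K"
    "y \<in> Obj C \<Longrightarrow> product K (carrier G) (\<lambda>h. FOb X (rO h y)) (FOb T y) (\<pi> y)"
    "(f, g) \<in> Hom D x y \<Longrightarrow> k \<in> carrier G \<Longrightarrow> \<pi> y k \<cdot> FAr T (f, g) = FAr X (rA k f) \<cdot> \<pi> x (k \<otimes>\<^bsub>G\<^esub> g)"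
    "y \<in> Obj C \<Longrightarrow> k \<in> carrier G \<Longrightarrow> \<pi> y k \<in> Hom K (FOb T y) (FOb X (rO k y))"
proof -
  show "X \<in> Functors C K" "T \<in> Functors D K" using c unfolding cofree_def by auto
  show p: "y \<in> Obj C \<Longrightarrow> product K (carrier G) (\<lambda>h. FOb X (rO h y)) (FOb T y) (\<pi> y)" for y using c unfolding cofree_def by auto
  show "(f, g) \<in> Hom D x y \<Longrightarrow> k \<in> carrier G \<Longrightarrow> \<pi> y k \<cdot> FAr T (f, g) = FAr X (rA k f) \<cdot> \<pi> x (k \<otimes>\<^bsub>G\<^esub> g)"
    using c unfolding cofree_def by blast
  show "y \<in> Obj C \<Longrightarrow> k \<in> carrier G \<Longrightarrow> \<pi> y k \<in> Hom K (FOb T y) (FOb X (rO k y))"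
    using productD(2)[OF p] by simp
qed

text \<open>The counit is the projection at the unit; all other projections are obtained from it by
  moving along the isomorphisms \<open>y \<rightarrow> \<rho>\<^sub>k y\<close>.\<close>

lemma cofree_counit_shift:
  assumes c: "cofree X T \<pi>" and y: "y \<in> Obj C" and k: "k \<in> carrier G"
  shows "\<pi> (rO k y) \<one>\<^bsub>G\<^esub> \<cdot> FAr T (Id C (rO k y), k) = \<pi> y k"
proof -
  have "\<pi> (rO k y) \<one>\<^bsub>G\<^esub> \<cdot> FAr T (Id C (rO k y), k) = FAr X (Id C (rO k y)) \<cdot> \<pi> y k"
    using cofreeD(4)[OF c D_shift(1)[OF k y] one_closed] k y by (simp add: rho_one)
  also have "FAr X (Id C (rO k y)) = Id K (FOb X (rO k y))" using functor_Id[OF FunctorsD[OF cofreeD(1)[OF c]]] k y by simp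
  finally show ?thesis using id_comp[OF K cofreeD(5)[OF c y k]] by simp
qed

lemma cofree_counit:
  assumes c: "cofree X T \<pi>"
  shows "\<lparr> Src = FOb V T, Tgt = X, Cmp = restrict (\<lambda>y. \<pi> y \<one>\<^bsub>G\<^esub>) (Obj C) \<rparr> \<in> Hom M (FOb V T) X"
proof (rule nat_HomI[OF C])
  show "FOb V T \<in> Functors C K" using functor_Ob[OF V_functor] cofreeD(2)[OF c] by simp
  show "X \<in> Functors C K" by (rule cofreeD(1)[OF c])
  show "\<pi> x \<one>\<^bsub>G\<^esub> \<in> Hom K (FOb (FOb V T) x) (FOb X x)" if "x \<in> Obj C" for x
    using cofreeD(5)[OF c that one_closed] that rho_one(1)[OF that] by simp
  show "\<pi> y \<one>\<^bsub>G\<^esub> \<cdot> FAr (FOb V T) f = FAr X f \<cdot> \<pi> x \<one>\<^bsub>G\<^esub>" if "f \<in> Hom C x y" for f x y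
    using cofreeD(4)[OF c D_base[OF that] one_closed] HomD(1)[OF that] rho_one by simp
qed

text \<open>By \<open>cofree_counit_shift\<close>, the component at \<open>k\<close> of an adjunct of \<open>w\<close> is forced to be \<open>w\<close> at
  \<open>\<rho>\<^sub>k y\<close> composed with the action of \<open>y \<rightarrow> \<rho>\<^sub>k y\<close> on \<open>Y\<close>.\<close>

lemma cofree_universal:
  assumes c: "cofree X T \<pi>" and Y: "Y \<in> Functors D K" and w: "w \<in> Hom M (FOb V Y) X"
    and \<epsilon>: "\<epsilon> = \<lparr> Src = FOb V T, Tgt = X, Cmp = restrict (\<lambda>y. \<pi> y \<one>\<^bsub>G\<^esub>) (Obj C) \<rparr>"
  shows "\<exists>!v. v \<in> Hom N Y T \<and> \<epsilon> \<cdot>\<^bsub>M\<^esub> FAr V v = w"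
proof -
  note T = cofreeD(2)[OF c] and X = cofreeD(1)[OF c]
  note fY = FunctorsD[OF Y] and fT = FunctorsD[OF T] and fX = FunctorsD[OF X]
  have wH: "Cmp w x \<in> Hom K (FOb Y x) (FOb X x)" if "x \<in> Obj C" for x using nat_comp_Hom[OF w that] that by simp
  have wsq: "Cmp w y \<cdot> FAr Y (f, \<one>\<^bsub>G\<^esub>) = FAr X f \<cdot> Cmp w x" if "f \<in> Hom C x y" for f x y
    using nat_square[OF w that] HomD(1)[OF that] by simp
  define s where "s = (\<lambda>y k. Cmp w (rO k y) \<cdot> FAr Y (Id C (rO k y), k))"
  have sH: "s y k \<in> Hom K (FOb Y y) (FOb X (rO k y))" if "y \<in> Obj C" "k \<in> carrier G" for y k
    unfolding s_def using comp_Hom[OF K functor_Hom[OF fY D_shift(1)[OF that(2,1)]] wH] that by simp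
  have "\<exists>h. y \<in> Obj C \<longrightarrow> h \<in> Hom K (FOb Y y) (FOb T y) \<and> (\<forall>k \<in> carrier G. \<pi> y k \<cdot> h = s y k)" for y
    using product_ex[OF cofreeD(3)[OF c, of y] functor_Ob[OF fY, of y] sH[of y]] by fastforce
  then obtain v where v: "\<And>y. y \<in> Obj C \<Longrightarrow> v y \<in> Hom K (FOb Y y) (FOb T y)"
    "\<And>y k. y \<in> Obj C \<Longrightarrow> k \<in> carrier G \<Longrightarrow> \<pi> y k \<cdot> v y = s y k" by metis
  let ?v = "\<lparr> Src = Y, Tgt = T, Cmp = restrict v (Obj D) \<rparr>"
  have vN: "?v \<in> Hom N Y T"
  proof (rule nat_HomI[OF D_category Y T])
    show "v x \<in> Hom K (FOb Y x) (FOb T x)" if "x \<in> Obj D" for x using v(1) that by simp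
    fix u x y assume u: "u \<in> Hom D x y"
    obtain f g where e: "u = (f, g)" by (metis surj_pair)
    note u = u[unfolded e]
    have x: "x \<in> Obj C" and y: "y \<in> Obj C" using Hom_Obj[OF D_category u] by auto
    have fg: "g \<in> carrier G" "f \<in> Hom C (rO g x) y" using u by (auto simp: D_Hom_iff)
    note Yu = functor_Hom[OF fY u] and Tu = functor_Hom[OF fT u]
    have "v y \<cdot> FAr Y (f, g) = FAr T (f, g) \<cdot> v x"
    proof (rule product_uniq[OF K cofreeD(3)[OF c y] comp_Hom[OF K Yu v(1)[OF y]] comp_Hom[OF K v(1)[OF x] Tu]])
      fix k assume k: "k \<in> carrier G"
      note kg = mult_closed[OF k fg(1)]
      note ky = rO_Obj[OF k y]
      have rkf: "rA k f \<in> Hom C (rO (k \<otimes>\<^bsub>G\<^esub> g) x) (rO k y)" using rA_Hom[OF k fg(2)] rO_mult[OF k fg(1) x] by simp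
      note sh1 = D_shift(1)[OF k y] and sh2 = D_shift(1)[OF kg x] and b = D_base[OF rkf]
      have comp: "(Id C (rO k y), k) \<cdot>\<^bsub>D\<^esub> (f, g) = (rA k f, \<one>\<^bsub>G\<^esub>) \<cdot>\<^bsub>D\<^esub> (Id C (rO (k \<otimes>\<^bsub>G\<^esub> g) x), k \<otimes>\<^bsub>G\<^esub> g)"
        using id_comp[OF C rkf] comp_id[OF C rkf] kg x by (simp add: rho_one(1)[OF rO_Obj[OF kg x]])
      have "\<pi> y k \<cdot> (v y \<cdot> FAr Y (f, g)) = Cmp w (rO k y) \<cdot> (FAr Y (Id C (rO k y), k) \<cdot> FAr Y (f, g))"
        using comp_assoc[OF K Yu v(1)[OF y] cofreeD(5)[OF c y k]] v(2)[OF y k] comp_assoc[OF K Yu functor_Hom[OF fY sh1] wH[OF ky]]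
        by (simp add: s_def)
      also have "FAr Y (Id C (rO k y), k) \<cdot> FAr Y (f, g) = FAr Y (rA k f, \<one>\<^bsub>G\<^esub>) \<cdot> FAr Y (Id C (rO (k \<otimes>\<^bsub>G\<^esub> g) x), k \<otimes>\<^bsub>G\<^esub> g)"
        using functor_Comp[OF fY u sh1] functor_Comp[OF fY sh2 b] comp by simp
      also have "Cmp w (rO k y) \<cdot> \<dots> = FAr X (rA k f) \<cdot> s x (k \<otimes>\<^bsub>G\<^esub> g)"
        using comp_assoc[OF K functor_Hom[OF fY sh2] functor_Hom[OF fY b] wH[OF ky]] wsq[OF rkf]
          comp_assoc[OF K functor_Hom[OF fY sh2] wH[OF rO_Obj[OF kg x]] functor_Hom[OF fX rkf]] by (simp add: s_def)
      also have "\<dots> = \<pi> y k \<cdot> (FAr T (f, g) \<cdot> v x)"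
        using comp_assoc[OF K v(1)[OF x] Tu cofreeD(5)[OF c y k]] cofreeD(4)[OF c u k]
          comp_assoc[OF K v(1)[OF x] cofreeD(5)[OF c x kg] functor_Hom[OF fX rkf]] v(2)[OF x kg] by simp
      finally show "\<pi> y k \<cdot> (v y \<cdot> FAr Y (f, g)) = \<pi> y k \<cdot> (FAr T (f, g) \<cdot> v x)" .
    qed
    then show "v y \<cdot> FAr Y u = FAr T u \<cdot> v x" by (simp add: e)
  qed
  have \<epsilon>H: "\<epsilon> \<in> Hom M (FOb V T) X" unfolding \<epsilon> by (rule cofree_counit[OF c])
  have VH: "FAr V t \<in> Hom M (FOb V Y) (FOb V T)" if "t \<in> Hom N Y T" for t by (rule functor_Hom[OF V_functor that])
  show ?thesis
  proof (rule ex1I[of _ ?v], intro conjI)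
    show "?v \<in> Hom N Y T" by (rule vN)
    show "\<epsilon> \<cdot>\<^bsub>M\<^esub> FAr V ?v = w"
    proof (rule nat_eqI[OF comp_Hom[OF M_category VH[OF vN] \<epsilon>H] w])
      fix x assume x: "x \<in> Obj C"
      have "FAr Y (Id C x, \<one>\<^bsub>G\<^esub>) = Id K (FOb Y x)" using functor_Id[OF fY, of x] x by simp
      then show "Cmp (\<epsilon> \<cdot>\<^bsub>M\<^esub> FAr V ?v) x = Cmp w x"
        using x v(2)[OF x one_closed] comp_id[OF K wH[OF x]] by (simp add: \<epsilon> s_def rho_one)
    qed
    fix v' assume v': "v' \<in> Hom N Y T \<and> \<epsilon> \<cdot>\<^bsub>M\<^esub> FAr V v' = w"
    then have v'N: "v' \<in> Hom N Y T" by simp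
    have v'H: "Cmp v' x \<in> Hom K (FOb Y x) (FOb T x)" if "x \<in> Obj C" for x using nat_comp_Hom[OF v'N] that by simp
    have e1: "\<pi> x \<one>\<^bsub>G\<^esub> \<cdot> Cmp v' x = Cmp w x" if "x \<in> Obj C" for x
      using arg_cong[OF v'[THEN conjunct2], of "\<lambda>t. Cmp t x"] that by (simp add: \<epsilon>)
    show "v' = ?v"
    proof (rule nat_eqI[OF v'N vN])
      fix y assume "y \<in> Obj D"
      then have y: "y \<in> Obj C" by simp
      have "Cmp v' y = v y"
      proof (rule product_uniq[OF K cofreeD(3)[OF c y] v'H[OF y] v(1)[OF y]])
        fix k assume k: "k \<in> carrier G"
        note ky = rO_Obj[OF k y] and sh = D_shift(1)[OF k y]
        have p1: "\<pi> (rO k y) \<one>\<^bsub>G\<^esub> \<in> Hom K (FOb T (rO k y)) (FOb X (rO k y))" using cofreeD(5)[OF c ky one_closed] rho_one(1)[OF ky] by simp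
        have "\<pi> y k \<cdot> Cmp v' y = \<pi> (rO k y) \<one>\<^bsub>G\<^esub> \<cdot> (FAr T (Id C (rO k y), k) \<cdot> Cmp v' y)"
          using comp_assoc[OF K v'H[OF y] functor_Hom[OF fT sh] p1] cofree_counit_shift[OF c y k] by simp
        also have "\<dots> = s y k"
          using nat_square[OF v'N sh] comp_assoc[OF K functor_Hom[OF fY sh] v'H[OF ky] p1] e1[OF ky] by (simp add: s_def)
        finally show "\<pi> y k \<cdot> Cmp v' y = \<pi> y k \<cdot> v y" using v(2)[OF y k] by simp
      qed
      then show "Cmp v' y = Cmp ?v y" using y by simp
    qed
  qed
qed

subsection \<open>The free functor\<close>

text \<open>The left Kan extension. A morphism to \<open>y\<close> with element \<open>g\<close> comes from \<open>\<rho>\<^sub>g\<^sup>-\<^sup>1 y\<close>, so the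
  summands are the values of \<open>X\<close> there; indexing them by \<open>h = g\<^sup>-\<^sup>1\<close> makes this the formal dual of
  \<open>cofree\<close>. The morphism \<open>(f, g)\<close> acts by the translate \<open>\<rho>\<^sub>k f\<close> from the summand \<open>k \<otimes> g\<close> to the
  summand \<open>k\<close>, and this describes its action completely because every \<open>h\<close> has the form \<open>k \<otimes> g\<close>.\<close>

definition free :: "('co, 'ca, 'ko, 'ka) fctr \<Rightarrow> ('co, 'ca \<times> 'g, 'ko, 'ka) fctr \<Rightarrow> ('co \<Rightarrow> 'g \<Rightarrow> 'ka) \<Rightarrow> bool" where
  "free X F \<kappa> \<longleftrightarrow> X \<in> Functors C K \<and> F \<in> Functors D K \<and>
    (\<forall>y \<in> Obj C. coproduct K (carrier G) (\<lambda>h. FOb X (rO h y)) (FOb F y) (\<kappa> y)) \<and>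
    (\<forall>f g x y k. (f, g) \<in> Hom D x y \<longrightarrow> k \<in> carrier G \<longrightarrow>
      FAr F (f, g) \<cdot> \<kappa> x (k \<otimes>\<^bsub>G\<^esub> g) = \<kappa> y k \<cdot> FAr X (rA k f))"

lemma right_mult_surj: "h \<in> carrier G \<Longrightarrow> g \<in> carrier G \<Longrightarrow> \<exists>k \<in> carrier G. h = k \<otimes>\<^bsub>G\<^esub> g"
  by (rule bexI[of _ "h \<otimes>\<^bsub>G\<^esub> inv\<^bsub>G\<^esub> g"]) (simp_all add: G_assoc)

lemma right_mult_cancel: "k \<in> carrier G \<Longrightarrow> g \<in> carrier G \<Longrightarrow> k \<otimes>\<^bsub>G\<^esub> g \<otimes>\<^bsub>G\<^esub> inv\<^bsub>G\<^esub> g = k"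
  by (simp add: G_assoc)

lemma free_exists:
  assumes X: "X \<in> Functors C K"
  shows "\<exists>F \<kappa>. free X F \<kappa>"
proof -
  note fX = FunctorsD[OF X]
  have "\<forall>y. \<exists>c \<kappa>. y \<in> Obj C \<longrightarrow> coproduct K (carrier G) (\<lambda>h. FOb X (rO h y)) c \<kappa>"
    using products_exist(2)[OF U bi sG, of "\<lambda>h. FOb X (rO h _)"] functor_Ob[OF fX] by (metis rO_Obj)
  then obtain cc \<kappa> where p: "\<And>y. y \<in> Obj C \<Longrightarrow> coproduct K (carrier G) (\<lambda>h. FOb X (rO h y)) (cc y) (\<kappa> y)" by metis
  note pH = coproductD(2)[OF p]
  have XA: "FAr X (rA k f) \<in> Hom K (FOb X (rO (k \<otimes>\<^bsub>G\<^esub> g) x)) (FOb X (rO k y))" if "(f, g) \<in> Hom D x y" "k \<in> carrier G" for f g x y k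
    using functor_Hom[OF fX rA_Hom[OF that(2), of f "rO g x" y]] that by (simp add: D_Hom_iff rO_mult)
  have arr: "\<exists>h. h \<in> Hom K (cc x) (cc y) \<and> (\<forall>k \<in> carrier G. h \<cdot> \<kappa> x (k \<otimes>\<^bsub>G\<^esub> g) = \<kappa> y k \<cdot> FAr X (rA k f))"
    if fg: "(f, g) \<in> Hom D x y" for f g x y
  proof -
    have x: "x \<in> Obj C" and y: "y \<in> Obj C" using Hom_Obj[OF D_category fg] by auto
    have g: "g \<in> carrier G" using fg by (simp add: D_Hom_iff)
    let ?\<sigma> = "\<lambda>h. \<kappa> y (h \<otimes>\<^bsub>G\<^esub> inv\<^bsub>G\<^esub> g) \<cdot> FAr X (rA (h \<otimes>\<^bsub>G\<^esub> inv\<^bsub>G\<^esub> g) f)"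
    have "\<exists>h. h \<in> Hom K (cc x) (cc y) \<and> (\<forall>i\<in>carrier G. h \<cdot> \<kappa> x i = ?\<sigma> i)"
    proof (rule coproduct_ex[OF p[OF x] coproductD(1)[OF p[OF y]]])
      fix i assume i: "i \<in> carrier G"
      have k: "i \<otimes>\<^bsub>G\<^esub> inv\<^bsub>G\<^esub> g \<in> carrier G" using i g by simp
      have "i \<otimes>\<^bsub>G\<^esub> inv\<^bsub>G\<^esub> g \<otimes>\<^bsub>G\<^esub> g = i" using i g by (simp add: G_assoc)
      then show "?\<sigma> i \<in> Hom K (FOb X (rO i x)) (cc y)" using comp_Hom[OF K XA[OF fg k] pH[OF y k]] by simp
    qed
    then show ?thesis using right_mult_cancel[OF _ g] g by force
  qed
  have "\<exists>h. u \<in> Arr D \<longrightarrow> h \<in> Hom K (cc (Dom D u)) (cc (Cod D u)) \<and>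
      (\<forall>k \<in> carrier G. h \<cdot> \<kappa> (Dom D u) (k \<otimes>\<^bsub>G\<^esub> snd u) = \<kappa> (Cod D u) k \<cdot> FAr X (rA k (fst u)))" for u
    using arr[of "fst u" "snd u" "Dom D u" "Cod D u"] HomI[of u D] by (metis prod.collapse)
  then obtain aa where aa0: "\<And>u. u \<in> Arr D \<Longrightarrow> aa u \<in> Hom K (cc (Dom D u)) (cc (Cod D u)) \<and>
      (\<forall>k \<in> carrier G. aa u \<cdot> \<kappa> (Dom D u) (k \<otimes>\<^bsub>G\<^esub> snd u) = \<kappa> (Cod D u) k \<cdot> FAr X (rA k (fst u)))" by metis
  have aaH: "aa (f, g) \<in> Hom K (cc x) (cc y)" and aa: "\<And>k. k \<in> carrier G \<Longrightarrow> aa (f, g) \<cdot> \<kappa> x (k \<otimes>\<^bsub>G\<^esub> g) = \<kappa> y k \<cdot> FAr X (rA k f)"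
    if "(f, g) \<in> Hom D x y" for f g x y
    using aa0[OF HomD(1)[OF that]] unfolding HomD(2,3)[OF that] by auto
  define F0 where "F0 = \<lparr> FOb = cc, FAr = aa \<rparr>"
  define F where "F = restrict_fctr D F0"
  have "is_functor D K F0"
  proof (rule is_functorI)
    fix x assume "x \<in> Obj D"
    then have x: "x \<in> Obj C" by simp
    show c: "FOb F0 x \<in> Obj K" using coproductD(1)[OF p[OF x]] by (simp add: F0_def)
    have i: "(Id C x, \<one>\<^bsub>G\<^esub>) \<in> Hom D x x" by (rule D_base[OF id_Hom[OF C x]])
    have "aa (Id C x, \<one>\<^bsub>G\<^esub>) = Id K (cc x)"
    proof (rule coproduct_uniq[OF K p[OF x] aaH[OF i] id_Hom[OF K]])
      show "cc x \<in> Obj K" using coproductD(1)[OF p[OF x]] .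
      fix k assume k: "k \<in> carrier G"
      show "aa (Id C x, \<one>\<^bsub>G\<^esub>) \<cdot> \<kappa> x k = Id K (cc x) \<cdot> \<kappa> x k"
        using aa[OF i k] k x functor_Id[OF fX, of "rO k x"] id_comp[OF K pH[OF x k]] comp_id[OF K pH[OF x k]] by simp
    qed
    then show "FAr F0 (Id D x) = Id K (FOb F0 x)" by (simp add: F0_def)
  next
    fix f x y assume "f \<in> Hom D x y"
    then show "FAr F0 f \<in> Hom K (FOb F0 x) (FOb F0 y)" using aaH[of "fst f" "snd f" x y] by (simp add: F0_def)
  next
    fix f f' x y z assume f: "f \<in> Hom D x y" and f': "f' \<in> Hom D y z"
    obtain a g b h where e: "f = (a, g)" "f' = (b, h)" by (metis surj_pair)
    note f = f[unfolded e] and f' = f'[unfolded e]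
    have x: "x \<in> Obj C" and y: "y \<in> Obj C" and z: "z \<in> Obj C" using Hom_Obj[OF D_category f] Hom_Obj[OF D_category f'] by auto
    have 1: "g \<in> carrier G" "a \<in> Hom C (rO g x) y" "h \<in> carrier G" "b \<in> Hom C (rO h y) z" using f f' by (auto simp: D_Hom_iff)
    have ff: "(b \<cdot>\<^bsub>C\<^esub> rA h a, h \<otimes>\<^bsub>G\<^esub> g) \<in> Hom D x z" using comp_Hom[OF D_category f f'] by simp
    have "aa (b \<cdot>\<^bsub>C\<^esub> rA h a, h \<otimes>\<^bsub>G\<^esub> g) = aa (b, h) \<cdot> aa (a, g)"
    proof (rule coproduct_uniq[OF K p[OF x] aaH[OF ff] comp_Hom[OF K aaH[OF f] aaH[OF f']]])
      fix l assume l: "l \<in> carrier G"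
      obtain k where k: "k \<in> carrier G" and l: "l = k \<otimes>\<^bsub>G\<^esub> (h \<otimes>\<^bsub>G\<^esub> g)" using right_mult_surj[OF l mult_closed[OF 1(3,1)]] by blast
      note kh = mult_closed[OF k 1(3)]
      have "rA k (b \<cdot>\<^bsub>C\<^esub> rA h a) = rA k b \<cdot>\<^bsub>C\<^esub> rA (k \<otimes>\<^bsub>G\<^esub> h) a"
        using rA_Comp[OF k rA_Hom[OF 1(3,2)] 1(4)] rA_mult[OF k 1(3) HomD(1)[OF 1(2)]] by simp
      moreover have "rA (k \<otimes>\<^bsub>G\<^esub> h) a \<in> Hom C (rO (k \<otimes>\<^bsub>G\<^esub> h \<otimes>\<^bsub>G\<^esub> g) x) (rO k (rO h y))"
        using rA_Hom[OF kh 1(2)] rO_mult[OF kh 1(1) x] rO_mult[OF k 1(3) y] by simp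
      ultimately have X2: "FAr X (rA k (b \<cdot>\<^bsub>C\<^esub> rA h a)) = FAr X (rA k b) \<cdot> FAr X (rA (k \<otimes>\<^bsub>G\<^esub> h) a)"
        using functor_Comp[OF fX _ rA_Hom[OF k 1(4)]] by simp
      have l': "l = k \<otimes>\<^bsub>G\<^esub> h \<otimes>\<^bsub>G\<^esub> g" using l G_assoc[OF k 1(3,1)] by simp
      have "(aa (b, h) \<cdot> aa (a, g)) \<cdot> \<kappa> x l = aa (b, h) \<cdot> (\<kappa> y (k \<otimes>\<^bsub>G\<^esub> h) \<cdot> FAr X (rA (k \<otimes>\<^bsub>G\<^esub> h) a))"
        unfolding l' using comp_assoc[OF K pH[OF x mult_closed[OF kh 1(1)]] aaH[OF f] aaH[OF f']] aa[OF f kh] by simp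
      also have "\<dots> = (\<kappa> z k \<cdot> FAr X (rA k b)) \<cdot> FAr X (rA (k \<otimes>\<^bsub>G\<^esub> h) a)"
        using comp_assoc[OF K XA[OF f kh] pH[OF y kh] aaH[OF f']] aa[OF f' k] by simp
      also have "\<dots> = \<kappa> z k \<cdot> FAr X (rA k (b \<cdot>\<^bsub>C\<^esub> rA h a))"
        using comp_assoc[OF K XA[OF f kh] XA[OF f' k] pH[OF z k]] X2 by simp
      also have "\<dots> = aa (b \<cdot>\<^bsub>C\<^esub> rA h a, h \<otimes>\<^bsub>G\<^esub> g) \<cdot> \<kappa> x l"
        unfolding l using aa[OF ff k] by simp
      finally show "aa (b \<cdot>\<^bsub>C\<^esub> rA h a, h \<otimes>\<^bsub>G\<^esub> g) \<cdot> \<kappa> x l = (aa (b, h) \<cdot> aa (a, g)) \<cdot> \<kappa> x l" by simp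
    qed
    then show "FAr F0 (f' \<cdot>\<^bsub>D\<^esub> f) = FAr F0 f' \<cdot> FAr F0 f" by (simp add: F0_def e)
  qed
  then have "F \<in> Functors D K" unfolding F_def by (rule restrict_fctr_Functors[OF D_category])
  moreover have "FOb F y = cc y" if "y \<in> Obj C" for y using that by (simp add: F_def F0_def)
  moreover have "FAr F (f, g) = aa (f, g)" if "(f, g) \<in> Hom D x y" for f g x y using HomD(1)[OF that] by (simp add: F_def F0_def)
  ultimately have "free X F \<kappa>" unfolding free_def using X p aa by simp
  then show ?thesis by blast
qed

text \<open>The unit includes the summand at the identity of \<open>G\<close>, and an adjunct is \<open>u\<close> at \<open>\<rho>\<^sub>h y\<close>
  followed by the inverse of the isomorphism \<open>y \<rightarrow> \<rho>\<^sub>h y\<close>.\<close>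

lemma free_universal:
  assumes X: "X \<in> Functors C K"
  shows "\<exists>F \<eta>. F \<in> Obj N \<and> \<eta> \<in> Hom M X (FOb V F) \<and>
    (\<forall>Y \<in> Obj N. \<forall>u \<in> Hom M X (FOb V Y). \<exists>!v. v \<in> Hom N F Y \<and> FAr V v \<cdot>\<^bsub>M\<^esub> \<eta> = u)"
proof -
  obtain F \<kappa> where free: "free X F \<kappa>" using free_exists[OF X] by blast
  have F: "F \<in> Functors D K" using free unfolding free_def by auto
  have cop: "coproduct K (carrier G) (\<lambda>h. FOb X (rO h y)) (FOb F y) (\<kappa> y)" if "y \<in> Obj C" for y using free that unfolding free_def by auto
  have nat: "FAr F (f, g) \<cdot> \<kappa> x (k \<otimes>\<^bsub>G\<^esub> g) = \<kappa> y k \<cdot> FAr X (rA k f)" if "(f, g) \<in> Hom D x y" "k \<in> carrier G" for f g x y k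
    using free that unfolding free_def by blast
  have kH: "\<kappa> y k \<in> Hom K (FOb X (rO k y)) (FOb F y)" if "y \<in> Obj C" "k \<in> carrier G" for y k using coproductD(2)[OF cop[OF that(1)] that(2)] by simp
  note fX = FunctorsD[OF X] and fF = FunctorsD[OF F]
  define \<eta> where "\<eta> = \<lparr> Src = X, Tgt = FOb V F, Cmp = restrict (\<lambda>y. \<kappa> y \<one>\<^bsub>G\<^esub>) (Obj C) \<rparr>"
  have VF: "FOb V F \<in> Functors C K" using functor_Ob[OF V_functor] F by simp
  have k1: "\<kappa> x \<one>\<^bsub>G\<^esub> \<in> Hom K (FOb X x) (FOb F x)" if "x \<in> Obj C" for x using kH[OF that one_closed] rho_one(1)[OF that] by simp
  have \<eta>: "\<eta> \<in> Hom M X (FOb V F)"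
    unfolding \<eta>_def
  proof (rule nat_HomI[OF C X VF])
    show "\<kappa> x \<one>\<^bsub>G\<^esub> \<in> Hom K (FOb X x) (FOb (FOb V F) x)" if "x \<in> Obj C" for x using k1[OF that] that by simp
    show "\<kappa> y \<one>\<^bsub>G\<^esub> \<cdot> FAr X f = FAr (FOb V F) f \<cdot> \<kappa> x \<one>\<^bsub>G\<^esub>" if "f \<in> Hom C x y" for f x y
      using nat[OF D_base[OF that] one_closed] HomD(1)[OF that] rho_one by simp
  qed
  have shift: "FAr F (Id C y, inv\<^bsub>G\<^esub> k) \<cdot> \<kappa> (rO k y) \<one>\<^bsub>G\<^esub> = \<kappa> y k" if y: "y \<in> Obj C" and k: "k \<in> carrier G" for y k
    using nat[OF D_shift(2)[OF k y] k] k y functor_Id[OF fX, of "rO k y"] comp_id[OF K kH[OF y k]] by simp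
  have "\<exists>!v. v \<in> Hom N F Y \<and> FAr V v \<cdot>\<^bsub>M\<^esub> \<eta> = u" if "Y \<in> Obj N" and u: "u \<in> Hom M X (FOb V Y)" for Y u
  proof -
    have Y: "Y \<in> Functors D K" using that(1) by simp
    note fY = FunctorsD[OF Y]
    have uH: "Cmp u x \<in> Hom K (FOb X x) (FOb Y x)" if "x \<in> Obj C" for x using nat_comp_Hom[OF u that] that by simp
    have usq: "Cmp u y \<cdot> FAr X f = FAr Y (f, \<one>\<^bsub>G\<^esub>) \<cdot> Cmp u x" if "f \<in> Hom C x y" for f x y
      using nat_square[OF u that] HomD(1)[OF that] by simp
    define s where "s = (\<lambda>y k. FAr Y (Id C y, inv\<^bsub>G\<^esub> k) \<cdot> Cmp u (rO k y))"
    have sH: "s y k \<in> Hom K (FOb X (rO k y)) (FOb Y y)" if "y \<in> Obj C" "k \<in> carrier G" for y k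
      unfolding s_def using comp_Hom[OF K uH functor_Hom[OF fY D_shift(2)[OF that(2,1)]]] that by simp
    have "\<exists>h. y \<in> Obj C \<longrightarrow> h \<in> Hom K (FOb F y) (FOb Y y) \<and> (\<forall>k \<in> carrier G. h \<cdot> \<kappa> y k = s y k)" for y
      using coproduct_ex[OF cop[of y] functor_Ob[OF fY, of y] sH[of y]] by fastforce
    then obtain v where v: "\<And>y. y \<in> Obj C \<Longrightarrow> v y \<in> Hom K (FOb F y) (FOb Y y)"
      "\<And>y k. y \<in> Obj C \<Longrightarrow> k \<in> carrier G \<Longrightarrow> v y \<cdot> \<kappa> y k = s y k" by metis
    let ?v = "\<lparr> Src = F, Tgt = Y, Cmp = restrict v (Obj D) \<rparr>"
    have vN: "?v \<in> Hom N F Y"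
    proof (rule nat_HomI[OF D_category F Y])
      show "v x \<in> Hom K (FOb F x) (FOb Y x)" if "x \<in> Obj D" for x using v(1) that by simp
      fix w x y assume w: "w \<in> Hom D x y"
      obtain f g where e: "w = (f, g)" by (metis surj_pair)
      note w = w[unfolded e]
      have x: "x \<in> Obj C" and y: "y \<in> Obj C" using Hom_Obj[OF D_category w] by auto
      have fg: "g \<in> carrier G" "f \<in> Hom C (rO g x) y" using w by (auto simp: D_Hom_iff)
      note Yw = functor_Hom[OF fY w] and Fw = functor_Hom[OF fF w]
      have "v y \<cdot> FAr F (f, g) = FAr Y (f, g) \<cdot> v x"
      proof (rule coproduct_uniq[OF K cop[OF x] comp_Hom[OF K Fw v(1)[OF y]] comp_Hom[OF K v(1)[OF x] Yw]])
        fix l assume l: "l \<in> carrier G"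
        obtain k where k: "k \<in> carrier G" and l: "l = k \<otimes>\<^bsub>G\<^esub> g" using right_mult_surj[OF l fg(1)] by blast
        note kg = mult_closed[OF k fg(1)]
        note ky = rO_Obj[OF k y] and kx = rO_Obj[OF kg x]
        have rkf: "rA k f \<in> Hom C (rO (k \<otimes>\<^bsub>G\<^esub> g) x) (rO k y)" using rA_Hom[OF k fg(2)] rO_mult[OF k fg(1) x] by simp
        note sh1 = D_shift(2)[OF k y] and sh2 = D_shift(2)[OF kg x] and b = D_base[OF rkf]
        have ik: "inv\<^bsub>G\<^esub> k = g \<otimes>\<^bsub>G\<^esub> inv\<^bsub>G\<^esub> (k \<otimes>\<^bsub>G\<^esub> g)"
          using k fg(1) G_assoc[OF fg(1) inv_closed[OF fg(1)] inv_closed[OF k]] by (simp add: inv_mult)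
        have c1: "rA (inv\<^bsub>G\<^esub> k) (rA k f) = f" using k HomD(1)[OF fg(2)] by simp
        have comp: "(f, g) \<cdot>\<^bsub>D\<^esub> (Id C x, inv\<^bsub>G\<^esub> (k \<otimes>\<^bsub>G\<^esub> g)) = (Id C y, inv\<^bsub>G\<^esub> k) \<cdot>\<^bsub>D\<^esub> (rA k f, \<one>\<^bsub>G\<^esub>)"
          using comp_id[OF C fg(2)] id_comp[OF C fg(2)] k x fg(1) c1 ik[symmetric] by simp
        have "(v y \<cdot> FAr F (f, g)) \<cdot> \<kappa> x l = s y k \<cdot> FAr X (rA k f)"
          unfolding l using comp_assoc[OF K kH[OF x kg] Fw v(1)[OF y]] nat[OF w k]
            comp_assoc[OF K functor_Hom[OF fX rkf] kH[OF y k] v(1)[OF y]] v(2)[OF y k] by simp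
        also have "\<dots> = (FAr Y (Id C y, inv\<^bsub>G\<^esub> k) \<cdot> FAr Y (rA k f, \<one>\<^bsub>G\<^esub>)) \<cdot> Cmp u (rO (k \<otimes>\<^bsub>G\<^esub> g) x)"
          unfolding s_def using comp_assoc[OF K functor_Hom[OF fX rkf] uH[OF ky] functor_Hom[OF fY sh1]] usq[OF rkf]
            comp_assoc[OF K uH[OF kx] functor_Hom[OF fY b] functor_Hom[OF fY sh1]] by simp
        also have "FAr Y (Id C y, inv\<^bsub>G\<^esub> k) \<cdot> FAr Y (rA k f, \<one>\<^bsub>G\<^esub>) = FAr Y (f, g) \<cdot> FAr Y (Id C x, inv\<^bsub>G\<^esub> (k \<otimes>\<^bsub>G\<^esub> g))"
          using functor_Comp[OF fY b sh1] functor_Comp[OF fY sh2 w] comp by simp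
        also have "(FAr Y (f, g) \<cdot> FAr Y (Id C x, inv\<^bsub>G\<^esub> (k \<otimes>\<^bsub>G\<^esub> g))) \<cdot> Cmp u (rO (k \<otimes>\<^bsub>G\<^esub> g) x) = FAr Y (f, g) \<cdot> s x l"
          unfolding s_def l by (rule comp_assoc[OF K uH[OF kx] functor_Hom[OF fY sh2] Yw])
        also have "\<dots> = (FAr Y (f, g) \<cdot> v x) \<cdot> \<kappa> x l"
          unfolding l using comp_assoc[OF K kH[OF x kg] v(1)[OF x] Yw] v(2)[OF x kg] by simp
        finally show "(v y \<cdot> FAr F (f, g)) \<cdot> \<kappa> x l = (FAr Y (f, g) \<cdot> v x) \<cdot> \<kappa> x l" .
      qed
      then show "v y \<cdot> FAr F w = FAr Y w \<cdot> v x" by (simp add: e)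
    qed
    have VH: "FAr V t \<in> Hom M (FOb V F) (FOb V Y)" if "t \<in> Hom N F Y" for t by (rule functor_Hom[OF V_functor that])
    show ?thesis
    proof (rule ex1I[of _ ?v], intro conjI)
      show "?v \<in> Hom N F Y" by (rule vN)
      show "FAr V ?v \<cdot>\<^bsub>M\<^esub> \<eta> = u"
      proof (rule nat_eqI[OF comp_Hom[OF M_category \<eta> VH[OF vN]] u])
        fix x assume x: "x \<in> Obj C"
        have "FAr Y (Id C x, \<one>\<^bsub>G\<^esub>) = Id K (FOb Y x)" using functor_Id[OF fY, of x] x by simp
        then show "Cmp (FAr V ?v \<cdot>\<^bsub>M\<^esub> \<eta>) x = Cmp u x"
          using x v(2)[OF x one_closed] id_comp[OF K uH[OF x]] by (simp add: \<eta>_def s_def rho_one)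
      qed
      fix v' assume v': "v' \<in> Hom N F Y \<and> FAr V v' \<cdot>\<^bsub>M\<^esub> \<eta> = u"
      then have v'N: "v' \<in> Hom N F Y" by simp
      have v'H: "Cmp v' x \<in> Hom K (FOb F x) (FOb Y x)" if "x \<in> Obj C" for x using nat_comp_Hom[OF v'N] that by simp
      have e1: "Cmp v' x \<cdot> \<kappa> x \<one>\<^bsub>G\<^esub> = Cmp u x" if "x \<in> Obj C" for x
        using arg_cong[OF v'[THEN conjunct2], of "\<lambda>t. Cmp t x"] that by (simp add: \<eta>_def)
      show "v' = ?v"
      proof (rule nat_eqI[OF v'N vN])
        fix y assume "y \<in> Obj D"
        then have y: "y \<in> Obj C" by simp
        have "Cmp v' y = v y"
        proof (rule coproduct_uniq[OF K cop[OF y] v'H[OF y] v(1)[OF y]])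
          fix k assume k: "k \<in> carrier G"
          note ky = rO_Obj[OF k y] and sh = D_shift(2)[OF k y]
          have "Cmp v' y \<cdot> \<kappa> y k = (Cmp v' y \<cdot> FAr F (Id C y, inv\<^bsub>G\<^esub> k)) \<cdot> \<kappa> (rO k y) \<one>\<^bsub>G\<^esub>"
            using comp_assoc[OF K k1[OF ky] functor_Hom[OF fF sh] v'H[OF y]] shift[OF y k] by simp
          also have "\<dots> = s y k"
            using nat_square[OF v'N sh] comp_assoc[OF K k1[OF ky] v'H[OF ky] functor_Hom[OF fY sh]] e1[OF ky] by (simp add: s_def)
          finally show "Cmp v' y \<cdot> \<kappa> y k = v y \<cdot> \<kappa> y k" using v(2)[OF y k] by simp
        qed
        then show "Cmp v' y = Cmp ?v y" using y by simp
      qed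
    qed
  qed
  then show ?thesis using F \<eta> by (intro exI[of _ F] exI[of _ \<eta>]) simp
qed

end

section \<open>Functors with adjoints\<close>

definition universal_from :: "('n, 'b) cat \<Rightarrow> ('m, 'a) cat \<Rightarrow> ('n, 'b, 'm, 'a) fctr \<Rightarrow> 'm \<Rightarrow> 'n \<Rightarrow> 'a \<Rightarrow> bool" where
  "universal_from N M V X F \<eta> \<longleftrightarrow> F \<in> Obj N \<and> \<eta> \<in> Hom M X (FOb V F) \<and>
    (\<forall>Y \<in> Obj N. \<forall>u \<in> Hom M X (FOb V Y). \<exists>!v. v \<in> Hom N F Y \<and> FAr V v \<cdot>\<^bsub>M\<^esub> \<eta> = u)"

definition universal_to :: "('n, 'b) cat \<Rightarrow> ('m, 'a) cat \<Rightarrow> ('n, 'b, 'm, 'a) fctr \<Rightarrow> 'm \<Rightarrow> 'n \<Rightarrow> 'a \<Rightarrow> bool" where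
  "universal_to N M V X T \<epsilon> \<longleftrightarrow> T \<in> Obj N \<and> \<epsilon> \<in> Hom M (FOb V T) X \<and>
    (\<forall>Y \<in> Obj N. \<forall>w \<in> Hom M (FOb V Y) X. \<exists>!v. v \<in> Hom N Y T \<and> \<epsilon> \<cdot>\<^bsub>M\<^esub> FAr V v = w)"

definition post_fctr :: "('n, 'b, 'm, 'a) fctr \<Rightarrow> ('j, 'k, 'n, 'b) fctr \<Rightarrow> ('j, 'k, 'm, 'a) fctr" where
  "post_fctr V Z = \<lparr> FOb = \<lambda>j. FOb V (FOb Z j), FAr = \<lambda>u. FAr V (FAr Z u) \<rparr>"

lemma post_fctr_simps [simp]:
  "FOb (post_fctr V Z) j = FOb V (FOb Z j)" "FAr (post_fctr V Z) u = FAr V (FAr Z u)"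
  by (simp_all add: post_fctr_def)

lemma post_functor:
  assumes "is_functor J N Z" "is_functor N M V"
  shows "is_functor J M (post_fctr V Z)"
  by (rule is_functorI)
    (use functor_Ob[OF assms(2) functor_Ob[OF assms(1)]] functor_Hom[OF assms(2) functor_Hom[OF assms(1)]]
      functor_Id[OF assms(1)] functor_Id[OF assms(2) functor_Ob[OF assms(1)]] functor_Comp[OF assms(1)]
      functor_Comp[OF assms(2) functor_Hom[OF assms(1)] functor_Hom[OF assms(1)]] in auto)

text \<open>Adjoints are given objectwise by universal arrows, the form in which free and cofree
  functors arise from coproducts and products.\<close>

locale adjoint_functor =
  fixes U :: "'u itself" and N :: "('n, 'b) cat" and M :: "('m, 'a) cat" (structure) and V :: "('n, 'b, 'm, 'a) fctr"
  assumes U: "universe U" and biN: "bicomplete U N" and M: "category M" and V: "is_functor N M V"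
    and left: "\<And>X. X \<in> Obj M \<Longrightarrow> \<exists>F \<eta>. universal_from N M V X F \<eta>"
    and right: "\<And>X. X \<in> Obj M \<Longrightarrow> \<exists>T \<epsilon>. universal_to N M V X T \<epsilon>"
begin

lemma N: "category N" using biN by (rule bicomplete_category)

lemma VH: "f \<in> Hom N x y \<Longrightarrow> FAr V f \<in> Hom M (FOb V x) (FOb V y)"
  by (rule functor_Hom[OF V])

lemma VC: "f \<in> Hom N x y \<Longrightarrow> g \<in> Hom N y z \<Longrightarrow> FAr V (g \<cdot>\<^bsub>N\<^esub> f) = FAr V g \<cdot> FAr V f"
  by (rule functor_Comp[OF V])

lemma from_ex:
  assumes "universal_from N M V X F \<eta>" "u \<in> Hom M X (FOb V Y)" "Y \<in> Obj N"
  shows "\<exists>v. v \<in> Hom N F Y \<and> FAr V v \<cdot> \<eta> = u"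
  using assms unfolding universal_from_def by blast

lemma from_uniq:
  assumes F: "universal_from N M V X F \<eta>" and v: "v \<in> Hom N F Y" "v' \<in> Hom N F Y"
    and eq: "FAr V v \<cdot> \<eta> = FAr V v' \<cdot> \<eta>"
  shows "v = v'"
proof -
  have \<eta>: "\<eta> \<in> Hom M X (FOb V F)" using F by (simp add: universal_from_def)
  have "\<exists>!w. w \<in> Hom N F Y \<and> FAr V w \<cdot> \<eta> = FAr V v' \<cdot> \<eta>"
    using F comp_Hom[OF M \<eta> VH[OF v(2)]] Hom_Obj(2)[OF N v(1)] unfolding universal_from_def by blast
  then show ?thesis using v eq by blast
qed

lemma to_ex:
  assumes "universal_to N M V X T \<epsilon>" "w \<in> Hom M (FOb V Y) X" "Y \<in> Obj N"
  shows "\<exists>v. v \<in> Hom N Y T \<and> \<epsilon> \<cdot> FAr V v = w"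
  using assms unfolding universal_to_def by blast

lemma to_uniq:
  assumes T: "universal_to N M V X T \<epsilon>" and v: "v \<in> Hom N Y T" "v' \<in> Hom N Y T"
    and eq: "\<epsilon> \<cdot> FAr V v = \<epsilon> \<cdot> FAr V v'"
  shows "v = v'"
proof -
  have \<epsilon>: "\<epsilon> \<in> Hom M (FOb V T) X" using T by (simp add: universal_to_def)
  have "\<exists>!w. w \<in> Hom N Y T \<and> \<epsilon> \<cdot> FAr V w = \<epsilon> \<cdot> FAr V v'"
    using T comp_Hom[OF M VH[OF v(2)] \<epsilon>] Hom_Obj(1)[OF N v(1)] unfolding universal_to_def by blast
  then show ?thesis using v eq by blast
qed

text \<open>This is where the right adjoint of \<open>V\<close> enters: cocones on \<open>V Z\<close> with vertex \<open>d\<close> correspond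
  to cocones on \<open>Z\<close> with the cofree object on \<open>d\<close> as vertex.\<close>

lemma preserves_colimits:
  assumes J: "category J" and Z: "is_functor J N Z" and c: "is_colimit J N Z c \<tau>"
  shows "is_colimit J M (post_fctr V Z) (FOb V c) (\<lambda>j. FAr V (\<tau> j))"
proof (rule colimitI)
  note coc = coconeD[OF colimit_cocone[OF c]]
  show "is_cocone J M (post_fctr V Z) (FOb V c) (\<lambda>j. FAr V (\<tau> j))"
  proof (rule coconeI)
    show "FOb V c \<in> Obj M" using functor_Ob[OF V coc(1)] .
    show "FAr V (\<tau> j) \<in> Hom M (FOb (post_fctr V Z) j) (FOb V c)" if "j \<in> Obj J" for j using VH[OF coc(2)[OF that]] by simp
    show "FAr V (\<tau> j) \<cdot> FAr (post_fctr V Z) u = FAr V (\<tau> i)" if "u \<in> Hom J i j" for u i j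
      using VC[OF functor_Hom[OF Z that] coc(2)[OF Hom_Obj(2)[OF J that]]] coc(3)[OF that] by simp
  qed
next
  note coc = coconeD[OF colimit_cocone[OF c]]
  fix d \<sigma> assume d: "is_cocone J M (post_fctr V Z) d \<sigma>"
  note dc = coconeD[OF d]
  obtain T \<epsilon> where T: "universal_to N M V d T \<epsilon>" using right[OF dc(1)] by blast
  have \<epsilon>: "\<epsilon> \<in> Hom M (FOb V T) d" and TO: "T \<in> Obj N" using T by (auto simp: universal_to_def)
  have "\<exists>v. j \<in> Obj J \<longrightarrow> v \<in> Hom N (FOb Z j) T \<and> \<epsilon> \<cdot> FAr V v = \<sigma> j" for j
    using to_ex[OF T _ functor_Ob[OF Z], of "\<sigma> j" j] dc(2)[of j] by auto
  then obtain s where s: "\<And>j. j \<in> Obj J \<Longrightarrow> s j \<in> Hom N (FOb Z j) T" "\<And>j. j \<in> Obj J \<Longrightarrow> \<epsilon> \<cdot> FAr V (s j) = \<sigma> j" by metis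
  have "is_cocone J N Z T s"
  proof (rule coconeI[OF TO s(1)])
    fix u i j assume u: "u \<in> Hom J i j"
    note i = Hom_Obj(1)[OF J u] and j = Hom_Obj(2)[OF J u]
    note Zu = functor_Hom[OF Z u]
    show "s j \<cdot>\<^bsub>N\<^esub> FAr Z u = s i"
    proof (rule to_uniq[OF T comp_Hom[OF N Zu s(1)[OF j]] s(1)[OF i]])
      show "\<epsilon> \<cdot> FAr V (s j \<cdot>\<^bsub>N\<^esub> FAr Z u) = \<epsilon> \<cdot> FAr V (s i)"
        using VC[OF Zu s(1)[OF j]] comp_assoc[OF M VH[OF Zu] VH[OF s(1)[OF j]] \<epsilon>] s(2)[OF j] s(2)[OF i] dc(3)[OF u] by simp
    qed
  qed
  then obtain h where h: "h \<in> Hom N c T" "\<And>j. j \<in> Obj J \<Longrightarrow> h \<cdot>\<^bsub>N\<^esub> \<tau> j = s j" using colimit_ex[OF c] by blast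
  have "(\<epsilon> \<cdot> FAr V h) \<cdot> FAr V (\<tau> j) = \<sigma> j" if j: "j \<in> Obj J" for j
    using comp_assoc[OF M VH[OF coc(2)[OF j]] VH[OF h(1)] \<epsilon>] VC[OF coc(2)[OF j] h(1)] h(2)[OF j] s(2)[OF j] by simp
  then show "\<exists>h. h \<in> Hom M (FOb V c) d \<and> (\<forall>j\<in>Obj J. h \<cdot> FAr V (\<tau> j) = \<sigma> j)"
    using comp_Hom[OF M VH[OF h(1)] \<epsilon>] by blast
next
  note coc = coconeD[OF colimit_cocone[OF c]]
  fix d h h' assume h: "h \<in> Hom M (FOb V c) d" "h' \<in> Hom M (FOb V c) d"
    and eq: "\<And>j. j \<in> Obj J \<Longrightarrow> h \<cdot> FAr V (\<tau> j) = h' \<cdot> FAr V (\<tau> j)"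
  obtain T \<epsilon> where T: "universal_to N M V d T \<epsilon>" using right[OF Hom_Obj(2)[OF M h(1)]] by blast
  have \<epsilon>: "\<epsilon> \<in> Hom M (FOb V T) d" using T by (auto simp: universal_to_def)
  obtain k where k: "k \<in> Hom N c T" "\<epsilon> \<cdot> FAr V k = h" using to_ex[OF T h(1) coc(1)] by blast
  obtain k' where k': "k' \<in> Hom N c T" "\<epsilon> \<cdot> FAr V k' = h'" using to_ex[OF T h(2) coc(1)] by blast
  have "k = k'"
  proof (rule colimit_uniq[OF N J Z c k(1) k'(1)])
    fix j assume j: "j \<in> Obj J"
    note tj = coc(2)[OF j]
    show "k \<cdot>\<^bsub>N\<^esub> \<tau> j = k' \<cdot>\<^bsub>N\<^esub> \<tau> j"
    proof (rule to_uniq[OF T comp_Hom[OF N tj k(1)] comp_Hom[OF N tj k'(1)]])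
      show "\<epsilon> \<cdot> FAr V (k \<cdot>\<^bsub>N\<^esub> \<tau> j) = \<epsilon> \<cdot> FAr V (k' \<cdot>\<^bsub>N\<^esub> \<tau> j)"
        using VC[OF tj k(1)] VC[OF tj k'(1)] comp_assoc[OF M VH[OF tj] VH[OF k(1)] \<epsilon>] comp_assoc[OF M VH[OF tj] VH[OF k'(1)] \<epsilon>]
          k(2) k'(2) eq[OF j] by simp
    qed
  qed
  then show "h = h'" using k k' by simp
qed

lemma post_lambda_sequence:
  assumes r: "Well_order r" and Z: "lambda_sequence r N Z"
  shows "lambda_sequence r M (post_fctr V Z)"
  unfolding lambda_sequence_def
proof (intro conjI allI impI)
  have fZ: "is_functor (ord_cat r) N Z" using Z by (simp add: lambda_sequence_def)
  show "is_functor (ord_cat r) M (post_fctr V Z)" by (rule post_functor[OF fZ V])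
  fix b assume "limit_elem r b"
  then have c: "is_colimit (ord_cat (Restr r (underS r b))) N Z (FOb Z b) (\<lambda>a. FAr Z (a, b))"
    using Z by (simp add: lambda_sequence_def)
  show "is_colimit (ord_cat (Restr r (underS r b))) M (post_fctr V Z) (FOb (post_fctr V Z) b) (\<lambda>a. FAr (post_fctr V Z) (a, b))"
    using preserves_colimits[OF wo_category[OF Restr_wo[OF r]] ord_functor_Restr[OF r fZ underS_subset] c] by simp
qed

text \<open>Maps out of the free object \<open>F\<close> on \<open>A\<close> are maps out of \<open>A\<close> after applying \<open>V\<close>, and \<open>V\<close>
  preserves the colimits of sequences.\<close>

lemma free_small:
  assumes A: "small_rel U M W A" and F: "universal_from N M V A F \<eta>" and W: "\<And>f. f \<in> W' \<Longrightarrow> FAr V f \<in> W"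
  shows "small_rel U N W' F"
proof -
  obtain \<kappa> :: "'u rel" where \<kappa>: "Card_order \<kappa>" "\<kappa> <o |UNIV :: 'u set|" "card_small_rel \<kappa> M W A"
    using A unfolding small_rel_def by blast
  have \<eta>: "\<eta> \<in> Hom M A (FOb V F)" using F by (simp add: universal_from_def)
  have "seq_small r N Z c \<tau> F"
    if r: "Card_order r" "infinite (Field r)" "regularCard r" "r <o |UNIV :: 'u set|" "\<kappa> \<le>o r"
      and Z: "lambda_sequence r N Z" and ZW: "\<And>a b. succ_elem r a b \<Longrightarrow> FAr Z (a, b) \<in> W'"
      and c: "is_colimit (ord_cat r) N Z c \<tau>" for r :: "'u rel" and Z c \<tau>
  proof -
    have wr: "Well_order r" using r(1) by (rule Card_order_wo)
    have fZ: "is_functor (ord_cat r) N Z" using Z by (simp add: lambda_sequence_def)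
    note coc = ord_coconeD[OF colimit_cocone[OF c]]
    have "FAr (post_fctr V Z) (a, b) \<in> W" if "succ_elem r a b" for a b using W[OF ZW[OF that]] by simp
    then have ss: "seq_small r M (post_fctr V Z) (FOb V c) (\<lambda>j. FAr V (\<tau> j)) A"
      using \<kappa>(3) r post_lambda_sequence[OF wr Z] preserves_colimits[OF wo_category[OF wr] fZ c]
      unfolding card_small_rel_iff[OF M] by blast
    show ?thesis
      unfolding seq_small_def
    proof (intro conjI ballI impI)
      fix f assume f: "f \<in> Hom N F c"
      obtain b g where b: "b \<in> Field r" "g \<in> Hom M A (FOb V (FOb Z b))" "FAr V (\<tau> b) \<cdot> g = FAr V f \<cdot> \<eta>"
        using ss comp_Hom[OF M \<eta> VH[OF f]] unfolding seq_small_def post_fctr_simps by blast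
      obtain g' where g': "g' \<in> Hom N F (FOb Z b)" "FAr V g' \<cdot> \<eta> = g"
        using from_ex[OF F b(2) ord_functor_Ob[OF fZ b(1)]] by blast
      have "\<tau> b \<cdot>\<^bsub>N\<^esub> g' = f"
        by (rule from_uniq[OF F comp_Hom[OF N g'(1) coc(2)[OF b(1)]] f])
          (use VC[OF g'(1) coc(2)[OF b(1)]] comp_assoc[OF M \<eta> VH[OF g'(1)] VH[OF coc(2)[OF b(1)]]] g'(2) b(3) in simp)
      then show "\<exists>b\<in>Field r. \<exists>g\<in>Hom N F (FOb Z b). \<tau> b \<cdot>\<^bsub>N\<^esub> g = f" using b(1) g'(1) by blast
    next
      fix b g g' assume b: "b \<in> Field r" and g: "g \<in> Hom N F (FOb Z b)" "g' \<in> Hom N F (FOb Z b)" and eq: "\<tau> b \<cdot>\<^bsub>N\<^esub> g = \<tau> b \<cdot>\<^bsub>N\<^esub> g'"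
      note tb = coc(2)[OF b]
      have "FAr V (\<tau> b) \<cdot> (FAr V g \<cdot> \<eta>) = FAr V (\<tau> b) \<cdot> (FAr V g' \<cdot> \<eta>)"
        using comp_assoc[OF M \<eta> VH[OF g(1)] VH[OF tb]] comp_assoc[OF M \<eta> VH[OF g(2)] VH[OF tb]] VC[OF g(1) tb] VC[OF g(2) tb] eq by simp
      then obtain b' where b': "(b, b') \<in> r" "FAr V (FAr Z (b, b')) \<cdot> (FAr V g \<cdot> \<eta>) = FAr V (FAr Z (b, b')) \<cdot> (FAr V g' \<cdot> \<eta>)"
        using ss b comp_Hom[OF M \<eta> VH[OF g(1)]] comp_Hom[OF M \<eta> VH[OF g(2)]] unfolding seq_small_def post_fctr_simps by blast
      note Zb = ord_functor_Hom[OF fZ b'(1)]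
      have "FAr Z (b, b') \<cdot>\<^bsub>N\<^esub> g = FAr Z (b, b') \<cdot>\<^bsub>N\<^esub> g'"
        by (rule from_uniq[OF F comp_Hom[OF N g(1) Zb] comp_Hom[OF N g(2) Zb]])
          (use comp_assoc[OF M \<eta> VH[OF g(1)] VH[OF Zb]] comp_assoc[OF M \<eta> VH[OF g(2)] VH[OF Zb]] VC[OF g(1) Zb] VC[OF g(2) Zb] b'(2) in simp)
      then show "\<exists>b'. (b, b') \<in> r \<and> FAr Z (b, b') \<cdot>\<^bsub>N\<^esub> g = FAr Z (b, b') \<cdot>\<^bsub>N\<^esub> g'" using b'(1) by blast
    qed
  qed
  then have "card_small_rel \<kappa> N W' F" unfolding card_small_rel_iff[OF N] by blast
  then show ?thesis using \<kappa> unfolding small_rel_def by blast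
qed

text \<open>The image of \<open>i\<close> under the left adjoint; lifting problems correspond under the adjunction.\<close>

lemma free_arrow:
  assumes i: "i \<in> Hom M A B" and A: "universal_from N M V A FA \<eta>A" and B: "universal_from N M V B FB \<eta>B"
  shows "\<exists>i'. i' \<in> Hom N FA FB \<and> FAr V i' \<cdot> \<eta>A = \<eta>B \<cdot> i \<and>
    (\<forall>y \<in> Arr N. has_lift N i' y \<longleftrightarrow> has_lift M i (FAr V y))"
proof -
  have FA: "FA \<in> Obj N" "\<eta>A \<in> Hom M A (FOb V FA)" and FB: "FB \<in> Obj N" "\<eta>B \<in> Hom M B (FOb V FB)"
    using A B by (auto simp: universal_from_def)
  obtain i' where i': "i' \<in> Hom N FA FB" "FAr V i' \<cdot> \<eta>A = \<eta>B \<cdot> i"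
    using from_ex[OF A comp_Hom[OF M i FB(2)] FB(1)] by blast
  have "has_lift N i' y \<longleftrightarrow> has_lift M i (FAr V y)" if "y \<in> Arr N" for y
  proof
    note y = HomI[OF that]
    let ?P = "Dom N y" and ?Q = "Cod N y"
    have P: "?P \<in> Obj N" and Q: "?Q \<in> Obj N" using Hom_Obj[OF N y] by auto
    {
      assume l: "has_lift N i' y"
      show "has_lift M i (FAr V y)"
      proof (rule has_liftI[OF i VH[OF y]])
        fix u v assume u: "u \<in> Hom M A (FOb V ?P)" and v: "v \<in> Hom M B (FOb V ?Q)" and e: "v \<cdot> i = FAr V y \<cdot> u"
        obtain u' where u': "u' \<in> Hom N FA ?P" "FAr V u' \<cdot> \<eta>A = u" using from_ex[OF A u P] by blast
        obtain v' where v': "v' \<in> Hom N FB ?Q" "FAr V v' \<cdot> \<eta>B = v" using from_ex[OF B v Q] by blast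
        have "v' \<cdot>\<^bsub>N\<^esub> i' = y \<cdot>\<^bsub>N\<^esub> u'"
        proof (rule from_uniq[OF A comp_Hom[OF N i'(1) v'(1)] comp_Hom[OF N u'(1) y]])
          have "FAr V (v' \<cdot>\<^bsub>N\<^esub> i') \<cdot> \<eta>A = v \<cdot> i"
            using VC[OF i'(1) v'(1)] comp_assoc[OF M FA(2) VH[OF i'(1)] VH[OF v'(1)]] i'(2) comp_assoc[OF M i FB(2) VH[OF v'(1)]] v'(2) by simp
          moreover have "FAr V (y \<cdot>\<^bsub>N\<^esub> u') \<cdot> \<eta>A = FAr V y \<cdot> u"
            using VC[OF u'(1) y] comp_assoc[OF M FA(2) VH[OF u'(1)] VH[OF y]] u'(2) by simp
          ultimately show "FAr V (v' \<cdot>\<^bsub>N\<^esub> i') \<cdot> \<eta>A = FAr V (y \<cdot>\<^bsub>N\<^esub> u') \<cdot> \<eta>A" using e by simp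
        qed
        then obtain h where h: "h \<in> Hom N FB ?P" "h \<cdot>\<^bsub>N\<^esub> i' = u'" "y \<cdot>\<^bsub>N\<^esub> h = v'"
          using has_liftD[OF l i'(1) y u'(1) v'(1)] by blast
        have "(FAr V h \<cdot> \<eta>B) \<cdot> i = u"
          using comp_assoc[OF M i FB(2) VH[OF h(1)]] i'(2) comp_assoc[OF M FA(2) VH[OF i'(1)] VH[OF h(1)]] VC[OF i'(1) h(1)] h(2) u'(2) by simp
        moreover have "FAr V y \<cdot> (FAr V h \<cdot> \<eta>B) = v"
          using comp_assoc[OF M FB(2) VH[OF h(1)] VH[OF y]] VC[OF h(1) y] h(3) v'(2) by simp
        ultimately show "\<exists>h. h \<in> Hom M B (FOb V ?P) \<and> h \<cdot> i = u \<and> FAr V y \<cdot> h = v"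
          using comp_Hom[OF M FB(2) VH[OF h(1)]] by blast
      qed
    next
      assume l: "has_lift M i (FAr V y)"
      show "has_lift N i' y"
      proof (rule has_liftI[OF i'(1) y])
        fix u v assume u: "u \<in> Hom N FA ?P" and v: "v \<in> Hom N FB ?Q" and e: "v \<cdot>\<^bsub>N\<^esub> i' = y \<cdot>\<^bsub>N\<^esub> u"
        note u1 = comp_Hom[OF M FA(2) VH[OF u]] and v1 = comp_Hom[OF M FB(2) VH[OF v]]
        have "(FAr V v \<cdot> \<eta>B) \<cdot> i = FAr V y \<cdot> (FAr V u \<cdot> \<eta>A)"
          using comp_assoc[OF M i FB(2) VH[OF v]] i'(2) comp_assoc[OF M FA(2) VH[OF i'(1)] VH[OF v]] VC[OF i'(1) v] e
            VC[OF u y] comp_assoc[OF M FA(2) VH[OF u] VH[OF y]] by simp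
        then obtain h where h: "h \<in> Hom M B (FOb V ?P)" "h \<cdot> i = FAr V u \<cdot> \<eta>A" "FAr V y \<cdot> h = FAr V v \<cdot> \<eta>B"
          using has_liftD[OF l i VH[OF y] u1 v1] by blast
        obtain h' where h': "h' \<in> Hom N FB ?P" "FAr V h' \<cdot> \<eta>B = h" using from_ex[OF B h(1) P] by blast
        have "h' \<cdot>\<^bsub>N\<^esub> i' = u"
          by (rule from_uniq[OF A comp_Hom[OF N i'(1) h'(1)] u])
            (use VC[OF i'(1) h'(1)] comp_assoc[OF M FA(2) VH[OF i'(1)] VH[OF h'(1)]] i'(2) comp_assoc[OF M i FB(2) VH[OF h'(1)]] h'(2) h(2) in simp)
        moreover have "y \<cdot>\<^bsub>N\<^esub> h' = v"
          by (rule from_uniq[OF B comp_Hom[OF N h'(1) y] v])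
            (use VC[OF h'(1) y] comp_assoc[OF M FB(2) VH[OF h'(1)] VH[OF y]] h'(2) h(3) in simp)
        ultimately show "\<exists>h. h \<in> Hom N FB ?P \<and> h \<cdot>\<^bsub>N\<^esub> i' = u \<and> y \<cdot>\<^bsub>N\<^esub> h = v" using h'(1) by blast
      qed
    }
  qed
  then show ?thesis using i' by blast
qed

subsection \<open>Free extensions\<close>

text \<open>\<open>s : X \<rightarrow> X'\<close> is the universal map out of \<open>X\<close> for which \<open>V s\<close> extends along \<open>i : V X \<rightarrow> B\<close>,
  and \<open>t : B \<rightarrow> V X'\<close> is the extension.\<close>

definition free_extension :: "'a \<Rightarrow> 'b \<Rightarrow> 'a \<Rightarrow> bool" where
  "free_extension i s t \<longleftrightarrow> i \<in> Hom M (FOb V (Dom N s)) (Cod M i) \<and> s \<in> Arr N \<and> t \<in> Hom M (Cod M i) (FOb V (Cod N s)) \<and>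
    t \<cdot> i = FAr V s \<and>
    (\<forall>Y. \<forall>p \<in> Hom N (Dom N s) Y. \<forall>w \<in> Hom M (Cod M i) (FOb V Y). w \<cdot> i = FAr V p \<longrightarrow>
      (\<exists>!k. k \<in> Hom N (Cod N s) Y \<and> k \<cdot>\<^bsub>N\<^esub> s = p \<and> FAr V k \<cdot> t = w))"

lemma free_extension_ex:
  assumes "free_extension i s t" "s \<in> Hom N X X'" "i \<in> Hom M (FOb V X) B" "p \<in> Hom N X Y" "w \<in> Hom M B (FOb V Y)" "w \<cdot> i = FAr V p"
  shows "\<exists>!k. k \<in> Hom N X' Y \<and> k \<cdot>\<^bsub>N\<^esub> s = p \<and> FAr V k \<cdot> t = w"
  using assms unfolding free_extension_def by (auto simp: HomD)

lemma free_extension_uniq: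
  assumes fe: "free_extension i s t" and s: "s \<in> Hom N X X'" and i: "i \<in> Hom M (FOb V X) B"
    and k: "k \<in> Hom N X' Y" "k' \<in> Hom N X' Y" "k \<cdot>\<^bsub>N\<^esub> s = k' \<cdot>\<^bsub>N\<^esub> s" "FAr V k \<cdot> t = FAr V k' \<cdot> t"
  shows "k = k'"
proof -
  have t: "t \<in> Hom M B (FOb V X')" "t \<cdot> i = FAr V s" using fe s i unfolding free_extension_def by (auto simp: HomD)
  have "(FAr V k' \<cdot> t) \<cdot> i = FAr V (k' \<cdot>\<^bsub>N\<^esub> s)"
    using comp_assoc[OF M i t(1) VH[OF k(2)]] t(2) VC[OF s k(2)] by simp
  from free_extension_ex[OF fe s i comp_Hom[OF N s k(2)] comp_Hom[OF M t(1) VH[OF k(2)]] this]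
  show ?thesis using k by blast
qed

text \<open>With \<open>F\<close> the left adjoint, \<open>X'\<close> is the pushout of \<open>F i\<close> along the counit \<open>F (V X) \<rightarrow> X\<close>.\<close>

lemma free_extension_exists:
  assumes X: "X \<in> Obj N" and i: "i \<in> Hom M (FOb V X) B"
  shows "\<exists>X' s t. s \<in> Hom N X X' \<and> t \<in> Hom M B (FOb V X') \<and> free_extension i s t"
proof -
  obtain FA \<eta>A where A: "universal_from N M V (FOb V X) FA \<eta>A" using left[OF Hom_Obj(1)[OF M i]] by blast
  obtain FB \<eta>B where B: "universal_from N M V B FB \<eta>B" using left[OF Hom_Obj(2)[OF M i]] by blast
  have FA: "FA \<in> Obj N" "\<eta>A \<in> Hom M (FOb V X) (FOb V FA)" and FB: "FB \<in> Obj N" "\<eta>B \<in> Hom M B (FOb V FB)"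
    using A B by (auto simp: universal_from_def)
  obtain i' where i': "i' \<in> Hom N FA FB" "FAr V i' \<cdot> \<eta>A = \<eta>B \<cdot> i"
    using free_arrow[OF i A B] by blast
  obtain e where e: "e \<in> Hom N FA X" "FAr V e \<cdot> \<eta>A = Id M (FOb V X)"
    using from_ex[OF A id_Hom[OF M Hom_Obj(1)[OF M i]] X] by blast
  obtain X' s b where s: "s \<in> Hom N X X'" and b: "b \<in> Hom N FB X'" and po: "is_pushout N i' e s b"
    using pushouts_exist[OF U biN i'(1) e(1)] by blast
  have sq: "s \<cdot>\<^bsub>N\<^esub> e = b \<cdot>\<^bsub>N\<^esub> i'" using po by (simp add: is_pushout_def)
  define t where "t = FAr V b \<cdot> \<eta>B"
  have t: "t \<in> Hom M B (FOb V X')" unfolding t_def by (rule comp_Hom[OF M FB(2) VH[OF b]])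
  have Vpe: "FAr V (p \<cdot>\<^bsub>N\<^esub> e) \<cdot> \<eta>A = FAr V p" if p: "p \<in> Hom N X Y" for p Y
    using VC[OF e(1) p] comp_assoc[OF M FA(2) VH[OF e(1)] VH[OF p]] e(2) comp_id[OF M VH[OF p]] by simp
  have Vqi: "FAr V (q \<cdot>\<^bsub>N\<^esub> i') \<cdot> \<eta>A = (FAr V q \<cdot> \<eta>B) \<cdot> i" if q: "q \<in> Hom N FB Y" for q Y
    using VC[OF i'(1) q] comp_assoc[OF M FA(2) VH[OF i'(1)] VH[OF q]] i'(2) comp_assoc[OF M i FB(2) VH[OF q]] by simp
  have ti: "t \<cdot> i = FAr V s" using Vpe[OF s] Vqi[OF b] sq by (simp add: t_def)
  have "free_extension i s t"
    unfolding free_extension_def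
  proof (intro conjI allI ballI impI)
    show "i \<in> Hom M (FOb V (Dom N s)) (Cod M i)" "s \<in> Arr N" "t \<in> Hom M (Cod M i) (FOb V (Cod N s))" "t \<cdot> i = FAr V s"
      using i s t ti by (auto simp: HomD)
    fix Y p w assume "p \<in> Hom N (Dom N s) Y" "w \<in> Hom M (Cod M i) (FOb V Y)" and wi: "w \<cdot> i = FAr V p"
    then have p: "p \<in> Hom N X Y" and w: "w \<in> Hom M B (FOb V Y)" using s i by (auto simp: HomD)
    obtain q where q: "q \<in> Hom N FB Y" "FAr V q \<cdot> \<eta>B = w" using from_ex[OF B w Hom_Obj(2)[OF N p]] by blast
    have pe: "p \<cdot>\<^bsub>N\<^esub> e = q \<cdot>\<^bsub>N\<^esub> i'"
      by (rule from_uniq[OF A comp_Hom[OF N e(1) p] comp_Hom[OF N i'(1) q(1)]]) (use Vpe[OF p] Vqi[OF q(1)] q(2) wi in simp)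
    have kt: "FAr V k \<cdot> t = FAr V (k \<cdot>\<^bsub>N\<^esub> b) \<cdot> \<eta>B" if "k \<in> Hom N X' Y" for k
      unfolding t_def using VC[OF b that] comp_assoc[OF M FB(2) VH[OF b] VH[OF that]] by simp
    have eq: "FAr V k \<cdot> t = w \<longleftrightarrow> k \<cdot>\<^bsub>N\<^esub> b = q" if k: "k \<in> Hom N X' Y" for k
      using kt[OF k] from_uniq[OF B comp_Hom[OF N b k] q(1)] q(2) by auto
    have "\<exists>!k. k \<in> Hom N X' Y \<and> k \<cdot>\<^bsub>N\<^esub> s = p \<and> k \<cdot>\<^bsub>N\<^esub> b = q" by (rule pushout_ex[OF po i'(1) s p q(1) pe])
    then have "\<exists>!k. k \<in> Hom N X' Y \<and> k \<cdot>\<^bsub>N\<^esub> s = p \<and> FAr V k \<cdot> t = w" using eq by (metis (no_types, lifting))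
    then show "\<exists>!k. k \<in> Hom N (Cod N s) Y \<and> k \<cdot>\<^bsub>N\<^esub> s = p \<and> FAr V k \<cdot> t = w" using s by (simp add: HomD)
  qed
  then show ?thesis using s t by blast
qed

lemma free_extension_has_lift:
  assumes fe: "free_extension i s t" and y: "y \<in> Arr N" and l: "has_lift M i (FAr V y)"
  shows "has_lift N s y"
proof -
  have s: "s \<in> Hom N (Dom N s) (Cod N s)" and i: "i \<in> Hom M (FOb V (Dom N s)) (Cod M i)"
    and t: "t \<in> Hom M (Cod M i) (FOb V (Cod N s))" "t \<cdot> i = FAr V s"
    using fe HomI[of s N] by (auto simp: free_extension_def)
  note yH = HomI[OF y]
  show ?thesis
  proof (rule has_liftI[OF s yH])
    fix u v assume u: "u \<in> Hom N (Dom N s) (Dom N y)" and v: "v \<in> Hom N (Cod N s) (Cod N y)" and e: "v \<cdot>\<^bsub>N\<^esub> s = y \<cdot>\<^bsub>N\<^esub> u"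
    have "(FAr V v \<cdot> t) \<cdot> i = FAr V y \<cdot> FAr V u"
      using comp_assoc[OF M i t(1) VH[OF v]] t(2) VC[OF s v] VC[OF u yH] e by simp
    then obtain h where h: "h \<in> Hom M (Cod M i) (FOb V (Dom N y))" "h \<cdot> i = FAr V u" "FAr V y \<cdot> h = FAr V v \<cdot> t"
      using has_liftD[OF l i VH[OF yH] VH[OF u] comp_Hom[OF M t(1) VH[OF v]]] by blast
    obtain k where k: "k \<in> Hom N (Cod N s) (Dom N y)" "k \<cdot>\<^bsub>N\<^esub> s = u" "FAr V k \<cdot> t = h"
      using free_extension_ex[OF fe s i u h(1,2)] by blast
    have "y \<cdot>\<^bsub>N\<^esub> k = v"
      by (rule free_extension_uniq[OF fe s i comp_Hom[OF N k(1) yH] v])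
        (use comp_assoc[OF N s k(1) yH] k e VC[OF k(1) yH] comp_assoc[OF M t(1) VH[OF k(1)] VH[OF yH]] h(3) in simp_all)
    then show "\<exists>h. h \<in> Hom N (Cod N s) (Dom N y) \<and> h \<cdot>\<^bsub>N\<^esub> s = u \<and> y \<cdot>\<^bsub>N\<^esub> h = v" using k by blast
  qed
qed

end

section \<open>Arrow categories\<close>

lemma arrow_cat_simps [simp]:
  "Obj (arrow_cat M) = Arr M" "Dom (arrow_cat M) (f, f', u, v) = f" "Cod (arrow_cat M) (f, f', u, v) = f'"
  "Id (arrow_cat M) f = (f, f, Id M (Dom M f), Id M (Cod M f))"
  "Comp (arrow_cat M) (f', f'', u', v') (f, g', u, v) = (f, f'', u' \<cdot>\<^bsub>M\<^esub> u, v' \<cdot>\<^bsub>M\<^esub> v)"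
  by (simp_all add: arrow_cat_def)

lemma arrow_Hom_iff:
  "(g, g', u, v) \<in> Hom (arrow_cat M) f f' \<longleftrightarrow> g = f \<and> g' = f' \<and> f \<in> Arr M \<and> f' \<in> Arr M \<and>
    u \<in> Hom M (Dom M f) (Dom M f') \<and> v \<in> Hom M (Cod M f) (Cod M f') \<and> v \<cdot>\<^bsub>M\<^esub> f = f' \<cdot>\<^bsub>M\<^esub> u"
  unfolding Hom_def[of "arrow_cat M"] by (auto simp: arrow_cat_def)

lemma arrow_HomE:
  assumes "w \<in> Hom (arrow_cat M) f f'"
  obtains u v where "w = (f, f', u, v)" "f \<in> Arr M" "f' \<in> Arr M" "u \<in> Hom M (Dom M f) (Dom M f')"
    "v \<in> Hom M (Cod M f) (Cod M f')" "v \<cdot>\<^bsub>M\<^esub> f = f' \<cdot>\<^bsub>M\<^esub> u"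
  using assms by (cases w) (auto simp: arrow_Hom_iff)

lemma arrow_cat_category:
  fixes M (structure)
  assumes M: "category M"
  shows "category (arrow_cat M)"
proof (rule categoryI)
  fix w assume "w \<in> Arr (arrow_cat M)"
  then show "Dom (arrow_cat M) w \<in> Obj (arrow_cat M) \<and> Cod (arrow_cat M) w \<in> Obj (arrow_cat M)"
    by (auto simp: arrow_cat_def)
next
  fix f assume "f \<in> Obj (arrow_cat M)"
  then have f: "f \<in> Hom M (Dom M f) (Cod M f)" using HomI by simp
  then show "Id (arrow_cat M) f \<in> Hom (arrow_cat M) f f"
    using id_Hom[OF M] Hom_Obj[OF M f] comp_id[OF M f] id_comp[OF M f] HomD(1)[OF f] by (simp add: arrow_Hom_iff)
next
  fix w w' a b c assume w: "w \<in> Hom (arrow_cat M) a b" and w': "w' \<in> Hom (arrow_cat M) b c"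
  obtain u v where 1: "w = (a, b, u, v)" "a \<in> Arr M" "b \<in> Arr M" "u \<in> Hom M (Dom M a) (Dom M b)"
    "v \<in> Hom M (Cod M a) (Cod M b)" "v \<cdot> a = b \<cdot> u" using arrow_HomE[OF w] .
  obtain u' v' where 2: "w' = (b, c, u', v')" "c \<in> Arr M" "u' \<in> Hom M (Dom M b) (Dom M c)"
    "v' \<in> Hom M (Cod M b) (Cod M c)" "v' \<cdot> b = c \<cdot> u'" using arrow_HomE[OF w'] by metis
  note aH = HomI[OF 1(2)] and bH = HomI[OF 1(3)] and cH = HomI[OF 2(2)]
  have "(v' \<cdot> v) \<cdot> a = c \<cdot> (u' \<cdot> u)"
    using comp_assoc[OF M aH 1(5) 2(4)] 1(6) comp_assoc[OF M 1(4) bH 2(4)] 2(5) comp_assoc[OF M 1(4) 2(3) cH] by simp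
  then show "w' \<cdot>\<^bsub>arrow_cat M\<^esub> w \<in> Hom (arrow_cat M) a c"
    using 1 2 comp_Hom[OF M 1(4) 2(3)] comp_Hom[OF M 1(5) 2(4)] by (simp add: arrow_Hom_iff)
next
  fix w a b assume w: "w \<in> Hom (arrow_cat M) a b"
  obtain u v where 1: "w = (a, b, u, v)" "a \<in> Arr M" "b \<in> Arr M" "u \<in> Hom M (Dom M a) (Dom M b)"
    "v \<in> Hom M (Cod M a) (Cod M b)" "v \<cdot> a = b \<cdot> u" using arrow_HomE[OF w] .
  show "w \<cdot>\<^bsub>arrow_cat M\<^esub> Id (arrow_cat M) a = w" "Id (arrow_cat M) b \<cdot>\<^bsub>arrow_cat M\<^esub> w = w"
    using 1 comp_id[OF M] id_comp[OF M] by auto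
next
  fix f g h a b c d assume f: "f \<in> Hom (arrow_cat M) a b" and g: "g \<in> Hom (arrow_cat M) b c" and h: "h \<in> Hom (arrow_cat M) c d"
  obtain u v where 1: "f = (a, b, u, v)" "u \<in> Hom M (Dom M a) (Dom M b)" "v \<in> Hom M (Cod M a) (Cod M b)" using arrow_HomE[OF f] by metis
  obtain u' v' where 2: "g = (b, c, u', v')" "u' \<in> Hom M (Dom M b) (Dom M c)" "v' \<in> Hom M (Cod M b) (Cod M c)" using arrow_HomE[OF g] by metis
  obtain u'' v'' where 3: "h = (c, d, u'', v'')" "u'' \<in> Hom M (Dom M c) (Dom M d)" "v'' \<in> Hom M (Cod M c) (Cod M d)" using arrow_HomE[OF h] by metis
  show "(h \<cdot>\<^bsub>arrow_cat M\<^esub> g) \<cdot>\<^bsub>arrow_cat M\<^esub> f = h \<cdot>\<^bsub>arrow_cat M\<^esub> (g \<cdot>\<^bsub>arrow_cat M\<^esub> f)"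
    using comp_assoc[OF M 1(2) 2(2) 3(2)] comp_assoc[OF M 1(3) 2(3) 3(3)] by (simp add: 1(1) 2(1) 3(1))
qed

definition dom_fctr :: "('o, 'a) cat \<Rightarrow> ('a, 'a \<times> 'a \<times> 'a \<times> 'a, 'o, 'a) fctr" where
  "dom_fctr N = restrict_fctr (arrow_cat N) \<lparr> FOb = Dom N, FAr = \<lambda>(f, f', u, v). u \<rparr>"

definition cod_fctr :: "('o, 'a) cat \<Rightarrow> ('a, 'a \<times> 'a \<times> 'a \<times> 'a, 'o, 'a) fctr" where
  "cod_fctr N = restrict_fctr (arrow_cat N) \<lparr> FOb = Cod N, FAr = \<lambda>(f, f', u, v). v \<rparr>"

lemma dom_cod_Functors:
  assumes N: "category N"
  shows "dom_fctr N \<in> Functors (arrow_cat N) N" "cod_fctr N \<in> Functors (arrow_cat N) N"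
proof -
  have "is_functor (arrow_cat N) N \<lparr> FOb = Dom N, FAr = \<lambda>(f, f', u, v). u \<rparr>"
    by (rule is_functorI) (auto simp: category.Dom_Obj[OF N] elim!: arrow_HomE)
  then show "dom_fctr N \<in> Functors (arrow_cat N) N"
    unfolding dom_fctr_def by (rule restrict_fctr_Functors[OF arrow_cat_category[OF N]])
  have "is_functor (arrow_cat N) N \<lparr> FOb = Cod N, FAr = \<lambda>(f, f', u, v). v \<rparr>"
    by (rule is_functorI) (auto simp: category.Cod_Obj[OF N] elim!: arrow_HomE)
  then show "cod_fctr N \<in> Functors (arrow_cat N) N"
    unfolding cod_fctr_def by (rule restrict_fctr_Functors[OF arrow_cat_category[OF N]])
qed

lemma dom_cod_simps:
  "f \<in> Arr N \<Longrightarrow> FOb (dom_fctr N) f = Dom N f" "f \<in> Arr N \<Longrightarrow> FOb (cod_fctr N) f = Cod N f"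
  "(f, f', u, v) \<in> Hom (arrow_cat N) a b \<Longrightarrow> FAr (dom_fctr N) (f, f', u, v) = u"
  "(f, f', u, v) \<in> Hom (arrow_cat N) a b \<Longrightarrow> FAr (cod_fctr N) (f, f', u, v) = v"
  by (auto simp: dom_fctr_def cod_fctr_def HomD)

text \<open>Every arrow is a map from its domain to its codomain, naturally in the arrow: the starting
  point for building functorial factorisations in a category of functors on arrows.\<close>

definition tautological_nat :: "('o, 'a) cat \<Rightarrow> ('a, 'a \<times> 'a \<times> 'a \<times> 'a, 'o, 'a) nattr" where
  "tautological_nat N = \<lparr> Src = dom_fctr N, Tgt = cod_fctr N, Cmp = restrict (\<lambda>f. f) (Arr N) \<rparr>"

lemma tautological_nat_Hom:
  fixes N (structure)
  assumes N: "category N"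
  shows "tautological_nat N \<in> Hom (fun_cat (arrow_cat N) N) (dom_fctr N) (cod_fctr N)"
proof -
  have "\<lparr> Src = dom_fctr N, Tgt = cod_fctr N, Cmp = restrict (\<lambda>f. f) (Obj (arrow_cat N)) \<rparr>
    \<in> Hom (fun_cat (arrow_cat N) N) (dom_fctr N) (cod_fctr N)"
  proof (rule nat_HomI[OF arrow_cat_category[OF N] dom_cod_Functors[OF N]])
    show "f \<in> Hom N (FOb (dom_fctr N) f) (FOb (cod_fctr N) f)" if "f \<in> Obj (arrow_cat N)" for f
      using that HomI by (simp add: dom_cod_simps)
    fix w f f' assume w: "w \<in> Hom (arrow_cat N) f f'"
    obtain u v where e: "w = (f, f', u, v)" "v \<cdot> f = f' \<cdot> u" using arrow_HomE[OF w] by metis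
    show "f' \<cdot> FAr (dom_fctr N) w = FAr (cod_fctr N) w \<cdot> f"
      using dom_cod_simps(3,4)[OF w[unfolded e(1)]] e by simp
  qed
  then show ?thesis by (simp add: tautological_nat_def)
qed

section \<open>Transferring factorisations along a right adjoint\<close>

context adjoint_functor
begin

abbreviation "AN \<equiv> arrow_cat N"
abbreviation "FN \<equiv> fun_cat (arrow_cat N) N"
abbreviation "CF \<equiv> cod_fctr N"

lemma AN: "category AN" by (rule arrow_cat_category[OF N])

lemma FN: "category FN" by (rule fun_cat_category[OF AN N])

text \<open>A stage of the construction is a functor \<open>X\<close> on the arrows of \<open>N\<close> with a natural map \<open>q\<close> to
  the codomain functor. Every value \<open>q f\<close> is sent to \<open>M\<close>, factored there, and \<open>X f\<close> is extended
  freely along the left factor. The free extension is functorial since the factorisation is, and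
  the right factor induces the new map \<open>q'\<close> to the codomain, again by the universal property.\<close>

lemma factorization_step:
  assumes E: "is_functor (arrow_cat M) M E"
    and lr: "\<And>f. f \<in> Arr M \<Longrightarrow> l f \<in> Hom M (Dom M f) (FOb E f) \<and> r f \<in> Hom M (FOb E f) (Cod M f) \<and> r f \<cdot> l f = f"
    and nat: "\<And>f f' u v. (f, f', u, v) \<in> Hom (arrow_cat M) f f' \<Longrightarrow> FAr E (f, f', u, v) \<cdot> l f = l f' \<cdot> u \<and>
           r f' \<cdot> FAr E (f, f', u, v) = v \<cdot> r f"
    and q: "q \<in> Hom FN X CF"
  shows "\<exists>X' s q'. s \<in> Hom FN X X' \<and> q' \<in> Hom FN X' CF \<and> q' \<cdot>\<^bsub>FN\<^esub> s = q \<and>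
    (\<forall>f \<in> Arr N. \<exists>t. t \<in> Hom M (FOb E (FAr V (Cmp q f))) (FOb V (FOb X' f)) \<and>
      free_extension (l (FAr V (Cmp q f))) (Cmp s f) t \<and> FAr V (Cmp q' f) \<cdot> t = r (FAr V (Cmp q f)))"
proof -
  have X: "X \<in> Functors AN N" and CFF: "CF \<in> Functors AN N" using nat_Functors[OF q] by auto
  note fX = FunctorsD[OF X] and fC = FunctorsD[OF CFF]
  define Q where "Q = (\<lambda>f. FAr V (Cmp q f))"
  have qH: "Cmp q f \<in> Hom N (FOb X f) (Cod N f)" if "f \<in> Arr N" for f
    using nat_comp_Hom[OF q, of f] that by (simp add: dom_cod_simps)
  have XO: "FOb X f \<in> Obj N" if "f \<in> Arr N" for f using functor_Ob[OF fX, of f] that by simp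
  have QH: "Q f \<in> Hom M (FOb V (FOb X f)) (FOb V (Cod N f))" if "f \<in> Arr N" for f unfolding Q_def by (rule VH[OF qH[OF that]])
  have lH: "l (Q f) \<in> Hom M (FOb V (FOb X f)) (FOb E (Q f))" and rH: "r (Q f) \<in> Hom M (FOb E (Q f)) (FOb V (Cod N f))"
    and rl: "r (Q f) \<cdot> l (Q f) = Q f" if "f \<in> Arr N" for f
    using lr[OF HomD(1)[OF QH[OF that]]] HomD(2,3)[OF QH[OF that]] by auto
  have "\<exists>X' s t. f \<in> Arr N \<longrightarrow> s \<in> Hom N (FOb X f) X' \<and> t \<in> Hom M (FOb E (Q f)) (FOb V X') \<and> free_extension (l (Q f)) s t" for f
    using free_extension_exists[OF XO lH] by blast
  then obtain X' s t where st: "\<And>f. f \<in> Arr N \<Longrightarrow> s f \<in> Hom N (FOb X f) (X' f)"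
    "\<And>f. f \<in> Arr N \<Longrightarrow> t f \<in> Hom M (FOb E (Q f)) (FOb V (X' f))"
    "\<And>f. f \<in> Arr N \<Longrightarrow> free_extension (l (Q f)) (s f) (t f)" by metis
  have tl: "t f \<cdot> l (Q f) = FAr V (s f)" if "f \<in> Arr N" for f using st(3)[OF that] by (simp add: free_extension_def)
  note uniq = free_extension_uniq[OF st(3) st(1) lH]
  \<comment> \<open>The square of \<open>M\<close> between the values of \<open>Q\<close> which a square \<open>w\<close> of \<open>N\<close> induces; \<open>E\<close> acts on
    it.\<close>
  define QA where "QA = (\<lambda>w. (Q (Dom AN w), Q (Cod AN w), FAr V (FAr X w), FAr V (FAr CF w)))"
  have arr: "f \<in> Arr N \<and> f' \<in> Arr N" if "w \<in> Hom AN f f'" for w f f' using Hom_Obj[OF AN that] by simp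
  have XH: "FAr X w \<in> Hom N (FOb X f) (FOb X f')" if "w \<in> Hom AN f f'" for w f f' using functor_Hom[OF fX that] .
  have CH: "FAr CF w \<in> Hom N (Cod N f) (Cod N f')" if "w \<in> Hom AN f f'" for w f f'
    using functor_Hom[OF fC that] arr[OF that] by (simp add: dom_cod_simps)
  have qsq: "Cmp q f' \<cdot>\<^bsub>N\<^esub> FAr X w = FAr CF w \<cdot>\<^bsub>N\<^esub> Cmp q f" if "w \<in> Hom AN f f'" for w f f' using nat_square[OF q that] .
  have QA: "QA w = (Q f, Q f', FAr V (FAr X w), FAr V (FAr CF w))" "QA w \<in> Hom (arrow_cat M) (Q f) (Q f')" if w: "w \<in> Hom AN f f'" for w f f'
  proof -
    show 1: "QA w = (Q f, Q f', FAr V (FAr X w), FAr V (FAr CF w))" using HomD[OF w] by (simp add: QA_def)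
    have "FAr V (FAr CF w) \<cdot> Q f = Q f' \<cdot> FAr V (FAr X w)"
      unfolding Q_def using VC[OF XH[OF w] qH] VC[OF qH CH[OF w]] qsq[OF w] arr[OF w] by metis
    then show "QA w \<in> Hom (arrow_cat M) (Q f) (Q f')"
      unfolding 1 arrow_Hom_iff using QH[of f] QH[of f'] arr[OF w] VH[OF XH[OF w]] VH[OF CH[OF w]] by (simp add: HomD)
  qed
  define e where "e = (\<lambda>w. FAr E (QA w))"
  have eH: "e w \<in> Hom M (FOb E (Q f)) (FOb E (Q f'))" if "w \<in> Hom AN f f'" for w f f'
    unfolding e_def by (rule functor_Hom[OF E QA(2)[OF that]])
  have el: "e w \<cdot> l (Q f) = l (Q f') \<cdot> FAr V (FAr X w)" and re: "r (Q f') \<cdot> e w = FAr V (FAr CF w) \<cdot> r (Q f)" if "w \<in> Hom AN f f'" for w f f'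
    using nat[of "Q f" "Q f'" "FAr V (FAr X w)" "FAr V (FAr CF w)"] QA[OF that] unfolding e_def by auto
  have eI: "e (Id AN f) = Id M (FOb E (Q f))" if f: "f \<in> Arr N" for f
  proof -
    have fo: "f \<in> Obj AN" using f by simp
    have CO: "FOb CF f \<in> Obj N" using functor_Ob[OF fC fo] .
    have "QA (Id AN f) = Id (arrow_cat M) (Q f)"
      using QA(1)[OF id_Hom[OF AN fo]] functor_Id[OF fX fo] functor_Id[OF fC fo] functor_Id[OF V XO[OF f]] functor_Id[OF V CO]
        HomD[OF QH[OF f]] f by (simp add: dom_cod_simps)
    then show ?thesis unfolding e_def using functor_Id[OF E, of "Q f"] HomD(1)[OF QH[OF f]] by simp
  qed
  have eC: "e (w' \<cdot>\<^bsub>AN\<^esub> w) = e w' \<cdot> e w" if w: "w \<in> Hom AN f f'" and w': "w' \<in> Hom AN f' f''" for w w' f f' f''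
  proof -
    have "QA (w' \<cdot>\<^bsub>AN\<^esub> w) = QA w' \<cdot>\<^bsub>arrow_cat M\<^esub> QA w"
      using QA(1)[OF comp_Hom[OF AN w w']] QA(1)[OF w] QA(1)[OF w'] functor_Comp[OF fX w w'] functor_Comp[OF fC w w']
        VC[OF XH[OF w] XH[OF w']] VC[OF CH[OF w] CH[OF w']] by simp
    then show ?thesis unfolding e_def using functor_Comp[OF E QA(2)[OF w] QA(2)[OF w']] by simp
  qed
  have "\<exists>k. k \<in> Hom N (X' f) (X' f') \<and> k \<cdot>\<^bsub>N\<^esub> s f = s f' \<cdot>\<^bsub>N\<^esub> FAr X w \<and> FAr V k \<cdot> t f = t f' \<cdot> e w" if w: "w \<in> Hom AN f f'" for w f f'
  proof -
    have f: "f \<in> Arr N" and f': "f' \<in> Arr N" using arr[OF w] by auto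
    have "(t f' \<cdot> e w) \<cdot> l (Q f) = FAr V (s f' \<cdot>\<^bsub>N\<^esub> FAr X w)"
      using comp_assoc[OF M lH[OF f] eH[OF w] st(2)[OF f']] el[OF w] comp_assoc[OF M VH[OF XH[OF w]] lH[OF f'] st(2)[OF f']] tl[OF f']
        VC[OF XH[OF w] st(1)[OF f']] by simp
    from free_extension_ex[OF st(3)[OF f] st(1)[OF f] lH[OF f] comp_Hom[OF N XH[OF w] st(1)[OF f']] comp_Hom[OF M eH[OF w] st(2)[OF f']] this]
    show ?thesis by blast
  qed
  then have "\<forall>w. \<exists>k. w \<in> Arr AN \<longrightarrow> k \<in> Hom N (X' (Dom AN w)) (X' (Cod AN w)) \<and> k \<cdot>\<^bsub>N\<^esub> s (Dom AN w) = s (Cod AN w) \<cdot>\<^bsub>N\<^esub> FAr X w \<and>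
      FAr V k \<cdot> t (Dom AN w) = t (Cod AN w) \<cdot> e w"
    using HomI[of _ AN] by meson
  then obtain k where k0: "\<And>w. w \<in> Arr AN \<Longrightarrow> k w \<in> Hom N (X' (Dom AN w)) (X' (Cod AN w)) \<and> k w \<cdot>\<^bsub>N\<^esub> s (Dom AN w) = s (Cod AN w) \<cdot>\<^bsub>N\<^esub> FAr X w \<and>
      FAr V (k w) \<cdot> t (Dom AN w) = t (Cod AN w) \<cdot> e w" by metis
  have k: "k w \<in> Hom N (X' f) (X' f')" "k w \<cdot>\<^bsub>N\<^esub> s f = s f' \<cdot>\<^bsub>N\<^esub> FAr X w" "FAr V (k w) \<cdot> t f = t f' \<cdot> e w"
    if "w \<in> Hom AN f f'" for w f f'
    using k0[OF HomD(1)[OF that]] unfolding HomD(2,3)[OF that] by auto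
  define Y where "Y = restrict_fctr AN \<lparr> FOb = X', FAr = k \<rparr>"
  have "is_functor AN N \<lparr> FOb = X', FAr = k \<rparr>"
  proof (rule is_functorI)
    fix f assume fo: "f \<in> Obj AN"
    then have f: "f \<in> Arr N" by simp
    show X'O: "FOb \<lparr> FOb = X', FAr = k \<rparr> f \<in> Obj N" using Hom_Obj(2)[OF N st(1)[OF f]] by simp
    then have iH: "Id N (X' f) \<in> Hom N (X' f) (X' f)" using id_Hom[OF N] by simp
    note i = id_Hom[OF AN fo]
    have "k (Id AN f) = Id N (X' f)"
    proof (rule uniq[OF f f f k(1)[OF i] iH])
      show "k (Id AN f) \<cdot>\<^bsub>N\<^esub> s f = Id N (X' f) \<cdot>\<^bsub>N\<^esub> s f"
        using k(2)[OF i] functor_Id[OF fX fo] comp_id[OF N st(1)[OF f]] id_comp[OF N st(1)[OF f]] by simp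
      show "FAr V (k (Id AN f)) \<cdot> t f = FAr V (Id N (X' f)) \<cdot> t f"
        using k(3)[OF i] eI[OF f] comp_id[OF M st(2)[OF f]] id_comp[OF M st(2)[OF f]] functor_Id[OF V] X'O by simp
    qed
    then show "FAr \<lparr> FOb = X', FAr = k \<rparr> (Id AN f) = Id N (FOb \<lparr> FOb = X', FAr = k \<rparr> f)" by simp
  next
    fix w f f' assume "w \<in> Hom AN f f'"
    then show "FAr \<lparr> FOb = X', FAr = k \<rparr> w \<in> Hom N (FOb \<lparr> FOb = X', FAr = k \<rparr> f) (FOb \<lparr> FOb = X', FAr = k \<rparr> f')" using k(1) by simp
  next
    fix w w' f f' f'' assume w: "w \<in> Hom AN f f'" and w': "w' \<in> Hom AN f' f''"
    have f: "f \<in> Arr N" and f': "f' \<in> Arr N" and f'': "f'' \<in> Arr N" using arr[OF w] arr[OF w'] by auto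
    note ww = comp_Hom[OF AN w w']
    have "k (w' \<cdot>\<^bsub>AN\<^esub> w) = k w' \<cdot>\<^bsub>N\<^esub> k w"
    proof (rule uniq[OF f f f k(1)[OF ww] comp_Hom[OF N k(1)[OF w] k(1)[OF w']]])
      show "k (w' \<cdot>\<^bsub>AN\<^esub> w) \<cdot>\<^bsub>N\<^esub> s f = (k w' \<cdot>\<^bsub>N\<^esub> k w) \<cdot>\<^bsub>N\<^esub> s f"
        using k(2)[OF ww] functor_Comp[OF fX w w'] comp_assoc[OF N st(1)[OF f] k(1)[OF w] k(1)[OF w']] k(2)[OF w]
          comp_assoc[OF N XH[OF w] st(1)[OF f'] k(1)[OF w']] k(2)[OF w'] comp_assoc[OF N XH[OF w] XH[OF w'] st(1)[OF f'']] by simp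
      show "FAr V (k (w' \<cdot>\<^bsub>AN\<^esub> w)) \<cdot> t f = FAr V (k w' \<cdot>\<^bsub>N\<^esub> k w) \<cdot> t f"
        using k(3)[OF ww] eC[OF w w'] VC[OF k(1)[OF w] k(1)[OF w']] comp_assoc[OF M st(2)[OF f] VH[OF k(1)[OF w]] VH[OF k(1)[OF w']]] k(3)[OF w]
          comp_assoc[OF M eH[OF w] st(2)[OF f'] VH[OF k(1)[OF w']]] k(3)[OF w'] comp_assoc[OF M eH[OF w] eH[OF w'] st(2)[OF f'']] by simp
    qed
    then show "FAr \<lparr> FOb = X', FAr = k \<rparr> (w' \<cdot>\<^bsub>AN\<^esub> w) = FAr \<lparr> FOb = X', FAr = k \<rparr> w' \<cdot>\<^bsub>N\<^esub> FAr \<lparr> FOb = X', FAr = k \<rparr> w" by simp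
  qed
  then have Y: "Y \<in> Functors AN N" unfolding Y_def by (rule restrict_fctr_Functors[OF AN])
  have YO: "FOb Y f = X' f" if "f \<in> Arr N" for f using that by (simp add: Y_def)
  have YA: "FAr Y w = k w" if "w \<in> Hom AN f f'" for w f f' using HomD(1)[OF that] by (simp add: Y_def)
  define s' where "s' = \<lparr> Src = X, Tgt = Y, Cmp = restrict s (Obj AN) \<rparr>"
  have s': "s' \<in> Hom FN X Y"
    unfolding s'_def
  proof (rule nat_HomI[OF AN X Y])
    show "s f \<in> Hom N (FOb X f) (FOb Y f)" if "f \<in> Obj AN" for f using st(1) that YO by simp
    show "s f' \<cdot>\<^bsub>N\<^esub> FAr X w = FAr Y w \<cdot>\<^bsub>N\<^esub> s f" if "w \<in> Hom AN f f'" for w f f' using k(2)[OF that] YA[OF that] by simp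
  qed
  have "\<exists>p. f \<in> Arr N \<longrightarrow> p \<in> Hom N (X' f) (Cod N f) \<and> p \<cdot>\<^bsub>N\<^esub> s f = Cmp q f \<and> FAr V p \<cdot> t f = r (Q f)" for f
  proof (cases "f \<in> Arr N")
    case True
    have e: "r (Q f) \<cdot> l (Q f) = FAr V (Cmp q f)" using rl[OF True] by (simp add: Q_def)
    show ?thesis
      using free_extension_ex[OF st(3)[OF True] st(1)[OF True] lH[OF True] qH[OF True] rH[OF True] e] by blast
  qed simp
  then obtain p where p: "\<And>f. f \<in> Arr N \<Longrightarrow> p f \<in> Hom N (X' f) (Cod N f)" "\<And>f. f \<in> Arr N \<Longrightarrow> p f \<cdot>\<^bsub>N\<^esub> s f = Cmp q f"
    "\<And>f. f \<in> Arr N \<Longrightarrow> FAr V (p f) \<cdot> t f = r (Q f)" by metis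
  define q' where "q' = \<lparr> Src = Y, Tgt = CF, Cmp = restrict p (Obj AN) \<rparr>"
  have q': "q' \<in> Hom FN Y CF"
    unfolding q'_def
  proof (rule nat_HomI[OF AN Y CFF])
    show "p f \<in> Hom N (FOb Y f) (FOb CF f)" if "f \<in> Obj AN" for f using p(1) that YO by (simp add: dom_cod_simps)
    fix w f f' assume w: "w \<in> Hom AN f f'"
    have f: "f \<in> Arr N" and f': "f' \<in> Arr N" using arr[OF w] by auto
    have "p f' \<cdot>\<^bsub>N\<^esub> k w = FAr CF w \<cdot>\<^bsub>N\<^esub> p f"
    proof (rule uniq[OF f f f comp_Hom[OF N k(1)[OF w] p(1)[OF f']] comp_Hom[OF N p(1)[OF f] CH[OF w]]])
      show "(p f' \<cdot>\<^bsub>N\<^esub> k w) \<cdot>\<^bsub>N\<^esub> s f = (FAr CF w \<cdot>\<^bsub>N\<^esub> p f) \<cdot>\<^bsub>N\<^esub> s f"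
        using comp_assoc[OF N st(1)[OF f] k(1)[OF w] p(1)[OF f']] k(2)[OF w] comp_assoc[OF N XH[OF w] st(1)[OF f'] p(1)[OF f']] p(2)[OF f']
          qsq[OF w] comp_assoc[OF N st(1)[OF f] p(1)[OF f] CH[OF w]] p(2)[OF f] by simp
      show "FAr V (p f' \<cdot>\<^bsub>N\<^esub> k w) \<cdot> t f = FAr V (FAr CF w \<cdot>\<^bsub>N\<^esub> p f) \<cdot> t f"
        using VC[OF k(1)[OF w] p(1)[OF f']] comp_assoc[OF M st(2)[OF f] VH[OF k(1)[OF w]] VH[OF p(1)[OF f']]] k(3)[OF w]
          comp_assoc[OF M eH[OF w] st(2)[OF f'] VH[OF p(1)[OF f']]] p(3)[OF f'] re[OF w]
          VC[OF p(1)[OF f] CH[OF w]] comp_assoc[OF M st(2)[OF f] VH[OF p(1)[OF f]] VH[OF CH[OF w]]] p(3)[OF f] by simp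
    qed
    then show "p f' \<cdot>\<^bsub>N\<^esub> FAr Y w = FAr CF w \<cdot>\<^bsub>N\<^esub> p f" using YA[OF w] by simp
  qed
  have "q' \<cdot>\<^bsub>FN\<^esub> s' = q"
    by (rule nat_eqI[OF comp_Hom[OF FN s' q'] q]) (use p(2) in \<open>simp add: q'_def s'_def\<close>)
  moreover have "\<exists>t. t \<in> Hom M (FOb E (FAr V (Cmp q f))) (FOb V (FOb Y f)) \<and> free_extension (l (FAr V (Cmp q f))) (Cmp s' f) t \<and>
      FAr V (Cmp q' f) \<cdot> t = r (FAr V (Cmp q f))" if f: "f \<in> Arr N" for f
    using st(2,3)[OF f] p(3)[OF f] YO[OF f] f unfolding Q_def s'_def q'_def by (intro exI[of _ "t f"]) simp
  ultimately show ?thesis using s' q' by blast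
qed

text \<open>Iterating \<open>factorization_step\<close> along a regular cardinal \<open>k\<close>, starting from the tautological
  factorisation, and taking the colimit. The left factor lifts against \<open>y\<close> whenever all of \<open>L\<close>
  lifts against \<open>V y\<close>, since the steps do. For the right factor \<open>r' f\<close> one has to lift a
  generating map \<open>i\<close> against \<open>V (r' f)\<close>: by smallness the problem is posed at a stage \<open>a\<close>; there
  \<open>V\<close> of the map to the codomain factors as \<open>r p \<cdot> l p\<close> with \<open>r p\<close> in \<open>R\<close>, a lift against \<open>r p\<close>
  exists, and the free extension along \<open>l p\<close> carries it to the next stage.

  The class \<open>W\<close> is any class containing the images under \<open>V\<close> of the steps, relative to which
  domains of the generating maps are small.\<close>

lemma adjoint_factorization:
  assumes ff: "functorial_factorization M L R"
    and IA: "I \<subseteq> Arr M" and sI: "small U I" and RI: "R = {q \<in> Arr M. \<forall>i \<in> I. has_lift M i q}"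
    and sm: "\<And>i. i \<in> I \<Longrightarrow> small_rel U M W (Dom M i)"
    and W: "\<And>s. s \<in> Arr N \<Longrightarrow> (\<And>y. y \<in> Arr N \<Longrightarrow> (\<And>e. e \<in> L \<Longrightarrow> has_lift M e (FAr V y)) \<Longrightarrow> has_lift N s y) \<Longrightarrow> FAr V s \<in> W"
  shows "functorial_factorization N
    {l \<in> Arr N. \<forall>y \<in> Arr N. (\<forall>e \<in> L. has_lift M e (FAr V y)) \<longrightarrow> has_lift N l y} {r \<in> Arr N. FAr V r \<in> R}"
proof -
  obtain E l r where E: "is_functor (arrow_cat M) M E"
    and lr0: "\<And>f. f \<in> Arr M \<Longrightarrow> l f \<in> Hom M (Dom M f) (FOb E f) \<inter> L \<and> r f \<in> Hom M (FOb E f) (Cod M f) \<inter> R \<and> r f \<cdot> l f = f"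
    and nat0: "\<forall>(f, f', u, v) \<in> Arr (arrow_cat M). FAr E (f, f', u, v) \<cdot> l f = l f' \<cdot> u \<and> r f' \<cdot> FAr E (f, f', u, v) = v \<cdot> r f"
    using ff unfolding functorial_factorization_def by blast
  have lr: "l f \<in> Hom M (Dom M f) (FOb E f) \<and> r f \<in> Hom M (FOb E f) (Cod M f) \<and> r f \<cdot> l f = f" and lL: "l f \<in> L" and rR: "r f \<in> R"
    if "f \<in> Arr M" for f using lr0[OF that] by auto
  have nat: "FAr E (f, f', u, v) \<cdot> l f = l f' \<cdot> u \<and> r f' \<cdot> FAr E (f, f', u, v) = v \<cdot> r f"
    if "(f, f', u, v) \<in> Hom (arrow_cat M) f f'" for f f' u v using nat0 HomD(1)[OF that] by fastforce
  have "\<forall>i \<in> I. \<exists>\<kappa> :: 'u rel. Card_order \<kappa> \<and> \<kappa> <o |UNIV :: 'u set| \<and> card_small_rel \<kappa> M W (Dom M i)"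
    using sm unfolding small_rel_def by blast
  then obtain kf :: "'a \<Rightarrow> 'u rel" where kf: "\<And>i. i \<in> I \<Longrightarrow> Card_order (kf i) \<and> kf i <o |UNIV :: 'u set|"
    "\<And>i. i \<in> I \<Longrightarrow> card_small_rel (kf i) M W (Dom M i)" by metis
  obtain k :: "'u rel" where k: "Card_order k" "infinite (Field k)" "regularCard k" "k <o |UNIV :: 'u set|"
    "\<And>i. i \<in> I \<Longrightarrow> kf i \<le>o k"
    using small_cardinals_bounded[OF U sI, of kf] kf(1) by blast
  have wk: "Well_order k" using k(1) by (rule Card_order_wo)
  have smk: "small U (Field k)"
    unfolding small_def using ordIso_ordLess_trans[OF card_of_Field_ordIso[OF k(1)] k(4)] .
  have smu: "small U (underS k b)" for b using small_subset[OF smk underS_subset] .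
  note dcF = dom_cod_Functors[OF N]
  \<comment> \<open>The relation between consecutive stages provided by \<open>factorization_step\<close>.\<close>
  define SR :: "('b, 'b \<times> 'b \<times> 'b \<times> 'b, 'n, 'b) nattr \<Rightarrow> ('b, 'b \<times> 'b \<times> 'b \<times> 'b, 'n, 'b) nattr
      \<Rightarrow> ('b, 'b \<times> 'b \<times> 'b \<times> 'b, 'n, 'b) nattr \<Rightarrow> bool" where "SR = (\<lambda>q s q'. \<forall>f \<in> Arr N. \<exists>t. t \<in> Hom M (FOb E (FAr V (Cmp q f))) (FOb V (Cod N (Cmp s f))) \<and>
      free_extension (l (FAr V (Cmp q f))) (Cmp s f) t \<and> FAr V (Cmp q' f) \<cdot> t = r (FAr V (Cmp q f)))"
  define Ext :: "'u \<Rightarrow> ('u, 'u \<times> 'u, ('b, 'b \<times> 'b \<times> 'b \<times> 'b, 'n, 'b) fctr, ('b, 'b \<times> 'b \<times> 'b \<times> 'b, 'n, 'b) nattr) fctr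
      \<Rightarrow> ('u \<Rightarrow> ('b, 'b \<times> 'b \<times> 'b \<times> 'b, 'n, 'b) nattr) \<Rightarrow> ('b, 'b \<times> 'b \<times> 'b \<times> 'b, 'n, 'b) fctr
      \<Rightarrow> ('u \<Rightarrow> ('b, 'b \<times> 'b \<times> 'b \<times> 'b, 'n, 'b) nattr) \<Rightarrow> ('b, 'b \<times> 'b \<times> 'b \<times> 'b, 'n, 'b) nattr \<Rightarrow> bool"
    where "Ext = (\<lambda>b D Q c \<tau> e. e \<in> Hom FN c CF \<and> (\<forall>a \<in> underS k b. e \<cdot>\<^bsub>FN\<^esub> \<tau> a = Q a) \<and>
      (least_elem k b \<longrightarrow> c = dom_fctr N \<and> e = tautological_nat N) \<and>
      (limit_elem k b \<longrightarrow> (\<forall>f \<in> Arr N. is_colimit (ord_cat (Restr k (underS k b))) N (eval_diag D f) (FOb c f) (\<lambda>a. Cmp (\<tau> a) f))) \<and>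
      (\<forall>a. succ_elem k a b \<longrightarrow> SR (Q a) (\<tau> a) e))"
  have "\<exists>Z Q. is_functor (ord_cat k) FN Z \<and> (\<forall>b \<in> Field k. Ext b Z Q (FOb Z b) (\<lambda>x. FAr Z (x, b)) (Q b))"
  proof (rule transfinite_construction[OF wk FN])
    fix b c \<tau> e E' \<tau>' and D D' :: "('u, 'u \<times> 'u, ('b, 'b \<times> 'b \<times> 'b \<times> 'b, 'n, 'b) fctr, ('b, 'b \<times> 'b \<times> 'b \<times> 'b, 'n, 'b) nattr) fctr" and Q
    assume e1: "\<And>a. a \<in> underS k b \<Longrightarrow> FOb D a = FOb D' a \<and> Q a = E' a \<and> \<tau> a = \<tau>' a"
      and e2: "\<And>a a'. (a, a') \<in> k \<Longrightarrow> a' \<in> underS k b \<Longrightarrow> FAr D (a, a') = FAr D' (a, a')"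
      and X: "Ext b D Q c \<tau> e"
    have "is_colimit (ord_cat (Restr k (underS k b))) N (eval_diag D f) (FOb c f) (\<lambda>a. Cmp (\<tau> a) f) \<longleftrightarrow>
        is_colimit (ord_cat (Restr k (underS k b))) N (eval_diag D' f) (FOb c f) (\<lambda>a. Cmp (\<tau>' a) f)" for f
      by (rule is_colimit_cong[OF wo_category[OF Restr_wo[OF wk]]]) (auto simp: Field_Restr_underS[OF wk] e1 e2)
    moreover have "SR (E' a) (\<tau>' a) e" if "succ_elem k a b" for a
      using X that e1[OF succ_elemD(3)[OF that]] unfolding Ext_def by metis
    ultimately show "Ext b D' E' c \<tau>' e" using X e1 unfolding Ext_def by simp
  next
    fix b Q and D :: "('u, 'u \<times> 'u, ('b, 'b \<times> 'b \<times> 'b \<times> 'b, 'n, 'b) fctr, ('b, 'b \<times> 'b \<times> 'b \<times> 'b, 'n, 'b) nattr) fctr"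
    assume b: "b \<in> Field k" and D: "is_functor (ord_cat (Restr k (underS k b))) FN D"
      and IH: "\<And>a. a \<in> underS k b \<Longrightarrow> Ext a D Q (FOb D a) (\<lambda>x. FAr D (x, a)) (Q a)"
    have fu: "Field (Restr k (underS k b)) = underS k b" by (rule Field_Restr_underS[OF wk])
    have QH: "Q a \<in> Hom FN (FOb D a) CF" if "a \<in> underS k b" for a using IH[OF that] by (simp add: Ext_def)
    have QD: "Q a \<cdot>\<^bsub>FN\<^esub> FAr D (x, a) = Q x" if "a \<in> underS k b" "(x, a) \<in> k" for a x
    proof (cases "x = a")
      case True
      have "FAr D (a, a) = Id FN (FOb D a)" using ord_functor_Id[OF D, of a] that fu by simp
      then show ?thesis unfolding True using comp_id[OF FN QH[OF that(1)]] by metis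
    next
      case False
      then show ?thesis using IH[OF that(1)] that(2) by (simp add: Ext_def underS_def)
    qed
    from b show "\<exists>c \<tau> e. is_cocone (ord_cat (Restr k (underS k b))) FN D c \<tau> \<and> Ext b D Q c \<tau> e"
    proof (cases rule: elem_cases)
      case 1
      then have u: "underS k b = {}" by (simp add: least_elem_def)
      have "is_cocone (ord_cat (Restr k (underS k b))) FN D (dom_fctr N) (\<lambda>_. tautological_nat N)"
        unfolding is_cocone_def using dcF by (simp add: u fu)
      moreover have "Ext b D Q (dom_fctr N) (\<lambda>_. tautological_nat N) (tautological_nat N)"
        using tautological_nat_Hom[OF N] 1 u by (auto simp: Ext_def limit_elem_def succ_elem_def)
      ultimately show ?thesis by blast
    next
      case (2 a)
      note ab = succ_elemD(3)[OF 2]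
      have below: "(x, a) \<in> k" if "x \<in> underS k b" for x using succ_elem_le[OF wk 2 that] .
      obtain c s e where s: "s \<in> Hom FN (FOb D a) c" "e \<in> Hom FN c CF" "e \<cdot>\<^bsub>FN\<^esub> s = Q a"
        and st: "\<forall>f \<in> Arr N. \<exists>t. t \<in> Hom M (FOb E (FAr V (Cmp (Q a) f))) (FOb V (FOb c f)) \<and>
            free_extension (l (FAr V (Cmp (Q a) f))) (Cmp s f) t \<and> FAr V (Cmp e f) \<cdot> t = r (FAr V (Cmp (Q a) f))"
        using factorization_step[OF E lr nat QH[OF ab]] by blast
      have sc: "Cod N (Cmp s f) = FOb c f" if "f \<in> Arr N" for f using nat_comp_Hom[OF s(1), of f] that by (simp add: HomD)
      have SRs: "SR (Q a) s e" unfolding SR_def using st sc by simp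
      define \<tau> where "\<tau> = (\<lambda>x. s \<cdot>\<^bsub>FN\<^esub> FAr D (x, a))"
      have Dxa: "FAr D (x, a) \<in> Hom FN (FOb D x) (FOb D a)" if "x \<in> underS k b" for x
        using ord_functor_Hom[OF D] below[OF that] that ab by simp
      have "FAr D (a, a) = Id FN (FOb D a)" using ord_functor_Id[OF D, of a] ab fu by simp
      then have ta: "\<tau> a = s" using comp_id[OF FN s(1)] unfolding \<tau>_def by metis
      have "is_cocone (ord_cat (Restr k (underS k b))) FN D c \<tau>"
      proof (rule ord_coconeI)
        show "c \<in> Obj FN" using Hom_Obj[OF FN s(1)] by simp
        show "\<tau> x \<in> Hom FN (FOb D x) c" if "x \<in> Field (Restr k (underS k b))" for x
          unfolding \<tau>_def using comp_Hom[OF FN Dxa s(1)] that fu by metis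
        fix x y assume xy: "(x, y) \<in> Restr k (underS k b)"
        then have y: "y \<in> underS k b" by auto
        have ya: "(y, a) \<in> Restr k (underS k b)" using below[OF y] y ab by simp
        show "\<tau> y \<cdot>\<^bsub>FN\<^esub> FAr D (x, y) = \<tau> x"
          unfolding \<tau>_def using comp_assoc[OF FN ord_functor_Hom[OF D xy] Dxa[OF y] s(1)] ord_functor_Comp[OF D xy ya] by metis
      qed
      moreover have "e \<cdot>\<^bsub>FN\<^esub> \<tau> x = Q x" if "x \<in> underS k b" for x
        unfolding \<tau>_def using comp_assoc[OF FN Dxa[OF that] s(1,2)] s(3) QD[OF ab below[OF that]] by metis
      moreover have "SR (Q a') (\<tau> a') e" if "succ_elem k a' b" for a'
        unfolding succ_elem_unique[OF wk that 2] ta by (rule SRs)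
      moreover have "\<not> least_elem k b" "\<not> limit_elem k b" using ab 2 by (auto simp: limit_elem_def least_elem_def)
      ultimately have "is_cocone (ord_cat (Restr k (underS k b))) FN D c \<tau> \<and> Ext b D Q c \<tau> e"
        unfolding Ext_def using s(2) by blast
      then show ?thesis by blast
    next
      case 3
      note cR = wo_category[OF Restr_wo[OF wk], of "underS k b"]
      have "\<exists>c \<tau>. is_colimit (ord_cat (Restr k (underS k b))) N (eval_diag D f) c \<tau>" if "f \<in> Obj AN" for f
        using wo_colimit_exists[OF U biN Restr_wo[OF wk] _ eval_diag_functor[OF AN N cR D that]] smu fu by metis
      then obtain c \<tau> where c: "is_cocone (ord_cat (Restr k (underS k b))) FN D c \<tau>"
        "\<And>f. f \<in> Obj AN \<Longrightarrow> is_colimit (ord_cat (Restr k (underS k b))) N (eval_diag D f) (FOb c f) (\<lambda>j. Cmp (\<tau> j) f)"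
        using pointwise_colimit_exists[OF AN N cR D] by blast
      note cc = pointwise_colimit[OF AN N cR D c]
      have "is_cocone (ord_cat (Restr k (underS k b))) FN D CF Q"
      proof (rule ord_coconeI)
        show "CF \<in> Obj FN" using dcF by simp
        show "Q j \<in> Hom FN (FOb D j) CF" if "j \<in> Field (Restr k (underS k b))" for j using QH that fu by metis
        show "Q j \<cdot>\<^bsub>FN\<^esub> FAr D (i, j) = Q i" if "(i, j) \<in> Restr k (underS k b)" for i j
          by (rule QD) (use that in auto)
      qed
      then obtain e where e: "e \<in> Hom FN c CF" "\<forall>a \<in> underS k b. e \<cdot>\<^bsub>FN\<^esub> \<tau> a = Q a"
        using colimit_ex[OF cc] unfolding ord_cat_simps fu by blast
      have "\<not> succ_elem k a b" "\<not> least_elem k b" for a using 3 by (auto simp: limit_elem_def)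
      then have "Ext b D Q c \<tau> e" using e c(2) unfolding Ext_def by simp
      then show ?thesis using c(1) by blast
    qed
  qed
  then obtain Z :: "('u, 'u \<times> 'u, ('b, 'b \<times> 'b \<times> 'b \<times> 'b, 'n, 'b) fctr, ('b, 'b \<times> 'b \<times> 'b \<times> 'b, 'n, 'b) nattr) fctr" and Q
    where fZ: "is_functor (ord_cat k) FN Z" and X: "\<And>b. b \<in> Field k \<Longrightarrow> Ext b Z Q (FOb Z b) (\<lambda>x. FAr Z (x, b)) (Q b)" by blast
  note ck = wo_category[OF wk]
  have QH: "Q a \<in> Hom FN (FOb Z a) CF" if "a \<in> Field k" for a using X[OF that] by (simp add: Ext_def)
  have QZ: "Q a \<cdot>\<^bsub>FN\<^esub> FAr Z (x, a) = Q x" if "(x, a) \<in> k" for a x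
  proof (cases "x = a")
    case True
    have a: "a \<in> Field k" using FieldD[OF that] by simp
    show ?thesis unfolding True using ord_functor_Id[OF fZ a] comp_id[OF FN QH[OF a]] by metis
  next
    case False
    then show ?thesis using X[of a] FieldD[OF that] that by (simp add: Ext_def underS_def)
  qed
  have ZH: "FAr Z (a, b) \<in> Hom FN (FOb Z a) (FOb Z b)" if "(a, b) \<in> k" for a b using ord_functor_Hom[OF fZ that] .
  have SR: "SR (Q a) (FAr Z (a, b)) (Q b)" if "succ_elem k a b" for a b
    using X[OF succ_elemD(2)[OF that]] that by (simp add: Ext_def)
  have "\<exists>c \<tau>. is_colimit (ord_cat k) N (eval_diag Z f) c \<tau>" if "f \<in> Obj AN" for f
    by (rule wo_colimit_exists[OF U biN wk smk eval_diag_functor[OF AN N ck fZ that]])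
  then obtain c \<tau> where c: "is_cocone (ord_cat k) FN Z c \<tau>"
    "\<And>f. f \<in> Obj AN \<Longrightarrow> is_colimit (ord_cat k) N (eval_diag Z f) (FOb c f) (\<lambda>j. Cmp (\<tau> j) f)"
    using pointwise_colimit_exists[OF AN N ck fZ] by blast
  note cc = pointwise_colimit[OF AN N ck fZ c]
  note coc = ord_coconeD[OF c(1)]
  have "is_cocone (ord_cat k) FN Z CF Q"
  proof (rule ord_coconeI)
    show "CF \<in> Obj FN" using dcF by simp
  qed (use QH QZ in auto)
  then obtain q where q: "q \<in> Hom FN c CF" "\<And>a. a \<in> Field k \<Longrightarrow> q \<cdot>\<^bsub>FN\<^esub> \<tau> a = Q a"
    using colimit_ex[OF cc] unfolding ord_cat_simps by blast
  have nek: "Field k \<noteq> {}" using k(2) by auto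
  obtain a0 where a0: "least_elem k a0" using least_elem_exists[OF wk nek] by blast
  have a0F: "a0 \<in> Field k" using a0 by (simp add: least_elem_def)
  have Z0: "FOb Z a0 = dom_fctr N" "Q a0 = tautological_nat N" using X[OF a0F] a0 by (auto simp: Ext_def)
  have lam: "lambda_sequence k N (eval_diag Z f)" if f: "f \<in> Arr N" for f
    unfolding lambda_sequence_def
  proof (intro conjI allI impI)
    show "is_functor (ord_cat k) N (eval_diag Z f)" using eval_diag_functor[OF AN N ck fZ] f by simp
    fix b assume "limit_elem k b"
    then show "is_colimit (ord_cat (Restr k (underS k b))) N (eval_diag Z f) (FOb (eval_diag Z f) b) (\<lambda>a. FAr (eval_diag Z f) (a, b))"
      using X[of b] f by (simp add: Ext_def limit_elem_def)
  qed
  have sl: "has_lift N (FAr (eval_diag Z f) (a, b)) y" if f: "f \<in> Arr N" and ab: "succ_elem k a b" and y: "y \<in> Arr N" "\<And>e. e \<in> L \<Longrightarrow> has_lift M e (FAr V y)" for f a b y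
  proof -
    obtain t where t: "free_extension (l (FAr V (Cmp (Q a) f))) (Cmp (FAr Z (a, b)) f) t" using SR[OF ab] f unfolding SR_def by blast
    have "Cmp (Q a) f \<in> Hom N (FOb (FOb Z a) f) (Cod N f)"
      using nat_comp_Hom[OF QH[OF succ_elemD(1)[OF ab]], of f] f by (simp add: dom_cod_simps)
    then have "l (FAr V (Cmp (Q a) f)) \<in> L" using lL[OF HomD(1)[OF VH]] by blast
    then show ?thesis using free_extension_has_lift[OF t y(1) y(2)] by simp
  qed
  have cF: "c \<in> Functors AN N" using coc(1) by simp
  define l' where "l' = (\<lambda>f. Cmp (\<tau> a0) f)"
  define r' where "r' = (\<lambda>f. Cmp q f)"
  have l'H: "l' f \<in> Hom N (Dom N f) (FOb c f)" if "f \<in> Arr N" for f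
    using nat_comp_Hom[OF coc(2)[OF a0F], of f] that unfolding Z0 l'_def by (simp add: dom_cod_simps)
  have r'H: "r' f \<in> Hom N (FOb c f) (Cod N f)" if "f \<in> Arr N" for f
    using nat_comp_Hom[OF q(1), of f] that unfolding r'_def by (simp add: dom_cod_simps)
  have rl: "r' f \<cdot>\<^bsub>N\<^esub> l' f = f" if "f \<in> Arr N" for f
  proof -
    have "Cmp (q \<cdot>\<^bsub>FN\<^esub> \<tau> a0) f = f" unfolding q(2)[OF a0F] Z0 using that by (simp add: tautological_nat_def)
    then show ?thesis using nat_Comp_Cmp[of f AN N q "\<tau> a0"] that unfolding l'_def r'_def by simp
  qed
  have l'L: "has_lift N (l' f) y" if f: "f \<in> Arr N" and y: "y \<in> Arr N" "\<And>e. e \<in> L \<Longrightarrow> has_lift M e (FAr V y)" for f y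
    unfolding l'_def
    by (rule transfinite_has_lift[OF N wk lam[OF f] c(2) a0 y(1) sl[OF f _ y]]) (use f in simp_all)
  have r'R: "FAr V (r' f) \<in> R" if f: "f \<in> Arr N" for f
  proof -
    have fo: "f \<in> Obj AN" using f by simp
    have fE: "is_functor (ord_cat k) N (eval_diag Z f)" using lam[OF f] by (simp add: lambda_sequence_def)
    note rH = VH[OF r'H[OF f]]
    have Zf: "Cmp (FAr Z (a, b)) f \<in> Hom N (FOb (FOb Z a) f) (FOb (FOb Z b) f)" if "(a, b) \<in> k" for a b using nat_comp_Hom[OF ZH[OF that] fo] .
    have tf: "Cmp (\<tau> a) f \<in> Hom N (FOb (FOb Z a) f) (FOb c f)" if "a \<in> Field k" for a using nat_comp_Hom[OF coc(2)[OF that] fo] .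
    have Qf: "Cmp (Q a) f \<in> Hom N (FOb (FOb Z a) f) (Cod N f)" if "a \<in> Field k" for a
      using nat_comp_Hom[OF QH[OF that] fo] f by (simp add: dom_cod_simps)
    have rt: "r' f \<cdot>\<^bsub>N\<^esub> Cmp (\<tau> a) f = Cmp (Q a) f" if "a \<in> Field k" for a
      unfolding r'_def using q(2)[OF that] nat_Comp_Cmp[OF fo, of N q "\<tau> a"] by metis
    have tZ: "Cmp (\<tau> b) f \<cdot>\<^bsub>N\<^esub> Cmp (FAr Z (a, b)) f = Cmp (\<tau> a) f" if "(a, b) \<in> k" for a b
      using coc(3)[OF that] nat_Comp_Cmp[OF fo, of N "\<tau> b" "FAr Z (a, b)"] by metis
    have VW: "FAr (post_fctr V (eval_diag Z f)) (a, b) \<in> W" if "succ_elem k a b" for a b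
      unfolding post_fctr_simps
      by (rule W[OF _ sl[OF f that]]) (use HomD(1)[OF Zf[OF succ_elemD(4)[OF that]]] in simp_all)
    note col = preserves_colimits[OF ck fE c(2)[OF fo]] and pl = post_lambda_sequence[OF wk lam[OF f]]
    have "has_lift M i (FAr V (r' f))" if i: "i \<in> I" for i
    proof -
      have ss: "seq_small k M (post_fctr V (eval_diag Z f)) (FOb V (FOb c f)) (\<lambda>j. FAr V (Cmp (\<tau> j) f)) (Dom M i)"
        using kf(2)[OF i] k(1-4) k(5)[OF i] pl VW col unfolding card_small_rel_iff[OF M] by blast
      have iH: "i \<in> Hom M (Dom M i) (Cod M i)" using HomI[OF subsetD[OF IA i]] .
      show ?thesis
      proof (rule has_liftI[OF iH rH])
        fix u v assume u: "u \<in> Hom M (Dom M i) (FOb V (FOb c f))" and v: "v \<in> Hom M (Cod M i) (FOb V (Cod N f))"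
          and eq: "v \<cdot> i = FAr V (r' f) \<cdot> u"
        obtain a u' where a: "a \<in> Field k" "u' \<in> Hom M (Dom M i) (FOb V (FOb (FOb Z a) f))" "FAr V (Cmp (\<tau> a) f) \<cdot> u' = u"
          using ss u unfolding seq_small_def post_fctr_simps eval_diag_simps by blast
        obtain b where ab: "succ_elem k a b" using infinite_card_succ[OF k(1,2) a(1)] by blast
        note abr = succ_elemD(4)[OF ab] and bF = succ_elemD(2)[OF ab]
        define p where "p = FAr V (Cmp (Q a) f)"
        have p: "p \<in> Hom M (FOb V (FOb (FOb Z a) f)) (FOb V (Cod N f))" unfolding p_def by (rule VH[OF Qf[OF a(1)]])
        have lp: "l p \<in> Hom M (FOb V (FOb (FOb Z a) f)) (FOb E p)" and rp: "r p \<in> Hom M (FOb E p) (FOb V (Cod N f))" and rlp: "r p \<cdot> l p = p"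
          using lr[OF HomD(1)[OF p]] HomD(2,3)[OF p] by auto
        obtain t where t: "t \<in> Hom M (FOb E p) (FOb V (FOb (FOb Z b) f))" "free_extension (l p) (Cmp (FAr Z (a, b)) f) t"
          "FAr V (Cmp (Q b) f) \<cdot> t = r p"
          using SR[OF ab] f HomD(3)[OF Zf[OF abr]] unfolding SR_def p_def by auto
        have tl: "t \<cdot> l p = FAr V (Cmp (FAr Z (a, b)) f)" using t(2) by (simp add: free_extension_def)
        have "v \<cdot> i = r p \<cdot> (l p \<cdot> u')"
          using eq a(3) comp_assoc[OF M a(2) VH[OF tf[OF a(1)]] rH] VC[OF tf[OF a(1)] r'H[OF f]] rt[OF a(1)]
            comp_assoc[OF M a(2) lp rp] rlp by (simp add: p_def)
        moreover have "has_lift M i (r p)" using rR[OF HomD(1)[OF p]] i unfolding RI by blast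
        ultimately obtain h where h: "h \<in> Hom M (Cod M i) (FOb E p)" "h \<cdot> i = l p \<cdot> u'" "r p \<cdot> h = v"
          using has_liftD[OF _ iH rp comp_Hom[OF M a(2) lp] v] by blast
        note tb = VH[OF tf[OF bF]] and th = comp_Hom[OF M h(1) t(1)]
        have "(FAr V (Cmp (\<tau> b) f) \<cdot> (t \<cdot> h)) \<cdot> i = u"
        proof -
          have "(t \<cdot> h) \<cdot> i = FAr V (Cmp (FAr Z (a, b)) f) \<cdot> u'"
            using comp_assoc[OF M iH h(1) t(1)] h(2) comp_assoc[OF M a(2) lp t(1)] tl by simp
          then show ?thesis
            using comp_assoc[OF M iH th tb] comp_assoc[OF M a(2) VH[OF Zf[OF abr]] tb] VC[OF Zf[OF abr] tf[OF bF]] tZ[OF abr] a(3) by simp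
        qed
        moreover have "FAr V (r' f) \<cdot> (FAr V (Cmp (\<tau> b) f) \<cdot> (t \<cdot> h)) = v"
          using comp_assoc[OF M th tb rH] VC[OF tf[OF bF] r'H[OF f]] rt[OF bF] comp_assoc[OF M h(1) t(1) VH[OF Qf[OF bF]]] t(3) h(3) by simp
        ultimately show "\<exists>h. h \<in> Hom M (Cod M i) (FOb V (FOb c f)) \<and> h \<cdot> i = u \<and> FAr V (r' f) \<cdot> h = v"
          using comp_Hom[OF M th tb] by blast
      qed
    qed
    then show ?thesis unfolding RI using HomD(1)[OF rH] by simp
  qed
  show ?thesis
    unfolding functorial_factorization_def
  proof (intro exI conjI)
    show "is_functor AN N c" by (rule FunctorsD[OF cF])
    show "\<forall>f\<in>Arr N. l' f \<in> Hom N (Dom N f) (FOb c f) \<inter> {l \<in> Arr N. \<forall>y\<in>Arr N. (\<forall>e\<in>L. has_lift M e (FAr V y)) \<longrightarrow> has_lift N l y} \<and>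
       r' f \<in> Hom N (FOb c f) (Cod N f) \<inter> {r \<in> Arr N. FAr V r \<in> R} \<and> r' f \<cdot>\<^bsub>N\<^esub> l' f = f"
      using l'H r'H rl l'L r'R HomD(1)[OF l'H] HomD(1)[OF r'H] by simp
    show "\<forall>(f, f', u, v)\<in>Arr AN. FAr c (f, f', u, v) \<cdot>\<^bsub>N\<^esub> l' f = l' f' \<cdot>\<^bsub>N\<^esub> u \<and> r' f' \<cdot>\<^bsub>N\<^esub> FAr c (f, f', u, v) = v \<cdot>\<^bsub>N\<^esub> r' f"
    proof (clarify)
      fix f f' u v assume "(f, f', u, v) \<in> Arr AN"
      then have w: "(f, f', u, v) \<in> Hom AN f f'" using HomI[of "(f, f', u, v)" AN] by simp
      show "FAr c (f, f', u, v) \<cdot>\<^bsub>N\<^esub> l' f = l' f' \<cdot>\<^bsub>N\<^esub> u \<and> r' f' \<cdot>\<^bsub>N\<^esub> FAr c (f, f', u, v) = v \<cdot>\<^bsub>N\<^esub> r' f"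
        using nat_square[OF coc(2)[OF a0F] w] nat_square[OF q(1) w] dom_cod_simps(3,4)[OF w] unfolding Z0 l'_def r'_def by simp
    qed
  qed
qed

end

section \<open>Retract arguments\<close>

text \<open>If \<open>f = r \<cdot> l\<close> lifts against \<open>r\<close>, a diagonal exhibits \<open>f\<close> as a retract of \<open>l\<close>.\<close>

lemma retract_argument:
  fixes M (structure)
  assumes M: "category M" and l: "l \<in> Hom M A E" and r: "r \<in> Hom M E B" and f: "f \<in> Hom M A B" and e: "r \<cdot> l = f"
    and lift: "has_lift M f r"
  shows "retract_of (arrow_cat M) f l"
proof -
  note idA = id_Hom[OF M Hom_Obj(1)[OF M f]] and idB = id_Hom[OF M Hom_Obj(2)[OF M f]]
  have "Id M B \<cdot> f = r \<cdot> l" using id_comp[OF M f] e by simp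
  then obtain h where h: "h \<in> Hom M B E" "h \<cdot> f = l" "r \<cdot> h = Id M B"
    using has_liftD[OF lift f r l idB] by blast
  have "(f, l, Id M A, h) \<in> Hom (arrow_cat M) f l"
    unfolding arrow_Hom_iff using f l h idA comp_id[OF M l] by (simp add: HomD)
  moreover have "(l, f, Id M A, r) \<in> Hom (arrow_cat M) l f"
    unfolding arrow_Hom_iff using f l r idA comp_id[OF M f] e by (simp add: HomD)
  moreover have "(l, f, Id M A, r) \<cdot>\<^bsub>arrow_cat M\<^esub> (f, l, Id M A, h) = Id (arrow_cat M) f"
    using h(3) comp_id[OF M idA] HomD[OF f] by simp
  ultimately show ?thesis unfolding retract_of_def by blast
qed

lemma retractE:
  fixes M (structure)
  assumes M: "category M" and rt: "retract_of (arrow_cat M) f g"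
  obtains u v u' v' where "f \<in> Arr M" "g \<in> Arr M" "(f, g, u, v) \<in> Hom (arrow_cat M) f g" "(g, f, u', v') \<in> Hom (arrow_cat M) g f"
    "u \<in> Hom M (Dom M f) (Dom M g)" "v \<in> Hom M (Cod M f) (Cod M g)" "u' \<in> Hom M (Dom M g) (Dom M f)" "v' \<in> Hom M (Cod M g) (Cod M f)"
    "v \<cdot> f = g \<cdot> u" "v' \<cdot> g = f \<cdot> u'" "u' \<cdot> u = Id M (Dom M f)" "v' \<cdot> v = Id M (Cod M f)"
proof -
  obtain i r where i: "i \<in> Hom (arrow_cat M) f g" and r: "r \<in> Hom (arrow_cat M) g f" and ri: "r \<cdot>\<^bsub>arrow_cat M\<^esub> i = Id (arrow_cat M) f"
    using rt unfolding retract_of_def by blast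
  obtain u v where 1: "i = (f, g, u, v)" using arrow_HomE[OF i] by metis
  obtain u' v' where 2: "r = (g, f, u', v')" using arrow_HomE[OF r] by metis
  show ?thesis
    by (rule that[of u v u' v']) (use i r ri in \<open>simp_all add: 1 2 arrow_Hom_iff\<close>)
qed

lemma retract_has_lift:
  fixes M (structure)
  assumes M: "category M" and rt: "retract_of (arrow_cat M) f g" and p: "p \<in> Arr M" and l: "has_lift M g p"
  shows "has_lift M f p"
proof -
  obtain u v u' v' where f: "f \<in> Arr M" and g: "g \<in> Arr M"
    and a: "u \<in> Hom M (Dom M f) (Dom M g)" "v \<in> Hom M (Cod M f) (Cod M g)" "u' \<in> Hom M (Dom M g) (Dom M f)" "v' \<in> Hom M (Cod M g) (Cod M f)"
    "v \<cdot> f = g \<cdot> u" "v' \<cdot> g = f \<cdot> u'" "u' \<cdot> u = Id M (Dom M f)" "v' \<cdot> v = Id M (Cod M f)"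
    using retractE[OF M rt] by metis
  note fH = HomI[OF f] and gH = HomI[OF g] and pH = HomI[OF p]
  show ?thesis
  proof (rule has_liftI[OF fH pH])
    fix s t assume s: "s \<in> Hom M (Dom M f) (Dom M p)" and t: "t \<in> Hom M (Cod M f) (Cod M p)" and e: "t \<cdot> f = p \<cdot> s"
    have "(t \<cdot> v') \<cdot> g = p \<cdot> (s \<cdot> u')"
      using comp_assoc[OF M gH a(4) t] a(6) comp_assoc[OF M a(3) fH t] e comp_assoc[OF M a(3) s pH] by simp
    then obtain h where h: "h \<in> Hom M (Cod M g) (Dom M p)" "h \<cdot> g = s \<cdot> u'" "p \<cdot> h = t \<cdot> v'"
      using has_liftD[OF l gH pH comp_Hom[OF M a(3) s] comp_Hom[OF M a(4) t]] by blast
    have "(h \<cdot> v) \<cdot> f = s"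
      using comp_assoc[OF M fH a(2) h(1)] a(5) comp_assoc[OF M a(1) gH h(1)] h(2) comp_assoc[OF M a(1,3) s] a(7) comp_id[OF M s] by simp
    moreover have "p \<cdot> (h \<cdot> v) = t"
      using comp_assoc[OF M a(2) h(1) pH] h(3) comp_assoc[OF M a(2,4) t] a(8) comp_id[OF M t] by simp
    ultimately show "\<exists>h. h \<in> Hom M (Cod M f) (Dom M p) \<and> h \<cdot> f = s \<and> p \<cdot> h = t"
      using comp_Hom[OF M a(2) h(1)] by blast
  qed
qed

lemma functor_retract:
  fixes N (structure)
  assumes N: "category N" and M: "category M" and V: "is_functor N M V" and rt: "retract_of (arrow_cat N) f g"
  shows "retract_of (arrow_cat M) (FAr V f) (FAr V g)"
proof -
  obtain u v u' v' where f: "f \<in> Arr N" and g: "g \<in> Arr N"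
    and a: "u \<in> Hom N (Dom N f) (Dom N g)" "v \<in> Hom N (Cod N f) (Cod N g)" "u' \<in> Hom N (Dom N g) (Dom N f)" "v' \<in> Hom N (Cod N g) (Cod N f)"
    "v \<cdot> f = g \<cdot> u" "v' \<cdot> g = f \<cdot> u'" "u' \<cdot> u = Id N (Dom N f)" "v' \<cdot> v = Id N (Cod N f)"
    using retractE[OF N rt] by metis
  note fH = HomI[OF f] and gH = HomI[OF g]
  note VH = functor_Hom[OF V] and VC = functor_Comp[OF V]
  have e1: "FAr V v \<cdot>\<^bsub>M\<^esub> FAr V f = FAr V g \<cdot>\<^bsub>M\<^esub> FAr V u" using VC[OF fH a(2)] VC[OF a(1) gH] a(5) by simp
  have e2: "FAr V v' \<cdot>\<^bsub>M\<^esub> FAr V g = FAr V f \<cdot>\<^bsub>M\<^esub> FAr V u'" using VC[OF gH a(4)] VC[OF a(3) fH] a(6) by simp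
  have e3: "FAr V u' \<cdot>\<^bsub>M\<^esub> FAr V u = Id M (FOb V (Dom N f))" "FAr V v' \<cdot>\<^bsub>M\<^esub> FAr V v = Id M (FOb V (Cod N f))"
    using VC[OF a(1,3)] VC[OF a(2,4)] a(7,8) functor_Id[OF V] Hom_Obj[OF N fH] by simp_all
  have "(FAr V f, FAr V g, FAr V u, FAr V v) \<in> Hom (arrow_cat M) (FAr V f) (FAr V g)"
    unfolding arrow_Hom_iff using VH[OF fH] VH[OF gH] VH[OF a(1)] VH[OF a(2)] e1 by (simp add: HomD)
  moreover have "(FAr V g, FAr V f, FAr V u', FAr V v') \<in> Hom (arrow_cat M) (FAr V g) (FAr V f)"
    unfolding arrow_Hom_iff using VH[OF fH] VH[OF gH] VH[OF a(3)] VH[OF a(4)] e2 by (simp add: HomD)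
  moreover have "(FAr V g, FAr V f, FAr V u', FAr V v') \<cdot>\<^bsub>arrow_cat M\<^esub> (FAr V f, FAr V g, FAr V u, FAr V v) = Id (arrow_cat M) (FAr V f)"
    using e3 HomD(2,3)[OF VH[OF fH]] by simp
  ultimately show ?thesis unfolding retract_of_def by blast
qed

lemma factorization_exists:
  assumes "functorial_factorization M L R" "f \<in> Arr M"
  shows "\<exists>E l r. l \<in> Hom M (Dom M f) E \<and> l \<in> L \<and> r \<in> Hom M E (Cod M f) \<and> r \<in> R \<and> r \<cdot>\<^bsub>M\<^esub> l = f"
  using assms unfolding functorial_factorization_def by blast

lemma functorial_factorization_mono:
  fixes M (structure)
  assumes "functorial_factorization M L R" "L \<subseteq> L'" "R \<subseteq> R'"
  shows "functorial_factorization M L' R'"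
proof -
  obtain E l r where 1: "is_functor (arrow_cat M) M E"
    "\<forall>f \<in> Arr M. l f \<in> Hom M (Dom M f) (FOb E f) \<inter> L \<and> r f \<in> Hom M (FOb E f) (Cod M f) \<inter> R \<and> r f \<cdot> l f = f"
    "\<forall>(f, f', u, v) \<in> Arr (arrow_cat M). FAr E (f, f', u, v) \<cdot> l f = l f' \<cdot> u \<and> r f' \<cdot> FAr E (f, f', u, v) = v \<cdot> r f"
    using assms(1) unfolding functorial_factorization_def by blast
  have 2: "\<forall>f \<in> Arr M. l f \<in> Hom M (Dom M f) (FOb E f) \<inter> L' \<and> r f \<in> Hom M (FOb E f) (Cod M f) \<inter> R' \<and> r f \<cdot> l f = f"
    using 1(2) assms(2,3) by auto
  show ?thesis unfolding functorial_factorization_def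
    by (rule exI[of _ E], rule exI[of _ l], rule exI[of _ r]) (intro conjI 1(1) 2 1(3))
qed

section \<open>The lifted model structure\<close>

context equivariant
begin

lemma restriction_has_adjoints: "adjoint_functor U N M V"
proof (rule adjoint_functor.intro)
  show "universe U" by (rule U)
  show "bicomplete U N" by (rule fun_cat_bicomplete[OF D_category bi])
  show "category M" by (rule M_category)
  show "is_functor N M V" by (rule V_functor)
next
  fix X assume "X \<in> Obj M"
  then have X: "X \<in> Functors C K" by simp
  show "\<exists>F \<eta>. universal_from N M V X F \<eta>" using free_universal[OF X] unfolding universal_from_def .
next
  fix X assume "X \<in> Obj M"
  then have X: "X \<in> Functors C K" by simp
  obtain T \<pi> where T: "cofree X T \<pi>" using cofree_exists[OF X] by blast
  define \<epsilon> where "\<epsilon> = \<lparr> Src = FOb V T, Tgt = X, Cmp = restrict (\<lambda>y. \<pi> y \<one>\<^bsub>G\<^esub>) (Obj C) \<rparr>"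
  have "universal_to N M V X T \<epsilon>"
    unfolding universal_to_def
    using cofreeD(2)[OF T] cofree_counit[OF T] cofree_universal[OF T _ _ \<epsilon>_def] \<epsilon>_def by simp
  then show "\<exists>T \<epsilon>. universal_to N M V X T \<epsilon>" by blast
qed

interpretation adj: adjoint_functor U N M V by (rule restriction_has_adjoints)

text \<open>The map \<open>p'\<close> is the value at \<open>p\<close> of the right adjoint of \<open>V\<close>. The second clause is the
  adjunction. For the first one, \<open>V p'\<close> is at \<open>y\<close> the product of the maps \<open>p\<close> at \<open>\<rho>\<^sub>g y\<close>. A
  lifting problem from \<open>i\<close> to it splits into one problem for each \<open>g\<close>, from \<open>i\<close> to the translate
  of \<open>p\<close> by \<open>g\<close>; translating back by the inverse of \<open>g\<close>, this is a problem from a translate of \<open>i\<close>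
  to \<open>p\<close>, and the solutions assemble to a map into the product.\<close>

lemma lifting_against_cofree:
  assumes p: "p \<in> Arr M"
  shows "\<exists>p' \<in> Arr N. (\<forall>i \<in> Arr M. (\<forall>g \<in> carrier G. has_lift M (FAr (precomp C (\<rho> g)) i) p) \<longrightarrow> has_lift M i (FAr V p')) \<and>
    (\<forall>s \<in> Arr N. has_lift N s p' \<longrightarrow> has_lift M (FAr V s) p)"
proof -
  define P Q where PQ: "P = Dom M p" "Q = Cod M p"
  have pH: "p \<in> Hom M P Q" unfolding PQ by (rule HomI[OF p])
  have P: "P \<in> Functors C K" and Q: "Q \<in> Functors C K" using nat_Functors[OF pH] by auto
  obtain TP \<pi> where TP: "cofree P TP \<pi>" using cofree_exists[OF P] by blast
  obtain TQ \<theta> where TQ: "cofree Q TQ \<theta>" using cofree_exists[OF Q] by blast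
  define \<epsilon>P where "\<epsilon>P = \<lparr> Src = FOb V TP, Tgt = P, Cmp = restrict (\<lambda>y. \<pi> y \<one>\<^bsub>G\<^esub>) (Obj C) \<rparr>"
  define \<epsilon>Q where "\<epsilon>Q = \<lparr> Src = FOb V TQ, Tgt = Q, Cmp = restrict (\<lambda>y. \<theta> y \<one>\<^bsub>G\<^esub>) (Obj C) \<rparr>"
  have \<epsilon>P: "\<epsilon>P \<in> Hom M (FOb V TP) P" unfolding \<epsilon>P_def by (rule cofree_counit[OF TP])
  have \<epsilon>Q: "\<epsilon>Q \<in> Hom M (FOb V TQ) Q" unfolding \<epsilon>Q_def by (rule cofree_counit[OF TQ])
  note TPF = cofreeD(2)[OF TP] and TQF = cofreeD(2)[OF TQ]
  note uP = cofree_universal[OF TP _ _ \<epsilon>P_def] and uQ = cofree_universal[OF TQ _ _ \<epsilon>Q_def]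
  note VH = adj.VH and VC = adj.VC
  obtain p' where p': "p' \<in> Hom N TP TQ" "\<epsilon>Q \<cdot>\<^bsub>M\<^esub> FAr V p' = p \<cdot>\<^bsub>M\<^esub> \<epsilon>P"
    using uQ[OF TPF comp_Hom[OF M_category \<epsilon>P pH]] by blast
  have pc: "Cmp p x \<in> Hom K (FOb P x) (FOb Q x)" if "x \<in> Obj C" for x using nat_comp_Hom[OF pH that] .
  have p'c: "Cmp p' x \<in> Hom K (FOb TP x) (FOb TQ x)" if "x \<in> Obj C" for x using nat_comp_Hom[OF p'(1), of x] that by simp
  have \<pi>1: "\<pi> x \<one>\<^bsub>G\<^esub> \<in> Hom K (FOb TP x) (FOb P x)" and \<theta>1: "\<theta> x \<one>\<^bsub>G\<^esub> \<in> Hom K (FOb TQ x) (FOb Q x)" if "x \<in> Obj C" for x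
    using cofreeD(5)[OF TP that one_closed] cofreeD(5)[OF TQ that one_closed] rho_one(1)[OF that] by auto
  have p1: "\<theta> x \<one>\<^bsub>G\<^esub> \<cdot> Cmp p' x = Cmp p x \<cdot> \<pi> x \<one>\<^bsub>G\<^esub>" if "x \<in> Obj C" for x
    using arg_cong[OF p'(2), of "\<lambda>t. Cmp t x"] that by (simp add: \<epsilon>P_def \<epsilon>Q_def)
  \<comment> \<open>Hence \<open>p'\<close> is the product of the translates of \<open>p\<close>, in terms of the projections.\<close>
  have pk: "\<theta> y k \<cdot> Cmp p' y = Cmp p (rO k y) \<cdot> \<pi> y k" if y: "y \<in> Obj C" and k: "k \<in> carrier G" for y k
  proof -
    note ky = rO_Obj[OF k y] and sh = D_shift(1)[OF k y]
    note TPs = functor_Hom[OF FunctorsD[OF TPF] sh] and TQs = functor_Hom[OF FunctorsD[OF TQF] sh]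
    have "\<theta> y k \<cdot> Cmp p' y = \<theta> (rO k y) \<one>\<^bsub>G\<^esub> \<cdot> (FAr TQ (Id C (rO k y), k) \<cdot> Cmp p' y)"
      using comp_assoc[OF K p'c[OF y] TQs \<theta>1[OF ky]] cofree_counit_shift[OF TQ y k] by simp
    also have "\<dots> = (Cmp p (rO k y) \<cdot> \<pi> (rO k y) \<one>\<^bsub>G\<^esub>) \<cdot> FAr TP (Id C (rO k y), k)"
      using nat_square[OF p'(1) sh] comp_assoc[OF K TPs p'c[OF ky] \<theta>1[OF ky]] p1[OF ky] by simp
    also have "\<dots> = Cmp p (rO k y) \<cdot> \<pi> y k"
      using comp_assoc[OF K TPs \<pi>1[OF ky] pc[OF ky]] cofree_counit_shift[OF TP y k] by simp
    finally show ?thesis .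
  qed
  have 2: "has_lift M (FAr V s) p" if s: "s \<in> Arr N" and l: "has_lift N s p'" for s
  proof -
    define X Y where XY: "X = Dom N s" "Y = Cod N s"
    have sH: "s \<in> Hom N X Y" unfolding XY by (rule HomI[OF s])
    have X: "X \<in> Functors D K" and Y: "Y \<in> Functors D K" using nat_Functors[OF sH] by auto
    show ?thesis
    proof (rule has_liftI[OF VH[OF sH] pH])
      fix u v assume u: "u \<in> Hom M (FOb V X) P" and v: "v \<in> Hom M (FOb V Y) Q" and e: "v \<cdot>\<^bsub>M\<^esub> FAr V s = p \<cdot>\<^bsub>M\<^esub> u"
      obtain u' where u': "u' \<in> Hom N X TP" "\<epsilon>P \<cdot>\<^bsub>M\<^esub> FAr V u' = u" using uP[OF X u] by blast
      obtain v' where v': "v' \<in> Hom N Y TQ" "\<epsilon>Q \<cdot>\<^bsub>M\<^esub> FAr V v' = v" using uQ[OF Y v] by blast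
      note vs = comp_Hom[OF N_category sH v'(1)] and pu = comp_Hom[OF N_category u'(1) p'(1)]
      have "\<epsilon>Q \<cdot>\<^bsub>M\<^esub> FAr V (v' \<cdot>\<^bsub>N\<^esub> s) = v \<cdot>\<^bsub>M\<^esub> FAr V s"
        unfolding VC[OF sH v'(1)] using comp_assoc[OF M_category VH[OF sH] VH[OF v'(1)] \<epsilon>Q] v'(2) by metis
      moreover have "\<epsilon>Q \<cdot>\<^bsub>M\<^esub> FAr V (p' \<cdot>\<^bsub>N\<^esub> u') = p \<cdot>\<^bsub>M\<^esub> u"
        unfolding VC[OF u'(1) p'(1)]
        using comp_assoc[OF M_category VH[OF u'(1)] VH[OF p'(1)] \<epsilon>Q] p'(2) comp_assoc[OF M_category VH[OF u'(1)] \<epsilon>P pH] u'(2) by metis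
      ultimately have "v' \<cdot>\<^bsub>N\<^esub> s = p' \<cdot>\<^bsub>N\<^esub> u'"
        using uQ[OF X comp_Hom[OF M_category VH[OF sH] v]] vs pu e by metis
      then obtain h where h: "h \<in> Hom N Y TP" "h \<cdot>\<^bsub>N\<^esub> s = u'" "p' \<cdot>\<^bsub>N\<^esub> h = v'"
        using has_liftD[OF l sH p'(1) u'(1) v'(1)] by blast
      have "(\<epsilon>P \<cdot>\<^bsub>M\<^esub> FAr V h) \<cdot>\<^bsub>M\<^esub> FAr V s = u"
        using comp_assoc[OF M_category VH[OF sH] VH[OF h(1)] \<epsilon>P] VC[OF sH h(1)] h(2) u'(2) by metis
      moreover have "p \<cdot>\<^bsub>M\<^esub> (\<epsilon>P \<cdot>\<^bsub>M\<^esub> FAr V h) = v"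
        using comp_assoc[OF M_category VH[OF h(1)] \<epsilon>P pH] p'(2) comp_assoc[OF M_category VH[OF h(1)] VH[OF p'(1)] \<epsilon>Q] VC[OF h(1) p'(1)] h(3) v'(2) by metis
      ultimately show "\<exists>h. h \<in> Hom M (FOb V Y) P \<and> h \<cdot>\<^bsub>M\<^esub> FAr V s = u \<and> p \<cdot>\<^bsub>M\<^esub> h = v"
        using comp_Hom[OF M_category VH[OF h(1)] \<epsilon>P] by blast
    qed
  qed
  have 1: "has_lift M i (FAr V p')" if i: "i \<in> Arr M" and l: "\<And>g. g \<in> carrier G \<Longrightarrow> has_lift M (FAr (precomp C (\<rho> g)) i) p" for i
  proof -
    define A B where AB: "A = Dom M i" "B = Cod M i"
    have iH: "i \<in> Hom M A B" unfolding AB by (rule HomI[OF i])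
    have A: "A \<in> Functors C K" and B: "B \<in> Functors C K" using nat_Functors[OF iH] by auto
    note fP = FunctorsD[OF P] and fQ = FunctorsD[OF Q] and fA = FunctorsD[OF A] and fB = FunctorsD[OF B]
      and fTP = FunctorsD[OF TPF] and fTQ = FunctorsD[OF TQF]
    have ic: "Cmp i x \<in> Hom K (FOb A x) (FOb B x)" if "x \<in> Obj C" for x using nat_comp_Hom[OF iH that] .
    show ?thesis
    proof (rule has_liftI[OF iH VH[OF p'(1)]])
      fix u v assume u: "u \<in> Hom M A (FOb V TP)" and v: "v \<in> Hom M B (FOb V TQ)" and e: "v \<cdot>\<^bsub>M\<^esub> i = FAr V p' \<cdot>\<^bsub>M\<^esub> u"
      have uc: "Cmp u x \<in> Hom K (FOb A x) (FOb TP x)" and vc: "Cmp v x \<in> Hom K (FOb B x) (FOb TQ x)" if "x \<in> Obj C" for x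
        using nat_comp_Hom[OF u that] nat_comp_Hom[OF v that] that by simp_all
      have ec: "Cmp v x \<cdot> Cmp i x = Cmp p' x \<cdot> Cmp u x" if "x \<in> Obj C" for x
        using arg_cong[OF e, of "\<lambda>t. Cmp t x"] that by simp
      have usq: "Cmp u y \<cdot> FAr A f = FAr TP (f, \<one>\<^bsub>G\<^esub>) \<cdot> Cmp u x" and vsq: "Cmp v y \<cdot> FAr B f = FAr TQ (f, \<one>\<^bsub>G\<^esub>) \<cdot> Cmp v x"
        if "f \<in> Hom C x y" for f x y
        using nat_square[OF u that] nat_square[OF v that] HomD(1)[OF that] by simp_all
      \<comment> \<open>The component at \<open>g\<close> of the square, as a square from the translate of \<open>i\<close> by the inverse
        of \<open>g\<close> to \<open>p\<close>.\<close>
      have "\<exists>h. h \<in> Hom M (comp_fctr C B (\<rho> (inv\<^bsub>G\<^esub> g))) P \<and>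
          (\<forall>y \<in> Obj C. Cmp h y \<cdot> Cmp i (rO (inv\<^bsub>G\<^esub> g) y) = \<pi> (rO (inv\<^bsub>G\<^esub> g) y) g \<cdot> Cmp u (rO (inv\<^bsub>G\<^esub> g) y)) \<and>
          (\<forall>y \<in> Obj C. Cmp p y \<cdot> Cmp h y = \<theta> (rO (inv\<^bsub>G\<^esub> g) y) g \<cdot> Cmp v (rO (inv\<^bsub>G\<^esub> g) y))" if g: "g \<in> carrier G" for g
      proof -
        define g' where "g' = inv\<^bsub>G\<^esub> g"
        have g': "g' \<in> carrier G" using g by (simp add: g'_def)
        have gg: "rO g (rO g' y) = y" if "y \<in> Obj C" for y using g that by (simp add: g'_def)
        have ggA: "rA g (rA g' f) = f" if "f \<in> Arr C" for f using g that by (simp add: g'_def)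
        note tf = rho_functor[OF g']
        define i' where "i' = FAr (precomp C (\<rho> g')) i"
        have i'H: "i' \<in> Hom M (comp_fctr C A (\<rho> g')) (comp_fctr C B (\<rho> g'))" unfolding i'_def by (rule precomp_Hom[OF C C tf iH])
        have A': "comp_fctr C A (\<rho> g') \<in> Functors C K" and B': "comp_fctr C B (\<rho> g') \<in> Functors C K" using nat_Functors[OF i'H] by auto
        have i'c: "Cmp i' y = Cmp i (rO g' y)" if "y \<in> Obj C" for y using that by (simp add: i'_def)
        have \<pi>g: "\<pi> (rO g' y) g \<in> Hom K (FOb TP (rO g' y)) (FOb P y)" and \<theta>g: "\<theta> (rO g' y) g \<in> Hom K (FOb TQ (rO g' y)) (FOb Q y)" if "y \<in> Obj C" for y
          using cofreeD(5)[OF TP rO_Obj[OF g' that] g] cofreeD(5)[OF TQ rO_Obj[OF g' that] g] gg[OF that] by auto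
        have \<pi>n: "\<pi> (rO g' y) g \<cdot> FAr TP (rA g' f, \<one>\<^bsub>G\<^esub>) = FAr P f \<cdot> \<pi> (rO g' x) g"
          and \<theta>n: "\<theta> (rO g' y) g \<cdot> FAr TQ (rA g' f, \<one>\<^bsub>G\<^esub>) = FAr Q f \<cdot> \<theta> (rO g' x) g" if f: "f \<in> Hom C x y" for f x y
          using cofreeD(4)[OF TP D_base[OF rA_Hom[OF g' f]] g] cofreeD(4)[OF TQ D_base[OF rA_Hom[OF g' f]] g] ggA[OF HomD(1)[OF f]] g by auto
        define u1 where "u1 = \<lparr> Src = comp_fctr C A (\<rho> g'), Tgt = P, Cmp = restrict (\<lambda>y. \<pi> (rO g' y) g \<cdot> Cmp u (rO g' y)) (Obj C) \<rparr>"
        define v1 where "v1 = \<lparr> Src = comp_fctr C B (\<rho> g'), Tgt = Q, Cmp = restrict (\<lambda>y. \<theta> (rO g' y) g \<cdot> Cmp v (rO g' y)) (Obj C) \<rparr>"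
        have u1: "u1 \<in> Hom M (comp_fctr C A (\<rho> g')) P"
          unfolding u1_def
        proof (rule nat_HomI[OF C A' P])
          show "\<pi> (rO g' y) g \<cdot> Cmp u (rO g' y) \<in> Hom K (FOb (comp_fctr C A (\<rho> g')) y) (FOb P y)" if "y \<in> Obj C" for y
            using comp_Hom[OF K uc[OF rO_Obj[OF g' that]] \<pi>g[OF that]] that by simp
          fix f x y assume f: "f \<in> Hom C x y"
          note x = Hom_Obj(1)[OF C f] and y = Hom_Obj(2)[OF C f]
          note x' = rO_Obj[OF g' x] and y' = rO_Obj[OF g' y] and f' = rA_Hom[OF g' f]
          show "(\<pi> (rO g' y) g \<cdot> Cmp u (rO g' y)) \<cdot> FAr (comp_fctr C A (\<rho> g')) f = FAr P f \<cdot> (\<pi> (rO g' x) g \<cdot> Cmp u (rO g' x))"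
            using comp_assoc[OF K functor_Hom[OF fA f'] uc[OF y'] \<pi>g[OF y]] usq[OF f'] comp_assoc[OF K uc[OF x'] functor_Hom[OF fTP D_base[OF f']] \<pi>g[OF y]]
              \<pi>n[OF f] comp_assoc[OF K uc[OF x'] \<pi>g[OF x] functor_Hom[OF fP f]] HomD(1)[OF f] by simp
        qed
        have v1: "v1 \<in> Hom M (comp_fctr C B (\<rho> g')) Q"
          unfolding v1_def
        proof (rule nat_HomI[OF C B' Q])
          show "\<theta> (rO g' y) g \<cdot> Cmp v (rO g' y) \<in> Hom K (FOb (comp_fctr C B (\<rho> g')) y) (FOb Q y)" if "y \<in> Obj C" for y
            using comp_Hom[OF K vc[OF rO_Obj[OF g' that]] \<theta>g[OF that]] that by simp
          fix f x y assume f: "f \<in> Hom C x y"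
          note x = Hom_Obj(1)[OF C f] and y = Hom_Obj(2)[OF C f]
          note x' = rO_Obj[OF g' x] and y' = rO_Obj[OF g' y] and f' = rA_Hom[OF g' f]
          show "(\<theta> (rO g' y) g \<cdot> Cmp v (rO g' y)) \<cdot> FAr (comp_fctr C B (\<rho> g')) f = FAr Q f \<cdot> (\<theta> (rO g' x) g \<cdot> Cmp v (rO g' x))"
            using comp_assoc[OF K functor_Hom[OF fB f'] vc[OF y'] \<theta>g[OF y]] vsq[OF f'] comp_assoc[OF K vc[OF x'] functor_Hom[OF fTQ D_base[OF f']] \<theta>g[OF y]]
              \<theta>n[OF f] comp_assoc[OF K vc[OF x'] \<theta>g[OF x] functor_Hom[OF fQ f]] HomD(1)[OF f] by simp
        qed
        have "v1 \<cdot>\<^bsub>M\<^esub> i' = p \<cdot>\<^bsub>M\<^esub> u1"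
        proof (rule nat_eqI[OF comp_Hom[OF M_category i'H v1] comp_Hom[OF M_category u1 pH]])
          fix y assume y: "y \<in> Obj C"
          note y' = rO_Obj[OF g' y]
          have "(\<theta> (rO g' y) g \<cdot> Cmp v (rO g' y)) \<cdot> Cmp i (rO g' y) = Cmp p y \<cdot> (\<pi> (rO g' y) g \<cdot> Cmp u (rO g' y))"
            using comp_assoc[OF K ic[OF y'] vc[OF y'] \<theta>g[OF y]] ec[OF y'] comp_assoc[OF K uc[OF y'] p'c[OF y'] \<theta>g[OF y]] pk[OF y' g] gg[OF y]
              comp_assoc[OF K uc[OF y'] \<pi>g[OF y] pc[OF y]] by simp
          then show "Cmp (v1 \<cdot>\<^bsub>M\<^esub> i') y = Cmp (p \<cdot>\<^bsub>M\<^esub> u1) y" using y by (simp add: u1_def v1_def i'c)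
        qed
        then obtain h where h: "h \<in> Hom M (comp_fctr C B (\<rho> g')) P" "h \<cdot>\<^bsub>M\<^esub> i' = u1" "p \<cdot>\<^bsub>M\<^esub> h = v1"
          using has_liftD[OF l[OF g', folded i'_def] i'H pH u1 v1] by blast
        have "Cmp h y \<cdot> Cmp i (rO g' y) = \<pi> (rO g' y) g \<cdot> Cmp u (rO g' y)" "Cmp p y \<cdot> Cmp h y = \<theta> (rO g' y) g \<cdot> Cmp v (rO g' y)" if y: "y \<in> Obj C" for y
          using arg_cong[OF h(2), of "\<lambda>t. Cmp t y"] arg_cong[OF h(3), of "\<lambda>t. Cmp t y"] y i'c[OF y] by (simp_all add: u1_def v1_def)
        then show ?thesis using h(1) unfolding g'_def by blast
      qed
      then obtain hh where hh: "\<And>g. g \<in> carrier G \<Longrightarrow> hh g \<in> Hom M (comp_fctr C B (\<rho> (inv\<^bsub>G\<^esub> g))) P"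
        "\<And>g y. g \<in> carrier G \<Longrightarrow> y \<in> Obj C \<Longrightarrow> Cmp (hh g) y \<cdot> Cmp i (rO (inv\<^bsub>G\<^esub> g) y) = \<pi> (rO (inv\<^bsub>G\<^esub> g) y) g \<cdot> Cmp u (rO (inv\<^bsub>G\<^esub> g) y)"
        "\<And>g y. g \<in> carrier G \<Longrightarrow> y \<in> Obj C \<Longrightarrow> Cmp p y \<cdot> Cmp (hh g) y = \<theta> (rO (inv\<^bsub>G\<^esub> g) y) g \<cdot> Cmp v (rO (inv\<^bsub>G\<^esub> g) y)" by metis
      have hc: "Cmp (hh g) (rO g y) \<in> Hom K (FOb B y) (FOb P (rO g y))" if "g \<in> carrier G" "y \<in> Obj C" for g y
        using nat_comp_Hom[OF hh(1)[OF that(1)] rO_Obj[OF that]] that by simp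
      have "\<exists>w. y \<in> Obj C \<longrightarrow> w \<in> Hom K (FOb B y) (FOb TP y) \<and> (\<forall>g \<in> carrier G. \<pi> y g \<cdot> w = Cmp (hh g) (rO g y))" for y
      proof (cases "y \<in> Obj C")
        case True
        show ?thesis using product_ex[OF cofreeD(3)[OF TP True] functor_Ob[OF fB True] hc[OF _ True]] by blast
      qed simp
      then obtain w where w: "\<And>y. y \<in> Obj C \<Longrightarrow> w y \<in> Hom K (FOb B y) (FOb TP y)"
        "\<And>y g. y \<in> Obj C \<Longrightarrow> g \<in> carrier G \<Longrightarrow> \<pi> y g \<cdot> w y = Cmp (hh g) (rO g y)" by metis
      have VTP: "FOb V TP \<in> Functors C K" using nat_Functors[OF u] by simp
      define h where "h = \<lparr> Src = B, Tgt = FOb V TP, Cmp = restrict w (Obj C) \<rparr>"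
      have h: "h \<in> Hom M B (FOb V TP)"
        unfolding h_def
      proof (rule nat_HomI[OF C B VTP])
        show "w y \<in> Hom K (FOb B y) (FOb (FOb V TP) y)" if "y \<in> Obj C" for y using w(1)[OF that] that by simp
        fix f x y assume f: "f \<in> Hom C x y"
        note x = Hom_Obj(1)[OF C f] and y = Hom_Obj(2)[OF C f]
        note TPf = functor_Hom[OF fTP D_base[OF f]] and Bf = functor_Hom[OF fB f]
        have "w y \<cdot> FAr B f = FAr TP (f, \<one>\<^bsub>G\<^esub>) \<cdot> w x"
        proof (rule product_uniq[OF K cofreeD(3)[OF TP y] comp_Hom[OF K Bf w(1)[OF y]] comp_Hom[OF K w(1)[OF x] TPf]])
          fix g assume g: "g \<in> carrier G"
          note \<pi>y = cofreeD(5)[OF TP y g] and \<pi>x = cofreeD(5)[OF TP x g] and gf = rA_Hom[OF g f]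
          have "Cmp (hh g) (rO g y) \<cdot> FAr B f = FAr P (rA g f) \<cdot> Cmp (hh g) (rO g x)"
            using nat_square[OF hh(1)[OF g] gf] g HomD(1)[OF f] by simp
          then show "\<pi> y g \<cdot> (w y \<cdot> FAr B f) = \<pi> y g \<cdot> (FAr TP (f, \<one>\<^bsub>G\<^esub>) \<cdot> w x)"
            using comp_assoc[OF K Bf w(1)[OF y] \<pi>y] w(2)[OF y g] comp_assoc[OF K w(1)[OF x] TPf \<pi>y] cofreeD(4)[OF TP D_base[OF f] g]
              comp_assoc[OF K w(1)[OF x] \<pi>x functor_Hom[OF fP gf]] w(2)[OF x g] g by simp
        qed
        then show "w y \<cdot> FAr B f = FAr (FOb V TP) f \<cdot> w x" using HomD(1)[OF f] by simp
      qed
      have "h \<cdot>\<^bsub>M\<^esub> i = u"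
      proof (rule nat_eqI[OF comp_Hom[OF M_category iH h] u])
        fix y assume y: "y \<in> Obj C"
        have "w y \<cdot> Cmp i y = Cmp u y"
        proof (rule product_uniq[OF K cofreeD(3)[OF TP y] comp_Hom[OF K ic[OF y] w(1)[OF y]] uc[OF y]])
          fix g assume g: "g \<in> carrier G"
          show "\<pi> y g \<cdot> (w y \<cdot> Cmp i y) = \<pi> y g \<cdot> Cmp u y"
            using comp_assoc[OF K ic[OF y] w(1)[OF y] cofreeD(5)[OF TP y g]] w(2)[OF y g] hh(2)[OF g rO_Obj[OF g y]] g y by simp
        qed
        then show "Cmp (h \<cdot>\<^bsub>M\<^esub> i) y = Cmp u y" using y by (simp add: h_def)
      qed
      moreover have "FAr V p' \<cdot>\<^bsub>M\<^esub> h = v"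
      proof (rule nat_eqI[OF comp_Hom[OF M_category h VH[OF p'(1)]] v])
        fix y assume y: "y \<in> Obj C"
        have "Cmp p' y \<cdot> w y = Cmp v y"
        proof (rule product_uniq[OF K cofreeD(3)[OF TQ y] comp_Hom[OF K w(1)[OF y] p'c[OF y]] vc[OF y]])
          fix g assume g: "g \<in> carrier G"
          show "\<theta> y g \<cdot> (Cmp p' y \<cdot> w y) = \<theta> y g \<cdot> Cmp v y"
            using comp_assoc[OF K w(1)[OF y] p'c[OF y] cofreeD(5)[OF TQ y g]] pk[OF y g]
              comp_assoc[OF K w(1)[OF y] cofreeD(5)[OF TP y g] pc[OF rO_Obj[OF g y]]] w(2)[OF y g] hh(3)[OF g rO_Obj[OF g y]] g y by simp
        qed
        then show "Cmp (FAr V p' \<cdot>\<^bsub>M\<^esub> h) y = Cmp v y" using y by (simp add: h_def)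
      qed
      ultimately show "\<exists>h. h \<in> Hom M B (FOb V TP) \<and> h \<cdot>\<^bsub>M\<^esub> i = u \<and> FAr V p' \<cdot>\<^bsub>M\<^esub> h = v" using h by blast
    qed
  qed
  show ?thesis using 1 2 HomD(1)[OF p'(1)] by blast
qed

text \<open>Transfer of a single weak factorisation system \<open>(L, R)\<close>; it is used for both systems of the
  model structure. The class \<open>W\<close> of \<open>adjoint_factorization\<close> is everything if all objects of \<open>K\<close>
  are small. Otherwise it is the left class \<open>L\<close>, described by lifting, and
  \<open>lifting_against_cofree\<close> shows that \<open>V\<close> sends maps of the transferred left class into it. The
  generating maps of \<open>N\<close> are the free maps on the generating maps of \<open>M\<close>.\<close>

lemma transfer_weak_factorization:
  assumes lsK: "locally_small_category U K"
    and ff: "functorial_factorization M L R" and LA: "L \<subseteq> Arr M"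
    and LR: "\<And>e p. e \<in> L \<Longrightarrow> p \<in> R \<Longrightarrow> has_lift M e p"
    and Lllp: "\<And>f. f \<in> Arr M \<Longrightarrow> (\<And>p. p \<in> R \<Longrightarrow> has_lift M f p) \<Longrightarrow> f \<in> L"
    and IA: "I \<subseteq> Arr M" and sI: "small U I" and soa: "permits_small_object_argument U M I"
    and RI: "R = {q \<in> Arr M. \<forall>i \<in> I. has_lift M i q}"
    and cond: "(\<forall>A \<in> Obj K. small_object U K A) \<or> (\<forall>g \<in> carrier G. \<forall>e \<in> L. FAr (precomp C (\<rho> g)) e \<in> L)"
  shows "functorial_factorization N
      {l \<in> Arr N. \<forall>y \<in> Arr N. (\<forall>e \<in> L. has_lift M e (FAr V y)) \<longrightarrow> has_lift N l y} {r \<in> Arr N. FAr V r \<in> R}"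
    and "\<exists>I'. I' \<subseteq> Arr N \<and> small U I' \<and> permits_small_object_argument U N I' \<and>
      {p \<in> Arr N. FAr V p \<in> R} = {p \<in> Arr N. \<forall>i \<in> I'. has_lift N i p}"
proof -
  define W where "W = (if \<forall>A \<in> Obj K. small_object U K A then UNIV else {f. \<forall>p \<in> R. has_lift M f p})"
  have bM: "bicomplete U M" by (rule fun_cat_bicomplete[OF C bi])
  have ls: "small U (Hom M x y)" if "x \<in> Obj M" "y \<in> Obj M" for x y
    using fun_cat_locally_small[OF U sC lsK] that by simp
  have VA: "FAr V s \<in> Arr M" if "s \<in> Arr N" for s using HomD(1)[OF adj.VH[OF HomI[OF that]]] .
  have IHom: "i \<in> Hom M (Dom M i) (Cod M i)" if "i \<in> I" for i using HomI[OF subsetD[OF IA that]] .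
  have IL: "i \<in> L" if "i \<in> I" for i using Lllp[of i] IA RI that by blast
  have sm: "small_rel U M W (Dom M i)" if i: "i \<in> I" for i
  proof (cases "\<forall>A \<in> Obj K. small_object U K A")
    case True
    have "Dom M i \<in> Functors C K" using Hom_Obj(1)[OF M_category IHom[OF i]] by simp
    then show ?thesis using fun_cat_objects_small[OF U sC bi] True by blast
  next
    case False
    have "small_rel U M (relative_cell U M I) (Dom M i)" using soa i unfolding permits_small_object_argument_def by blast
    moreover have "has_lift M f p" if "f \<in> W" "p \<in> Arr M" "\<And>i. i \<in> I \<Longrightarrow> has_lift M i p" for f p
      using that False RI unfolding W_def by auto
    ultimately show ?thesis using small_rel_llp[OF U bM ls IA sI soa, of "Dom M i" W] by blast
  qed
  have W: "FAr V s \<in> W" if s: "s \<in> Arr N" and l: "\<And>y. y \<in> Arr N \<Longrightarrow> (\<And>e. e \<in> L \<Longrightarrow> has_lift M e (FAr V y)) \<Longrightarrow> has_lift N s y" for s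
  proof (cases "\<forall>A \<in> Obj K. small_object U K A")
    case False
    then have tw: "\<And>g e. g \<in> carrier G \<Longrightarrow> e \<in> L \<Longrightarrow> FAr (precomp C (\<rho> g)) e \<in> L" using cond by blast
    have "has_lift M (FAr V s) p" if p: "p \<in> R" for p
    proof -
      have pA: "p \<in> Arr M" using p RI by blast
      obtain p' where p': "p' \<in> Arr N" "\<And>i. i \<in> Arr M \<Longrightarrow> (\<And>g. g \<in> carrier G \<Longrightarrow> has_lift M (FAr (precomp C (\<rho> g)) i) p) \<Longrightarrow> has_lift M i (FAr V p')"
        "\<And>s. s \<in> Arr N \<Longrightarrow> has_lift N s p' \<Longrightarrow> has_lift M (FAr V s) p" using lifting_against_cofree[OF pA] by metis
      have "has_lift M e (FAr V p')" if "e \<in> L" for e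
        by (rule p'(2)) (use LA that LR[OF tw[OF _ that] p] in auto)
      then show ?thesis using p'(3)[OF s] l[OF p'(1)] by blast
    qed
    then show ?thesis using False by (simp add: W_def)
  qed (simp add: W_def)
  show "functorial_factorization N
      {l \<in> Arr N. \<forall>y \<in> Arr N. (\<forall>e \<in> L. has_lift M e (FAr V y)) \<longrightarrow> has_lift N l y} {r \<in> Arr N. FAr V r \<in> R}"
    by (rule adj.adjoint_factorization[OF ff IA sI RI]) (fact sm W)+
  define P where "P i i' \<longleftrightarrow> i' \<in> Arr N \<and> (\<exists>\<eta>. universal_from N M V (Dom M i) (Dom N i') \<eta>) \<and>
      (\<forall>y \<in> Arr N. has_lift N i' y \<longleftrightarrow> has_lift M i (FAr V y))" for i i'
  have "\<forall>i \<in> I. \<exists>i'. P i i'"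
  proof
    fix i assume i: "i \<in> I"
    note iH = IHom[OF i]
    obtain FA \<eta> where A: "universal_from N M V (Dom M i) FA \<eta>" using adj.left[OF Hom_Obj(1)[OF M_category iH]] by blast
    obtain FB \<theta> where B: "universal_from N M V (Cod M i) FB \<theta>" using adj.left[OF Hom_Obj(2)[OF M_category iH]] by blast
    obtain i' where i': "i' \<in> Hom N FA FB" "\<forall>y \<in> Arr N. has_lift N i' y \<longleftrightarrow> has_lift M i (FAr V y)"
      using adj.free_arrow[OF iH A B] by (elim exE conjE)
    have "P i i'" unfolding P_def HomD(2)[OF i'(1)] by (intro conjI exI[of _ \<eta>] A i'(2) HomD(1)[OF i'(1)])
    then show "\<exists>i'. P i i'" by (rule exI)
  qed
  then have "\<exists>fi. \<forall>i \<in> I. P i (fi i)" by (rule bchoice)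
  then obtain fi where fi0: "\<forall>i \<in> I. P i (fi i)" by (elim exE)
  have fi: "fi i \<in> Arr N" "\<exists>\<eta>. universal_from N M V (Dom M i) (Dom N (fi i)) \<eta>"
    "\<And>y. y \<in> Arr N \<Longrightarrow> has_lift N (fi i) y \<longleftrightarrow> has_lift M i (FAr V y)" if "i \<in> I" for i
    using bspec[OF fi0 that] unfolding P_def by simp_all
  have "small_rel U N (relative_cell U N (fi ` I)) (Dom N (fi i))" if i: "i \<in> I" for i
  proof -
    obtain \<eta> where \<eta>: "universal_from N M V (Dom M i) (Dom N (fi i)) \<eta>" using fi(2)[OF i] by (elim exE)
    show ?thesis
    proof (rule adj.free_small[OF sm[OF i] \<eta>])
    fix f assume f: "f \<in> relative_cell U N (fi ` I)"
    show "FAr V f \<in> W"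
    proof (rule W[OF relative_cell_Arr[OF f]])
      fix y assume y: "y \<in> Arr N" and l: "\<And>e. e \<in> L \<Longrightarrow> has_lift M e (FAr V y)"
      show "has_lift N f y"
        by (rule relative_cell_has_lift[OF N_category f y]) (use fi(3) y l IL in auto)
    qed
    qed
  qed
  then have "permits_small_object_argument U N (fi ` I)" unfolding permits_small_object_argument_def by blast
  moreover have "{p \<in> Arr N. FAr V p \<in> R} = {p \<in> Arr N. \<forall>i \<in> fi ` I. has_lift N i p}"
    using fi(3) VA RI by auto
  moreover have "fi ` I \<subseteq> Arr N" using fi(1) by blast
  moreover have "small U (fi ` I)" by (rule small_image[OF sI])
  ultimately show "\<exists>I'. I' \<subseteq> Arr N \<and> small U I' \<and> permits_small_object_argument U N I' \<and>
      {p \<in> Arr N. FAr V p \<in> R} = {p \<in> Arr N. \<forall>i \<in> I'. has_lift N i p}"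
    by (intro exI[of _ "fi ` I"] conjI)
qed

text \<open>Cofibrations are defined by the lifting property against acyclic fibrations. The left
  factors of the second factorisation lift against all fibrations and, as translation preserves
  acyclic cofibrations, are sent by \<open>V\<close> to acyclic cofibrations. The remaining lifting axiom
  follows by the usual retract argument: an acyclic cofibration \<open>i\<close> factors as \<open>b \<cdot> a\<close> of this
  kind, the fibration \<open>b\<close> is acyclic by two out of three, so \<open>i\<close> lifts against \<open>b\<close> and is a
  retract of \<open>a\<close>.\<close>

lemma lifted_model_structure:
  fixes S :: "('co, 'ca, 'ko, 'ka) nattr model_str"
  assumes lsK: "locally_small_category U K" and mc: "model_category U M S" and cg: "cofibrantly_generated U M S"
    and twJ: "\<And>g e. g \<in> carrier G \<Longrightarrow> e \<in> Cofib S \<inter> WE S \<Longrightarrow> FAr (precomp C (\<rho> g)) e \<in> Cofib S \<inter> WE S"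
    and cond: "(\<forall>A \<in> Obj K. small_object U K A) \<or> (\<forall>g \<in> carrier G. \<forall>e \<in> Cofib S. FAr (precomp C (\<rho> g)) e \<in> Cofib S)"
  shows "\<exists>T. model_category U N T \<and> cofibrantly_generated U N T \<and> lifted_along N T S V"
proof -
  note M = M_category and N = N_category
  have sub: "WE S \<subseteq> Arr M" "Cofib S \<subseteq> Arr M" "Fib S \<subseteq> Arr M"
    and two: "\<And>f g. f \<in> Arr M \<Longrightarrow> g \<in> Arr M \<Longrightarrow> Dom M g = Cod M f \<Longrightarrow>
        (f \<in> WE S \<and> g \<in> WE S \<longrightarrow> g \<cdot>\<^bsub>M\<^esub> f \<in> WE S) \<and>
        (f \<in> WE S \<and> g \<cdot>\<^bsub>M\<^esub> f \<in> WE S \<longrightarrow> g \<in> WE S) \<and>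
        (g \<in> WE S \<and> g \<cdot>\<^bsub>M\<^esub> f \<in> WE S \<longrightarrow> f \<in> WE S)"
    and ret: "\<And>f g. f \<in> Arr M \<Longrightarrow> retract_of (arrow_cat M) f g \<Longrightarrow>
        (g \<in> WE S \<longrightarrow> f \<in> WE S) \<and> (g \<in> Cofib S \<longrightarrow> f \<in> Cofib S) \<and> (g \<in> Fib S \<longrightarrow> f \<in> Fib S)"
    and l1: "\<And>i p. i \<in> Cofib S \<Longrightarrow> p \<in> Fib S \<inter> WE S \<Longrightarrow> has_lift M i p"
    and l2: "\<And>i p. i \<in> Cofib S \<inter> WE S \<Longrightarrow> p \<in> Fib S \<Longrightarrow> has_lift M i p"
    and f1: "functorial_factorization M (Cofib S) (Fib S \<inter> WE S)" and f2: "functorial_factorization M (Cofib S \<inter> WE S) (Fib S)"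
  proof -
    note mc' = mc[unfolded model_category_def]
    show "WE S \<subseteq> Arr M" using mc' by (elim conjE)
    show "Cofib S \<subseteq> Arr M" using mc' by (elim conjE)
    show "Fib S \<subseteq> Arr M" using mc' by (elim conjE)
    show "functorial_factorization M (Cofib S) (Fib S \<inter> WE S)" using mc' by (elim conjE)
    show "functorial_factorization M (Cofib S \<inter> WE S) (Fib S)" using mc' by (elim conjE)
    have 1: "\<forall>f \<in> Arr M. \<forall>g \<in> Arr M. Dom M g = Cod M f \<longrightarrow>
        (f \<in> WE S \<and> g \<in> WE S \<longrightarrow> g \<cdot>\<^bsub>M\<^esub> f \<in> WE S) \<and>
        (f \<in> WE S \<and> g \<cdot>\<^bsub>M\<^esub> f \<in> WE S \<longrightarrow> g \<in> WE S) \<and>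
        (g \<in> WE S \<and> g \<cdot>\<^bsub>M\<^esub> f \<in> WE S \<longrightarrow> f \<in> WE S)" using mc' by (elim conjE)
    show "(f \<in> WE S \<and> g \<in> WE S \<longrightarrow> g \<cdot>\<^bsub>M\<^esub> f \<in> WE S) \<and> (f \<in> WE S \<and> g \<cdot>\<^bsub>M\<^esub> f \<in> WE S \<longrightarrow> g \<in> WE S) \<and>
        (g \<in> WE S \<and> g \<cdot>\<^bsub>M\<^esub> f \<in> WE S \<longrightarrow> f \<in> WE S)" if "f \<in> Arr M" "g \<in> Arr M" "Dom M g = Cod M f" for f g
      by (rule bspec[OF bspec[OF 1 that(1)] that(2), rule_format, OF that(3)])
    have 2: "\<forall>W \<in> {WE S, Cofib S, Fib S}. \<forall>f \<in> Arr M. \<forall>g \<in> W. retract_of (arrow_cat M) f g \<longrightarrow> f \<in> W"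
      using mc' by (elim conjE)
    show "(g \<in> WE S \<longrightarrow> f \<in> WE S) \<and> (g \<in> Cofib S \<longrightarrow> f \<in> Cofib S) \<and> (g \<in> Fib S \<longrightarrow> f \<in> Fib S)"
      if "f \<in> Arr M" "retract_of (arrow_cat M) f g" for f g using 2 that by blast
    have 3: "\<forall>i \<in> Cofib S. \<forall>p \<in> Fib S \<inter> WE S. has_lift M i p" using mc' by (elim conjE)
    have 4: "\<forall>i \<in> Cofib S \<inter> WE S. \<forall>p \<in> Fib S. has_lift M i p" using mc' by (elim conjE)
    show "has_lift M i p" if "i \<in> Cofib S" "p \<in> Fib S \<inter> WE S" for i p by (rule bspec[OF bspec[OF 3 that(1)] that(2)])
    show "has_lift M i p" if "i \<in> Cofib S \<inter> WE S" "p \<in> Fib S" for i p by (rule bspec[OF bspec[OF 4 that(1)] that(2)])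
  qed
  obtain I where I: "I \<subseteq> Arr M" "small U I" "permits_small_object_argument U M I" "Fib S \<inter> WE S = {p \<in> Arr M. \<forall>i \<in> I. has_lift M i p}"
    using cg unfolding cofibrantly_generated_def by blast
  obtain J where J: "J \<subseteq> Arr M" "small U J" "permits_small_object_argument U M J" "Fib S = {p \<in> Arr M. \<forall>j \<in> J. has_lift M j p}"
    using cg unfolding cofibrantly_generated_def by blast
  \<comment> \<open>In \<open>M\<close> the left classes are determined by the lifting property, again by the retract
    argument.\<close>
  have llp1: "f \<in> Cofib S" if f: "f \<in> Arr M" and l: "\<And>p. p \<in> Fib S \<inter> WE S \<Longrightarrow> has_lift M f p" for f
  proof -
    obtain E a b where "a \<in> Hom M (Dom M f) E" "a \<in> Cofib S" "b \<in> Hom M E (Cod M f)" "b \<in> Fib S \<inter> WE S" "b \<cdot>\<^bsub>M\<^esub> a = f"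
      using factorization_exists[OF f1 f] by blast
    then show ?thesis using retract_argument[OF M _ _ HomI[OF f]] l ret[OF f] by blast
  qed
  have llp2: "f \<in> Cofib S \<inter> WE S" if f: "f \<in> Arr M" and l: "\<And>p. p \<in> Fib S \<Longrightarrow> has_lift M f p" for f
  proof -
    obtain E a b where "a \<in> Hom M (Dom M f) E" "a \<in> Cofib S \<inter> WE S" "b \<in> Hom M E (Cod M f)" "b \<in> Fib S" "b \<cdot>\<^bsub>M\<^esub> a = f"
      using factorization_exists[OF f2 f] by blast
    then show ?thesis using retract_argument[OF M _ _ HomI[OF f]] l ret[OF f] by blast
  qed
  have condJ: "(\<forall>A \<in> Obj K. small_object U K A) \<or> (\<forall>g \<in> carrier G. \<forall>e \<in> Cofib S \<inter> WE S. FAr (precomp C (\<rho> g)) e \<in> Cofib S \<inter> WE S)"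
    using twJ by blast
  have CWA: "Cofib S \<inter> WE S \<subseteq> Arr M" using sub by blast
  note t1 = transfer_weak_factorization[OF lsK f1 sub(2) l1 llp1 I cond]
  note t2 = transfer_weak_factorization[OF lsK f2 CWA l2 llp2 J condJ]
  define T where "T = \<lparr> WE = {f \<in> Arr N. FAr V f \<in> WE S},
    Cofib = {f \<in> Arr N. \<forall>p \<in> Arr N. FAr V p \<in> Fib S \<inter> WE S \<longrightarrow> has_lift N f p}, Fib = {f \<in> Arr N. FAr V f \<in> Fib S} \<rparr>"
  have Ts: "WE T = {f \<in> Arr N. FAr V f \<in> WE S}" "Fib T = {f \<in> Arr N. FAr V f \<in> Fib S}"
    "Cofib T = {f \<in> Arr N. \<forall>p \<in> Arr N. FAr V p \<in> Fib S \<inter> WE S \<longrightarrow> has_lift N f p}" by (simp_all add: T_def)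
  have FW: "Fib T \<inter> WE T = {p \<in> Arr N. FAr V p \<in> Fib S \<inter> WE S}" by (auto simp: Ts)
  have VA: "FAr V s \<in> Arr M" if "s \<in> Arr N" for s using HomD(1)[OF adj.VH[OF HomI[OF that]]] .
  have twoT: "(f \<in> WE T \<and> g \<in> WE T \<longrightarrow> g \<cdot>\<^bsub>N\<^esub> f \<in> WE T) \<and> (f \<in> WE T \<and> g \<cdot>\<^bsub>N\<^esub> f \<in> WE T \<longrightarrow> g \<in> WE T) \<and>
      (g \<in> WE T \<and> g \<cdot>\<^bsub>N\<^esub> f \<in> WE T \<longrightarrow> f \<in> WE T)" if fg: "f \<in> Arr N" "g \<in> Arr N" "Dom N g = Cod N f" for f g
  proof -
    have g: "g \<in> Hom N (Cod N f) (Cod N g)" using HomI[OF fg(2)] fg(3) by simp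
    note f = HomI[OF fg(1)]
    have e: "FAr V (g \<cdot>\<^bsub>N\<^esub> f) = FAr V g \<cdot>\<^bsub>M\<^esub> FAr V f" by (rule adj.VC[OF f g])
    have "Dom M (FAr V g) = Cod M (FAr V f)" using HomD(2)[OF adj.VH[OF g]] HomD(3)[OF adj.VH[OF f]] by metis
    from two[OF VA[OF fg(1)] VA[OF fg(2)] this] show ?thesis
      unfolding Ts mem_Collect_eq e using fg(1,2) HomD(1)[OF comp_Hom[OF N f g]] by blast
  qed
  \<comment> \<open>The left factors of the second factorisation are acyclic cofibrations.\<close>
  have JL: "l \<in> Cofib T \<inter> WE T \<and> (\<forall>p \<in> Fib T. has_lift N l p)"
    if l: "l \<in> Arr N" "\<forall>y \<in> Arr N. (\<forall>e \<in> Cofib S \<inter> WE S. has_lift M e (FAr V y)) \<longrightarrow> has_lift N l y" for l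
  proof -
    have lF: "has_lift N l p" if "p \<in> Arr N" "FAr V p \<in> Fib S" for p using l(2) that l2 by blast
    have "FAr V l \<in> Cofib S \<inter> WE S"
    proof (rule llp2[OF VA[OF l(1)]])
      fix p assume p: "p \<in> Fib S"
      have pA: "p \<in> Arr M" using p sub by blast
      obtain p' where p': "p' \<in> Arr N" "\<And>i. i \<in> Arr M \<Longrightarrow> (\<And>g. g \<in> carrier G \<Longrightarrow> has_lift M (FAr (precomp C (\<rho> g)) i) p) \<Longrightarrow> has_lift M i (FAr V p')"
        "\<And>s. s \<in> Arr N \<Longrightarrow> has_lift N s p' \<Longrightarrow> has_lift M (FAr V s) p" using lifting_against_cofree[OF pA] by metis
      have "has_lift M e (FAr V p')" if "e \<in> Cofib S \<inter> WE S" for e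
        by (rule p'(2)[OF subsetD[OF CWA that] l2[OF twJ[OF _ that] p]])
      then show "has_lift M (FAr V l) p" using p'(3)[OF l(1)] l(2) p'(1) by blast
    qed
    then show ?thesis using l(1) lF unfolding Ts by blast
  qed
  have fT1: "functorial_factorization N (Cofib T) (Fib T \<inter> WE T)"
    by (rule functorial_factorization_mono[OF t1(1)]) (use l1 in \<open>auto simp: Ts\<close>)
  have ff2: "functorial_factorization N {l \<in> Arr N. \<forall>y \<in> Arr N. (\<forall>e \<in> Cofib S \<inter> WE S. has_lift M e (FAr V y)) \<longrightarrow> has_lift N l y} (Fib T)"
    using t2(1) unfolding Ts .
  have fT2: "functorial_factorization N (Cofib T \<inter> WE T) (Fib T)"
    by (rule functorial_factorization_mono[OF ff2]) (use JL in auto)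
  have lT1: "has_lift N i p" if "i \<in> Cofib T" "p \<in> Fib T \<inter> WE T" for i p using that unfolding FW Ts by blast
  have lT2: "has_lift N i p" if i: "i \<in> Cofib T \<inter> WE T" and p: "p \<in> Fib T" for i p
  proof -
    have iA: "i \<in> Arr N" and pA: "p \<in> Arr N" using i p by (auto simp: Ts)
    obtain E a b where ab: "a \<in> Hom N (Dom N i) E" "a \<in> {l \<in> Arr N. \<forall>y \<in> Arr N. (\<forall>e \<in> Cofib S \<inter> WE S. has_lift M e (FAr V y)) \<longrightarrow> has_lift N l y}"
      "b \<in> Hom N E (Cod N i)" "b \<in> Fib T" "b \<cdot>\<^bsub>N\<^esub> a = i" using factorization_exists[OF ff2 iA] by blast
    have a: "a \<in> Cofib T \<inter> WE T" "\<forall>p \<in> Fib T. has_lift N a p" using JL ab(2) by auto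
    have bD: "Dom N b = Cod N a" using HomD(2)[OF ab(3)] HomD(3)[OF ab(1)] by metis
    have "a \<in> WE T \<and> b \<cdot>\<^bsub>N\<^esub> a \<in> WE T" using a(1) i unfolding ab(5) by simp
    then have "b \<in> WE T" by (rule twoT[OF HomD(1)[OF ab(1)] HomD(1)[OF ab(3)] bD, THEN conjunct2, THEN conjunct1, rule_format])
    then have "has_lift N i b" using i ab(4) by (intro lT1) simp_all
    then have "retract_of (arrow_cat N) i a" by (rule retract_argument[OF N ab(1,3) HomI[OF iA] ab(5)])
    then show ?thesis by (rule retract_has_lift[OF N _ pA bspec[OF a(2) p]])
  qed
  have retT: "f \<in> W" if W: "W \<in> {WE T, Cofib T, Fib T}" and f: "f \<in> Arr N" and g: "g \<in> W" and rt: "retract_of (arrow_cat N) f g" for W f g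
  proof -
    note rV = ret[OF VA[OF f] functor_retract[OF N M V_functor rt]]
    consider "W = WE T" | "W = Cofib T" | "W = Fib T" using W by blast
    then show ?thesis
    proof cases
      case 1
      then show ?thesis using rV f g by (simp add: Ts)
    next
      case 2
      then show ?thesis using retract_has_lift[OF N rt] f g by (simp add: Ts)
    next
      case 3
      then show ?thesis using rV f g by (simp add: Ts)
    qed
  qed
  have "model_category U N T"
    unfolding model_category_def
  proof (intro conjI ballI impI)
    show "bicomplete U N" by (rule adj.biN)
    show "WE T \<subseteq> Arr N" "Cofib T \<subseteq> Arr N" "Fib T \<subseteq> Arr N" by (auto simp: Ts)
    show "functorial_factorization N (Cofib T) (Fib T \<inter> WE T)" by (rule fT1)
    show "functorial_factorization N (Cofib T \<inter> WE T) (Fib T)" by (rule fT2)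
    show "f \<in> W" if "W \<in> {WE T, Cofib T, Fib T}" "f \<in> Arr N" "g \<in> W" "retract_of (arrow_cat N) f g" for W f g by (rule retT[OF that])
    show "has_lift N i p" if "i \<in> Cofib T" "p \<in> Fib T \<inter> WE T" for i p by (rule lT1[OF that])
    show "has_lift N i p" if "i \<in> Cofib T \<inter> WE T" "p \<in> Fib T" for i p by (rule lT2[OF that])
    fix f g assume fg: "f \<in> Arr N" "g \<in> Arr N" "Dom N g = Cod N f"
    show "f \<in> WE T \<and> g \<in> WE T \<Longrightarrow> g \<cdot>\<^bsub>N\<^esub> f \<in> WE T" using twoT[OF fg] by blast
    show "f \<in> WE T \<and> g \<cdot>\<^bsub>N\<^esub> f \<in> WE T \<Longrightarrow> g \<in> WE T" using twoT[OF fg] by blast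
    show "g \<in> WE T \<and> g \<cdot>\<^bsub>N\<^esub> f \<in> WE T \<Longrightarrow> f \<in> WE T" using twoT[OF fg] by blast
  qed
  moreover have "cofibrantly_generated U N T"
    using t1(2) t2(2) unfolding cofibrantly_generated_def FW[symmetric] Ts(2)[symmetric] by (rule conjI)
  moreover have "lifted_along N T S V" unfolding lifted_along_def Ts by blast
  ultimately show ?thesis by blast
qed

end

theorem theorem4p3:
  fixes U :: "'u itself"
    and G :: "('g, 'z) monoid_scheme"
    and C :: "('co, 'ca) cat"
    and K :: "('ko, 'ka) cat"
    and \<rho> :: "'g \<Rightarrow> ('co, 'ca, 'co, 'ca) fctr"
    and S :: "('co, 'ca, 'ko, 'ka) nattr model_str"
  assumes "universe U"
    and "group G" and "small U (carrier G)"
    and "small_category U C"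
    and "\<rho> \<in> hom G (Aut_cat C)"
    and "locally_small_category U K" and "bicomplete U K"
    and "model_category U (fun_cat C K) S" and "cofibrantly_generated U (fun_cat C K) S"
    and "((\<forall>A \<in> Obj K. small_object U K A) \<and>
          (\<forall>g \<in> carrier G. \<forall>f \<in> Cofib S \<inter> WE S. FAr (precomp C (\<rho> g)) f \<in> Cofib S \<inter> WE S))
       \<or> (\<forall>g \<in> carrier G. left_quillen (fun_cat C K) S (fun_cat C K) S (precomp C (\<rho> g)))"
  shows "\<exists>T :: ('co, 'ca \<times> 'g, 'ko, 'ka) nattr model_str.
           model_category U (fun_cat (semidirect C G \<rho>) K) T \<and>
           cofibrantly_generated U (fun_cat (semidirect C G \<rho>) K) T \<and>
           lifted_along (fun_cat (semidirect C G \<rho>) K) T S (precomp C (semidirect_incl C G))"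
proof -
  interpret equivariant U G C K \<rho>
    by (rule equivariant.intro) (fact assms)+
  have twJ: "FAr (precomp C (\<rho> g)) e \<in> Cofib S \<inter> WE S" if "g \<in> carrier G" "e \<in> Cofib S \<inter> WE S" for g e
    using assms(10) that unfolding left_quillen_def by blast
  have cond: "(\<forall>A \<in> Obj K. small_object U K A) \<or> (\<forall>g \<in> carrier G. \<forall>e \<in> Cofib S. FAr (precomp C (\<rho> g)) e \<in> Cofib S)"
    using assms(10) unfolding left_quillen_def by blast
  show ?thesis
    by (rule lifted_model_structure[OF assms(6,8,9) twJ cond])
qed

end
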